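(* Let $E$ be an $H_\infty$-ring spectrum, $G$ a finite group, $m\ge1$, and let $H\triangleleft G$ be a normal subgroup. Then $J_H^G\subseteq E^0(BG\times B\Sigma_m)$ is the ideal generated by $I_{\mathrm{Tr}}$ and the images of the transfers along the inclusions $$(\Sigma_q)^n\rtimes\Gamma(a_{S/H})\longrightarrow G\times\Sigma_m$$ for all factorizations $m=nq$ and all subgroups $H<S\le G$ with $[S:H]=n\ne1$.
   Context: For an inclusion $\Lambda\le\Lambda'$ of finite groups, $B\Lambda\to B\Lambda'$ is (equivalent to) a finite cover, giving an additive transfer map $E^0(B\Lambda)\to E^0(B\Lambda')$; more generally finite covers of spaces give transfers in $E$-cohomology. $I_{\mathrm{Tr}}\subseteq E^0(BG\times B\Sigma_m)$ is the ideal given by the image of the direct sum of the transfers along $G\times\Sigma_i\times\Sigma_j\le G\times\Sigma_m$ for $i+j=m$, $i,j>0$. The group $G\times\Sigma_m$ acts on $(G/H)^{\times m}$, $G$ diagonally and $\Sigma_m$ by permuting factors. Let $\Delta(G/H)=\{(gH,\dots,gH)\mid g\in G\}$ and $Z^{G,H}=(G/H)^{\times m}\setminus\Delta(G/H)$. $J_H^G\subseteq E^0(BG\times B\Sigma_m)$ is defined to be the ideal generated by the images of the transfers along (i) $G\times\Sigma_i\times\Sigma_j\subseteq G\times\Sigma_m$ for $i,j>0$, $i+j=m$, and (ii) the composite $Z^{G,H}_{h(G\times\Sigma_m)}\subseteq(G/H)^{\times m}_{h(G\times\Sigma_m)}\to BG\times B\Sigma_m$. For $H\le S\le G$ with $[S:H]=n$,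 $a_{S/H}:S\to\mathrm{Aut}_{\mathrm{Set}}(S/H)\cong\Sigma_n$ is the action by left multiplication (for a chosen ordering of $S/H$; the choice does not affect the image of the transfer), and $\Gamma(a_{S/H})=\{(s,a_{S/H}(s))\mid s\in S\}\le G\times\Sigma_n$ is its graph. With $m=nq$, $\Gamma(a_{S/H})$ acts on $(\Sigma_q)^n$ through its projection to $\Sigma_n$, and $(\Sigma_q)^n\rtimes\Gamma(a_{S/H})\le(\Sigma_q)^n\rtimes(G\times\Sigma_n)\cong G\times(\Sigma_q\wr\Sigma_n)\le G\times\Sigma_m$, where $\Sigma_q\wr\Sigma_n\le\Sigma_{qn}=\Sigma_m$ acts on $n$ blocks of size $q$. *)

theory Defs
  imports "HOL-Analysis.Analysis" "HOL-Algebra.Ideal" "HOL-Algebra.Sym_Groups" "HOL-Algebra.Left_Coset"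
begin

section \<open>The universe and its linear isometries\<close>

text \<open>
  Spectra are coordinate-free spectra in the sense of Lewis, May and Steinberger, indexed on the
  finite-dimensional subspaces of the universe of finitely supported real sequences, in the
  category of compactly generated Hausdorff spaces.
\<close>

type_synonym vec = "nat \<Rightarrow> real"

definition vzero :: vec where
  "vzero = (\<lambda>_. 0)"

definition coord_space :: "nat \<Rightarrow> vec set" where
  "coord_space n = {v. \<forall>i\<ge>n. v i = 0}"

definition univ_space :: "vec set" where
  "univ_space = (\<Union>n. coord_space n)"

text \<open>The colimit topology, strictly finer than the topology of pointwise convergence.\<close>

definition univ_top :: "vec topology" where
  "univ_top = topology (\<lambda>S. S \<subseteq> univ_space \<and>
     (\<forall>n. openin (top_of_set (coord_space n)) (S \<inter> coord_space n)))"

lemma openin_univ_top: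
  "openin univ_top S \<longleftrightarrow> S \<subseteq> univ_space \<and>
     (\<forall>n. openin (top_of_set (coord_space n)) (S \<inter> coord_space n))"
proof -
  have eq1: "(S \<inter> T) \<inter> C = (S \<inter> C) \<inter> (T \<inter> C)" for S T C :: "vec set"
    by blast
  have eq2: "(\<Union>\<K>) \<inter> C = (\<Union>K\<in>\<K>. K \<inter> C)" for \<K> :: "vec set set" and C
    by blast
  have "istopology (\<lambda>S. S \<subseteq> univ_space \<and>
     (\<forall>n. openin (top_of_set (coord_space n)) (S \<inter> coord_space n)))"
    unfolding istopology_def
  proof (intro conjI allI impI, goal_cases)
    case (2 S T n)
    then show ?case by (subst eq1) (auto intro: openin_Int)
  next
    case (4 \<K> n)
    then have "openin (top_of_set (coord_space n)) (\<Union>K\<in>\<K>. K \<inter> coord_space n)"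
      by (intro openin_Union) auto
    then show ?case by (simp only: eq2)
  qed auto
  then show ?thesis
    by (simp only: univ_top_def topology_inverse')
qed

definition vip :: "vec \<Rightarrow> vec \<Rightarrow> real" where
  "vip v w = (\<Sum>i | v i \<noteq> 0. v i * w i)"

text \<open>A subspace of the universe is finite dimensional iff it lies in some \<^term>\<open>coord_space n\<close>.\<close>

definition fd_subspace :: "vec set \<Rightarrow> bool" where
  "fd_subspace V \<longleftrightarrow> vzero \<in> V \<and>
     (\<forall>v\<in>V. \<forall>w\<in>V. \<forall>a b. (\<lambda>i. a * v i + b * w i) \<in> V) \<and> (\<exists>n. V \<subseteq> coord_space n)"

definition ocomp :: "vec set \<Rightarrow> vec set \<Rightarrow> vec set" where
  "ocomp W V = {w \<in> W. \<forall>v\<in>V. vip w v = 0}"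

text \<open>
  Elements of the n-fold sum of the universe, and likewise n-tuples of points or of index spaces,
  are functions that are extensional on \<open>{..<n}\<close>.
\<close>

definition tuples :: "nat \<Rightarrow> (nat \<Rightarrow> vec) set" where
  "tuples n = {..<n} \<rightarrow>\<^sub>E univ_space"

definition index_tuples :: "nat \<Rightarrow> (nat \<Rightarrow> vec set) set" where
  "index_tuples n = {..<n} \<rightarrow>\<^sub>E Collect fd_subspace"

type_synonym isom = "(nat \<Rightarrow> vec) \<Rightarrow> vec"

definition lin_isoms :: "nat \<Rightarrow> isom set" where
  "lin_isoms n = {\<alpha> \<in> tuples n \<rightarrow>\<^sub>E univ_space.
     (\<forall>v\<in>tuples n. \<forall>w\<in>tuples n. \<forall>a b.
        \<alpha> (\<lambda>k\<in>{..<n}. \<lambda>i. a * v k i + b * w k i) = (\<lambda>i. a * \<alpha> v i + b * \<alpha> w i)) \<and>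
     (\<forall>v\<in>tuples n. \<forall>w\<in>tuples n. vip (\<alpha> v) (\<alpha> w) = (\<Sum>k<n. vip (v k) (w k)))}"

text \<open>
  The n-th space of the linear isometries operad. On linear maps into \<^term>\<open>univ_top\<close> the
  topology of pointwise convergence is the compact-open topology, because compact subsets of the
  source are finite dimensional. The space is contractible with free action of the symmetric group,
  so it serves as the total space of the universal bundle of the symmetric group.
\<close>

definition isom_top :: "nat \<Rightarrow> isom topology" where
  "isom_top n = subtopology (product_topology (\<lambda>_. univ_top) (tuples n)) (lin_isoms n)"

definition isom_perm :: "nat \<Rightarrow> (nat \<Rightarrow> nat) \<Rightarrow> isom \<Rightarrow> isom" where
  "isom_perm n \<pi> \<alpha> = (\<lambda>v\<in>tuples n. \<alpha> (v \<circ> \<pi>))"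

definition dsum_image :: "nat \<Rightarrow> isom \<Rightarrow> (nat \<Rightarrow> vec set) \<Rightarrow> vec set" where
  "dsum_image n \<alpha> V = \<alpha> ` (\<Pi>\<^sub>E k\<in>{..<n}. V k)"

text \<open>
  A tuple of length \<open>ks 0 + \<dots> + ks (j - 1)\<close> is cut into \<open>j\<close> consecutive blocks, block \<open>b\<close>
  having length \<open>ks b\<close>.
\<close>

definition blk :: "(nat \<Rightarrow> nat) \<Rightarrow> nat \<Rightarrow> (nat \<Rightarrow> 'x) \<Rightarrow> nat \<Rightarrow> 'x" where
  "blk ks b x = (\<lambda>r\<in>{..<ks b}. x ((\<Sum>c<b. ks c) + r))"

definition isom_comp :: "nat \<Rightarrow> (nat \<Rightarrow> nat) \<Rightarrow> isom \<Rightarrow> (nat \<Rightarrow> isom) \<Rightarrow> isom" where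
  "isom_comp j ks \<alpha> \<beta> = (\<lambda>v\<in>tuples (\<Sum>c<j. ks c). \<alpha> (\<lambda>b\<in>{..<j}. \<beta> b (blk ks b v)))"

section \<open>Spectra\<close>

text \<open>The one-point compactification of an inner product space, with point at infinity \<^term>\<open>None\<close>.\<close>

definition sph :: "vec set \<Rightarrow> vec option topology" where
  "sph V = Alexandroff_compactification (top_of_set V)"

definition compact_open :: "'x topology \<Rightarrow> 'y topology \<Rightarrow> ('x \<Rightarrow> 'y) topology" where
  "compact_open X Y = topology_generated_by
     {{f \<in> extensional (topspace X). continuous_map X Y f \<and> f ` K \<subseteq> U} | K U.
        compactin X K \<and> openin Y U}"

definition loops :: "vec set \<Rightarrow> 'a topology \<Rightarrow> 'a \<Rightarrow> (vec option \<Rightarrow> 'a) topology" where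
  "loops V X p = kification (subtopology (compact_open (sph V) X) {f. f None = p})"

text \<open>
  \<open>smap E V W w x\<close> is the image of \<open>w \<and> x\<close> under the structure map from the smash product of the
  sphere of \<^term>\<open>ocomp W V\<close> with the \<open>V\<close>-th space to the \<open>W\<close>-th space. Its adjoint is required to
  be a homeomorphism onto the loop space.
\<close>

record 'a spec =
  lev :: "vec set \<Rightarrow> 'a topology"
  bpt :: "vec set \<Rightarrow> 'a"
  smap :: "vec set \<Rightarrow> vec set \<Rightarrow> vec option \<Rightarrow> 'a \<Rightarrow> 'a"

definition spectrum :: "'a spec \<Rightarrow> bool" where
  "spectrum E \<longleftrightarrow>
     (\<forall>V. fd_subspace V \<longrightarrow>
        Hausdorff_space (lev E V) \<and> k_space (lev E V) \<and> bpt E V \<in> topspace (lev E V) \<and>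
        (\<forall>x\<in>topspace (lev E V). smap E V V (Some vzero) x = x)) \<and>
     (\<forall>V W. fd_subspace V \<and> fd_subspace W \<and> V \<subseteq> W \<longrightarrow>
        (\<forall>x\<in>topspace (lev E V). smap E V W None x = bpt E W) \<and>
        (\<forall>w\<in>topspace (sph (ocomp W V)). smap E V W w (bpt E V) = bpt E W) \<and>
        homeomorphic_map (lev E V) (loops (ocomp W V) (lev E W) (bpt E W))
          (\<lambda>x. \<lambda>w\<in>topspace (sph (ocomp W V)). smap E V W w x)) \<and>
     (\<forall>V W Z. fd_subspace V \<and> fd_subspace W \<and> fd_subspace Z \<and> V \<subseteq> W \<and> W \<subseteq> Z \<longrightarrow>
        (\<forall>x\<in>topspace (lev E V). \<forall>w\<in>ocomp W V. \<forall>z\<in>ocomp Z W.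
           smap E W Z (Some z) (smap E V W (Some w) x) = smap E V Z (Some (\<lambda>i. w i + z i)) x))"

definition points :: "'a spec \<Rightarrow> nat \<Rightarrow> (nat \<Rightarrow> vec set) \<Rightarrow> (nat \<Rightarrow> 'a) set" where
  "points E n V = (\<Pi>\<^sub>E k\<in>{..<n}. topspace (lev E (V k)))"

section \<open>H-infinity ring spectra\<close>

text \<open>
  Let \<open>A\<close> be a space over the n-th space of the linear isometries operad via \<open>\<theta>\<close>. A map of
  spectra from the twisted half-smash product of \<open>A\<close> with the n-fold external smash power of \<open>E\<close>
  to \<open>E\<close> amounts to a family of maps
  \<open>E(V\<^sub>0) \<and> \<dots> \<and> E(V\<^sub>n\<^sub>-\<^sub>1) \<rightarrow> E(\<theta>(a)(V\<^sub>0 \<oplus> \<dots> \<oplus> V\<^sub>n\<^sub>-\<^sub>1))\<close> that is compatible with the structure maps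
  and continuous in the following sense: for each \<open>W\<close>, over those \<open>a\<close> for which \<open>\<theta>(a)\<close> carries
  the sum of the \<open>V\<^sub>k\<close> into \<open>W\<close>, it gives a continuous map to \<open>E(W)\<close> on the smash product
  with the Thom space of the bundle with fibre the complement of the image in \<open>W\<close>. For \<open>n = 0\<close>
  the smash power is the two-point space, the empty tuple being its non-base point.
\<close>

definition twisted_map ::
  "'a spec \<Rightarrow> nat \<Rightarrow> 'p topology \<Rightarrow> ('p \<Rightarrow> isom) \<Rightarrow> ('p \<Rightarrow> (nat \<Rightarrow> vec set) \<Rightarrow> (nat \<Rightarrow> 'a) \<Rightarrow> 'a) \<Rightarrow> bool" where
  "twisted_map E n A \<theta> F \<longleftrightarrow>
     (\<forall>V\<in>index_tuples n. \<forall>a\<in>topspace A. \<forall>x\<in>points E n V.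
        F a V x \<in> topspace (lev E (dsum_image n (\<theta> a) V)) \<and>
        ((\<exists>k<n. x k = bpt E (V k)) \<longrightarrow> F a V x = bpt E (dsum_image n (\<theta> a) V))) \<and>
     (\<forall>V\<in>index_tuples n. \<forall>W\<in>index_tuples n. (\<forall>k<n. V k \<subseteq> W k) \<longrightarrow>
        (\<forall>a\<in>topspace A. \<forall>x\<in>points E n V. \<forall>w\<in>(\<Pi>\<^sub>E k\<in>{..<n}. ocomp (W k) (V k)).
           F a W (\<lambda>k\<in>{..<n}. smap E (V k) (W k) (Some (w k)) (x k)) =
           smap E (dsum_image n (\<theta> a) V) (dsum_image n (\<theta> a) W) (Some (\<theta> a w)) (F a V x))) \<and>
     (\<forall>V\<in>index_tuples n. \<forall>W. fd_subspace W \<longrightarrow>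
        continuous_map
          (kification (subtopology
             (prod_topology A (prod_topology (sph W) (product_topology (\<lambda>k. lev E (V k)) {..<n})))
             {(a, w, x). dsum_image n (\<theta> a) V \<subseteq> W \<and>
                w \<in> insert None (Some ` ocomp W (dsum_image n (\<theta> a) V))}))
          (lev E W)
          (\<lambda>(a, w, x). smap E (dsum_image n (\<theta> a) V) W w (F a V x)))"

text \<open>
  A symmetry consists of a self-map \<open>\<rho>\<close> of the parameter space and a permutation \<open>\<tau>\<close> of the
  tuple positions with \<open>\<theta> (\<rho> a) = isom_perm n \<tau> (\<theta> a)\<close>. Maps invariant under a group of
  symmetries are maps out of the orbit spectrum.
\<close>

definition invariant ::
  "'a spec \<Rightarrow> nat \<Rightarrow> 'p topology \<Rightarrow> (('p \<Rightarrow> 'p) \<times> (nat \<Rightarrow> nat)) set \<Rightarrow>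
     ('p \<Rightarrow> (nat \<Rightarrow> vec set) \<Rightarrow> (nat \<Rightarrow> 'a) \<Rightarrow> 'a) \<Rightarrow> bool" where
  "invariant E n A R F \<longleftrightarrow>
     (\<forall>(\<rho>, \<tau>)\<in>R. \<forall>a\<in>topspace A. \<forall>V\<in>index_tuples n. \<forall>x\<in>points E n V.
        F (\<rho> a) V x = F a (V \<circ> \<tau>) (x \<circ> \<tau>))"

definition twisted_homotopic ::
  "'a spec \<Rightarrow> nat \<Rightarrow> 'p topology \<Rightarrow> ('p \<Rightarrow> isom) \<Rightarrow> (('p \<Rightarrow> 'p) \<times> (nat \<Rightarrow> nat)) set \<Rightarrow>
     ('p \<Rightarrow> (nat \<Rightarrow> vec set) \<Rightarrow> (nat \<Rightarrow> 'a) \<Rightarrow> 'a) \<Rightarrow>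
     ('p \<Rightarrow> (nat \<Rightarrow> vec set) \<Rightarrow> (nat \<Rightarrow> 'a) \<Rightarrow> 'a) \<Rightarrow> bool" where
  "twisted_homotopic E n A \<theta> R F F' \<longleftrightarrow>
     (\<exists>h. twisted_map E n (prod_topology A (top_of_set {0..1::real})) (\<lambda>(a, t). \<theta> a) h \<and>
        (\<forall>t\<in>{0..1}. invariant E n A R (\<lambda>a. h (a, t))) \<and>
        (\<forall>a\<in>topspace A. \<forall>V\<in>index_tuples n. \<forall>x\<in>points E n V.
           h (a, 0) V x = F a V x \<and> h (a, 1) V x = F' a V x))"

type_synonym 'a power_maps = "nat \<Rightarrow> isom \<Rightarrow> (nat \<Rightarrow> vec set) \<Rightarrow> (nat \<Rightarrow> 'a) \<Rightarrow> 'a"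

definition power_comp ::
  "'a power_maps \<Rightarrow> nat \<Rightarrow> (nat \<Rightarrow> nat) \<Rightarrow> isom \<Rightarrow> (nat \<Rightarrow> isom) \<Rightarrow> (nat \<Rightarrow> vec set) \<Rightarrow> (nat \<Rightarrow> 'a) \<Rightarrow> 'a" where
  "power_comp \<xi> j ks \<alpha> \<beta> V x =
     \<xi> j \<alpha> (\<lambda>b\<in>{..<j}. dsum_image (ks b) (\<beta> b) (blk ks b V))
           (\<lambda>b\<in>{..<j}. \<xi> (ks b) (\<beta> b) (blk ks b V) (blk ks b x))"

definition sum_symmetries ::
  "nat \<Rightarrow> nat \<Rightarrow> ((isom \<times> isom \<Rightarrow> isom \<times> isom) \<times> (nat \<Rightarrow> nat)) set" where
  "sum_symmetries j k =
     {(\<lambda>(\<alpha>, \<beta>). (isom_perm j \<pi> \<alpha>, isom_perm k \<rho> \<beta>),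
       \<lambda>s. if s < j then \<pi> s else if s < j + k then j + \<rho> (s - j) else s) | \<pi> \<rho>.
       \<pi> permutes {..<j} \<and> \<rho> permutes {..<k}}"

definition wreath_symmetries ::
  "nat \<Rightarrow> nat \<Rightarrow> ((isom \<times> (nat \<Rightarrow> isom) \<Rightarrow> isom \<times> (nat \<Rightarrow> isom)) \<times> (nat \<Rightarrow> nat)) set" where
  "wreath_symmetries j k =
     {(\<lambda>(\<alpha>, \<beta>). (isom_perm j \<pi> \<alpha>, \<lambda>c\<in>{..<j}. isom_perm k (\<rho> c) (\<beta> (inv_into UNIV \<pi> c))),
       \<lambda>s. if s < j * k then \<pi> (s div k) * k + \<rho> (\<pi> (s div k)) (s mod k) else s) | \<pi> \<rho>.
       \<pi> permutes {..<j} \<and> (\<forall>c<j. \<rho> c permutes {..<k})}"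

text \<open>
  The definition of Bruner, May, McClure and Steinberger: maps \<open>\<xi>\<^sub>n : D\<^sub>n E \<rightarrow> E\<close> out of the extended
  powers such that \<open>\<xi>\<^sub>1\<close> is the identity and the two diagrams built from
  \<open>D\<^sub>j E \<and> D\<^sub>k E \<rightarrow> D\<^sub>j\<^sub>+\<^sub>k E\<close> and \<open>D\<^sub>j D\<^sub>k E \<rightarrow> D\<^sub>j\<^sub>k E\<close> commute up to homotopy, with no coherence
  required of the homotopies. The internal smash product is formed along any isometry \<open>\<iota>\<close>.

  Maps and homotopies are those of the spectra themselves; no separate localisation appears. If
  \<open>E\<close> has the homotopy type of a CW spectrum, then so do the extended powers, and these are exactly
  the maps in the stable homotopy category; every object of that category has such a representative.
  For arbitrary \<open>E\<close>, Whitehead's theorem transports the structure to a CW approximation, so it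
  still is an H-infinity structure in the stable homotopy category.
\<close>

definition Hinf_ring_spectrum :: "'a spec \<Rightarrow> 'a power_maps \<Rightarrow> bool" where
  "Hinf_ring_spectrum E \<xi> \<longleftrightarrow>
     spectrum E \<and>
     (\<forall>n. twisted_map E n (isom_top n) (\<lambda>\<alpha>. \<alpha>) (\<xi> n) \<and>
          invariant E n (isom_top n) {(isom_perm n \<pi>, \<pi>) | \<pi>. \<pi> permutes {..<n}} (\<xi> n)) \<and>
     twisted_homotopic E 1 (discrete_topology {()}) (\<lambda>_. \<lambda>v\<in>tuples 1. v 0) {}
       (\<lambda>_. \<xi> 1 (\<lambda>v\<in>tuples 1. v 0)) (\<lambda>_ V x. x 0) \<and>
     (\<forall>\<iota>\<in>lin_isoms 2. \<forall>j k.
        let ks = (\<lambda>b. if b = 0 then j else k); pr = (\<lambda>\<alpha> \<beta> b. if b = (0::nat) then \<alpha> else \<beta>) in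
        twisted_homotopic E (j + k) (prod_topology (isom_top j) (isom_top k))
          (\<lambda>(\<alpha>, \<beta>). isom_comp 2 ks \<iota> (pr \<alpha> \<beta>)) (sum_symmetries j k)
          (\<lambda>(\<alpha>, \<beta>). \<xi> (j + k) (isom_comp 2 ks \<iota> (pr \<alpha> \<beta>)))
          (\<lambda>(\<alpha>, \<beta>). power_comp \<xi> 2 ks \<iota> (pr \<alpha> \<beta>))) \<and>
     (\<forall>j k.
        twisted_homotopic E (j * k)
          (prod_topology (isom_top j) (product_topology (\<lambda>_. isom_top k) {..<j}))
          (\<lambda>(\<alpha>, \<beta>). isom_comp j (\<lambda>_. k) \<alpha> \<beta>) (wreath_symmetries j k)
          (\<lambda>(\<alpha>, \<beta>). \<xi> (j * k) (isom_comp j (\<lambda>_. k) \<alpha> \<beta>))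
          (\<lambda>(\<alpha>, \<beta>). power_comp \<xi> j (\<lambda>_. k) \<alpha> \<beta>))"

section \<open>Cohomology and transfers\<close>

abbreviation zspace :: "'a spec \<Rightarrow> 'a topology" where
  "zspace E \<equiv> lev E {vzero}"

text \<open>
  A little box in n-space is a product of increasing open embeddings of the line into itself, so the
  following is the action of the little boxes operad on the n-fold loop space \<open>\<Omega>\<^sup>n E(\<real>\<^sup>n) = E(0)\<close>:
  \<open>e\<close> is obtained from the family \<open>f\<close> of loops by collapsing the complement of the disjoint boxes
  \<open>c x\<close>, for \<open>x \<in> I\<close>, and applying \<open>f x\<close> on the box \<open>c x\<close>.
\<close>

definition box_point :: "(nat \<Rightarrow> real \<Rightarrow> real) \<Rightarrow> vec \<Rightarrow> vec" where
  "box_point d w = (\<lambda>i. d i (w i))"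

definition box_sum ::
  "'a spec \<Rightarrow> nat \<Rightarrow> 'x set \<Rightarrow> ('x \<Rightarrow> nat \<Rightarrow> real \<Rightarrow> real) \<Rightarrow> ('x \<Rightarrow> 'a) \<Rightarrow> 'a \<Rightarrow> bool" where
  "box_sum E n I c f e \<longleftrightarrow>
     e \<in> topspace (zspace E) \<and>
     (\<forall>x\<in>I. \<forall>w\<in>coord_space n.
        smap E {vzero} (coord_space n) (Some (box_point (c x) w)) e =
        smap E {vzero} (coord_space n) (Some w) (f x)) \<and>
     (\<forall>v\<in>coord_space n - (\<Union>x\<in>I. box_point (c x) ` coord_space n).
        smap E {vzero} (coord_space n) (Some v) e = bpt E (coord_space n))"

abbreviation htpy_class :: "'a spec \<Rightarrow> 'x topology \<Rightarrow> ('x \<Rightarrow> 'a) \<Rightarrow> ('x \<Rightarrow> 'a) set" where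
  "htpy_class E X f \<equiv> {h. homotopic_with (\<lambda>_. True) X (zspace E) f h}"

text \<open>Addition of two loops in the first coordinate, on the negative and on the positive half-line.\<close>

definition halves :: "bool \<Rightarrow> nat \<Rightarrow> real \<Rightarrow> real" where
  "halves b i s = (if i = 0 then (if b then exp s else - exp (- s)) else s)"

text \<open>
  The ring \<open>E\<^sup>0(X)\<close> of homotopy classes of unbased maps from \<open>X\<close> to the zeroth space of \<open>E\<close>, for
  \<open>X\<close> of the homotopy type of a CW complex. The product comes from \<open>\<xi>\<^sub>2\<close> and the unit from \<open>\<xi>\<^sub>0\<close>; the
  choice of isometry does not matter because the spaces of isometries are path connected.
\<close>

definition coh :: "'a spec \<Rightarrow> 'a power_maps \<Rightarrow> 'x topology \<Rightarrow> ('x \<Rightarrow> 'a) set ring" where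
  "coh E \<xi> X =
     \<lparr>carrier = {htpy_class E X f | f. continuous_map X (zspace E) f},
      mult = (\<lambda>a b. \<Union>f\<in>a. \<Union>g\<in>b. \<Union>\<iota>\<in>lin_isoms 2. htpy_class E X
        (\<lambda>x. \<xi> 2 \<iota> (\<lambda>k\<in>{..<2}. {vzero}) (\<lambda>k\<in>{..<2}. if k = 0 then f x else g x))),
      one = (\<Union>\<iota>\<in>lin_isoms 0. htpy_class E X (\<lambda>x. \<xi> 0 \<iota> (\<lambda>_. undefined) (\<lambda>_. undefined))),
      zero = htpy_class E X (\<lambda>x. bpt E {vzero}),
      add = (\<lambda>a b. \<Union>f\<in>a. \<Union>g\<in>b. \<Union>s\<in>{s. \<forall>x\<in>topspace X.
                box_sum E 1 UNIV halves (\<lambda>p. if p then g x else f x) (s x)}. htpy_class E X s)\<rparr>"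

text \<open>
  Fibrewise disjoint boxes for a map \<open>p\<close> with finite fibres, that is, a fibrewise embedding of \<open>X\<close>
  in the product of \<open>Y\<close> with the infinite-dimensional space, with a trivialised tubular
  neighbourhood. Locally over \<open>Y\<close> only finitely many coordinates are used.
\<close>

definition box_embedding ::
  "'x topology \<Rightarrow> 'y topology \<Rightarrow> ('x \<Rightarrow> 'y) \<Rightarrow> ('x \<Rightarrow> nat \<Rightarrow> real \<Rightarrow> real) \<Rightarrow> bool" where
  "box_embedding X Y p c \<longleftrightarrow>
     (\<forall>x\<in>topspace X. \<forall>i. strict_mono (c x i)) \<and>
     (\<forall>i. continuous_map (prod_topology X euclideanreal) euclideanreal (\<lambda>(x, s). c x i s)) \<and>
     (\<forall>y\<in>topspace Y. \<exists>U n. openin Y U \<and> y \<in> U \<and>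
        (\<forall>x\<in>topspace X. p x \<in> U \<longrightarrow> (\<forall>i\<ge>n. c x i = id))) \<and>
     (\<forall>x\<in>topspace X. \<forall>x'\<in>topspace X. x \<noteq> x' \<and> p x = p x' \<longrightarrow>
        (\<exists>i. range (c x i) \<inter> range (c x' i) = {}))"

text \<open>
  The additive transfer \<open>E\<^sup>0(X) \<rightarrow> E\<^sup>0(Y)\<close> along a finite cover \<open>p\<close> of a paracompact space \<open>Y\<close>,
  by the Pontryagin--Thom construction. The union ranges over all representatives and all box
  embeddings; these embeddings exist and any two are homotopic, so the union is one homotopy class.
\<close>

definition transfer_along ::
  "'a spec \<Rightarrow> 'x topology \<Rightarrow> 'y topology \<Rightarrow> ('x \<Rightarrow> 'y) \<Rightarrow> ('x \<Rightarrow> 'a) set \<Rightarrow> ('y \<Rightarrow> 'a) set" where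
  "transfer_along E X Y p a =
     (\<Union>f\<in>a. \<Union>c\<in>Collect (box_embedding X Y p).
        \<Union>g\<in>{g. \<forall>y\<in>topspace Y. \<forall>n.
               (\<forall>x\<in>topspace X. p x = y \<longrightarrow> (\<forall>i\<ge>n. c x i = id)) \<longrightarrow>
               box_sum E n {x \<in> topspace X. p x = y} c f (g y)}.
          htpy_class E Y g)"

section \<open>Classifying spaces\<close>

text \<open>
  Milnor's infinite join: \<open>u (n, g)\<close> is the n-th join coordinate if \<open>g\<close> is the n-th group
  coordinate, and is 0 otherwise.
\<close>

definition EG :: "('g, 'b) monoid_scheme \<Rightarrow> (nat \<times> 'g \<Rightarrow> real) topology" where
  "EG G = top_of_set {u. (\<forall>z. 0 \<le> u z) \<and> finite {z. u z \<noteq> 0} \<and> {z. u z \<noteq> 0} \<subseteq> UNIV \<times> carrier G \<and>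
     (\<forall>n g h. u (n, g) \<noteq> 0 \<and> u (n, h) \<noteq> 0 \<longrightarrow> g = h) \<and> (\<Sum>z | u z \<noteq> 0. u z) = 1}"

definition EG_act :: "('g, 'b) monoid_scheme \<Rightarrow> 'g \<Rightarrow> (nat \<times> 'g \<Rightarrow> real) \<Rightarrow> nat \<times> 'g \<Rightarrow> real" where
  "EG_act G g u = (\<lambda>(n, h). if h \<in> carrier G then u (n, inv\<^bsub>G\<^esub> g \<otimes>\<^bsub>G\<^esub> h) else 0)"

definition orb :: "('k \<Rightarrow> 'x \<Rightarrow> 'x) \<Rightarrow> 'k set \<Rightarrow> 'x \<Rightarrow> 'x set" where
  "orb act K x = (\<lambda>k. act k x) ` K"

definition orbit_space :: "'x topology \<Rightarrow> ('k \<Rightarrow> 'x \<Rightarrow> 'x) \<Rightarrow> 'k set \<Rightarrow> 'x set topology" where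
  "orbit_space X act K = topology (\<lambda>U. U \<subseteq> orb act K ` topspace X \<and>
     openin X {x \<in> topspace X. orb act K x \<in> U})"

lemma openin_orbit_space:
  "openin (orbit_space X act K) U \<longleftrightarrow>
     U \<subseteq> orb act K ` topspace X \<and> openin X {x \<in> topspace X. orb act K x \<in> U}"
proof -
  have eq1: "{x \<in> topspace X. orb act K x \<in> S \<inter> T} =
      {x \<in> topspace X. orb act K x \<in> S} \<inter> {x \<in> topspace X. orb act K x \<in> T}" for S T
    by blast
  have eq2: "{x \<in> topspace X. orb act K x \<in> \<Union>\<K>} =
      (\<Union>U\<in>\<K>. {x \<in> topspace X. orb act K x \<in> U})" for \<K>
    by blast
  have "istopology (\<lambda>U. U \<subseteq> orb act K ` topspace X \<and>
      openin X {x \<in> topspace X. orb act K x \<in> U})"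
    unfolding istopology_def
  proof (intro conjI allI impI, goal_cases)
    case (2 S T)
    then show ?case by (subst eq1) (auto intro: openin_Int)
  next
    case (4 \<K>)
    then show ?case by (subst eq2) (intro openin_Union, auto)
  qed auto
  then show ?thesis
    by (simp only: orbit_space_def topology_inverse')
qed

definition BG :: "('g, 'b) monoid_scheme \<Rightarrow> (nat \<times> 'g \<Rightarrow> real) set topology" where
  "BG G = orbit_space (EG G) (EG_act G) (carrier G)"

type_synonym 'g epoint = "(nat \<times> 'g \<Rightarrow> real) \<times> (nat \<times> (nat \<Rightarrow> nat) \<Rightarrow> real)"
type_synonym 'g bpoint = "(nat \<times> 'g \<Rightarrow> real) set \<times> (nat \<times> (nat \<Rightarrow> nat) \<Rightarrow> real) set"

text \<open>\<open>E(G \<times> \<Sigma>\<^sub>m)\<close> is taken to be \<open>EG \<times> E\<Sigma>\<^sub>m\<close>.\<close>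

definition Etot :: "('g, 'b) monoid_scheme \<Rightarrow> nat \<Rightarrow> 'g epoint topology" where
  "Etot G m = prod_topology (EG G) (EG (sym_group m))"

definition Etot_act ::
  "('g, 'b) monoid_scheme \<Rightarrow> nat \<Rightarrow> 'g \<times> (nat \<Rightarrow> nat) \<Rightarrow> 'g epoint \<Rightarrow> 'g epoint" where
  "Etot_act G m k u = (EG_act G (fst k) (fst u), EG_act (sym_group m) (snd k) (snd u))"

definition Bprod :: "('g, 'b) monoid_scheme \<Rightarrow> nat \<Rightarrow> 'g bpoint topology" where
  "Bprod G m = prod_topology (BG G) (BG (sym_group m))"

definition Bproj :: "('g, 'b) monoid_scheme \<Rightarrow> nat \<Rightarrow> 'g epoint \<Rightarrow> 'g bpoint" where
  "Bproj G m u = (orb (EG_act G) (carrier G) (fst u),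
     orb (EG_act (sym_group m)) (carrier (sym_group m)) (snd u))"

text \<open>
  The cover \<open>BK \<rightarrow> BG \<times> B\<Sigma>\<^sub>m\<close> of a subgroup \<open>K\<close> of \<open>G \<times> \<Sigma>\<^sub>m\<close>, and the cover
  \<open>Z\<^sub>h\<^sub>(\<^sub>G\<^sub>\<times>\<^sub>\<Sigma>\<^sub>m\<^sub>) \<rightarrow> BG \<times> B\<Sigma>\<^sub>m\<close> of a finite set \<open>Z\<close> with an action. The projections are constant on orbits,
  so \<^const>\<open>the_elem\<close> picks their only value.
\<close>

definition Bsub :: "('g, 'b) monoid_scheme \<Rightarrow> nat \<Rightarrow> ('g \<times> (nat \<Rightarrow> nat)) set \<Rightarrow> 'g epoint set topology" where
  "Bsub G m K = orbit_space (Etot G m) (Etot_act G m) K"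

definition tr_subgroup ::
  "'a spec \<Rightarrow> ('g, 'b) monoid_scheme \<Rightarrow> nat \<Rightarrow> ('g \<times> (nat \<Rightarrow> nat)) set \<Rightarrow>
     ('g epoint set \<Rightarrow> 'a) set \<Rightarrow> ('g bpoint \<Rightarrow> 'a) set" where
  "tr_subgroup E G m K =
     transfer_along E (Bsub G m K) (Bprod G m) (\<lambda>B. the_elem (Bproj G m ` B))"

definition homotopy_orbits ::
  "('g, 'b) monoid_scheme \<Rightarrow> nat \<Rightarrow> ('g \<times> (nat \<Rightarrow> nat) \<Rightarrow> 'z \<Rightarrow> 'z) \<Rightarrow> 'z set \<Rightarrow>
     ('g epoint \<times> 'z) set topology" where
  "homotopy_orbits G m act Z =
     orbit_space (prod_topology (Etot G m) (discrete_topology Z))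
       (\<lambda>k x. (Etot_act G m k (fst x), act k (snd x))) (carrier (G \<times>\<times> sym_group m))"

definition tr_homotopy_orbits ::
  "'a spec \<Rightarrow> ('g, 'b) monoid_scheme \<Rightarrow> nat \<Rightarrow> ('g \<times> (nat \<Rightarrow> nat) \<Rightarrow> 'z \<Rightarrow> 'z) \<Rightarrow> 'z set \<Rightarrow>
     (('g epoint \<times> 'z) set \<Rightarrow> 'a) set \<Rightarrow> ('g bpoint \<Rightarrow> 'a) set" where
  "tr_homotopy_orbits E G m act Z =
     transfer_along E (homotopy_orbits G m act Z) (Bprod G m) (\<lambda>B. the_elem ((Bproj G m \<circ> fst) ` B))"

section \<open>The ideals\<close>

definition tr_image ::
  "'a spec \<Rightarrow> 'a power_maps \<Rightarrow> ('g, 'b) monoid_scheme \<Rightarrow> nat \<Rightarrow> ('g \<times> (nat \<Rightarrow> nat)) set \<Rightarrow>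
     ('g bpoint \<Rightarrow> 'a) set set" where
  "tr_image E \<xi> G m K = tr_subgroup E G m K ` carrier (coh E \<xi> (Bsub G m K))"

text \<open>The subgroup \<open>G \<times> \<Sigma>\<^sub>i \<times> \<Sigma>\<^sub>m\<^sub>-\<^sub>i\<close> of \<open>G \<times> \<Sigma>\<^sub>m\<close>.\<close>

definition young :: "('g, 'b) monoid_scheme \<Rightarrow> nat \<Rightarrow> nat \<Rightarrow> ('g \<times> (nat \<Rightarrow> nat)) set" where
  "young G m i = carrier G \<times> {\<sigma>. \<sigma> permutes {1..m} \<and> \<sigma> ` {1..i} = {1..i}}"

definition I_Tr ::
  "'a spec \<Rightarrow> 'a power_maps \<Rightarrow> ('g, 'b) monoid_scheme \<Rightarrow> nat \<Rightarrow> ('g bpoint \<Rightarrow> 'a) set set" where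
  "I_Tr E \<xi> G m =
     {finsum (coh E \<xi> (Bprod G m)) (\<lambda>i. tr_subgroup E G m (young G m i) (a i)) {1..<m} | a.
        \<forall>i\<in>{1..<m}. a i \<in> carrier (coh E \<xi> (Bsub G m (young G m i)))}"

definition lcos :: "('g, 'b) monoid_scheme \<Rightarrow> 'g set \<Rightarrow> 'g set \<Rightarrow> 'g set set" where
  "lcos G S H = (\<lambda>s. s <#\<^bsub>G\<^esub> H) ` S"

definition coset_power_act ::
  "('g, 'b) monoid_scheme \<Rightarrow> nat \<Rightarrow> 'g \<times> (nat \<Rightarrow> nat) \<Rightarrow> (nat \<Rightarrow> 'g set) \<Rightarrow> nat \<Rightarrow> 'g set" where
  "coset_power_act G m k z = (\<lambda>i\<in>{1..m}. fst k <#\<^bsub>G\<^esub> z (inv_into UNIV (snd k) i))"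

definition Zset :: "('g, 'b) monoid_scheme \<Rightarrow> 'g set \<Rightarrow> nat \<Rightarrow> (nat \<Rightarrow> 'g set) set" where
  "Zset G H m = ({1..m} \<rightarrow>\<^sub>E lcos G (carrier G) H) - {\<lambda>i\<in>{1..m}. g <#\<^bsub>G\<^esub> H | g. g \<in> carrier G}"

definition J_ideal ::
  "'a spec \<Rightarrow> 'a power_maps \<Rightarrow> ('g, 'b) monoid_scheme \<Rightarrow> 'g set \<Rightarrow> nat \<Rightarrow> ('g bpoint \<Rightarrow> 'a) set set" where
  "J_ideal E \<xi> G H m = Idl\<^bsub>coh E \<xi> (Bprod G m)\<^esub>
     ((\<Union>i\<in>{1..<m}. tr_image E \<xi> G m (young G m i)) \<union>
      tr_homotopy_orbits E G m (coset_power_act G m) (Zset G H m) `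
        carrier (coh E \<xi> (homotopy_orbits G m (coset_power_act G m) (Zset G H m))))"

text \<open>
  For an ordering \<open>\<omega>\<close> of \<open>S/H\<close>, a bijection from \<open>{1..n}\<close>, the permutation of \<open>{1..n}\<close> by which
  \<open>s\<close> acts on \<open>S/H\<close>.
\<close>

definition coset_perm ::
  "('g, 'b) monoid_scheme \<Rightarrow> nat \<Rightarrow> (nat \<Rightarrow> 'g set) \<Rightarrow> 'g \<Rightarrow> nat \<Rightarrow> nat" where
  "coset_perm G n \<omega> s i = (if i \<in> {1..n} then inv_into {1..n} \<omega> (s <#\<^bsub>G\<^esub> \<omega> i) else i)"

definition act_graph ::
  "('g, 'b) monoid_scheme \<Rightarrow> 'g set \<Rightarrow> nat \<Rightarrow> (nat \<Rightarrow> 'g set) \<Rightarrow> ('g \<times> (nat \<Rightarrow> nat)) set" where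
  "act_graph G S n \<omega> = {(s, coset_perm G n \<omega> s) | s. s \<in> S}"

text \<open>
  The element \<open>(\<rho>, \<pi>)\<close> of the wreath product as a permutation of \<open>{1..n * q}\<close>: it moves block \<open>b\<close>,
  consisting of \<open>(b - 1) * q + r\<close> for \<open>r \<in> {1..q}\<close>, to block \<open>\<pi> b\<close> and then permutes that block
  by \<open>\<rho> (\<pi> b)\<close>.
\<close>

definition wreath_perm :: "nat \<Rightarrow> nat \<Rightarrow> (nat \<Rightarrow> nat \<Rightarrow> nat) \<Rightarrow> (nat \<Rightarrow> nat) \<Rightarrow> nat \<Rightarrow> nat" where
  "wreath_perm q n \<rho> \<pi> k =
     (if k \<in> {1..n * q}
      then let b = (k - 1) div q + 1; r = (k - 1) mod q + 1 in (\<pi> b - 1) * q + \<rho> (\<pi> b) r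
      else k)"

definition wreath_graph ::
  "('g, 'b) monoid_scheme \<Rightarrow> 'g set \<Rightarrow> nat \<Rightarrow> nat \<Rightarrow> (nat \<Rightarrow> 'g set) \<Rightarrow> ('g \<times> (nat \<Rightarrow> nat)) set" where
  "wreath_graph G S n q \<omega> =
     {(s, wreath_perm q n \<rho> \<pi>) | s \<pi> \<rho>.
        (s, \<pi>) \<in> act_graph G S n \<omega> \<and> (\<forall>b\<in>{1..n}. \<rho> b permutes {1..q})}"

end

theory Submission imports Defs begin

text \<open>Write Gamma for \<open>G \<times>\<times> sym_group m\<close>. All covers involved are
  homotopy orbits of finite Gamma-sets, and the theorem comes from decomposing
  \<open>Zset G H m\<close> into orbits. Three properties of the transfer carry this. It is additive
  over disjoint unions of covers (\<open>transfer_add\<close>, \<open>tr_add\<close>). A transfer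
  along a composite cover is a transfer along its second factor, so an equivariant map of finite
  Gamma-sets gives an inclusion of transfer images (\<open>transfer_comp\<close>,
  \<open>tr_set_mono\<close>). For a transitive set the image is that of the transfer from the
  classifying space of a stabilizer (\<open>tr_set_orbit\<close>). Hence an ideal contains all
  transfers from a Gamma-set as soon as it contains those from its orbits
  (\<open>tr_set_ideal\<close>); conversely, extension by zero shows that the transfers from one
  orbit are among those from the whole set (\<open>tr_set_subset\<close>).

  What remains is the combinatorics of a nondiagonal point z of the m-fold power of G/H
  (\<open>normalized_config_cases\<close>). After translation the first entry of z is H. The
  stabilizer of z acts on the positions 1, ..., m through its permutation part. If this action is
  not transitive, the orbit of position 1 is a proper nonempty set of positions preserved by the
  stabilizer; the stabilizer is then conjugate into a Young subgroup, and the transfers lie in the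
  ideal generated by the Young transfers. If it is transitive, let S be the projection of the
  stabilizer to G. Since H is normal, its elements fix every coset, so H is contained in S. The
  entries of z are exactly the cosets in S/H, and each occurs equally often, say q times, because
  the stabilizer carries the positions of one entry to the positions of another. So m = nq with n =
  [S:H], and n is not 1 because z is not diagonal. Up to a permutation z is the configuration that
  repeats each coset of S/H in a block of length q (\<open>block_config\<close>), whose stabilizer
  is the wreath graph (\<open>stab_block_config\<close>): the group element dictates how the blocks
  move, and within blocks everything is allowed. Conversely every such block configuration is a
  point of \<open>Zset G H m\<close> (\<open>block_config_Zset\<close>).

  The longest part makes transfers computable from their definition as a union over all
  representatives and all box embeddings. A map into the zeroth space is given by a family of loops
  (\<open>adjoint_lift\<close>). Over an evenly covered set the loops of the sheets fit together
  because the boxes in a fibre are disjoint (\<open>pt_local\<close>), and these local sums paste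
  (\<open>pt_exists\<close>) because they are unique. The same construction over a cylinder yields
  homotopies (\<open>pt_homotopic\<close>), and any two box embeddings are homotopic
  (\<open>pt_homotopic_boxes\<close>), so the union is one class (\<open>transfer_eq\<close>).
  Addition in cohomology is itself a transfer along a trivial double cover (\<open>coh_add\<close>).
  Local triviality and box embeddings come from bump functions on Milnor's join
  (\<open>principal_action_Etot\<close>, \<open>box_embedding_hoq\<close>). The two ideals are
  compared by testing which ideals contain their generators (\<open>genideal_cong\<close>).\<close>

section \<open>The exponential law for the compact-open topology\<close>

lemma topspace_compact_open:
  "topspace (compact_open X Y) = {f \<in> extensional (topspace X). continuous_map X Y f}"
proof -
  have "topspace (compact_open X Y) = \<Union>{{f \<in> extensional (topspace X). continuous_map X Y f \<and> f ` K \<subseteq> U} | K U.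
        compactin X K \<and> openin Y U}"
    by (simp add: compact_open_def)
  also have "\<dots> = {f \<in> extensional (topspace X). continuous_map X Y f}"
  proof (intro equalityI subsetI)
    fix f assume "f \<in> {f \<in> extensional (topspace X). continuous_map X Y f}"
    \<comment> \<open>For the empty compact set the subbasic condition is vacuous, so a single
      generator already contains every continuous extensional map.\<close>
    then have "f \<in> {f \<in> extensional (topspace X). continuous_map X Y f \<and> f ` {} \<subseteq> {}}"
      by auto
    moreover have "compactin X {}" "openin Y {}" by auto
    ultimately show "f \<in> \<Union>{{f \<in> extensional (topspace X). continuous_map X Y f \<and> f ` K \<subseteq> U} | K U.
        compactin X K \<and> openin Y U}" by blast
  qed auto
  finally show ?thesis .
qed

lemma openin_compact_open:
  assumes "compactin X K" "openin Y U"
  shows "openin (compact_open X Y) {f \<in> extensional (topspace X). continuous_map X Y f \<and> f ` K \<subseteq> U}"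
  unfolding compact_open_def by (rule topology_generated_by_Basis) (use assms in blast)

text \<open>A subbasic set tests the curried map only on a compact \<open>K\<close>, and the tube
  lemma thickens the slice over \<open>a\<close> to a product neighbourhood of it.\<close>

lemma continuous_map_curry:
  assumes f: "continuous_map (prod_topology A X) Y f"
  shows "continuous_map A (compact_open X Y) (\<lambda>a. \<lambda>x\<in>topspace X. f (a, x))"
proof -
  have slice: "continuous_map X Y (\<lambda>x\<in>topspace X. f (a, x))" if "a \<in> topspace A" for a
  proof -
    have "continuous_map X Y (f \<circ> Pair a)"
      by (rule continuous_map_o_Pair[OF f that])
    then show ?thesis by (rule continuous_map_eq) auto
  qed
  have op: "openin A ((\<lambda>a. \<lambda>x\<in>topspace X. f (a, x)) -`
      {g \<in> extensional (topspace X). continuous_map X Y g \<and> g ` K \<subseteq> U} \<inter> topspace A)"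
    (is "openin A ?P") if K: "compactin X K" and U: "openin Y U" for K U
  proof (subst openin_subopen, intro ballI)
    fix a assume a: "a \<in> ?P"
    have KX: "K \<subseteq> topspace X" by (rule compactin_subset_topspace[OF K])
    have opW: "openin (prod_topology A X) {z \<in> topspace (prod_topology A X). f z \<in> U}"
      by (rule openin_continuous_map_preimage[OF f U])
    have "{a} \<times> K \<subseteq> {z \<in> topspace (prod_topology A X). f z \<in> U}"
      using a KX by (auto simp: image_subset_iff subset_iff)
    then obtain V W where VW: "openin A V" "a \<in> V" "K \<subseteq> W" "V \<times> W \<subseteq> {z \<in> topspace (prod_topology A X). f z \<in> U}"
      using tube_lemma_right[OF opW K, of a] a by auto
    have "V \<subseteq> ?P"
    proof
      fix b assume b: "b \<in> V"
      then have bA: "b \<in> topspace A" using VW(1) openin_subset by blast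
      have "(\<lambda>x\<in>topspace X. f (b, x)) ` K \<subseteq> U"
        using VW(3,4) b KX by (auto simp: restrict_def)
      then show "b \<in> ?P" using slice[OF bA] bA by simp
    qed
    with VW show "\<exists>T. openin A T \<and> a \<in> T \<and> T \<subseteq> ?P" by blast
  qed
  show ?thesis
    unfolding compact_open_def
  proof (rule continuous_on_generated_topo)
    fix U assume "U \<in> {{f \<in> extensional (topspace X). continuous_map X Y f \<and> f ` K \<subseteq> U} | K U.
        compactin X K \<and> openin Y U}"
    then obtain K V where "U = {f \<in> extensional (topspace X). continuous_map X Y f \<and> f ` K \<subseteq> V}"
      "compactin X K" "openin Y V" by blast
    then show "openin A ((\<lambda>a. \<lambda>x\<in>topspace X. f (a, x)) -` U \<inter> topspace A)"
      using op[of K V] by simp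
  next
    have "(\<lambda>a. \<lambda>x\<in>topspace X. f (a, x)) ` topspace A \<subseteq> topspace (compact_open X Y)"
      using slice by (auto simp: topspace_compact_open)
    then show "(\<lambda>a. \<lambda>x\<in>topspace X. f (a, x)) ` topspace A \<subseteq>
       \<Union>{{f \<in> extensional (topspace X). continuous_map X Y f \<and> f ` K \<subseteq> U} | K U.
        compactin X K \<and> openin Y U}"
      by (simp only: compact_open_def topology_generated_by_topspace)
  qed
qed

text \<open>In a compact Hausdorff space each point has a compact neighbourhood inside the preimage
  of \<open>U\<close>; that neighbourhood and \<open>U\<close> together define a subbasic
  neighbourhood of the map.\<close>

lemma continuous_map_eval:
  assumes "compact_space X" "Hausdorff_space X"
  shows "continuous_map (prod_topology X (compact_open X Y)) Y (\<lambda>(x, f). f x)"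
  unfolding continuous_map_def
proof (intro conjI allI impI)
  show "(\<lambda>(x, f). f x) \<in> topspace (prod_topology X (compact_open X Y)) \<rightarrow> topspace Y"
    by (auto simp: topspace_compact_open continuous_map_def)
next
  fix U assume U: "openin Y U"
  let ?P = "{z \<in> topspace (prod_topology X (compact_open X Y)). (case z of (x, f) \<Rightarrow> f x) \<in> U}"
  show "openin (prod_topology X (compact_open X Y)) ?P"
  proof (subst openin_subopen, intro ballI)
    fix z assume z: "z \<in> ?P"
    then obtain x f where zz: "z = (x, f)" "x \<in> topspace X" "f \<in> extensional (topspace X)"
        "continuous_map X Y f" "f x \<in> U"
      by (auto simp: topspace_compact_open)
    have "openin X {x \<in> topspace X. f x \<in> U}"
      by (rule openin_continuous_map_preimage[OF zz(4) U])
    moreover have "neighbourhood_base_of (\<lambda>C. compactin X C \<and> closedin X C) X"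
      using assms compact_imp_locally_compact_space compact_Hausdorff_imp_regular_space
        locally_compact_regular_space_neighbourhood_base by blast
    ultimately obtain N K where NK: "openin X N" "x \<in> N" "N \<subseteq> K" "compactin X K"
        "K \<subseteq> {x \<in> topspace X. f x \<in> U}"
      unfolding neighbourhood_base_of using zz by (smt (verit, best) mem_Collect_eq)
    let ?Q = "{f \<in> extensional (topspace X). continuous_map X Y f \<and> f ` K \<subseteq> U}"
    have "openin (prod_topology X (compact_open X Y)) (N \<times> ?Q)"
      by (simp add: openin_prod_Times_iff NK openin_compact_open U)
    moreover have "z \<in> N \<times> ?Q" using zz NK by auto
    moreover have "N \<times> ?Q \<subseteq> ?P"
      using NK openin_subset[OF NK(1)] by (auto simp: topspace_compact_open image_subset_iff subset_iff)
    ultimately show "\<exists>T. openin (prod_topology X (compact_open X Y)) T \<and> z \<in> T \<and> T \<subseteq> ?P" by blast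
  qed
qed

section \<open>Coordinate subspaces and their spheres\<close>

lemma vzero_coord [simp]: "vzero \<in> coord_space n"
  by (simp add: coord_space_def vzero_def)

lemma coord_space_mono: "n \<le> N \<Longrightarrow> coord_space n \<subseteq> coord_space N"
  by (auto simp: coord_space_def)

lemma fd_coord [simp]: "fd_subspace (coord_space n)"
  unfolding fd_subspace_def by (auto simp: coord_space_def vzero_def)

lemma fd_zero [simp]: "fd_subspace {vzero}"
  unfolding fd_subspace_def by (auto simp: coord_space_def vzero_def)

lemma ocomp_zero [simp]: "ocomp V {vzero} = V"
  by (auto simp: ocomp_def vip_def vzero_def)

lemma openin_coord_bounded:
  "openin (top_of_set (coord_space n)) {v \<in> coord_space n. \<forall>i<n. \<bar>v i\<bar> < r}"
proof -
  have "{v::nat\<Rightarrow>real. \<forall>i<n. \<bar>v i\<bar> < r} = (\<Inter>i<n. {v. \<bar>v i\<bar> < r})" by auto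
  moreover have "open (\<Inter>i<n. {v::nat\<Rightarrow>real. \<bar>v i\<bar> < r})"
    by (intro open_INT finite_lessThan ballI open_Collect_less continuous_on_rabs continuous_on_const
        continuous_on_product_coordinates)
  ultimately have "open {v::nat\<Rightarrow>real. \<forall>i<n. \<bar>v i\<bar> < r}" by simp
  then show ?thesis
    by (subst openin_open, intro exI[of _ "{v. \<forall>i<n. \<bar>v i\<bar> < r}"]) blast
qed

lemma compact_coord_box:
  "compactin (top_of_set (coord_space n)) {v \<in> coord_space n. \<forall>i<n. v i \<in> {a i..b i}}"
proof -
  \<comment> \<open>With the single point 0 as factor beyond \<open>n\<close>, the box is a product
    of compact sets over all indices, and Tychonoff's theorem applies.\<close>
  have eq: "{v \<in> coord_space n. \<forall>i<n. v i \<in> {a i..b i}} = Pi\<^sub>E UNIV (\<lambda>i. if i < n then {a i..b i} else {0})"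
  proof (rule Set.set_eqI)
    fix v
    show "v \<in> {v \<in> coord_space n. \<forall>i<n. v i \<in> {a i..b i}} \<longleftrightarrow>
        v \<in> Pi\<^sub>E UNIV (\<lambda>i. if i < n then {a i..b i} else {0})"
      unfolding coord_space_def PiE_UNIV_domain Pi_iff mem_Collect_eq
      by (metis UNIV_I linorder_not_le singleton_iff)
  qed
  have "compactin (product_topology (\<lambda>i. euclideanreal) UNIV) (Pi\<^sub>E UNIV (\<lambda>i. if i < n then {a i..b i} else {0}))"
    by (subst compactin_PiE) auto
  then have "compact {v \<in> coord_space n. \<forall>i<n. v i \<in> {a i..b i}}"
    unfolding eq by (metis (no_types) compactin_euclidean_iff euclidean_product_topology)
  then show ?thesis by (auto simp: compactin_subtopology)
qed

lemma locally_compact_coord: "locally_compact_space (top_of_set (coord_space n))"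
  unfolding locally_compact_space_def
proof (intro ballI)
  fix v assume v: "v \<in> topspace (top_of_set (coord_space n))"
  define r where "r = 1 + (\<Sum>i<n. \<bar>v i\<bar>)"
  have vr: "\<forall>i<n. \<bar>v i\<bar> < r"
  proof (intro allI impI)
    fix i assume "i < n"
    then have "\<bar>v i\<bar> \<le> (\<Sum>i<n. \<bar>v i\<bar>)" by (intro member_le_sum) auto
    then show "\<bar>v i\<bar> < r" by (simp add: r_def)
  qed
  have "{v \<in> coord_space n. \<forall>i<n. \<bar>v i\<bar> < r} \<subseteq> {v \<in> coord_space n. \<forall>i<n. v i \<in> {-r..r}}"
  proof (intro subsetI CollectI conjI allI impI)
    fix w i assume "w \<in> {v \<in> coord_space n. \<forall>i<n. \<bar>v i\<bar> < r}" "i < n"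
    then have "\<bar>w i\<bar> < r" by blast
    then show "w i \<in> {-r..r}" by auto
  qed auto
  then show "\<exists>U K. openin (top_of_set (coord_space n)) U \<and> compactin (top_of_set (coord_space n)) K \<and> v \<in> U \<and> U \<subseteq> K"
    using openin_coord_bounded[of n r] compact_coord_box[of n "\<lambda>_. -r" "\<lambda>_. r"] v vr
    by (intro exI conjI) auto
qed

lemma topspace_sph [simp]: "topspace (sph V) = insert None (Some ` V)"
  by (simp add: sph_def)

lemma compact_sph [simp]: "compact_space (sph V)"
  by (simp add: sph_def)

lemma Hausdorff_sph [simp]: "Hausdorff_space (sph (coord_space n))"
  unfolding sph_def
  by (simp add: Hausdorff_space_Alexandroff_compactification locally_compact_coord Hausdorff_space_subtopology)

lemma topspace_loops:
  "topspace (loops V X p) = {f \<in> extensional (topspace (sph V)). continuous_map (sph V) X f \<and> f None = p}"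
  by (auto simp: loops_def topspace_compact_open)

section \<open>Structure maps and loops in the zeroth space\<close>

locale spectrum_loc =
  fixes E :: "'a spec"
  assumes spectrum: "spectrum E"
begin

abbreviation "sm n w x \<equiv> smap E {vzero} (coord_space n) w x"
abbreviation "b0 \<equiv> bpt E {vzero}"
abbreviation "bn n \<equiv> bpt E (coord_space n)"

lemma b0_in [simp]: "b0 \<in> topspace (zspace E)"
  using spectrum unfolding spectrum_def by simp

lemma bn_in [simp]: "bn n \<in> topspace (lev E (coord_space n))"
  using spectrum unfolding spectrum_def by simp

lemma sm_None [simp]: "x \<in> topspace (zspace E) \<Longrightarrow> sm n None x = bn n"
  using spectrum unfolding spectrum_def by simp

lemma sm_b0: "w \<in> topspace (sph (coord_space n)) \<Longrightarrow> sm n w b0 = bn n"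
proof -
  have "fd_subspace {vzero} \<and> fd_subspace (coord_space n) \<and> {vzero} \<subseteq> coord_space n" by simp
  with spectrum show "w \<in> topspace (sph (coord_space n)) \<Longrightarrow> sm n w b0 = bn n"
    unfolding spectrum_def by (metis ocomp_zero)
qed

lemma adj_gen:
  assumes "fd_subspace V" "fd_subspace W" "V \<subseteq> W"
  shows "homeomorphic_map (lev E V) (loops (ocomp W V) (lev E W) (bpt E W))
          (\<lambda>x. \<lambda>w\<in>topspace (sph (ocomp W V)). smap E V W w x)"
  using spectrum assms unfolding spectrum_def by blast

lemma adj: "homeomorphic_map (zspace E) (loops (coord_space n) (lev E (coord_space n)) (bn n))
          (\<lambda>x. \<lambda>w\<in>topspace (sph (coord_space n)). sm n w x)"
  using adj_gen[of "{vzero}" "coord_space n"] by simp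

lemma sm_in: "x \<in> topspace (zspace E) \<Longrightarrow> w \<in> topspace (sph (coord_space n)) \<Longrightarrow>
   sm n w x \<in> topspace (lev E (coord_space n))"
proof -
  assume x: "x \<in> topspace (zspace E)" and w: "w \<in> topspace (sph (coord_space n))"
  have "(\<lambda>x. \<lambda>w\<in>topspace (sph (coord_space n)). sm n w x) \<in> topspace (zspace E) \<rightarrow>
     topspace (loops (coord_space n) (lev E (coord_space n)) (bn n))"
    using homeomorphic_imp_continuous_map[OF adj] unfolding continuous_map_def by blast
  then have "continuous_map (sph (coord_space n)) (lev E (coord_space n))
     (\<lambda>w\<in>topspace (sph (coord_space n)). sm n w x)"
    using x by (auto simp: topspace_loops)
  then have "(\<lambda>w\<in>topspace (sph (coord_space n)). sm n w x) w \<in> topspace (lev E (coord_space n))"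
    using w unfolding continuous_map_def by blast
  then show ?thesis using w by simp
qed

text \<open>The adjoint structure map is injective and its value at \<open>None\<close> is forced,
  so the finite points decide. Elements of the zeroth space are compared in this way
  throughout.\<close>

lemma sm_inj:
  assumes "x \<in> topspace (zspace E)" "y \<in> topspace (zspace E)"
    "\<And>v. v \<in> coord_space n \<Longrightarrow> sm n (Some v) x = sm n (Some v) y"
  shows "x = y"
proof -
  have "(\<lambda>w\<in>topspace (sph (coord_space n)). sm n w x) = (\<lambda>w\<in>topspace (sph (coord_space n)). sm n w y)"
    using assms by (intro restrict_ext) auto
  then show ?thesis
    using homeomorphic_imp_injective_map[OF adj] assms(1,2) by (auto dest: inj_onD)
qed

lemma smap_inj:
  assumes "fd_subspace V" "fd_subspace W" "V \<subseteq> W"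
    "x \<in> topspace (lev E V)" "y \<in> topspace (lev E V)"
    "\<And>v. v \<in> ocomp W V \<Longrightarrow> smap E V W (Some v) x = smap E V W (Some v) y"
  shows "x = y"
proof -
  have n: "smap E V W None z = bpt E W" if "z \<in> topspace (lev E V)" for z
    using spectrum assms(1-3) that unfolding spectrum_def by blast
  have "(\<lambda>w\<in>topspace (sph (ocomp W V)). smap E V W w x) = (\<lambda>w\<in>topspace (sph (ocomp W V)). smap E V W w y)"
    using assms n by (intro restrict_ext) auto
  then show ?thesis
    using homeomorphic_imp_injective_map[OF adj_gen[OF assms(1-3)]] assms(4,5) by (auto dest: inj_onD)
qed

lemma smap_bpt:
  assumes "fd_subspace V" "fd_subspace W" "V \<subseteq> W" "v \<in> ocomp W V"
  shows "smap E V W (Some v) (bpt E V) = bpt E W"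
  using spectrum assms unfolding spectrum_def by auto

lemma sm_assoc:
  assumes "n \<le> N" "v \<in> coord_space n" "v' \<in> ocomp (coord_space N) (coord_space n)"
    "x \<in> topspace (zspace E)"
  shows "sm N (Some (\<lambda>i. v i + v' i)) x =
    smap E (coord_space n) (coord_space N) (Some v') (sm n (Some v) x)"
proof -
  have "{vzero} \<subseteq> coord_space n" "coord_space n \<subseteq> coord_space N"
    using coord_space_mono[OF assms(1)] by auto
  then have "smap E (coord_space n) (coord_space N) (Some v') (sm n (Some v) x) = sm N (Some (\<lambda>i. v i + v' i)) x"
    using assms by (intro spectrum[unfolded spectrum_def, THEN conjunct2, THEN conjunct2, rule_format]) auto
  then show ?thesis by simp
qed

text \<open>The adjoint is continuous into the k-ified loop space, hence also into the coarser
  compact-open topology; composing with evaluation on the compact Hausdorff sphere gives joint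
  continuity.\<close>

lemma sm_continuous:
  "continuous_map (prod_topology (sph (coord_space n)) (zspace E)) (lev E (coord_space n))
     (\<lambda>(w, x). sm n w x)"
proof -
  let ?S = "sph (coord_space n)" and ?En = "lev E (coord_space n)"
  let ?ad = "\<lambda>x. \<lambda>w\<in>topspace ?S. sm n w x"
  have idk: "continuous_map (kification (subtopology (compact_open ?S ?En) {f. f None = bn n})) (compact_open ?S ?En) id"
    using continuous_map_from_kification continuous_map_from_subtopology continuous_map_id by blast
  have "continuous_map (zspace E) (compact_open ?S ?En) (id \<circ> ?ad)"
    using homeomorphic_imp_continuous_map[OF adj] idk unfolding loops_def
    by (rule continuous_map_compose)
  then have "continuous_map (prod_topology ?S (zspace E)) (prod_topology ?S (compact_open ?S ?En))
     (\<lambda>(w, x). (w, ?ad x))"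
    by (intro continuous_map_prod_top[THEN iffD2]) (simp add: o_def)
  then have "continuous_map (prod_topology ?S (zspace E)) ?En ((\<lambda>(w, f). f w) \<circ> (\<lambda>(w, x). (w, ?ad x)))"
    by (rule continuous_map_compose) (rule continuous_map_eval; simp)
  then show ?thesis
    by (rule continuous_map_eq) auto
qed

text \<open>This is how maps into the zeroth space are produced. A continuous family of based maps
  of a sphere curries to a map into the loop space, which passes to the k-ification because
  \<open>A\<close> is a k-space; the inverse of the adjoint homeomorphism does the rest.\<close>

lemma adjoint_lift:
  assumes k: "k_space A"
    and L: "continuous_map (prod_topology A (sph (coord_space n))) (lev E (coord_space n)) L"
    and b: "\<And>a. a \<in> topspace A \<Longrightarrow> L (a, None) = bn n"
  obtains g where "continuous_map A (zspace E) g"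
    "\<And>a w. a \<in> topspace A \<Longrightarrow> w \<in> topspace (sph (coord_space n)) \<Longrightarrow> sm n w (g a) = L (a, w)"
proof -
  let ?S = "sph (coord_space n)" and ?En = "lev E (coord_space n)"
  let ?lp = "loops (coord_space n) ?En (bn n)"
  let ?ad = "\<lambda>x. \<lambda>w\<in>topspace ?S. sm n w x"
  let ?c = "\<lambda>a. \<lambda>w\<in>topspace ?S. L (a, w)"
  obtain h where h: "homeomorphic_maps (zspace E) ?lp ?ad h"
    using adj homeomorphic_map_maps by blast
  have "continuous_map A (compact_open ?S ?En) ?c"
    by (rule continuous_map_curry[OF L])
  then have c: "continuous_map A ?lp ?c"
    unfolding loops_def by (subst continuous_map_into_kification[OF k])
      (auto simp: continuous_map_in_subtopology b)
  have hc: "continuous_map A (zspace E) (h \<circ> ?c)"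
    using c h unfolding homeomorphic_maps_def by (blast intro: continuous_map_compose)
  moreover have "sm n w ((h \<circ> ?c) a) = L (a, w)" if a: "a \<in> topspace A" and w: "w \<in> topspace ?S" for a w
  proof -
    have "?c a \<in> topspace ?lp" using c a unfolding continuous_map_def by blast
    then have "?ad (h (?c a)) = ?c a" using h unfolding homeomorphic_maps_def by blast
    from fun_cong[OF this, of w] show ?thesis using w by simp
  qed
  ultimately show thesis by (rule that)
qed

end

section \<open>Box sums: uniqueness, change of dimension, composition\<close>

lemma ocomp_coord:
  assumes "n \<le> N"
  shows "ocomp (coord_space N) (coord_space n) = {w \<in> coord_space N. \<forall>i<n. w i = 0}"
proof (intro equalityI subsetI)
  fix w assume w: "w \<in> ocomp (coord_space N) (coord_space n)"
  then have wN: "w \<in> coord_space N" by (simp add: ocomp_def)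
  have "j < N" if "w j \<noteq> 0" for j
    using wN that by (cases "N \<le> j") (auto simp: coord_space_def)
  then have "{j. w j \<noteq> 0} \<subseteq> {..<N}" by auto
  then have fin: "finite {j. w j \<noteq> 0}" by (rule finite_subset) simp
  have "w i = 0" if "i < n" for i
  proof (rule ccontr)
    assume i: "w i \<noteq> 0"
    \<comment> \<open>Pairing with the \<open>i\<close>-th unit vector isolates the coordinate
      \<open>w i\<close>.\<close>
    have "(\<lambda>j. if j = i then 1 else 0) \<in> coord_space n"
      using that by (auto simp: coord_space_def)
    then have "vip w (\<lambda>j. if j = i then 1 else 0) = 0"
      using w by (simp add: ocomp_def)
    moreover have "vip w (\<lambda>j. if j = i then 1 else 0) = (\<Sum>j | w j \<noteq> 0. if j = i then w j else 0)"
      unfolding vip_def by (rule sum.cong) auto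
    moreover have "(\<Sum>j | w j \<noteq> 0. if j = i then w j else 0) = w i"
      using fin i by (subst sum.delta) auto
    ultimately show False using i by simp
  qed
  with wN show "w \<in> {w \<in> coord_space N. \<forall>i<n. w i = 0}" by simp
next
  fix w assume w: "w \<in> {w \<in> coord_space N. \<forall>i<n. w i = 0}"
  have "vip w v = 0" if "v \<in> coord_space n" for v
    unfolding vip_def
  proof (rule sum.neutral, intro ballI)
    fix i assume "i \<in> {i. w i \<noteq> 0}"
    with w have "\<not> i < n" by auto
    with that show "w i * v i = 0" by (simp add: coord_space_def not_less)
  qed
  then show "w \<in> ocomp (coord_space N) (coord_space n)"
    using w by (simp add: ocomp_def)
qed

definition lo_part :: "nat \<Rightarrow> vec \<Rightarrow> vec" where
  "lo_part n v = (\<lambda>i. if i < n then v i else 0)"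

definition hi_part :: "nat \<Rightarrow> vec \<Rightarrow> vec" where
  "hi_part n v = (\<lambda>i. if i < n then 0 else v i)"

lemma lo_part_in [simp]: "lo_part n v \<in> coord_space n"
  by (simp add: lo_part_def coord_space_def)

lemma hi_part_in: "n \<le> N \<Longrightarrow> v \<in> coord_space N \<Longrightarrow> hi_part n v \<in> ocomp (coord_space N) (coord_space n)"
  by (simp add: ocomp_coord) (auto simp: hi_part_def coord_space_def)

lemma lo_hi: "(\<lambda>i. lo_part n v i + hi_part n v i) = v"
  by (auto simp: lo_part_def hi_part_def)

lemma add_in_coord:
  "n \<le> N \<Longrightarrow> v \<in> coord_space n \<Longrightarrow> v' \<in> ocomp (coord_space N) (coord_space n) \<Longrightarrow>
    (\<lambda>i. v i + v' i) \<in> coord_space N"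
  by (simp add: ocomp_coord) (auto simp: coord_space_def)

lemma box_point_in_coord:
  assumes "\<And>i. n \<le> i \<Longrightarrow> d i = id" "w \<in> coord_space n"
  shows "box_point d w \<in> coord_space n"
  using assms by (auto simp: box_point_def coord_space_def)

text \<open>Boxes are trivial in the directions from \<open>n\<close> on, so they commute with
  translation by a vector supported there. This makes box sums compatible with the structure
  maps.\<close>

lemma box_point_add:
  assumes "\<And>i. n \<le> i \<Longrightarrow> d i = id" "w \<in> coord_space n" "n \<le> N"
    "v' \<in> ocomp (coord_space N) (coord_space n)"
  shows "box_point d (\<lambda>i. w i + v' i) = (\<lambda>i. box_point d w i + v' i)"
proof
  fix i show "box_point d (\<lambda>i. w i + v' i) i = box_point d w i + v' i"
  proof (cases "i < n")
    case True then show ?thesis using assms(4) by (simp add: ocomp_coord[OF assms(3)] box_point_def)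
  next
    case False then show ?thesis using assms(1)[of i] assms(2) by (simp add: box_point_def coord_space_def)
  qed
qed

lemma box_sum_cong:
  assumes "\<And>x. x \<in> I \<Longrightarrow> c x = c' x" "\<And>x. x \<in> I \<Longrightarrow> f x = f' x"
  shows "box_sum E n I c f e \<longleftrightarrow> box_sum E n I c' f' e"
  unfolding box_sum_def using assms by simp

context spectrum_loc
begin

lemma box_sum_in: "box_sum E n I c f e \<Longrightarrow> e \<in> topspace (zspace E)"
  by (simp add: box_sum_def)

lemma box_sum_inside:
  "box_sum E n I c f e \<Longrightarrow> x \<in> I \<Longrightarrow> w \<in> coord_space n \<Longrightarrow>
    sm n (Some (box_point (c x) w)) e = sm n (Some w) (f x)"
  by (simp add: box_sum_def)

lemma box_sum_outside:
  "box_sum E n I c f e \<Longrightarrow> v \<in> coord_space n \<Longrightarrow> v \<notin> (\<Union>x\<in>I. box_point (c x) ` coord_space n) \<Longrightarrow>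
    sm n (Some v) e = bn n"
  unfolding box_sum_def by (elim conjE bspec) simp

lemma box_sumI:
  assumes "e \<in> topspace (zspace E)"
    "\<And>x w. x \<in> I \<Longrightarrow> w \<in> coord_space n \<Longrightarrow> sm n (Some (box_point (c x) w)) e = sm n (Some w) (f x)"
    "\<And>v. v \<in> coord_space n \<Longrightarrow> v \<notin> (\<Union>x\<in>I. box_point (c x) ` coord_space n) \<Longrightarrow> sm n (Some v) e = bn n"
  shows "box_sum E n I c f e"
  unfolding box_sum_def using assms by blast

text \<open>Each point of the sphere lies in some box or outside all of them, and the conditions
  prescribe the loop in both cases.\<close>

lemma box_sum_unique:
  assumes "box_sum E n I c f e" "box_sum E n I c f e'"
  shows "e = e'"
proof (rule sm_inj)
  show "e \<in> topspace (zspace E)" "e' \<in> topspace (zspace E)"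
    using assms by (auto simp: box_sum_def)
  fix v assume v: "v \<in> coord_space n"
  show "sm n (Some v) e = sm n (Some v) e'"
  proof (cases "v \<in> (\<Union>x\<in>I. box_point (c x) ` coord_space n)")
    case True
    then obtain x w where "x \<in> I" "w \<in> coord_space n" "v = box_point (c x) w" by blast
    then show ?thesis using assms unfolding box_sum_def by metis
  next
    case False
    with v assms show ?thesis unfolding box_sum_def by (metis DiffI)
  qed
qed

text \<open>Associativity of the structure maps splits a point of the larger space into
  \<open>lo_part\<close>, on which the boxes act, and \<open>hi_part\<close>, which they leave
  alone.\<close>

lemma box_sum_raise:
  assumes bs: "box_sum E n I c f e" and nN: "n \<le> N"
    and id: "\<And>x i. x \<in> I \<Longrightarrow> n \<le> i \<Longrightarrow> c x i = id"
    and f: "\<And>x. x \<in> I \<Longrightarrow> f x \<in> topspace (zspace E)"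
  shows "box_sum E N I c f e"
  unfolding box_sum_def
proof (intro conjI ballI)
  show e: "e \<in> topspace (zspace E)" using bs by (simp add: box_sum_def)
  have split: "sm N (Some v) x = smap E (coord_space n) (coord_space N) (Some (hi_part n v)) (sm n (Some (lo_part n v)) x)"
    if "v \<in> coord_space N" "x \<in> topspace (zspace E)" for v x
    using sm_assoc[OF nN lo_part_in hi_part_in[OF nN that(1)] that(2), of v] by (simp add: lo_hi)
  fix x w assume x: "x \<in> I" and w: "w \<in> coord_space N"
  have lb: "lo_part n (box_point (c x) w) = box_point (c x) (lo_part n w)"
    using id[OF x] by (auto simp: lo_part_def box_point_def fun_eq_iff not_less)
  have hb: "hi_part n (box_point (c x) w) = hi_part n w"
    using id[OF x] by (auto simp: hi_part_def box_point_def fun_eq_iff not_less)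
  have bN: "box_point (c x) w \<in> coord_space N"
    using id[OF x] nN w by (intro box_point_in_coord) auto
  show "sm N (Some (box_point (c x) w)) e = sm N (Some w) (f x)"
    unfolding split[OF bN e] split[OF w f[OF x]] lb hb
    using bs x by (simp add: box_sum_def)
next
  fix v assume v: "v \<in> coord_space N - (\<Union>x\<in>I. box_point (c x) ` coord_space N)"
  have e: "e \<in> topspace (zspace E)" using bs by (simp add: box_sum_def)
  have "lo_part n v \<notin> (\<Union>x\<in>I. box_point (c x) ` coord_space n)"
  proof
    assume "lo_part n v \<in> (\<Union>x\<in>I. box_point (c x) ` coord_space n)"
    then obtain x u where xu: "x \<in> I" "u \<in> coord_space n" "lo_part n v = box_point (c x) u" by blast
    have h: "hi_part n v \<in> ocomp (coord_space N) (coord_space n)" using v nN by (intro hi_part_in) auto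
    have "box_point (c x) (\<lambda>i. u i + hi_part n v i) = (\<lambda>i. lo_part n v i + hi_part n v i)"
      unfolding xu(3) by (rule box_point_add[OF id[OF xu(1)] xu(2) nN h])
    then have "v = box_point (c x) (\<lambda>i. u i + hi_part n v i)" by (simp add: lo_hi)
    moreover have "(\<lambda>i. u i + hi_part n v i) \<in> coord_space N"
      by (rule add_in_coord[OF nN xu(2) h])
    ultimately show False using v xu(1) by blast
  qed
  then have "sm n (Some (lo_part n v)) e = bn n"
    using bs unfolding box_sum_def by (metis DiffI lo_part_in)
  then have "sm N (Some v) e = smap E (coord_space n) (coord_space N) (Some (hi_part n v)) (bn n)"
    using sm_assoc[OF nN lo_part_in hi_part_in[OF nN] e, of v v] v by (simp add: lo_hi)
  also have "\<dots> = bn N"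
    using v by (intro smap_bpt) (auto intro: hi_part_in nN simp: coord_space_mono[OF nN])
  finally show "sm N (Some v) e = bn N" .
qed

text \<open>The adjoint structure map from level \<open>n\<close> to level \<open>N\<close> is
  injective, so an identity at level \<open>n\<close> may be checked after adding all vectors of the
  complement.\<close>

lemma box_sum_lower:
  assumes bs: "box_sum E N I c f e" and nN: "n \<le> N"
    and id: "\<And>x i. x \<in> I \<Longrightarrow> n \<le> i \<Longrightarrow> c x i = id"
    and f: "\<And>x. x \<in> I \<Longrightarrow> f x \<in> topspace (zspace E)"
  shows "box_sum E n I c f e"
  unfolding box_sum_def
proof (intro conjI ballI)
  show e: "e \<in> topspace (zspace E)" using bs by (simp add: box_sum_def)
  fix x w assume x: "x \<in> I" and w: "w \<in> coord_space n"
  have bx: "box_point (c x) w \<in> coord_space n"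
    using id[OF x] w by (intro box_point_in_coord) auto
  show "sm n (Some (box_point (c x) w)) e = sm n (Some w) (f x)"
  proof (rule smap_inj[of "coord_space n" "coord_space N"])
    fix v' assume v': "v' \<in> ocomp (coord_space N) (coord_space n)"
    have "smap E (coord_space n) (coord_space N) (Some v') (sm n (Some (box_point (c x) w)) e)
        = sm N (Some (box_point (c x) (\<lambda>i. w i + v' i))) e"
      using sm_assoc[OF nN bx v' e] box_point_add[OF id[OF x] w nN v'] by simp
    also have "\<dots> = sm N (Some (\<lambda>i. w i + v' i)) (f x)"
      using bs x add_in_coord[OF nN w v'] by (simp add: box_sum_def)
    also have "\<dots> = smap E (coord_space n) (coord_space N) (Some v') (sm n (Some w) (f x))"
      by (rule sm_assoc[OF nN w v' f[OF x]])
    finally show "smap E (coord_space n) (coord_space N) (Some v') (sm n (Some (box_point (c x) w)) e)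
        = smap E (coord_space n) (coord_space N) (Some v') (sm n (Some w) (f x))" .
  qed (use bx w e f[OF x] in \<open>auto intro: sm_in simp: coord_space_mono[OF nN]\<close>)
next
  have e: "e \<in> topspace (zspace E)" using bs by (simp add: box_sum_def)
  fix v assume v: "v \<in> coord_space n - (\<Union>x\<in>I. box_point (c x) ` coord_space n)"
  show "sm n (Some v) e = bn n"
  proof (rule smap_inj[of "coord_space n" "coord_space N"])
    fix v' assume v': "v' \<in> ocomp (coord_space N) (coord_space n)"
    have "(\<lambda>i. v i + v' i) \<notin> (\<Union>x\<in>I. box_point (c x) ` coord_space N)"
    proof
      assume "(\<lambda>i. v i + v' i) \<in> (\<Union>x\<in>I. box_point (c x) ` coord_space N)"
      then obtain x u where xu: "x \<in> I" "(\<lambda>i. v i + v' i) = box_point (c x) u" by blast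
      \<comment> \<open>Below \<open>n\<close> the vector \<open>v'\<close> vanishes; from
        \<open>n\<close> on both sides vanish, because the box is the identity there.\<close>
      have "v = box_point (c x) (lo_part n u)"
      proof
        fix i show "v i = box_point (c x) (lo_part n u) i"
        proof (cases "i < n")
          case True
          then show ?thesis using fun_cong[OF xu(2), of i] v'
            by (simp add: ocomp_coord[OF nN] box_point_def lo_part_def)
        next
          case False
          then show ?thesis using v id[OF xu(1), of i] by (simp add: box_point_def lo_part_def coord_space_def)
        qed
      qed
      then show False using v xu(1) by auto
    qed
    then have "sm N (Some (\<lambda>i. v i + v' i)) e = bn N"
      using bs add_in_coord[OF nN _ v', of v] v unfolding box_sum_def by blast
    moreover have "smap E (coord_space n) (coord_space N) (Some v') (bn n) = bn N"
      using v' by (intro smap_bpt) (auto simp: coord_space_mono[OF nN])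
    ultimately show "smap E (coord_space n) (coord_space N) (Some v') (sm n (Some v) e)
        = smap E (coord_space n) (coord_space N) (Some v') (bn n)"
      using sm_assoc[OF nN _ v' e, of v] v by simp
  qed (use v e in \<open>auto intro: sm_in simp: coord_space_mono[OF nN]\<close>)
qed

lemma box_sum_indep:
  assumes "box_sum E n I c f e"
    and "\<And>x i. x \<in> I \<Longrightarrow> n \<le> i \<Longrightarrow> c x i = id" "\<And>x i. x \<in> I \<Longrightarrow> N \<le> i \<Longrightarrow> c x i = id"
    and "\<And>x. x \<in> I \<Longrightarrow> f x \<in> topspace (zspace E)"
  shows "box_sum E N I c f e"
proof (cases "n \<le> N")
  case True
  show ?thesis by (rule box_sum_raise[OF assms(1) True assms(2) assms(4)])
next
  case False
  then have "N \<le> n" by simp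
  from box_sum_lower[OF assms(1) this assms(3) assms(4)] show ?thesis .
qed

text \<open>Operadic composition of little boxes. A point that avoids every composite box either
  avoids the outer boxes, or lies in an outer box with its coordinate there outside all inner boxes.
  Composition of covers and additivity both rest on this.\<close>

lemma box_sum_comp:
  assumes b2: "box_sum E N I2 c2 g e"
    and b1: "\<And>x'. x' \<in> I2 \<Longrightarrow> box_sum E N (I1 x') c1 f (g x')"
    and id: "\<And>x' x i. x' \<in> I2 \<Longrightarrow> x \<in> I1 x' \<Longrightarrow> N \<le> i \<Longrightarrow> c1 x i = id"
    and c: "\<And>x' x i. x' \<in> I2 \<Longrightarrow> x \<in> I1 x' \<Longrightarrow> c x i = c2 x' i \<circ> c1 x i"
  shows "box_sum E N (\<Union>x'\<in>I2. I1 x') c f e"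
proof -
  have bp: "box_point (c x) w = box_point (c2 x') (box_point (c1 x) w)" if "x' \<in> I2" "x \<in> I1 x'" for x x' w
    using c[OF that] by (simp add: box_point_def)
  show ?thesis
  proof (rule box_sumI)
    show "e \<in> topspace (zspace E)" by (rule box_sum_in[OF b2])
  next
    fix x w assume "x \<in> (\<Union>x'\<in>I2. I1 x')" and w: "w \<in> coord_space N"
    then obtain x' where x: "x' \<in> I2" "x \<in> I1 x'" by blast
    have bw: "box_point (c1 x) w \<in> coord_space N" by (rule box_point_in_coord[OF id[OF x] w])
    have "sm N (Some (box_point (c x) w)) e = sm N (Some (box_point (c1 x) w)) (g x')"
      unfolding bp[OF x] by (rule box_sum_inside[OF b2 x(1) bw])
    also have "\<dots> = sm N (Some w) (f x)" by (rule box_sum_inside[OF b1[OF x(1)] x(2) w])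
    finally show "sm N (Some (box_point (c x) w)) e = sm N (Some w) (f x)" .
  next
    fix v assume v: "v \<in> coord_space N" "v \<notin> (\<Union>x\<in>\<Union>x'\<in>I2. I1 x'. box_point (c x) ` coord_space N)"
    show "sm N (Some v) e = bn N"
    proof (cases "v \<in> (\<Union>x'\<in>I2. box_point (c2 x') ` coord_space N)")
      case False
      show ?thesis by (rule box_sum_outside[OF b2 v(1) False])
    next
      case True
      then obtain x' w where x': "x' \<in> I2" "w \<in> coord_space N" "v = box_point (c2 x') w" by blast
      have "w \<notin> (\<Union>x\<in>I1 x'. box_point (c1 x) ` coord_space N)"
      proof
        assume "w \<in> (\<Union>x\<in>I1 x'. box_point (c1 x) ` coord_space N)"
        then obtain x u where xu: "x \<in> I1 x'" "u \<in> coord_space N" "w = box_point (c1 x) u" by blast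
        then have "v = box_point (c x) u" using x' bp[OF x'(1) xu(1), of u] by simp
        with v(2) x'(1) xu(1,2) show False by blast
      qed
      from box_sum_outside[OF b1[OF x'(1)] x'(2) this] show ?thesis
        unfolding x'(3) by (simp add: box_sum_inside[OF b2 x'(1,2)])
    qed
  qed
qed

end

section \<open>Pontryagin-Thom maps for a fixed box embedding\<close>

text \<open>The innermost condition of \<open>transfer_along\<close>, isolated for one
  representative \<open>f\<close> and one box embedding \<open>c\<close>.\<close>

definition pt_map ::
  "'a spec \<Rightarrow> 'x topology \<Rightarrow> 'y topology \<Rightarrow> ('x \<Rightarrow> 'y) \<Rightarrow> ('x \<Rightarrow> nat \<Rightarrow> real \<Rightarrow> real) \<Rightarrow> ('x \<Rightarrow> 'a) \<Rightarrow> ('y \<Rightarrow> 'a) \<Rightarrow> bool"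
  where "pt_map E X Y p c f g \<longleftrightarrow> (\<forall>y\<in>topspace Y. \<forall>n.
               (\<forall>x\<in>topspace X. p x = y \<longrightarrow> (\<forall>i\<ge>n. c x i = id)) \<longrightarrow>
               box_sum E n {x \<in> topspace X. p x = y} c f (g y))"

lemma transfer_along_pt_map:
  "transfer_along E X Y p a =
     (\<Union>f\<in>a. \<Union>c\<in>Collect (box_embedding X Y p). \<Union>g\<in>{g. pt_map E X Y p c f g}. htpy_class E Y g)"
  by (simp add: transfer_along_def pt_map_def)

lemma box_embedding_bound:
  assumes "box_embedding X Y p c" "y \<in> topspace Y"
  obtains U n where "openin Y U" "y \<in> U" "\<And>x i. x \<in> topspace X \<Longrightarrow> p x \<in> U \<Longrightarrow> n \<le> i \<Longrightarrow> c x i = id"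
  using assms unfolding box_embedding_def by (meson)

context spectrum_loc
begin

text \<open>The definition asks for all admissible dimensions; by \<open>box_sum_indep\<close> one
  of them per base point is enough.\<close>

lemma pt_mapI:
  assumes f: "\<And>x. x \<in> topspace X \<Longrightarrow> f x \<in> topspace (zspace E)"
    and ex: "\<And>y. y \<in> topspace Y \<Longrightarrow> \<exists>n. (\<forall>x\<in>topspace X. p x = y \<longrightarrow> (\<forall>i\<ge>n. c x i = id)) \<and>
       box_sum E n {x \<in> topspace X. p x = y} c f (g y)"
  shows "pt_map E X Y p c f g"
  unfolding pt_map_def
proof (intro ballI allI impI)
  fix y N assume y: "y \<in> topspace Y" and N: "\<forall>x\<in>topspace X. p x = y \<longrightarrow> (\<forall>i\<ge>N. c x i = id)"
  obtain n where n: "\<forall>x\<in>topspace X. p x = y \<longrightarrow> (\<forall>i\<ge>n. c x i = id)" "box_sum E n {x \<in> topspace X. p x = y} c f (g y)"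
    using ex[OF y] by blast
  show "box_sum E N {x \<in> topspace X. p x = y} c f (g y)"
    by (rule box_sum_indep[OF n(2)]) (use n(1) N f in auto)
qed

lemma pt_map_unique:
  assumes "box_embedding X Y p c" "pt_map E X Y p c f g" "pt_map E X Y p c f g'" "y \<in> topspace Y"
  shows "g y = g' y"
proof -
  obtain U n where "y \<in> U" "\<And>x i. x \<in> topspace X \<Longrightarrow> p x \<in> U \<Longrightarrow> n \<le> i \<Longrightarrow> c x i = id"
    using box_embedding_bound[OF assms(1,4)] by metis
  then have "\<forall>x\<in>topspace X. p x = y \<longrightarrow> (\<forall>i\<ge>n. c x i = id)" by blast
  then show ?thesis using assms(2-4) unfolding pt_map_def by (blast intro: box_sum_unique)
qed

end

section \<open>Collapsing a sphere onto a box\<close>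

text \<open>The Pontryagin-Thom collapse of the \<open>n\<close>-sphere onto one open box.\<close>

definition collapse :: "nat \<Rightarrow> (nat \<Rightarrow> real \<Rightarrow> real) \<Rightarrow> vec option \<Rightarrow> vec option" where
  "collapse n d v = (case v of None \<Rightarrow> None | Some u \<Rightarrow>
     if u \<in> box_point d ` coord_space n then Some (inv_into (coord_space n) (box_point d) u) else None)"

lemma inj_box_point:
  assumes "\<And>i. strict_mono (d i)"
  shows "inj (box_point d)"
proof (rule injI)
  fix v w assume "box_point d v = box_point d w"
  then have "d i (v i) = d i (w i)" for i
    by (metis box_point_def)
  then have "v i = w i" for i
    using strict_mono_eq[OF assms] by blast
  then show "v = w" by blast
qed

lemma collapse_None [simp]: "collapse n d None = None"
  by (simp add: collapse_def)

lemma collapse_outside: "u \<notin> box_point d ` coord_space n \<Longrightarrow> collapse n d (Some u) = None"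
  by (simp add: collapse_def)

lemma collapse_inside:
  assumes "\<And>i. strict_mono (d i)" "w \<in> coord_space n"
  shows "collapse n d (Some (box_point d w)) = Some w"
proof -
  have "inj_on (box_point d) (coord_space n)"
    using inj_box_point[of d] assms(1) by (meson inj_on_subset subset_UNIV)
  then show ?thesis using assms(2) by (simp add: collapse_def inv_into_f_f)
qed

lemma collapse_eq_Some_iff:
  assumes "\<And>i. strict_mono (d i)"
  shows "collapse n d v = Some w \<longleftrightarrow> w \<in> coord_space n \<and> v = Some (box_point d w)"
proof
  assume c: "collapse n d v = Some w"
  then obtain u where u: "v = Some u" "u \<in> box_point d ` coord_space n"
    by (auto simp: collapse_def split: option.splits if_splits)
  then obtain w' where w': "w' \<in> coord_space n" "u = box_point d w'" by blast
  have "collapse n d v = Some w'" unfolding u(1) w'(2) by (rule collapse_inside[OF assms w'(1)])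
  with c have "w' = w" by simp
  then show "w \<in> coord_space n \<and> v = Some (box_point d w)" using u(1) w' by simp
next
  assume "w \<in> coord_space n \<and> v = Some (box_point d w)"
  then show "collapse n d v = Some w" using collapse_inside[OF assms, of w n] by simp
qed

lemma collapse_in: "(\<And>i. strict_mono (d i)) \<Longrightarrow> collapse n d v \<in> topspace (sph (coord_space n))"
  using collapse_eq_Some_iff[of d n v] by (cases "collapse n d v") auto

lemma continuous_map_coord: "continuous_map (top_of_set (coord_space n)) euclideanreal (\<lambda>w. w i)"
  by (intro continuous_map_from_subtopology) (simp add: continuous_on_product_coordinates)

lemma continuous_map_into_coord:
  assumes "\<And>i. continuous_map A euclideanreal (\<lambda>a. f a i)" "f \<in> topspace A \<rightarrow> coord_space n"
  shows "continuous_map A (top_of_set (coord_space n)) f"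
proof -
  have "continuous_map A (product_topology (\<lambda>i. euclideanreal) UNIV) f"
    using assms(1) by (subst continuous_map_componentwise_UNIV) simp
  then have "continuous_map A (euclidean :: vec topology) f"
    by (simp only: euclidean_product_topology)
  then show ?thesis using assms(2) by (auto simp: continuous_map_in_subtopology)
qed

text \<open>Only the first \<open>n\<close> coordinates carry a condition, since the others vanish
  on the subspace. The endpoints serve later as test points for the intermediate value
  theorem.\<close>

lemma coord_interval_nbhd:
  assumes U: "openin (top_of_set (coord_space n)) U" and w: "w \<in> U"
  obtains lo hi where "\<And>i. lo i < w i" "\<And>i. w i < hi i"
    "\<And>v. v \<in> coord_space n \<Longrightarrow> (\<And>i. i < n \<Longrightarrow> v i \<in> {lo i..hi i}) \<Longrightarrow> v \<in> U"
proof -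
  obtain T where T: "open T" "U = coord_space n \<inter> T" using U by (auto simp: openin_open)
  have "openin (product_topology (\<lambda>i. euclideanreal) UNIV) T"
    using T(1) by (simp only: euclidean_product_topology open_openin)
  then obtain X where X: "w \<in> Pi\<^sub>E UNIV X" "\<And>i. openin euclideanreal (X i)" "Pi\<^sub>E UNIV X \<subseteq> T"
    using product_topology_open_contains_basis[of "\<lambda>i. euclideanreal" UNIV T w] w T by auto
  have "\<exists>l h. l < w i \<and> w i < h \<and> {l..h} \<subseteq> X i" for i
  proof -
    have "open (X i)" "w i \<in> X i" using X by auto
    then obtain e where "e > 0" "cball (w i) e \<subseteq> X i" using open_contains_cball by blast
    then show ?thesis
      by (intro exI[of _ "w i - e"] exI[of _ "w i + e"]) (auto simp: cball_eq_atLeastAtMost)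
  qed
  then obtain lo hi where lh: "\<And>i. lo i < w i \<and> w i < hi i \<and> {lo i..hi i} \<subseteq> X i" by metis
  show thesis
  proof (rule that[of lo hi])
    fix v assume v: "v \<in> coord_space n" "\<And>i. i < n \<Longrightarrow> v i \<in> {lo i..hi i}"
    have "v i \<in> X i" for i
    proof (cases "i < n")
      case True then show ?thesis using v(2) lh by blast
    next
      case False
      then have "v i = w i" using v(1) w T by (simp add: coord_space_def)
      then show ?thesis using X(1) by auto
    qed
    then show "v \<in> U" using v(1) T(2) X(3) by (auto simp: PiE_UNIV_domain)
  qed (use lh in auto)
qed

lemma continuous_map_slice_right:
  assumes "continuous_map (prod_topology A euclideanreal) euclideanreal (\<lambda>(a, s). c a s)" "a \<in> topspace A"
  shows "continuous_on UNIV (c a)"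
proof -
  have "continuous_map euclideanreal euclideanreal ((\<lambda>(a, s). c a s) \<circ> Pair a)"
    by (rule continuous_map_o_Pair[OF assms])
  then show ?thesis by (simp add: o_def)
qed

lemma continuous_map_boxes:
  assumes cont: "\<And>i. continuous_map (prod_topology A euclideanreal) euclideanreal (\<lambda>(a, s). d a i s)"
    and f: "continuous_map B A f" and w: "continuous_map B euclideanreal w"
  shows "continuous_map B euclideanreal (\<lambda>b. d (f b) i (w b))"
proof -
  have "continuous_map B (prod_topology A euclideanreal) (\<lambda>b. (f b, w b))"
    using f w by (simp add: continuous_map_pairwise o_def)
  from continuous_map_compose[OF this cont] show ?thesis by (simp add: o_def)
qed

lemma open_map_prod:
  assumes f: "open_map X X' f" and g: "open_map Y Y' g"
  shows "open_map (prod_topology X Y) (prod_topology X' Y') (\<lambda>(x, y). (f x, g y))"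
  unfolding open_map_def
proof (intro allI impI)
  fix W assume W: "openin (prod_topology X Y) W"
  show "openin (prod_topology X' Y') ((\<lambda>(x, y). (f x, g y)) ` W)"
  proof (subst openin_subopen, intro ballI)
    fix z assume "z \<in> (\<lambda>(x, y). (f x, g y)) ` W"
    then obtain x y where xy: "z = (f x, g y)" "(x, y) \<in> W" by auto
    then obtain U V where UV: "openin X U" "openin Y V" "x \<in> U" "y \<in> V" "U \<times> V \<subseteq> W"
      using openin_prod_topology_alt[THEN iffD1, OF W, rule_format, OF xy(2)] by blast
    have "openin (prod_topology X' Y') (f ` U \<times> g ` V)"
      using f g UV(1,2) by (simp add: openin_prod_Times_iff open_map_def)
    moreover have "f ` U \<times> g ` V \<subseteq> (\<lambda>(x, y). (f x, g y)) ` W"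
      by (rule subset_trans[OF _ image_mono[OF UV(5)]]) auto
    moreover have "z \<in> f ` U \<times> g ` V" using xy(1) UV(3,4) by simp
    ultimately show "\<exists>T. openin (prod_topology X' Y') T \<and> z \<in> T \<and> T \<subseteq> (\<lambda>(x, y). (f x, g y)) ` W"
      by (intro exI conjI)
  qed
qed

text \<open>If the images of the endpoints \<open>lo i\<close> and \<open>hi i\<close> lie strictly
  on the two sides of each coordinate of a point, the same holds for nearby parameters and points;
  by the intermediate value theorem these nearby points are still hit from within
  \<open>U\<close>.\<close>

lemma openin_collapse_preimage:
  assumes sm: "\<And>a i. a \<in> topspace A \<Longrightarrow> strict_mono (d a i)"
    and cont: "\<And>i. continuous_map (prod_topology A euclideanreal) euclideanreal (\<lambda>(a, s). d a i s)"
    and id: "\<And>a i. a \<in> topspace A \<Longrightarrow> n \<le> i \<Longrightarrow> d a i = id"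
    and U: "openin (top_of_set (coord_space n)) U"
  shows "openin (prod_topology A (sph (coord_space n)))
    {(a, v). a \<in> topspace A \<and> (\<exists>w\<in>U. v = Some (box_point (d a) w))}" (is "openin _ ?P")
proof (subst openin_subopen, intro ballI)
  let ?R = "top_of_set (coord_space n)"
  fix z assume z: "z \<in> ?P"
  obtain a v where av: "z = (a, v)" by (cases z)
  with z have "a \<in> topspace A \<and> (\<exists>w\<in>U. v = Some (box_point (d a) w))" by simp
  then obtain w where aw: "z = (a, Some (box_point (d a) w))" "a \<in> topspace A" "w \<in> U"
    using av by blast
  have wc: "w \<in> coord_space n" using U aw(3) openin_subset by fastforce
  obtain lo hi where lh: "\<And>i. lo i < w i" "\<And>i. w i < hi i"
    "\<And>v. v \<in> coord_space n \<Longrightarrow> (\<And>i. i < n \<Longrightarrow> v i \<in> {lo i..hi i}) \<Longrightarrow> v \<in> U"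
    using coord_interval_nbhd[OF U aw(3)] by blast
  have ci: "continuous_map (prod_topology A ?R) euclideanreal (\<lambda>p. d (fst p) i s)" for i s
    by (rule continuous_map_boxes[OF cont continuous_map_fst]) simp
  have cv: "continuous_map (prod_topology A ?R) euclideanreal (\<lambda>p. snd p i)" for i
    using continuous_map_compose[OF continuous_map_snd continuous_map_coord[of n i]] by (simp add: o_def)
  define Q where "Q = {p \<in> topspace (prod_topology A ?R). \<forall>i<n. d (fst p) i (lo i) < snd p i \<and> snd p i < d (fst p) i (hi i)}"
  have Qi: "openin (prod_topology A ?R) {p \<in> topspace (prod_topology A ?R). d (fst p) i (lo i) < snd p i \<and> snd p i < d (fst p) i (hi i)}" for i
  proof -
    have c1: "continuous_map (prod_topology A ?R) euclideanreal (\<lambda>p. snd p i - d (fst p) i (lo i))"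
      by (rule continuous_map_diff[OF cv ci])
    have c2: "continuous_map (prod_topology A ?R) euclideanreal (\<lambda>p. d (fst p) i (hi i) - snd p i)"
      by (rule continuous_map_diff[OF ci cv])
    have o: "openin euclideanreal {0<..}" by simp
    have "openin (prod_topology A ?R) ({p \<in> topspace (prod_topology A ?R). snd p i - d (fst p) i (lo i) \<in> {0<..}} \<inter>
       {p \<in> topspace (prod_topology A ?R). d (fst p) i (hi i) - snd p i \<in> {0<..}})"
      by (intro openin_Int openin_continuous_map_preimage[OF c1 o] openin_continuous_map_preimage[OF c2 o])
    then show ?thesis
      by (rule back_subst[of "openin _"]) auto
  qed
  have "openin (prod_topology A ?R) (topspace (prod_topology A ?R) \<inter> (\<Inter>i\<in>{..<n}. {p \<in> topspace (prod_topology A ?R). d (fst p) i (lo i) < snd p i \<and> snd p i < d (fst p) i (hi i)}))"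
  proof (cases "n = 0")
    case False
    then show ?thesis by (intro openin_Int openin_topspace openin_INT2 Qi) auto
  next
    case True
    then show ?thesis using openin_topspace[of "prod_topology A ?R"] by (simp del: topspace_prod_topology)
  qed
  then have Qo: "openin (prod_topology A ?R) Q"
    by (rule back_subst[of "openin _"]) (auto simp: Q_def)
  have om: "open_map (prod_topology A ?R) (prod_topology A (sph (coord_space n))) (\<lambda>(a, v). (a, Some v))"
    using open_map_prod[of A A "\<lambda>x. x" ?R "sph (coord_space n)" Some] open_map_id[of A] open_map_Some[of ?R]
    by (simp add: sph_def id_def)
  let ?T = "(\<lambda>(a, v). (a, Some v)) ` Q"
  have "openin (prod_topology A (sph (coord_space n))) ?T"
    using om Qo unfolding open_map_def by blast
  moreover have "z \<in> ?T"
  proof -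
    have "(a, box_point (d a) w) \<in> Q"
      using aw(2) lh sm[OF aw(2)] box_point_in_coord[OF id[OF aw(2)] wc]
      by (auto simp: Q_def box_point_def strict_mono_less)
    then show ?thesis using aw(1) by force
  qed
  moreover have "?T \<subseteq> ?P"
  proof
    fix t assume "t \<in> ?T"
    then obtain b u where bu: "t = (b, Some u)" "(b, u) \<in> Q" by auto
    then have b: "b \<in> topspace A" and u: "u \<in> coord_space n"
      and ui: "\<And>i. i < n \<Longrightarrow> d b i (lo i) < u i \<and> u i < d b i (hi i)"
      by (auto simp: Q_def)
    \<comment> \<open>The strictly enclosed value \<open>u i\<close> is attained between the
      endpoints, because the box coordinate is continuous at the fixed parameter
      \<open>b\<close>.\<close>
    have "\<exists>s. lo i \<le> s \<and> s \<le> hi i \<and> d b i s = u i" if "i < n" for i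
      using ui[OF that] lh(1,2)[of i]
      by (intro IVT' continuous_on_subset[OF continuous_map_slice_right[OF cont[of i] b]]) auto
    then obtain s where s: "\<And>i. i < n \<Longrightarrow> lo i \<le> s i \<and> s i \<le> hi i \<and> d b i (s i) = u i" by metis
    define w' where "w' = lo_part n s"
    have "w' \<in> U" using s by (intro lh(3)) (auto simp: w'_def lo_part_def coord_space_def)
    moreover have "u = box_point (d b) w'"
    proof
      fix i show "u i = box_point (d b) w' i"
        using s[of i] id[OF b, of i] u
        by (cases "i < n") (auto simp: box_point_def w'_def lo_part_def coord_space_def)
    qed
    ultimately show "t \<in> ?P" using bu b by auto
  qed
  ultimately show "\<exists>T. openin (prod_topology A (sph (coord_space n))) T \<and> z \<in> T \<and> T \<subseteq> ?P" by blast
qed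

lemma continuous_map_box_point:
  assumes cont: "\<And>i. continuous_map (prod_topology A euclideanreal) euclideanreal (\<lambda>(a, s). d a i s)"
    and id: "\<And>a i. a \<in> topspace A \<Longrightarrow> n \<le> i \<Longrightarrow> d a i = id"
    and f: "continuous_map B A f" and w: "continuous_map B (top_of_set (coord_space n)) w"
  shows "continuous_map B (top_of_set (coord_space n)) (\<lambda>b. box_point (d (f b)) (w b))"
proof (rule continuous_map_into_coord)
  fix i
  have "continuous_map B euclideanreal (\<lambda>b. w b i)"
    using continuous_map_compose[OF w continuous_map_coord] by (simp add: o_def)
  from continuous_map_boxes[OF cont f this]
  show "continuous_map B euclideanreal (\<lambda>b. box_point (d (f b)) (w b) i)"
    by (simp add: box_point_def)
next
  show "(\<lambda>b. box_point (d (f b)) (w b)) \<in> topspace B \<rightarrow> coord_space n"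
  proof
    fix b assume b: "b \<in> topspace B"
    then have "f b \<in> topspace A" "w b \<in> coord_space n"
      using f w unfolding continuous_map_def by auto
    then show "box_point (d (f b)) (w b) \<in> coord_space n"
      by (intro box_point_in_coord id)
  qed
qed

text \<open>The graph of the box map over \<open>K\<close> is closed since the sphere is Hausdorff,
  and projecting away a compact factor is a closed map.\<close>

lemma closedin_collapse_preimage:
  assumes cont: "\<And>i. continuous_map (prod_topology A euclideanreal) euclideanreal (\<lambda>(a, s). d a i s)"
    and id: "\<And>a i. a \<in> topspace A \<Longrightarrow> n \<le> i \<Longrightarrow> d a i = id"
    and K: "compactin (top_of_set (coord_space n)) K"
  shows "closedin (prod_topology A (sph (coord_space n)))
    {(a, v). a \<in> topspace A \<and> (\<exists>w\<in>K. v = Some (box_point (d a) w))}" (is "closedin _ ?P")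
proof -
  let ?R = "top_of_set (coord_space n)"
  let ?A = "prod_topology A (sph (coord_space n))"
  let ?T = "prod_topology ?A (subtopology ?R K)"
  have KR: "K \<subseteq> coord_space n" using compactin_subset_topspace[OF K] by simp
  have cK: "compact_space (subtopology ?R K)" by (rule compact_space_subtopology[OF K])
  have w: "continuous_map ?T ?R snd"
    using continuous_map_snd continuous_map_into_fulltopology by blast
  have a: "continuous_map ?T A (fst \<circ> fst)"
    by (rule continuous_map_compose[OF continuous_map_fst continuous_map_fst])
  have "continuous_map ?T ?R (\<lambda>z. box_point (d ((fst \<circ> fst) z)) (snd z))"
    by (rule continuous_map_box_point[OF cont id a w])
  from continuous_map_compose[OF this continuous_map_Some]
  have "continuous_map ?T (sph (coord_space n)) (\<lambda>z. Some (box_point (d (fst (fst z))) (snd z)))"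
    by (simp add: sph_def o_def)
  moreover have "continuous_map ?T (sph (coord_space n)) (\<lambda>z. snd (fst z))"
    by (rule continuous_map_compose[OF continuous_map_fst continuous_map_snd, unfolded o_def])
  ultimately have "closedin ?T {z \<in> topspace ?T. Some (box_point (d (fst (fst z))) (snd z)) = snd (fst z)}"
    by (intro closedin_continuous_maps_eq[OF Hausdorff_sph])
  with closed_map_fst[OF cK, of ?A]
  have "closedin ?A (fst ` {z \<in> topspace ?T. Some (box_point (d (fst (fst z))) (snd z)) = snd (fst z)})"
    unfolding closed_map_def by blast
  moreover have "fst ` {z \<in> topspace ?T. Some (box_point (d (fst (fst z))) (snd z)) = snd (fst z)} = ?P"
  proof (intro equalityI subsetI)
    fix t assume "t \<in> ?P"
    then obtain a w where t: "t = (a, Some (box_point (d a) w))" "a \<in> topspace A" "w \<in> K" by auto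
    have "box_point (d a) w \<in> coord_space n" using t KR by (intro box_point_in_coord id) auto
    then have "((a, Some (box_point (d a) w)), w) \<in> {z \<in> topspace ?T. Some (box_point (d (fst (fst z))) (snd z)) = snd (fst z)}"
      using t KR by auto
    then show "t \<in> fst ` {z \<in> topspace ?T. Some (box_point (d (fst (fst z))) (snd z)) = snd (fst z)}"
      unfolding t(1) by (metis (no_types, lifting) fst_conv image_eqI)
  qed auto
  ultimately show ?thesis by simp
qed

text \<open>Closed sets of a one-point compactification are images of compact sets, or complements
  of images of open sets; the two preceding lemmas treat one kind each.\<close>

lemma continuous_map_collapse:
  assumes sm: "\<And>a i. a \<in> topspace A \<Longrightarrow> strict_mono (d a i)"
    and cont: "\<And>i. continuous_map (prod_topology A euclideanreal) euclideanreal (\<lambda>(a, s). d a i s)"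
    and id: "\<And>a i. a \<in> topspace A \<Longrightarrow> n \<le> i \<Longrightarrow> d a i = id"
  shows "continuous_map (prod_topology A (sph (coord_space n))) (sph (coord_space n))
     (\<lambda>(a, v). collapse n (d a) v)"
proof (subst continuous_map_closedin, intro conjI ballI allI impI)
  let ?R = "top_of_set (coord_space n)"
  let ?X = "prod_topology A (sph (coord_space n))"
  show "(\<lambda>(a, v). collapse n (d a) v) \<in> topspace ?X \<rightarrow> topspace (sph (coord_space n))"
    by (auto simp del: topspace_sph intro!: collapse_in sm)
  have pre: "{x \<in> topspace ?X. (case x of (a, v) \<Rightarrow> collapse n (d a) v) \<in> Some ` U} =
      {(a, v). a \<in> topspace A \<and> (\<exists>w\<in>U. v = Some (box_point (d a) w))}" if "U \<subseteq> coord_space n" for U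
  proof (intro Set.set_eqI iffI)
    fix x assume "x \<in> {x \<in> topspace ?X. (case x of (a, v) \<Rightarrow> collapse n (d a) v) \<in> Some ` U}"
    then obtain a v w where x: "x = (a, v)" "a \<in> topspace A" "w \<in> U" "collapse n (d a) v = Some w" by auto
    then show "x \<in> {(a, v). a \<in> topspace A \<and> (\<exists>w\<in>U. v = Some (box_point (d a) w))}"
      using collapse_eq_Some_iff[OF sm[OF x(2)]] by auto
  next
    fix x assume "x \<in> {(a, v). a \<in> topspace A \<and> (\<exists>w\<in>U. v = Some (box_point (d a) w))}"
    then obtain a w where x: "x = (a, Some (box_point (d a) w))" "a \<in> topspace A" "w \<in> U" by auto
    then have "w \<in> coord_space n" using that by blast
    then show "x \<in> {x \<in> topspace ?X. (case x of (a, v) \<Rightarrow> collapse n (d a) v) \<in> Some ` U}"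
      using x collapse_inside[OF sm[OF x(2)], where n=n] box_point_in_coord[OF id[OF x(2)]] by auto
  qed
  fix C assume "closedin (sph (coord_space n)) C"
  then consider K where "compactin ?R K" "C = Some ` K"
    | U where "openin ?R U" "C = topspace (sph (coord_space n)) - Some ` U"
    unfolding sph_def closedin_Alexandroff_compactification by blast
  then show "closedin ?X {x \<in> topspace ?X. (case x of (a, v) \<Rightarrow> collapse n (d a) v) \<in> C}"
  proof cases
    case 1
    have "K \<subseteq> coord_space n" using compactin_subset_topspace[OF 1(1)] by simp
    then show ?thesis unfolding 1(2) pre[OF \<open>K \<subseteq> coord_space n\<close>]
      by (intro closedin_collapse_preimage[OF cont id 1(1)])
  next
    case 2
    have U: "U \<subseteq> coord_space n" using openin_subset[OF 2(1)] by simp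
    have "{x \<in> topspace ?X. (case x of (a, v) \<Rightarrow> collapse n (d a) v) \<in> C} =
       topspace ?X - {x \<in> topspace ?X. (case x of (a, v) \<Rightarrow> collapse n (d a) v) \<in> Some ` U}"
    proof -
      have "collapse n (d a) v \<in> topspace (sph (coord_space n))" if "a \<in> topspace A" for a v
        by (rule collapse_in[OF sm[OF that]])
      then show ?thesis unfolding 2(2) by (auto simp del: topspace_sph)
    qed
    also have "closedin ?X \<dots>" unfolding pre[OF U]
      by (intro closedin_diff closedin_topspace openin_collapse_preimage[OF sm cont id 2(1)])
    finally show ?thesis .
  qed
qed

section \<open>Finite covers and existence of Pontryagin-Thom maps\<close>

text \<open>Sheets are recorded as a finite set of sections with open images, so the fibre over
  \<open>y\<close> is directly the set of values \<open>s y\<close>. Distinct sections differ at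
  every point of \<open>U\<close>; fibres may be empty.\<close>

definition evenly_covered :: "'x topology \<Rightarrow> 'y topology \<Rightarrow> ('x \<Rightarrow> 'y) \<Rightarrow> 'y set \<Rightarrow> ('y \<Rightarrow> 'x) set \<Rightarrow> bool" where
  "evenly_covered X Y p U S \<longleftrightarrow> openin Y U \<and> finite S \<and>
     (\<forall>s\<in>S. continuous_map (subtopology Y U) X s \<and> openin X (s ` U) \<and> (\<forall>u\<in>U. p (s u) = u)) \<and>
     (\<forall>s\<in>S. \<forall>s'\<in>S. \<forall>u\<in>U. s u = s' u \<longrightarrow> s = s') \<and>
     (\<forall>x\<in>topspace X. p x \<in> U \<longrightarrow> (\<exists>s\<in>S. x = s (p x)))"

definition finite_cover :: "'x topology \<Rightarrow> 'y topology \<Rightarrow> ('x \<Rightarrow> 'y) \<Rightarrow> bool" where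
  "finite_cover X Y p \<longleftrightarrow> continuous_map X Y p \<and>
     (\<forall>y\<in>topspace Y. \<exists>U S. y \<in> U \<and> evenly_covered X Y p U S)"

text \<open>The condition on the base under which \<open>adjoint_lift\<close> applies over every
  open subset.\<close>

definition locally_k :: "'y topology \<Rightarrow> bool" where
  "locally_k Y \<longleftrightarrow> (\<forall>U. openin Y U \<longrightarrow> k_space (subtopology Y U))"

lemma evenly_coveredD:
  assumes "evenly_covered X Y p U S"
  shows "openin Y U" "finite S" "U \<subseteq> topspace Y"
    "\<And>s. s \<in> S \<Longrightarrow> continuous_map (subtopology Y U) X s"
    "\<And>s. s \<in> S \<Longrightarrow> openin X (s ` U)"
    "\<And>s u. s \<in> S \<Longrightarrow> u \<in> U \<Longrightarrow> p (s u) = u"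
    "\<And>s s' u. s \<in> S \<Longrightarrow> s' \<in> S \<Longrightarrow> u \<in> U \<Longrightarrow> s u = s' u \<Longrightarrow> s = s'"
    "\<And>x. x \<in> topspace X \<Longrightarrow> p x \<in> U \<Longrightarrow> \<exists>s\<in>S. x = s (p x)"
    "\<And>s u. s \<in> S \<Longrightarrow> u \<in> U \<Longrightarrow> s u \<in> topspace X"
proof -
  note * = assms[unfolded evenly_covered_def]
  show "openin Y U" "finite S"
    "\<And>s. s \<in> S \<Longrightarrow> continuous_map (subtopology Y U) X s"
    "\<And>s. s \<in> S \<Longrightarrow> openin X (s ` U)"
    "\<And>s u. s \<in> S \<Longrightarrow> u \<in> U \<Longrightarrow> p (s u) = u"
    "\<And>x. x \<in> topspace X \<Longrightarrow> p x \<in> U \<Longrightarrow> \<exists>s\<in>S. x = s (p x)"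
    using * by simp_all
  then show "U \<subseteq> topspace Y" by (intro openin_subset)
  show "s = s'" if "s \<in> S" "s' \<in> S" "u \<in> U" "s u = s' u" for s s' u
    using that * by blast
  show "s u \<in> topspace X" if "s \<in> S" "u \<in> U" for s u
  proof -
    have "openin X (s ` U)" using * that(1) by simp
    then show ?thesis using openin_subset that(2) by blast
  qed
qed

lemma evenly_coveredI:
  assumes "openin Y U" "finite S"
    "\<And>s. s \<in> S \<Longrightarrow> continuous_map (subtopology Y U) X s"
    "\<And>s. s \<in> S \<Longrightarrow> openin X (s ` U)"
    "\<And>s u. s \<in> S \<Longrightarrow> u \<in> U \<Longrightarrow> p (s u) = u"
    "\<And>s s' u. s \<in> S \<Longrightarrow> s' \<in> S \<Longrightarrow> u \<in> U \<Longrightarrow> s u = s' u \<Longrightarrow> s = s'"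
    "\<And>x. x \<in> topspace X \<Longrightarrow> p x \<in> U \<Longrightarrow> \<exists>s\<in>S. x = s (p x)"
  shows "evenly_covered X Y p U S"
  unfolding evenly_covered_def
proof (intro conjI ballI impI)
  show "openin Y U" "finite S" by fact+
  show "continuous_map (subtopology Y U) X s" "openin X (s ` U)" if "s \<in> S" for s
    using assms(3,4) that by simp_all
  show "p (s u) = u" if "s \<in> S" "u \<in> U" for s u using assms(5) that by simp
  show "s = s'" if "s \<in> S" "s' \<in> S" "u \<in> U" "s u = s' u" for s s' u
    by (rule assms(6)[OF that])
  show "\<exists>s\<in>S. x = s (p x)" if "x \<in> topspace X" "p x \<in> U" for x
    by (rule assms(7)[OF that])
qed

lemma evenly_covered_subset:
  assumes ev: "evenly_covered X Y p U S" and p: "continuous_map X Y p" and V: "openin Y V" "V \<subseteq> U"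
  shows "evenly_covered X Y p V S"
proof -
  note D = evenly_coveredD[OF ev]
  have "openin X (s ` V)" if "s \<in> S" for s
  proof -
    have "openin X (s ` U \<inter> {x \<in> topspace X. p x \<in> V})"
      by (rule openin_Int[OF D(5)[OF that] openin_continuous_map_preimage[OF p V(1)]])
    also have "s ` U \<inter> {x \<in> topspace X. p x \<in> V} = s ` V"
    proof (intro equalityI subsetI)
      fix x assume "x \<in> s ` U \<inter> {x \<in> topspace X. p x \<in> V}"
      then obtain u where "u \<in> U" "x = s u" "p x \<in> V" by blast
      then show "x \<in> s ` V" using D(6)[OF that, of u] by simp
    next
      fix x assume "x \<in> s ` V"
      then obtain u where u: "u \<in> V" "x = s u" by blast
      then have "u \<in> U" using V(2) by blast
      then show "x \<in> s ` U \<inter> {x \<in> topspace X. p x \<in> V}"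
        using u D(6)[OF that] D(9)[OF that] by simp
    qed
    finally show ?thesis .
  qed
  moreover have "continuous_map (subtopology Y V) X s" if "s \<in> S" for s
    using D(4)[OF that] V(2) by (rule continuous_map_from_subtopology_mono)
  moreover have "s = s'" if "s \<in> S" "s' \<in> S" "u \<in> V" "s u = s' u" for s s' u
    using D(7)[OF that(1,2) _ that(4)] that(3) V(2) by blast
  moreover have "\<exists>s\<in>S. x = s (p x)" if "x \<in> topspace X" "p x \<in> V" for x
    using D(8)[OF that(1)] that(2) V(2) by blast
  moreover have "p (s u) = u" if "s \<in> S" "u \<in> V" for s u
    using D(6)[OF that(1)] that(2) V(2) by blast
  ultimately show ?thesis
    unfolding evenly_covered_def using V(1) D(2) by simp
qed

lemma box_embedding_disjoint:
  assumes "box_embedding X Y p c" "x \<in> topspace X" "x' \<in> topspace X" "x \<noteq> x'" "p x = p x'"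
  shows "box_point (c x) w \<noteq> box_point (c x') w'"
proof
  assume eq: "box_point (c x) w = box_point (c x') w'"
  obtain i where i: "range (c x i) \<inter> range (c x' i) = {}"
    using assms unfolding box_embedding_def by meson
  have "c x i (w i) = c x' i (w' i)" using fun_cong[OF eq, of i] by (simp add: box_point_def)
  then show False using i by (metis disjoint_iff rangeI)
qed

context spectrum_loc
begin

text \<open>For a sheet \<open>s\<close>, collapse the sphere onto the box of \<open>s y\<close> and
  apply the loop of \<open>f (s y)\<close>. Boxes of different sheets are disjoint, so at most one
  of these contributions is nontrivial at a given point, and together they form one continuous
  family of loops, which \<open>adjoint_lift\<close> turns into a map.\<close>

lemma pt_local:
  assumes ev: "evenly_covered X Y p U S"
    and k: "k_space (subtopology Y U)"
    and c: "box_embedding X Y p c"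
    and n: "\<And>x i. x \<in> topspace X \<Longrightarrow> p x \<in> U \<Longrightarrow> n \<le> i \<Longrightarrow> c x i = id"
    and f: "continuous_map X (zspace E) f"
  obtains g where "continuous_map (subtopology Y U) (zspace E) g"
    "\<And>y. y \<in> U \<Longrightarrow> box_sum E n {x \<in> topspace X. p x = y} c f (g y)"
proof -
  note D = evenly_coveredD[OF ev]
  let ?A = "subtopology Y U" and ?S = "sph (coord_space n)" and ?En = "lev E (coord_space n)"
  let ?P = "prod_topology ?A ?S"
  have tA: "topspace ?A = U" using D(3) by (simp add: inf.absorb2)
  have tP: "z \<in> topspace ?P \<longleftrightarrow> fst z \<in> U \<and> snd z \<in> topspace ?S" for z
    by (simp only: topspace_prod_topology tA mem_Times_iff)
  have csm: "strict_mono (c x i)" if "x \<in> topspace X" for x i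
    using c that unfolding box_embedding_def by simp
  have ccont: "continuous_map (prod_topology X euclideanreal) euclideanreal (\<lambda>(x, r). c x i r)" for i
    using c unfolding box_embedding_def by simp
  have fib: "{x \<in> topspace X. p x = y} = (\<lambda>s. s y) ` S" if "y \<in> U" for y
  proof (intro equalityI subsetI)
    fix x assume "x \<in> {x \<in> topspace X. p x = y}"
    then show "x \<in> (\<lambda>s. s y) ` S" using D(8)[of x] that by auto
  next
    fix x assume "x \<in> (\<lambda>s. s y) ` S"
    then show "x \<in> {x \<in> topspace X. p x = y}" using D(6,9) that by auto
  qed
  have csec: "continuous_map (prod_topology ?A euclideanreal) euclideanreal (\<lambda>(y, r). c (s y) i r)" if "s \<in> S" for s i
  proof -
    have "continuous_map (prod_topology ?A euclideanreal) euclideanreal (\<lambda>b. c ((s \<circ> fst) b) i (snd b))"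
      by (rule continuous_map_boxes[OF ccont continuous_map_compose[OF continuous_map_fst D(4)[OF that]] continuous_map_snd])
    then show ?thesis by (simp add: case_prod_unfold o_def)
  qed
  define K where "K s z = collapse n (c (s (fst z))) (snd z)" for s :: "'c \<Rightarrow> 'b" and z
  have Kc: "continuous_map ?P ?S (K s)" if s: "s \<in> S" for s
  proof -
    have "continuous_map ?P ?S (\<lambda>(y, v). collapse n (c (s y)) v)"
    proof (rule continuous_map_collapse[OF _ csec[OF s]])
      fix y i assume y: "y \<in> topspace ?A"
      then show "strict_mono (c (s y) i)" using csm D(9)[OF s] tA by blast
      show "c (s y) i = id" if "n \<le> i" using n[OF D(9)[OF s] _ that] D(6)[OF s] y tA by simp
    qed
    then show ?thesis by (simp add: K_def[abs_def] case_prod_unfold)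
  qed
  define M where "M s z = sm n (K s z) (f (s (fst z)))" for s :: "'c \<Rightarrow> 'b" and z
  have Mc: "continuous_map ?P ?En (M s)" if s: "s \<in> S" for s
  proof -
    have "continuous_map ?P (zspace E) (\<lambda>z. f (s (fst z)))"
      using continuous_map_compose[OF continuous_map_compose[OF continuous_map_fst D(4)[OF s]] f]
      by (simp add: o_def)
    then have "continuous_map ?P (prod_topology ?S (zspace E)) (\<lambda>z. (K s z, f (s (fst z))))"
      using Kc[OF s] by (simp add: continuous_map_pairwise o_def)
    from continuous_map_compose[OF this sm_continuous] show ?thesis
      by (simp add: M_def[abs_def] o_def)
  qed
  have fZ: "f x \<in> topspace (zspace E)" if "x \<in> topspace X" for x
    using f that unfolding continuous_map_def by blast
  \<comment> \<open>On \<open>T s\<close> all sheets but \<open>s\<close> collapse to the base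
    point, so the sum is the contribution of \<open>s\<close> alone. These finitely many sets are
    closed, since the base point is closed, and they cover by disjointness of the boxes.\<close>
  define T where "T s = {z \<in> topspace ?P. \<forall>s'\<in>S - {s}. K s' z = None}" for s
  have Tcl: "closedin ?P (T s)" if "s \<in> S" for s
  proof -
    have cN: "closedin ?S {None}"
      by (rule closedin_Hausdorff_singleton[OF Hausdorff_sph]) simp
    have "closedin ?P (topspace ?P \<inter> (\<Inter>s'\<in>S - {s}. {z \<in> topspace ?P. K s' z \<in> {None}}))"
    proof (cases "S - {s} = {}")
      case True
      show ?thesis using closedin_topspace[of ?P] by (simp only: True INT_empty inf_top_right)
    next
      case False
      show ?thesis
        by (intro closedin_Int closedin_topspace closedin_INT False closedin_continuous_map_preimage[OF Kc cN]) blast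
    qed
    then show ?thesis
      by (rule back_subst[of "closedin _"]) (unfold T_def, blast)
  qed
  have disj: "K s' z = None" if h: "s \<in> S" "s' \<in> S" "s \<noteq> s'" "fst z \<in> U" "K s z \<noteq> None" for s s' z
  proof (rule ccontr)
    assume "K s' z \<noteq> None"
    then obtain w w' where w: "K s z = Some w" "K s' z = Some w'" using h(5) by blast
    have "snd z = Some (box_point (c (s (fst z))) w)"
      by (rule collapse_eq_Some_iff[OF csm[OF D(9)[OF h(1,4)]], THEN iffD1, OF w(1)[unfolded K_def], THEN conjunct2])
    moreover have "snd z = Some (box_point (c (s' (fst z))) w')"
      by (rule collapse_eq_Some_iff[OF csm[OF D(9)[OF h(2,4)]], THEN iffD1, OF w(2)[unfolded K_def], THEN conjunct2])
    ultimately have eq: "box_point (c (s (fst z))) w = box_point (c (s' (fst z))) w'" by simp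
    have ne: "s (fst z) \<noteq> s' (fst z)" using D(7)[OF h(1,2,4)] h(3) by blast
    have pp: "p (s (fst z)) = p (s' (fst z))" using D(6)[OF h(1,4)] D(6)[OF h(2,4)] by simp
    from box_embedding_disjoint[OF c D(9)[OF h(1,4)] D(9)[OF h(2,4)] ne pp] eq
    show False by blast
  qed
  have "\<exists>L. continuous_map ?P ?En L \<and> (\<forall>s\<in>S. \<forall>z\<in>T s. L z = M s z) \<and> (\<forall>z\<in>topspace ?P. (\<forall>s\<in>S. K s z = None) \<longrightarrow> L z = bn n)"
  proof (cases "S = {}")
    case True
    have "continuous_map ?P ?En (\<lambda>z. bn n)" by simp
    then show ?thesis using True by blast
  next
    case False
    then obtain s0 where s0: "s0 \<in> S" by blast
    have cov: "topspace ?P \<subseteq> (\<Union>s\<in>S. T s)"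
    proof
      fix z assume z: "z \<in> topspace ?P"
      then have zU: "fst z \<in> U" using tP by blast
      show "z \<in> (\<Union>s\<in>S. T s)"
      proof (cases "\<exists>s\<in>S. K s z \<noteq> None")
        case True
        then obtain s where s: "s \<in> S" "K s z \<noteq> None" by blast
        then have "z \<in> T s" using disj[OF s(1) _ _ zU s(2)] z unfolding T_def by blast
        then show ?thesis using s(1) by blast
      next
        case False
        then have "z \<in> T s0" using z unfolding T_def by blast
        then show ?thesis using s0 by blast
      qed
    qed
    have MT: "continuous_map (subtopology ?P (T s)) ?En (M s)" if "s \<in> S" for s
      by (rule continuous_map_from_subtopology[OF Mc[OF that]])
    have MM: "M s z = M s' z" if "s \<in> S" "s' \<in> S" "z \<in> topspace ?P \<inter> T s \<inter> T s'" for s s' z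
    proof (cases "s = s'")
      case False
      then have "K s z = None" "K s' z = None" using that unfolding T_def by blast+
      moreover have "fst z \<in> U" using that(3) tP by blast
      ultimately show ?thesis unfolding M_def
        using fZ[OF D(9)] that(1,2) by simp
    qed simp
    obtain L where L: "continuous_map ?P ?En L" "\<And>z s. s \<in> S \<Longrightarrow> z \<in> topspace ?P \<inter> T s \<Longrightarrow> L z = M s z"
      using pasting_lemma_exists_closed[OF D(2) cov Tcl MT MM] by blast
    moreover have "L z = bn n" if "z \<in> topspace ?P" "\<forall>s\<in>S. K s z = None" for z
    proof -
      have "z \<in> T s0" using that unfolding T_def by simp
      then have "L z = M s0 z" using L(2)[OF s0] that(1) by simp
      moreover have "fst z \<in> U" using that(1) tP by blast
      ultimately show ?thesis unfolding M_def using that(2) s0 fZ[OF D(9)[OF s0]] by simp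
    qed
    moreover have "T s \<subseteq> topspace ?P" for s unfolding T_def by blast
    ultimately show ?thesis by (intro exI[of _ L]) blast
  qed
  then obtain L where L0: "continuous_map ?P ?En L \<and> (\<forall>s\<in>S. \<forall>z\<in>T s. L z = M s z) \<and>
    (\<forall>z\<in>topspace ?P. (\<forall>s\<in>S. K s z = None) \<longrightarrow> L z = bn n)" ..
  have L1: "continuous_map ?P ?En L" using L0 by (rule conjunct1)
  have L2: "L z = M s z" if "s \<in> S" "z \<in> T s" for s z
    using L0[THEN conjunct2, THEN conjunct1] that by blast
  have L3: "L z = bn n" if "z \<in> topspace ?P" "\<And>s. s \<in> S \<Longrightarrow> K s z = None" for z
    using L0[THEN conjunct2, THEN conjunct2] that by blast
  have LN: "L (y, None) = bn n" if "y \<in> topspace ?A" for y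
    using that unfolding tA by (intro L3) (simp_all add: tP K_def del: topspace_prod_topology)
  obtain g where g: "continuous_map ?A (zspace E) g"
    "\<And>y w. y \<in> topspace ?A \<Longrightarrow> w \<in> topspace ?S \<Longrightarrow> sm n w (g y) = L (y, w)"
    using adjoint_lift[OF k L1 LN] by blast
  show thesis
  proof (rule that[OF g(1)])
    fix y assume y: "y \<in> U"
    then have yA: "y \<in> topspace ?A" using tA by simp
    show "box_sum E n {x \<in> topspace X. p x = y} c f (g y)"
      unfolding fib[OF y]
    proof (rule box_sumI)
      show "g y \<in> topspace (zspace E)" using g(1) yA unfolding continuous_map_def by blast
    next
      fix x w assume "x \<in> (\<lambda>s. s y) ` S" and w: "w \<in> coord_space n"
      then obtain s where s: "s \<in> S" "x = s y" by blast
      have sX: "s y \<in> topspace X" by (rule D(9)[OF s(1) y])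
      have bw: "box_point (c (s y)) w \<in> coord_space n"
        using n[OF sX] D(6)[OF s(1) y] y w by (intro box_point_in_coord) auto
      let ?z = "(y, Some (box_point (c (s y)) w))"
      have K1: "K s ?z = Some w"
        unfolding K_def using collapse_inside[OF csm[OF sX] w] by simp
      have "K s' ?z = None" if "s' \<in> S - {s}" for s'
        using that y K1 by (intro disj[OF s(1)]) auto
      moreover have zP: "?z \<in> topspace ?P" using y bw by (simp add: tP del: topspace_prod_topology)
      ultimately have "?z \<in> T s" unfolding T_def by blast
      then have "L ?z = M s ?z" by (rule L2[OF s(1)])
      then show "sm n (Some (box_point (c x) w)) (g y) = sm n (Some w) (f x)"
        using g(2)[OF yA] bw unfolding s(2) M_def K1 by simp
    next
      fix v assume v: "v \<in> coord_space n" "v \<notin> (\<Union>x\<in>(\<lambda>s. s y) ` S. box_point (c x) ` coord_space n)"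
      have "K s (y, Some v) = None" if "s \<in> S" for s
        using v that unfolding K_def by (simp add: collapse_outside)
      then have "L (y, Some v) = bn n" using y v(1) by (intro L3) (simp_all add: tP del: topspace_prod_topology)
      then show "sm n (Some v) (g y) = bn n" using g(2)[OF yA] v(1) by simp
    qed
  qed
qed

text \<open>Local solutions may use different dimensions, but box sums are unique and independent of
  the dimension, so the solutions agree on overlaps and paste.\<close>

lemma pt_exists:
  assumes cov: "finite_cover X Y p"
    and k: "locally_k Y"
    and c: "box_embedding X Y p c"
    and f: "continuous_map X (zspace E) f"
  obtains g where "continuous_map Y (zspace E) g" "pt_map E X Y p c f g"
proof -
  have p: "continuous_map X Y p" using cov by (simp add: finite_cover_def)
  have fZ: "f x \<in> topspace (zspace E)" if "x \<in> topspace X" for x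
    using f that unfolding continuous_map_def by blast
  define Q where "Q y U n g \<longleftrightarrow> openin Y U \<and> y \<in> U \<and> continuous_map (subtopology Y U) (zspace E) g \<and>
      (\<forall>x\<in>topspace X. \<forall>i\<ge>n. p x \<in> U \<longrightarrow> c x i = id) \<and>
      (\<forall>u\<in>U. box_sum E n {x \<in> topspace X. p x = u} c f (g u))" for y U n g
  have "\<exists>U n g. Q y U n g" if y: "y \<in> topspace Y" for y
  proof -
    obtain U1 S where U1: "y \<in> U1" "evenly_covered X Y p U1 S"
      using cov y unfolding finite_cover_def by blast
    obtain U2 n where U2: "openin Y U2" "y \<in> U2"
       "\<And>x i. x \<in> topspace X \<Longrightarrow> p x \<in> U2 \<Longrightarrow> n \<le> i \<Longrightarrow> c x i = id"
      using box_embedding_bound[OF c y] by metis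
    have o: "openin Y (U1 \<inter> U2)" using evenly_coveredD(1)[OF U1(2)] U2(1) by blast
    have ev: "evenly_covered X Y p (U1 \<inter> U2) S"
      by (rule evenly_covered_subset[OF U1(2) p o]) blast
    have kU: "k_space (subtopology Y (U1 \<inter> U2))" using k o unfolding locally_k_def by blast
    have n: "c x i = id" if "x \<in> topspace X" "p x \<in> U1 \<inter> U2" "n \<le> i" for x i
      using U2(3) that by blast
    obtain g where "continuous_map (subtopology Y (U1 \<inter> U2)) (zspace E) g"
      "\<And>y. y \<in> U1 \<inter> U2 \<Longrightarrow> box_sum E n {x \<in> topspace X. p x = y} c f (g y)"
      using pt_local[OF ev kU c n f] by blast
    then have "Q y (U1 \<inter> U2) n g" unfolding Q_def using o U1(1) U2(2) n by blast
    then show ?thesis by blast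
  qed
  then obtain U n g where Q: "\<And>y. y \<in> topspace Y \<Longrightarrow> Q y (U y) (n y) (g y)" by metis
  note Ung = Q[unfolded Q_def]
  have agree: "g y u = g y' u" if y: "y \<in> topspace Y" "y' \<in> topspace Y" and u: "u \<in> U y" "u \<in> U y'" for y y' u
  proof -
    let ?I = "{x \<in> topspace X. p x = u}"
    have 1: "box_sum E (n y) ?I c f (g y u)" and 2: "box_sum E (n y') ?I c f (g y' u)"
      using Ung[OF y(1)] Ung[OF y(2)] u by blast+
    have "box_sum E (n y') ?I c f (g y u)"
      by (rule box_sum_indep[OF 1]) (use Ung[OF y(1)] Ung[OF y(2)] u fZ in blast)+
    from box_sum_unique[OF this 2] show ?thesis .
  qed
  show thesis
  proof (rule that[of "\<lambda>y. g y y"])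
    show "continuous_map Y (zspace E) (\<lambda>y. g y y)"
    proof (rule pasting_lemma[where I="topspace Y" and T=U and f=g])
      show "openin Y (U i)" "continuous_map (subtopology Y (U i)) (zspace E) (g i)" if "i \<in> topspace Y" for i
        using Ung[OF that] by blast+
      show "g i x = g j x" if "i \<in> topspace Y" "j \<in> topspace Y" "x \<in> topspace Y \<inter> U i \<inter> U j" for i j x
        using agree that by blast
      show "\<exists>j. j \<in> topspace Y \<and> x \<in> U j \<and> g x x = g j x" if "x \<in> topspace Y" for x
        using Ung[OF that] that by blast
    qed
    show "pt_map E X Y p c f (\<lambda>y. g y y)"
    proof (rule pt_mapI[OF fZ])
      fix y assume y: "y \<in> topspace Y"
      from Ung[OF y] have U: "y \<in> U y" "\<forall>x\<in>topspace X. \<forall>i\<ge>n y. p x \<in> U y \<longrightarrow> c x i = id"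
        "\<forall>u\<in>U y. box_sum E (n y) {x \<in> topspace X. p x = u} c f (g y u)" by blast+
      show "\<exists>n. (\<forall>x\<in>topspace X. p x = y \<longrightarrow> (\<forall>i\<ge>n. c x i = id)) \<and>
         box_sum E n {x \<in> topspace X. p x = y} c f (g y y)"
        using U by (intro exI[of _ "n y"] conjI) blast+
    qed
  qed
qed

end

section \<open>Homotopies between box embeddings\<close>

definition mix :: "real \<Rightarrow> (real \<Rightarrow> real) \<Rightarrow> real \<Rightarrow> real" where
  "mix a d s = (1 - a) * s + a * d s"

lemma mix_0 [simp]: "mix 0 d = id"
  by (simp add: mix_def fun_eq_iff)

lemma mix_1 [simp]: "mix 1 d = d"
  by (simp add: mix_def fun_eq_iff)

lemma mix_id [simp]: "mix a id = id"
  by (simp add: mix_def fun_eq_iff algebra_simps)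

lemma strict_mono_comp: "strict_mono f \<Longrightarrow> strict_mono g \<Longrightarrow> strict_mono (f \<circ> g)"
  by (simp add: strict_mono_def)

lemma strict_mono_mix:
  assumes a: "0 \<le> a" "a \<le> 1" and d: "strict_mono d"
  shows "strict_mono (mix a d)"
proof (rule strict_monoI)
  fix x y :: real assume xy: "x < y"
  then have "d x < d y" using d by (simp add: strict_mono_less)
  then have le: "a * d x \<le> a * d y" using a(1) by (intro mult_left_mono) auto
  have le2: "(1 - a) * x \<le> (1 - a) * y" using a(2) xy by (intro mult_left_mono) auto
  show "mix a d x < mix a d y"
  proof (cases "a = 0")
    case True then show ?thesis using xy by simp
  next
    case False
    then have "a * d x < a * d y" using a(1) \<open>d x < d y\<close> by simp
    then show ?thesis using le2 unfolding mix_def by linarith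
  qed
qed

definition clamp01 :: "real \<Rightarrow> real" where
  "clamp01 r = max 0 (min 1 r)"

lemma clamp01_bounds: "0 \<le> clamp01 r" "clamp01 r \<le> 1"
  by (auto simp: clamp01_def)

lemma continuous_clamp01: "continuous_on S f \<Longrightarrow> continuous_on S (\<lambda>t. clamp01 (f t))"
  unfolding clamp01_def by (intro continuous_intros)

definition jcont :: "'b topology \<Rightarrow> ('b \<Rightarrow> real \<Rightarrow> real) \<Rightarrow> bool" where
  "jcont B d \<longleftrightarrow> continuous_map (prod_topology B euclideanreal) euclideanreal (\<lambda>(b, s). d b s)"

lemma jcont_comp:
  assumes "jcont B d1" "jcont B d2"
  shows "jcont B (\<lambda>b. d1 b \<circ> d2 b)"
proof -
  let ?P = "prod_topology B euclideanreal"
  have "continuous_map ?P ?P (\<lambda>z. (fst z, (case z of (b, s) \<Rightarrow> d2 b s)))"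
    using assms(2) unfolding jcont_def by (simp add: continuous_map_pairwise o_def continuous_map_fst)
  from continuous_map_compose[OF this assms(1)[unfolded jcont_def]]
  show ?thesis by (simp add: jcont_def o_def case_prod_unfold)
qed

lemma jcont_id [simp]: "jcont B (\<lambda>b. id)"
  by (simp add: jcont_def case_prod_unfold continuous_map_snd)

lemma jcont_mix:
  assumes d: "jcont B d" and a: "continuous_map B euclideanreal a"
  shows "jcont B (\<lambda>b. mix (a b) (d b))"
proof -
  let ?P = "prod_topology B euclideanreal"
  have a': "continuous_map ?P euclideanreal (\<lambda>z. a (fst z))"
    using continuous_map_compose[OF continuous_map_fst a] by (simp add: o_def)
  have s: "continuous_map ?P euclideanreal (\<lambda>z. snd z)" by (rule continuous_map_snd)
  have d': "continuous_map ?P euclideanreal (\<lambda>z. d (fst z) (snd z))"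
    using d by (simp add: jcont_def case_prod_unfold)
  have "continuous_map ?P euclideanreal (\<lambda>z. (1 - a (fst z)) * snd z + a (fst z) * d (fst z) (snd z))"
    by (intro continuous_map_add continuous_map_real_mult continuous_map_diff a' s d') simp
  then show ?thesis by (simp add: jcont_def mix_def case_prod_unfold)
qed

lemma jcont_pullback:
  assumes d: "jcont B d" and f: "continuous_map B' B f"
  shows "jcont B' (\<lambda>b. d (f b))"
proof -
  have "continuous_map (prod_topology B' euclideanreal) B (\<lambda>z. f (fst z))"
    using continuous_map_compose[OF continuous_map_fst f] by (simp add: o_def)
  then have "continuous_map (prod_topology B' euclideanreal) (prod_topology B euclideanreal) (\<lambda>z. (f (fst z), snd z))"
    by (simp add: continuous_map_pairwise o_def continuous_map_snd)
  from continuous_map_compose[OF this d[unfolded jcont_def]]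
  show ?thesis by (simp add: jcont_def o_def case_prod_unfold)
qed

abbreviation cyl :: "'x topology \<Rightarrow> (real \<times> 'x) topology" where
  "cyl X \<equiv> prod_topology (top_of_set {0..1}) X"

abbreviation cylmap :: "('x \<Rightarrow> 'y) \<Rightarrow> real \<times> 'x \<Rightarrow> real \<times> 'y" where
  "cylmap p \<equiv> (\<lambda>z. (fst z, p (snd z)))"

lemma cylmap_continuous: "continuous_map X Y p \<Longrightarrow> continuous_map (cyl X) (cyl Y) (cylmap p)"
  using continuous_map_compose[OF continuous_map_snd, of X Y p "top_of_set {0..1::real}"]
  by (simp add: continuous_map_pairwise o_def continuous_map_fst)

lemma evenly_covered_cyl:
  assumes ev: "evenly_covered X Y p U S"
  shows "evenly_covered (cyl X) (cyl Y) (cylmap p) ({0..1} \<times> U) ((\<lambda>s. cylmap s) ` S)"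
proof -
  note D = evenly_coveredD[OF ev]
  have sub: "subtopology (cyl Y) ({0..1} \<times> U) = cyl (subtopology Y U)"
    by (simp add: subtopology_Times subtopology_subtopology)
  have c: "continuous_map (subtopology (cyl Y) ({0..1} \<times> U)) (cyl X) (cylmap s)" if "s \<in> S" for s
    unfolding sub by (rule cylmap_continuous[OF D(4)[OF that]])
  have o: "openin (cyl X) (cylmap s ` ({0..1} \<times> U))" if "s \<in> S" for s
  proof -
    have "cylmap s ` ({0..1} \<times> U) = {0..1} \<times> s ` U" by force
    moreover have "openin (cyl X) ({0..1} \<times> s ` U)"
      using D(5)[OF that] by (simp add: openin_prod_Times_iff)
    ultimately show ?thesis by simp
  qed
  show ?thesis
  proof (rule evenly_coveredI)
    show "openin (cyl Y) ({0..1} \<times> U)" using D(1) by (simp add: openin_prod_Times_iff)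
    show "finite ((\<lambda>s. cylmap s) ` S)" using D(2) by simp
    fix r assume "r \<in> (\<lambda>s. cylmap s) ` S"
    then obtain s where s: "s \<in> S" "r = cylmap s" by (rule imageE)
    show "continuous_map (subtopology (cyl Y) ({0..1} \<times> U)) (cyl X) r"
      unfolding s(2) by (rule c[OF s(1)])
    show "openin (cyl X) (r ` ({0..1} \<times> U))" unfolding s(2) by (rule o[OF s(1)])
    show "cylmap p (r z) = z" if "z \<in> {0..1} \<times> U" for z
      using D(6)[OF s(1), of "snd z"] that unfolding s(2) by (simp add: mem_Times_iff)
    fix r' z assume "r' \<in> (\<lambda>s. cylmap s) ` S" and z: "z \<in> {0..1} \<times> U" and eq: "r z = r' z"
    then obtain s' where s': "s' \<in> S" "r' = cylmap s'" by (elim imageE)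
    have "snd z \<in> U" using z by (simp add: mem_Times_iff)
    moreover have "s (snd z) = s' (snd z)" using eq unfolding s(2) s'(2) by simp
    ultimately have "s = s'" by (rule D(7)[OF s(1) s'(1)])
    then show "r = r'" unfolding s(2) s'(2) by simp
  next
    fix z assume z: "z \<in> topspace (cyl X)" "cylmap p z \<in> {0..1} \<times> U"
    have "snd z \<in> topspace X" "p (snd z) \<in> U" using z by (simp_all add: mem_Times_iff)
    from D(8)[OF this] obtain s where s: "s \<in> S" "snd z = s (p (snd z))" by blast
    then have "z = cylmap s (cylmap p z)" by (simp add: prod_eq_iff)
    then show "\<exists>r\<in>(\<lambda>s. cylmap s) ` S. z = r (cylmap p z)" using imageI[OF s(1), of "\<lambda>s. cylmap s"] by (rule rev_bexI[rotated])
  qed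
qed

lemma finite_cover_cyl:
  assumes "finite_cover X Y p"
  shows "finite_cover (cyl X) (cyl Y) (cylmap p)"
  unfolding finite_cover_def
proof (intro conjI ballI)
  show "continuous_map (cyl X) (cyl Y) (cylmap p)"
    using assms by (intro cylmap_continuous) (simp add: finite_cover_def)
  fix z assume z: "z \<in> topspace (cyl Y)"
  then have "snd z \<in> topspace Y" by (simp add: mem_Times_iff)
  then obtain U S where U: "snd z \<in> U" "evenly_covered X Y p U S"
    using assms unfolding finite_cover_def by blast
  have "z \<in> {0..1} \<times> U" using z U(1) by (simp add: mem_Times_iff)
  with evenly_covered_cyl[OF U(2)] show "\<exists>U S. z \<in> U \<and> evenly_covered (cyl X) (cyl Y) (cylmap p) U S"
    by (intro exI conjI)
qed

lemma box_embeddingI: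
  assumes "\<And>x i. x \<in> topspace X \<Longrightarrow> strict_mono (c x i)"
    "\<And>i. jcont X (\<lambda>x. c x i)"
    "\<And>y. y \<in> topspace Y \<Longrightarrow> \<exists>U n. openin Y U \<and> y \<in> U \<and> (\<forall>x\<in>topspace X. p x \<in> U \<longrightarrow> (\<forall>i\<ge>n. c x i = id))"
    "\<And>x x'. x \<in> topspace X \<Longrightarrow> x' \<in> topspace X \<Longrightarrow> x \<noteq> x' \<Longrightarrow> p x = p x' \<Longrightarrow> \<exists>i. range (c x i) \<inter> range (c x' i) = {}"
  shows "box_embedding X Y p c"
  unfolding box_embedding_def using assms by (simp add: jcont_def)

lemma box_embeddingD:
  assumes "box_embedding X Y p c"
  shows "\<And>x i. x \<in> topspace X \<Longrightarrow> strict_mono (c x i)" "\<And>i. jcont X (\<lambda>x. c x i)"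
    "\<And>x x'. x \<in> topspace X \<Longrightarrow> x' \<in> topspace X \<Longrightarrow> x \<noteq> x' \<Longrightarrow> p x = p x' \<Longrightarrow> \<exists>i. range (c x i) \<inter> range (c x' i) = {}"
  using assms by (simp_all add: box_embedding_def jcont_def)

text \<open>Applied with \<open>E k > k\<close>: the box coordinate \<open>k\<close> is moved to the free coordinate \<open>E k\<close>.\<close>

definition shift_boxes :: "(nat \<Rightarrow> nat) \<Rightarrow> ('x \<Rightarrow> nat \<Rightarrow> real \<Rightarrow> real) \<Rightarrow> 'x \<Rightarrow> nat \<Rightarrow> real \<Rightarrow> real" where
  "shift_boxes e c x j = (if j \<in> range e then c x (inv_into UNIV e j) else id)"

lemma shift_boxes_at: "inj e \<Longrightarrow> shift_boxes e c x (e k) = c x k"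
  by (simp add: shift_boxes_def)

text \<open>The sum of the first \<open>n\<close> values of \<open>e\<close> bounds each of them, so
  an index above it can only come from some \<open>k\<close> with \<open>n \<le> k\<close>.\<close>

lemma shift_boxes_bound:
  assumes e: "inj e" and c: "\<And>i. n \<le> i \<Longrightarrow> c x i = id" and j: "(\<Sum>k<n. e k) < j"
  shows "shift_boxes e c x j = id"
proof (cases "j \<in> range e")
  case True
  then obtain k where k: "j = e k" by blast
  have "n \<le> k"
  proof (rule ccontr)
    assume "\<not> n \<le> k"
    then have "e k \<le> (\<Sum>k<n. e k)" by (intro member_le_sum) auto
    then show False using j k by simp
  qed
  then show ?thesis unfolding k shift_boxes_at[OF e] by (rule c)
qed (simp add: shift_boxes_def)

lemma jcont_shift_boxes:
  assumes "\<And>i. jcont X (\<lambda>x. c x i)"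
  shows "jcont X (\<lambda>x. shift_boxes e c x j)"
  using assms by (cases "j \<in> range e") (simp_all add: shift_boxes_def)

lemma strict_mono_shift_boxes:
  assumes "\<And>i. strict_mono (c x i)"
  shows "strict_mono (shift_boxes e c x j)"
  using assms by (simp add: shift_boxes_def strict_mono_def)

text \<open>The timetable for moving coordinates. Coordinate \<open>k\<close> is treated between the
  times 1/(k+2) and 1/(k+1): in the first half its copy is switched on (\<open>gain_wt\<close>),
  from the midpoint on the original is switched off (\<open>drop_wt\<close>). High coordinates move
  first, so a larger index is already vacated when a smaller one is moved into it.\<close>

definition drop_wt :: "nat \<Rightarrow> real \<Rightarrow> real" where
  "drop_wt j t = clamp01 (2 * (real j + 2) * (1 - (real j + 1) * t))"

definition gain_wt :: "nat \<Rightarrow> real \<Rightarrow> real" where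
  "gain_wt k t = clamp01 (2 * (real k + 1) * ((real k + 2) * t - 1))"

lemma drop_gain:
  "drop_wt k t = 1 \<or> gain_wt k t = 1"
proof -
  have "2 * (real k + 2) * (1 - (real k + 1) * t) \<ge> 1 \<or> 2 * (real k + 1) * ((real k + 2) * t - 1) \<ge> 1"
  proof (rule ccontr)
    assume "\<not> ?thesis"
    then have "2 * (real k + 2) * (1 - (real k + 1) * t) + 2 * (real k + 1) * ((real k + 2) * t - 1) < 2" by linarith
    moreover have "2 * (real k + 2) * (1 - (real k + 1) * t) + 2 * (real k + 1) * ((real k + 2) * t - 1) = 2"
      by (simp add: algebra_simps)
    ultimately show False by simp
  qed
  then show ?thesis unfolding drop_wt_def gain_wt_def clamp01_def by auto
qed

lemma gain_drop:
  assumes "gain_wt k t = 1" "k < j"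
  shows "drop_wt j t = 0"
proof -
  have "2 * (real k + 1) * ((real k + 2) * t - 1) \<ge> 1"
    using assms(1) unfolding gain_wt_def clamp01_def by (auto simp: max_def min_def split: if_splits)
  then have "0 < 2 * (real k + 1) * ((real k + 2) * t - 1)" by linarith
  then have p: "0 < (real k + 2) * t - 1" by (simp add: zero_less_mult_iff)
  then have "0 < (real k + 2) * t" by linarith
  then have t: "0 < t" by (simp add: zero_less_mult_iff)
  have "real k + 2 \<le> real j + 1" using assms(2) by simp
  then have "(real k + 2) * t \<le> (real j + 1) * t" using t by (intro mult_right_mono) auto
  then have "1 - (real j + 1) * t \<le> 0" using p by linarith
  then have "2 * (real j + 2) * (1 - (real j + 1) * t) \<le> 0"
    by (intro mult_nonneg_nonpos) auto
  then show ?thesis unfolding drop_wt_def clamp01_def by simp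
qed

lemma drop_gain_ends: "drop_wt k 0 = 1" "gain_wt k 0 = 0" "drop_wt k 1 = 0" "gain_wt k 1 = 1"
proof -
  show "drop_wt k 0 = 1" "gain_wt k 0 = 0"
    by (simp_all add: drop_wt_def gain_wt_def clamp01_def)
  have "2 * (real k + 2) * (1 - (real k + 1) * 1) \<le> 0" by (intro mult_nonneg_nonpos) auto
  then show "drop_wt k 1 = 0" unfolding drop_wt_def clamp01_def by linarith
  have "(1::real) * 1 \<le> (2 * (real k + 1)) * ((real k + 2) * 1 - 1)" by (intro mult_mono) auto
  then show "gain_wt k 1 = 1" unfolding gain_wt_def clamp01_def by linarith
qed

lemma continuous_map_cyl_time:
  assumes "continuous_on UNIV (f :: real \<Rightarrow> real)"
  shows "continuous_map (cyl X) euclideanreal (\<lambda>z. f (fst z))"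
proof -
  have "continuous_map (top_of_set {0..1}) euclideanreal f"
    using assms continuous_on_subset by (auto simp: continuous_map_iff_continuous)
  from continuous_map_compose[OF continuous_map_fst this] show ?thesis by (simp add: o_def)
qed

lemma continuous_drop: "continuous_map (cyl X) euclideanreal (\<lambda>z. drop_wt j (fst z))"
  unfolding drop_wt_def by (intro continuous_map_cyl_time continuous_clamp01 continuous_intros)

lemma continuous_gain: "continuous_map (cyl X) euclideanreal (\<lambda>z. gain_wt j (fst z))"
  unfolding gain_wt_def by (intro continuous_map_cyl_time continuous_clamp01 continuous_intros)

definition boxes_related :: "'x topology \<Rightarrow> 'y topology \<Rightarrow> ('x \<Rightarrow> 'y) \<Rightarrow> ('x \<Rightarrow> nat \<Rightarrow> real \<Rightarrow> real) \<Rightarrow>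
    ('x \<Rightarrow> nat \<Rightarrow> real \<Rightarrow> real) \<Rightarrow> bool" where
  "boxes_related X Y p c c' \<longleftrightarrow> (\<exists>C. box_embedding (cyl X) (cyl Y) (cylmap p) C \<and>
     (\<forall>x\<in>topspace X. C (0, x) = c x \<and> C (1, x) = c' x))"

lemma range_comp_subset: "range (f \<circ> g) \<subseteq> range f"
  by auto

lemma cyl_nbhd:
  assumes c: "box_embedding X Y p c" and z: "z \<in> topspace (cyl Y)"
  obtains U n where "openin (cyl Y) U" "z \<in> U"
    "\<And>x i. x \<in> topspace (cyl X) \<Longrightarrow> cylmap p x \<in> U \<Longrightarrow> n \<le> i \<Longrightarrow> c (snd x) i = id"
proof -
  have "snd z \<in> topspace Y" using z by (simp add: mem_Times_iff)
  from box_embedding_bound[OF c this] obtain U n where U: "openin Y U" "snd z \<in> U"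
    "\<And>x i. x \<in> topspace X \<Longrightarrow> p x \<in> U \<Longrightarrow> n \<le> i \<Longrightarrow> c x i = id" by metis
  show thesis
  proof (rule that[of "{0..1} \<times> U" n])
    show "openin (cyl Y) ({0..1} \<times> U)" using U(1) by (simp add: openin_prod_Times_iff)
    show "z \<in> {0..1} \<times> U" using U(2) z by (simp add: mem_Times_iff)
    fix x i assume "x \<in> topspace (cyl X)" "cylmap p x \<in> {0..1} \<times> U" "n \<le> i"
    then show "c (snd x) i = id" by (intro U(3)) (simp_all add: mem_Times_iff)
  qed
qed

lemma cyl_pair:
  assumes "x \<in> topspace (cyl X)" "x' \<in> topspace (cyl X)" "x \<noteq> x'" "cylmap p x = cylmap p x'"
  shows "fst x = fst x'" "snd x \<in> topspace X" "snd x' \<in> topspace X" "snd x \<noteq> snd x'" "p (snd x) = p (snd x')"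
  using assms by (simp_all add: prod_eq_iff mem_Times_iff)

lemma jcont_snd: "jcont X d \<Longrightarrow> jcont (cyl X) (\<lambda>z. d (snd z))"
  by (rule jcont_pullback[OF _ continuous_map_snd])

text \<open>A coordinate that separates two points survives at every time. Either it is still fully
  present at \<open>i\<close>, where composing with a second map only shrinks the image, or its copy
  is fully present at \<open>e i\<close>, whose old content is gone because
  \<open>i < e i\<close>.\<close>

lemma boxes_related_shift:
  assumes c: "box_embedding X Y p c" and e: "inj e" "\<And>k. k < e k"
  shows "boxes_related X Y p c (shift_boxes e c)"
proof -
  note D = box_embeddingD[OF c]
  define C where "C z j = mix (drop_wt j (fst z)) (c (snd z) j) \<circ>
     (if j \<in> range e then mix (gain_wt (inv_into UNIV e j) (fst z)) (c (snd z) (inv_into UNIV e j)) else id)" for z :: "real \<times> 'a" and j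
  have "box_embedding (cyl X) (cyl Y) (cylmap p) C"
  proof (rule box_embeddingI)
    fix z i assume z: "z \<in> topspace (cyl X)"
    then have zX: "snd z \<in> topspace X" by (simp add: mem_Times_iff)
    have A: "strict_mono (mix (drop_wt i (fst z)) (c (snd z) i))"
      by (rule strict_mono_mix[OF _ _ D(1)[OF zX]]) (simp_all add: drop_wt_def clamp01_bounds)
    have B: "strict_mono (mix (gain_wt k (fst z)) (c (snd z) k))" for k
      by (rule strict_mono_mix[OF _ _ D(1)[OF zX]]) (simp_all add: gain_wt_def clamp01_bounds)
    have "strict_mono (if i \<in> range e then mix (gain_wt (inv_into UNIV e i) (fst z)) (c (snd z) (inv_into UNIV e i)) else id)"
      using B strict_monoI[of "id :: real \<Rightarrow> real"] by simp
    then show "strict_mono (C z i)"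
      unfolding C_def by (rule strict_mono_comp[OF A])
  next
    fix i
    have 1: "jcont (cyl X) (\<lambda>z. mix (drop_wt i (fst z)) (c (snd z) i))"
      by (intro jcont_mix jcont_snd D(2) continuous_drop)
    have 2: "jcont (cyl X) (\<lambda>z. mix (gain_wt (inv_into UNIV e i) (fst z)) (c (snd z) (inv_into UNIV e i)))"
      by (intro jcont_mix jcont_snd D(2) continuous_gain)
    show "jcont (cyl X) (\<lambda>z. C z i)"
      unfolding C_def by (rule jcont_comp[OF 1]) (cases "i \<in> range e"; simp add: 2)
  next
    fix y assume "y \<in> topspace (cyl Y)"
    from cyl_nbhd[OF c this] obtain U n where U: "openin (cyl Y) U" "y \<in> U"
      "\<And>x i. x \<in> topspace (cyl X) \<Longrightarrow> cylmap p x \<in> U \<Longrightarrow> n \<le> i \<Longrightarrow> c (snd x) i = id" by metis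
    have "C x i = id" if "x \<in> topspace (cyl X)" "cylmap p x \<in> U" "n + (\<Sum>k<n. e k) + 1 \<le> i" for x i
    proof -
      have ci: "c (snd x) i = id" using that by (intro U(3)) auto
      have "shift_boxes e c (snd x) i = id"
        using that U(3)[OF that(1,2)] by (intro shift_boxes_bound[OF e(1), of n]) auto
      then show ?thesis unfolding C_def shift_boxes_def ci by (cases "i \<in> range e") simp_all
    qed
    then show "\<exists>U n. openin (cyl Y) U \<and> y \<in> U \<and> (\<forall>x\<in>topspace (cyl X). cylmap p x \<in> U \<longrightarrow> (\<forall>i\<ge>n. C x i = id))"
      using U(1,2) by (intro exI[of _ U] exI[of _ "n + (\<Sum>k<n. e k) + 1"]) blast
  next
    fix x x' assume x: "x \<in> topspace (cyl X)" "x' \<in> topspace (cyl X)" "x \<noteq> x'" "cylmap p x = cylmap p x'"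
    note P = cyl_pair[OF x]
    obtain i where i: "range (c (snd x) i) \<inter> range (c (snd x') i) = {}"
      using D(3)[OF P(2,3,4,5)] by blast
    show "\<exists>j. range (C x j) \<inter> range (C x' j) = {}"
    proof (cases "drop_wt i (fst x) = 1")
      case True
      then have "range (C x i) \<subseteq> range (c (snd x) i)" "range (C x' i) \<subseteq> range (c (snd x') i)"
        unfolding C_def using P(1) by (simp_all only: mix_1 range_comp_subset)
      with i show ?thesis by (intro exI[of _ i]) blast
    next
      case False
      then have g: "gain_wt i (fst x) = 1" using drop_gain by blast
      then have d: "drop_wt (e i) (fst x) = 0" using gain_drop e(2) by blast
      have "C x (e i) = c (snd x) i" "C x' (e i) = c (snd x') i"
        unfolding C_def using g d P(1)[symmetric] e(1) by simp_all
      with i show ?thesis by (intro exI[of _ "e i"]) simp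
    qed
  qed
  moreover have "C (0, x) = c x \<and> C (1, x) = shift_boxes e c x" for x
    by (auto simp: C_def fun_eq_iff drop_gain_ends shift_boxes_def)
  ultimately show ?thesis unfolding boxes_related_def by blast
qed

text \<open>As the two families use different coordinates, the second can be switched on during the
  first half of the time and the first switched off during the second half; at every moment one of
  them is complete.\<close>

lemma boxes_related_disjoint_shifts:
  assumes c: "box_embedding X Y p c" and c': "box_embedding X Y p c'"
    and e: "inj e" "inj e'" "range e \<inter> range e' = {}"
  shows "boxes_related X Y p (shift_boxes e c) (shift_boxes e' c')"
proof -
  note D = box_embeddingD[OF c] and D' = box_embeddingD[OF c']
  define a b where "a = (\<lambda>t::real. clamp01 (2 - 2 * t))" and "b = (\<lambda>t::real. clamp01 (2 * t))"
  have ab: "a t = 1 \<or> b t = 1" for t by (auto simp: a_def b_def clamp01_def)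
  have ca: "continuous_map (cyl X) euclideanreal (\<lambda>z. a (fst z))"
    and cb: "continuous_map (cyl X) euclideanreal (\<lambda>z. b (fst z))"
    unfolding a_def b_def by (intro continuous_map_cyl_time continuous_clamp01 continuous_intros)+
  define C where "C z j = mix (a (fst z)) (shift_boxes e c (snd z) j) \<circ>
     mix (b (fst z)) (shift_boxes e' c' (snd z) j)" for z :: "real \<times> 'a" and j
  have "box_embedding (cyl X) (cyl Y) (cylmap p) C"
  proof (rule box_embeddingI)
    fix z i assume z: "z \<in> topspace (cyl X)"
    then have zX: "snd z \<in> topspace X" by (simp add: mem_Times_iff)
    show "strict_mono (C z i)"
      unfolding C_def a_def b_def
      by (intro strict_mono_comp strict_mono_mix clamp01_bounds strict_mono_shift_boxes D(1) D'(1) zX)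
  next
    fix i
    show "jcont (cyl X) (\<lambda>z. C z i)"
      unfolding C_def by (intro jcont_comp jcont_mix ca cb jcont_snd jcont_shift_boxes D(2) D'(2))
  next
    fix y assume y: "y \<in> topspace (cyl Y)"
    from cyl_nbhd[OF c y] obtain U n where U: "openin (cyl Y) U" "y \<in> U"
      "\<And>x i. x \<in> topspace (cyl X) \<Longrightarrow> cylmap p x \<in> U \<Longrightarrow> n \<le> i \<Longrightarrow> c (snd x) i = id" by metis
    from cyl_nbhd[OF c' y] obtain U' n' where U': "openin (cyl Y) U'" "y \<in> U'"
      "\<And>x i. x \<in> topspace (cyl X) \<Longrightarrow> cylmap p x \<in> U' \<Longrightarrow> n' \<le> i \<Longrightarrow> c' (snd x) i = id" by metis
    have "C x i = id" if "x \<in> topspace (cyl X)" "cylmap p x \<in> U \<inter> U'" "(\<Sum>k<n. e k) + (\<Sum>k<n'. e' k) + 1 \<le> i" for x i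
    proof -
      have "shift_boxes e c (snd x) i = id"
        using that U(3)[OF that(1)] by (intro shift_boxes_bound[OF e(1), of n]) auto
      moreover have "shift_boxes e' c' (snd x) i = id"
        using that U'(3)[OF that(1)] by (intro shift_boxes_bound[OF e(2), of n']) auto
      ultimately show ?thesis unfolding C_def by simp
    qed
    then show "\<exists>U n. openin (cyl Y) U \<and> y \<in> U \<and> (\<forall>x\<in>topspace (cyl X). cylmap p x \<in> U \<longrightarrow> (\<forall>i\<ge>n. C x i = id))"
      using openin_Int[OF U(1) U'(1)] U(2) U'(2)
      by (intro exI[of _ "U \<inter> U'"] exI[of _ "(\<Sum>k<n. e k) + (\<Sum>k<n'. e' k) + 1"]) blast
  next
    fix x x' assume x: "x \<in> topspace (cyl X)" "x' \<in> topspace (cyl X)" "x \<noteq> x'" "cylmap p x = cylmap p x'"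
    note P = cyl_pair[OF x]
    obtain i where i: "range (c (snd x) i) \<inter> range (c (snd x') i) = {}"
      using D(3)[OF P(2,3,4,5)] by blast
    obtain i' where i': "range (c' (snd x) i') \<inter> range (c' (snd x') i') = {}"
      using D'(3)[OF P(2,3,4,5)] by blast
    have n1: "shift_boxes e' c' w (e i) = id" for w
      using e(3) by (auto simp: shift_boxes_def)
    have n2: "shift_boxes e c w (e' i') = id" for w
      using e(3) by (auto simp: shift_boxes_def)
    show "\<exists>j. range (C x j) \<inter> range (C x' j) = {}"
    proof (cases "a (fst x) = 1")
      case True
      then have "C x (e i) = c (snd x) i" "C x' (e i) = c (snd x') i"
        unfolding C_def n1 using P(1)[symmetric] by (simp_all add: shift_boxes_at[OF e(1)])
      with i show ?thesis by (intro exI[of _ "e i"]) simp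
    next
      case False
      then have "b (fst x) = 1" using ab by blast
      then have "C x (e' i') = c' (snd x) i'" "C x' (e' i') = c' (snd x') i'"
        unfolding C_def n2 using P(1)[symmetric] by (simp_all add: shift_boxes_at[OF e(2)])
      with i' show ?thesis by (intro exI[of _ "e' i'"]) simp
    qed
  qed
  moreover have "C (0, x) = shift_boxes e c x \<and> C (1, x) = shift_boxes e' c' x" for x
    by (auto simp: C_def fun_eq_iff a_def b_def clamp01_def)
  ultimately show ?thesis unfolding boxes_related_def by blast
qed

lemma box_embedding_slice:
  assumes C: "box_embedding (cyl X) (cyl Y) (cylmap p) C" and t: "t \<in> {0..1}"
  shows "box_embedding X Y p (\<lambda>x. C (t, x))"
proof (rule box_embeddingI)
  note D = box_embeddingD[OF C]
  fix x i assume "x \<in> topspace X" then show "strict_mono (C (t, x) i)" using t by (intro D(1)) simp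
next
  note D = box_embeddingD[OF C]
  have "continuous_map X (cyl X) (Pair t)" using t by (simp add: continuous_map_pairwise o_def)
  then show "jcont X (\<lambda>x. C (t, x) i)" for i by (rule jcont_pullback[OF D(2)])
next
  fix y assume y: "y \<in> topspace Y"
  then have ty: "(t, y) \<in> topspace (cyl Y)" using t by simp
  obtain U n where U: "openin (cyl Y) U" "(t, y) \<in> U"
    "\<And>x i. x \<in> topspace (cyl X) \<Longrightarrow> cylmap p x \<in> U \<Longrightarrow> n \<le> i \<Longrightarrow> C x i = id"
    using box_embedding_bound[OF C ty] by metis
  have ct: "continuous_map Y (cyl Y) (Pair t)" using t by (simp add: continuous_map_pairwise o_def)
  have o: "openin Y {u \<in> topspace Y. (t, u) \<in> U}"
    by (rule openin_continuous_map_preimage[OF ct U(1)])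
  have "C (t, x) i = id" if "x \<in> topspace X" "p x \<in> {u \<in> topspace Y. (t, u) \<in> U}" "n \<le> i" for x i
    using that t by (intro U(3)) auto
  then show "\<exists>U n. openin Y U \<and> y \<in> U \<and> (\<forall>x\<in>topspace X. p x \<in> U \<longrightarrow> (\<forall>i\<ge>n. C (t, x) i = id))"
    using o y U(2) by (intro exI[of _ "{u \<in> topspace Y. (t, u) \<in> U}"] exI[of _ n]) blast
next
  note D = box_embeddingD[OF C]
  fix x x' assume "x \<in> topspace X" "x' \<in> topspace X" "x \<noteq> x'" "p x = p x'"
  then show "\<exists>i. range (C (t, x) i) \<inter> range (C (t, x') i) = {}"
    using t by (intro D(3)) auto
qed

lemma box_embedding_const:
  assumes c: "box_embedding X Y p c"
  shows "box_embedding (cyl X) (cyl Y) (cylmap p) (\<lambda>z. c (snd z))"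
proof (rule box_embeddingI)
  note D = box_embeddingD[OF c]
  show "strict_mono (c (snd x) i)" if "x \<in> topspace (cyl X)" for x i
    using that by (intro D(1)) (simp add: mem_Times_iff)
  show "jcont (cyl X) (\<lambda>x. c (snd x) i)" for i by (rule jcont_snd[OF D(2)])
  show "\<exists>i. range (c (snd x) i) \<inter> range (c (snd x') i) = {}"
    if "x \<in> topspace (cyl X)" "x' \<in> topspace (cyl X)" "x \<noteq> x'" "cylmap p x = cylmap p x'" for x x'
    using cyl_pair[OF that] by (intro D(3))
  fix y assume "y \<in> topspace (cyl Y)"
  from cyl_nbhd[OF c this] obtain U n where U: "openin (cyl Y) U" "y \<in> U"
    "\<And>x i. x \<in> topspace (cyl X) \<Longrightarrow> cylmap p x \<in> U \<Longrightarrow> n \<le> i \<Longrightarrow> c (snd x) i = id" by metis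
  then show "\<exists>U n. openin (cyl Y) U \<and> y \<in> U \<and> (\<forall>x\<in>topspace (cyl X). cylmap p x \<in> U \<longrightarrow> (\<forall>i\<ge>n. c (snd x) i = id))"
    by (intro exI[of _ U] exI[of _ n]) blast
qed

lemma box_embedding_cong:
  assumes "box_embedding X Y p c" "\<And>x. x \<in> topspace X \<Longrightarrow> c x = c' x" "\<And>x. x \<in> topspace X \<Longrightarrow> p x = p' x"
  shows "box_embedding X Y p' c'"
proof (rule box_embeddingI)
  note D = box_embeddingD[OF assms(1)]
  show "strict_mono (c' x i)" if "x \<in> topspace X" for x i using D(1)[OF that] assms(2)[OF that] by simp
  show "jcont X (\<lambda>x. c' x i)" for i
    using D(2)[of i] unfolding jcont_def by (rule continuous_map_eq) (auto simp: assms(2))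
  show "\<exists>i. range (c' x i) \<inter> range (c' x' i) = {}"
    if "x \<in> topspace X" "x' \<in> topspace X" "x \<noteq> x'" "p' x = p' x'" for x x'
    using D(3)[OF that(1-3)] that assms(2,3) by simp
  fix y assume "y \<in> topspace Y"
  from box_embedding_bound[OF assms(1) this] obtain U n where "openin Y U" "y \<in> U"
    "\<And>x i. x \<in> topspace X \<Longrightarrow> p x \<in> U \<Longrightarrow> n \<le> i \<Longrightarrow> c x i = id" by metis
  then show "\<exists>U n. openin Y U \<and> y \<in> U \<and> (\<forall>x\<in>topspace X. p' x \<in> U \<longrightarrow> (\<forall>i\<ge>n. c' x i = id))"
    using assms(2,3) by (intro exI[of _ U] exI[of _ n]) simp
qed

section \<open>Transfers are well defined on homotopy classes\<close>

lemma box_sum_reindex: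
  "box_sum E n (h ` I) c f e \<longleftrightarrow> box_sum E n I (\<lambda>x. c (h x)) (\<lambda>x. f (h x)) e"
  unfolding box_sum_def by simp

lemma htpy_class_eq:
  assumes "homotopic_with (\<lambda>_. True) X (zspace E) f g"
  shows "htpy_class E X f = htpy_class E X g"
proof (rule Set.set_eqI)
  fix h show "h \<in> htpy_class E X f \<longleftrightarrow> h \<in> htpy_class E X g"
    using assms homotopic_with_trans[of "\<lambda>_. True" X "zspace E"] homotopic_with_sym[of "\<lambda>_. True" X "zspace E"]
    unfolding mem_Collect_eq by metis
qed

lemma in_htpy_class: "continuous_map X (zspace E) f \<Longrightarrow> f \<in> htpy_class E X f"
  by simp

lemma htpy_class_cong:
  assumes "continuous_map X (zspace E) f" "\<And>x. x \<in> topspace X \<Longrightarrow> f x = g x"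
  shows "htpy_class E X f = htpy_class E X g"
  by (rule htpy_class_eq, rule homotopic_with_equal) (use assms in simp_all)

lemma carrier_coh: "carrier (coh E \<xi> X) = {htpy_class E X f | f. continuous_map X (zspace E) f}"
  by (simp add: coh_def)

lemma pt_map_slice:
  assumes h: "pt_map E (cyl X) (cyl Y) (cylmap p) C F h" and t: "t \<in> {0..1}"
  shows "pt_map E X Y p (\<lambda>x. C (t, x)) (\<lambda>x. F (t, x)) (\<lambda>y. h (t, y))"
  unfolding pt_map_def
proof (intro ballI allI impI)
  fix y n assume y: "y \<in> topspace Y" and n: "\<forall>x\<in>topspace X. p x = y \<longrightarrow> (\<forall>i\<ge>n. C (t, x) i = id)"
  have fib: "{z \<in> topspace (cyl X). cylmap p z = (t, y)} = Pair t ` {x \<in> topspace X. p x = y}"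
  proof (intro equalityI subsetI)
    fix z assume z: "z \<in> {z \<in> topspace (cyl X). cylmap p z = (t, y)}"
    then have "fst z = t" "snd z \<in> topspace X" "p (snd z) = y" by (simp_all add: mem_Times_iff)
    then show "z \<in> Pair t ` {x \<in> topspace X. p x = y}"
      by (intro image_eqI[of _ _ "snd z"]) (simp_all add: prod_eq_iff)
  next
    fix z assume "z \<in> Pair t ` {x \<in> topspace X. p x = y}"
    then obtain x where "z = (t, x)" "x \<in> topspace X" "p x = y" by blast
    then show "z \<in> {z \<in> topspace (cyl X). cylmap p z = (t, y)}" using t by simp
  qed
  have valid: "\<forall>z\<in>topspace (cyl X). cylmap p z = (t, y) \<longrightarrow> (\<forall>i\<ge>n. C z i = id)"
  proof (intro ballI impI)
    fix z assume "z \<in> topspace (cyl X)" "cylmap p z = (t, y)"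
    then have "z \<in> {z \<in> topspace (cyl X). cylmap p z = (t, y)}" by (intro CollectI conjI)
    then have "z \<in> Pair t ` {x \<in> topspace X. p x = y}" unfolding fib .
    then obtain x where "z = (t, x)" "x \<in> topspace X" "p x = y" by blast
    then show "\<forall>i\<ge>n. C z i = id" using n by simp
  qed
  have "(t, y) \<in> topspace (cyl Y)" using t y by simp
  then have "box_sum E n {z \<in> topspace (cyl X). cylmap p z = (t, y)} C F (h (t, y))"
    using h valid unfolding pt_map_def by simp
  then show "box_sum E n {x \<in> topspace X. p x = y} (\<lambda>x. C (t, x)) (\<lambda>x. F (t, x)) (h (t, y))"
    unfolding fib box_sum_reindex .
qed

lemma pt_map_cong:
  assumes "\<And>x. x \<in> topspace X \<Longrightarrow> c x = c' x" "\<And>x. x \<in> topspace X \<Longrightarrow> f x = f' x"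
    "\<And>x. x \<in> topspace X \<Longrightarrow> p x = p' x"
  shows "pt_map E X Y p c f g \<longleftrightarrow> pt_map E X Y p' c' f' g"
proof -
  have fib: "{x \<in> topspace X. p x = y} = {x \<in> topspace X. p' x = y}" for y
    using assms(3) by (intro Collect_cong) (simp cong: conj_cong)
  have "box_sum E n {x \<in> topspace X. p' x = y} c f e \<longleftrightarrow> box_sum E n {x \<in> topspace X. p' x = y} c' f' e" for n y e
    by (rule box_sum_cong) (simp_all add: assms)
  then show ?thesis unfolding pt_map_def fib using assms by (simp cong: ball_cong)
qed

lemma transfer_along_cong:
  assumes "\<And>x. x \<in> topspace X \<Longrightarrow> p x = p' x"
  shows "transfer_along E X Y p a = transfer_along E X Y p' a"
proof -
  have b: "box_embedding X Y p = box_embedding X Y p'"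
    using box_embedding_cong[of X Y p _ _ p'] box_embedding_cong[of X Y p' _ _ p] assms by (intro ext) metis
  have pt: "pt_map E X Y p = pt_map E X Y p'"
    by (intro ext, rule pt_map_cong) (simp_all add: assms)
  show ?thesis unfolding transfer_along_pt_map b pt ..
qed

context spectrum_loc
begin

text \<open>Running the construction over the cylinder produces a homotopy, whose ends are the given
  maps by uniqueness.\<close>

lemma pt_homotopic:
  assumes cov: "finite_cover X Y p" and k: "locally_k (cyl Y)"
    and C: "box_embedding (cyl X) (cyl Y) (cylmap p) C"
    and F: "continuous_map (cyl X) (zspace E) F"
    and g0: "pt_map E X Y p (\<lambda>x. C (0, x)) (\<lambda>x. F (0, x)) g0"
    and g1: "pt_map E X Y p (\<lambda>x. C (1, x)) (\<lambda>x. F (1, x)) g1"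
  shows "homotopic_with (\<lambda>_. True) Y (zspace E) g0 g1"
proof -
  obtain h where h: "continuous_map (cyl Y) (zspace E) h" "pt_map E (cyl X) (cyl Y) (cylmap p) C F h"
    using pt_exists[OF finite_cover_cyl[OF cov] k C F] by blast
  have 0: "h (0, y) = g0 y" if "y \<in> topspace Y" for y
    by (rule pt_map_unique[OF box_embedding_slice[OF C] pt_map_slice[OF h(2)] g0 that]) simp_all
  have 1: "h (1, y) = g1 y" if "y \<in> topspace Y" for y
    by (rule pt_map_unique[OF box_embedding_slice[OF C] pt_map_slice[OF h(2)] g1 that]) simp_all
  show ?thesis
    by (subst homotopic_with) (use h(1) 0 1 in auto)
qed

lemma pt_homotopic_related:
  assumes cov: "finite_cover X Y p" and k: "locally_k (cyl Y)"
    and r: "boxes_related X Y p c c'" and f: "continuous_map X (zspace E) f"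
    and g: "pt_map E X Y p c f g" and g': "pt_map E X Y p c' f g'"
  shows "homotopic_with (\<lambda>_. True) Y (zspace E) g g'"
proof -
  obtain C where C: "box_embedding (cyl X) (cyl Y) (cylmap p) C"
    "\<forall>x\<in>topspace X. C (0, x) = c x \<and> C (1, x) = c' x"
    using r unfolding boxes_related_def by blast
  have F: "continuous_map (cyl X) (zspace E) (\<lambda>z. f (snd z))"
    using continuous_map_compose[OF continuous_map_snd f] by (simp add: o_def)
  show ?thesis
  proof (rule pt_homotopic[OF cov k C(1) F])
    show "pt_map E X Y p (\<lambda>x. C (0, x)) (\<lambda>x. f (snd (0, x))) g"
      using g by (subst pt_map_cong[where c'=c and f'=f and p'=p]) (simp_all add: C(2))
    show "pt_map E X Y p (\<lambda>x. C (1, x)) (\<lambda>x. f (snd (1, x))) g'"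
      using g' by (subst pt_map_cong[where c'=c' and f'=f and p'=p]) (simp_all add: C(2))
  qed
qed

lemma pt_homotopic_class:
  assumes cov: "finite_cover X Y p" and k: "locally_k (cyl Y)"
    and c: "box_embedding X Y p c" and f: "homotopic_with (\<lambda>_. True) X (zspace E) f f'"
    and g: "pt_map E X Y p c f g" and g': "pt_map E X Y p c f' g'"
  shows "homotopic_with (\<lambda>_. True) Y (zspace E) g g'"
proof -
  obtain F where F: "continuous_map (cyl X) (zspace E) F" "\<forall>x. F (0, x) = f x" "\<forall>x. F (1, x) = f' x"
    using f unfolding homotopic_with_def by blast
  show ?thesis
    by (rule pt_homotopic[OF cov k box_embedding_const[OF c] F(1)]) (simp_all add: F(2,3) g g')
qed

lemma related_box_embedding:
  assumes "boxes_related X Y p c c'"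
  shows "box_embedding X Y p c'"
proof -
  obtain C where C: "box_embedding (cyl X) (cyl Y) (cylmap p) C"
    "\<forall>x\<in>topspace X. C (0, x) = c x \<and> C (1, x) = c' x"
    using assms unfolding boxes_related_def by blast
  show ?thesis
    by (rule box_embedding_cong[OF box_embedding_slice[OF C(1), of 1]]) (simp_all add: C(2))
qed

text \<open>Any two box embeddings are homotopic: move one to the odd and the other to the even coordinates.\<close>

lemma pt_homotopic_boxes:
  assumes cov: "finite_cover X Y p" and k: "locally_k Y" "locally_k (cyl Y)"
    and c: "box_embedding X Y p c" and c': "box_embedding X Y p c'"
    and f: "continuous_map X (zspace E) f"
    and g: "pt_map E X Y p c f g" and g': "pt_map E X Y p c' f g'"
  shows "homotopic_with (\<lambda>_. True) Y (zspace E) g g'"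
proof -
  let ?e = "\<lambda>k::nat. 2 * k + 1" and ?e' = "\<lambda>k::nat. 2 * k + 2"
  have inj: "inj ?e" "inj ?e'" by (simp_all add: inj_on_def)
  have disj: "range ?e \<inter> range ?e' = {}"
  proof -
    have "(2 * k + 1 :: nat) \<noteq> 2 * l + 2" for k l by presburger
    then show ?thesis by blast
  qed
  have r1: "boxes_related X Y p c (shift_boxes ?e c)" by (rule boxes_related_shift[OF c inj(1)]) simp
  have r2: "boxes_related X Y p c' (shift_boxes ?e' c')" by (rule boxes_related_shift[OF c' inj(2)]) simp
  have r3: "boxes_related X Y p (shift_boxes ?e c) (shift_boxes ?e' c')"
    by (rule boxes_related_disjoint_shifts[OF c c' inj disj])
  obtain g1 where g1: "pt_map E X Y p (shift_boxes ?e c) f g1"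
    using pt_exists[OF cov k(1) related_box_embedding[OF r1] f] by blast
  obtain g2 where g2: "pt_map E X Y p (shift_boxes ?e' c') f g2"
    using pt_exists[OF cov k(1) related_box_embedding[OF r2] f] by blast
  have h1: "homotopic_with (\<lambda>_. True) Y (zspace E) g g1" by (rule pt_homotopic_related[OF cov k(2) r1 f g g1])
  have h2: "homotopic_with (\<lambda>_. True) Y (zspace E) g1 g2" by (rule pt_homotopic_related[OF cov k(2) r3 f g1 g2])
  have h3: "homotopic_with (\<lambda>_. True) Y (zspace E) g2 g'"
    using pt_homotopic_related[OF cov k(2) r2 f g' g2] by (rule homotopic_with_symD)
  show ?thesis
    by (rule homotopic_with_trans[OF homotopic_with_trans[OF h1 h2] h3])
qed

text \<open>Every other representative and every other box embedding gives a homotopic map, so all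
  members of the union coincide, while the data \<open>c\<close>, \<open>f\<close>, \<open>g\<close>
  show that the union is not empty. All later transfers are evaluated by this rule.\<close>

lemma transfer_eq:
  assumes cov: "finite_cover X Y p" and k: "locally_k Y" "locally_k (cyl Y)"
    and c: "box_embedding X Y p c" and f: "continuous_map X (zspace E) f"
    and g: "pt_map E X Y p c f g"
  shows "transfer_along E X Y p (htpy_class E X f) = htpy_class E Y g"
proof -
  have key: "htpy_class E Y g' = htpy_class E Y g"
    if f': "f' \<in> htpy_class E X f" and c': "box_embedding X Y p c'" and g': "pt_map E X Y p c' f' g'" for f' c' g'
  proof -
    have ff: "homotopic_with (\<lambda>_. True) X (zspace E) f f'" using f' by simp
    then have f'c: "continuous_map X (zspace E) f'" using homotopic_with_imp_continuous_maps by blast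
    obtain g1 where g1: "pt_map E X Y p c f' g1" using pt_exists[OF cov k(1) c f'c] by blast
    have h1: "homotopic_with (\<lambda>_. True) Y (zspace E) g g1" by (rule pt_homotopic_class[OF cov k(2) c ff g g1])
    have h2: "homotopic_with (\<lambda>_. True) Y (zspace E) g1 g'" by (rule pt_homotopic_boxes[OF cov k c c' f'c g1 g'])
    show ?thesis by (rule htpy_class_eq[OF homotopic_with_trans[OF h1 h2], symmetric])
  qed
  have sub: "transfer_along E X Y p (htpy_class E X f) \<subseteq> htpy_class E Y g"
    unfolding transfer_along_pt_map
  proof (intro UN_least)
    fix f' c' g'
    assume a: "f' \<in> htpy_class E X f" "c' \<in> Collect (box_embedding X Y p)" "g' \<in> {g. pt_map E X Y p c' f' g}"
    have "htpy_class E Y g' = htpy_class E Y g"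
      by (rule key[OF a(1)]) (use a(2,3) in simp_all)
    then show "htpy_class E Y g' \<subseteq> htpy_class E Y g" by (rule equalityD1)
  qed
  have "htpy_class E Y g \<subseteq> transfer_along E X Y p (htpy_class E X f)"
    unfolding transfer_along_pt_map
  proof
    fix h assume h: "h \<in> htpy_class E Y g"
    show "h \<in> (\<Union>f\<in>htpy_class E X f. \<Union>c\<in>Collect (box_embedding X Y p). \<Union>g\<in>{g. pt_map E X Y p c f g}. htpy_class E Y g)"
      by (rule UN_I[of f], rule in_htpy_class[OF f], rule UN_I[of c], simp add: c, rule UN_I[of g], simp add: g, rule h)
  qed
  with sub show ?thesis by blast
qed

lemma transfer_carrier:
  assumes cov: "finite_cover X Y p" and k: "locally_k Y" "locally_k (cyl Y)"
    and c: "box_embedding X Y p c" and a: "a \<in> carrier (coh E \<xi> X)"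
  shows "transfer_along E X Y p a \<in> carrier (coh E \<xi> Y)"
proof -
  obtain f where f: "a = htpy_class E X f" "continuous_map X (zspace E) f"
    using a unfolding carrier_coh by blast
  obtain g where g: "continuous_map Y (zspace E) g" "pt_map E X Y p c f g"
    using pt_exists[OF cov k(1) c f(2)] by blast
  show ?thesis unfolding f(1) transfer_eq[OF cov k c f(2) g(2)] carrier_coh using g(1) by blast
qed

lemma transfer_zero:
  assumes cov: "finite_cover X Y p" and k: "locally_k Y" "locally_k (cyl Y)"
    and c: "box_embedding X Y p c"
  shows "transfer_along E X Y p \<zero>\<^bsub>coh E \<xi> X\<^esub> = \<zero>\<^bsub>coh E \<xi> Y\<^esub>"
proof -
  have f: "continuous_map X (zspace E) (\<lambda>x. b0)" by simp
  have "pt_map E X Y p c (\<lambda>x. b0) (\<lambda>y. b0)"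
  proof (rule pt_mapI)
    fix y assume "y \<in> topspace Y"
    then obtain U n where Un: "openin Y U" "y \<in> U"
      "\<And>x i. x \<in> topspace X \<Longrightarrow> p x \<in> U \<Longrightarrow> n \<le> i \<Longrightarrow> c x i = id"
      using box_embedding_bound[OF c] by metis
    have valid: "\<forall>x\<in>topspace X. p x = y \<longrightarrow> (\<forall>i\<ge>n. c x i = id)" using Un(2,3) by blast
    have "box_sum E n {x \<in> topspace X. p x = y} c (\<lambda>x. b0) b0"
    proof (rule box_sumI)
      fix x w assume x: "x \<in> {x \<in> topspace X. p x = y}" and w: "w \<in> coord_space n"
      have "box_point (c x) w \<in> coord_space n"
        using x valid w by (intro box_point_in_coord) auto
      then show "sm n (Some (box_point (c x) w)) b0 = sm n (Some w) b0"
        using w by (simp add: sm_b0)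
    qed (simp_all add: sm_b0)
    then show "\<exists>n. (\<forall>x\<in>topspace X. p x = y \<longrightarrow> (\<forall>i\<ge>n. c x i = id)) \<and>
       box_sum E n {x \<in> topspace X. p x = y} c (\<lambda>x. b0) b0" using valid by blast
  qed simp
  from transfer_eq[OF cov k c f this] show ?thesis by (simp add: coh_def)
qed

end

section \<open>Addition as a transfer along the trivial double cover\<close>

lemma continuous_map_prod_discrete:
  assumes "\<And>b. b \<in> D \<Longrightarrow> continuous_map Y Z (\<lambda>y. f (y, b))"
  shows "continuous_map (prod_topology Y (discrete_topology D)) Z f"
proof (rule pasting_lemma[where I=D and T="\<lambda>b. topspace Y \<times> {b}" and f="\<lambda>_. f"])
  fix b assume b: "b \<in> D"
  show "openin (prod_topology Y (discrete_topology D)) (topspace Y \<times> {b})"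
    using b by (simp add: openin_prod_Times_iff)
  have "continuous_map (subtopology (prod_topology Y (discrete_topology D)) (topspace Y \<times> {b})) Y fst"
    by (intro continuous_map_from_subtopology continuous_map_fst)
  from continuous_map_compose[OF this assms[OF b]]
  show "continuous_map (subtopology (prod_topology Y (discrete_topology D)) (topspace Y \<times> {b})) Z f"
    by (rule continuous_map_eq) (metis IntD2 comp_apply mem_Times_iff prod.collapse singletonD topspace_subtopology)
qed (simp_all add: mem_Times_iff)

lemma strict_mono_halves: "strict_mono (halves b i)"
  by (rule strict_monoI) (simp add: halves_def)

lemma halves_id: "1 \<le> i \<Longrightarrow> halves b i = id"
  by (simp add: halves_def fun_eq_iff)

lemma halves_disjoint:
  assumes "b \<noteq> b'"
  shows "range (halves b 0) \<inter> range (halves b' 0) = {}"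
proof -
  have sign: "0 < halves b 0 s \<longleftrightarrow> b" for b s
    using exp_gt_zero[of "- s"] by (simp add: halves_def)
  have "halves b 0 s \<noteq> halves b' 0 t" for s t
    using sign[of b s] sign[of b' t] assms by metis
  then show ?thesis by blast
qed

abbreviation double :: "'y topology \<Rightarrow> ('y \<times> bool) topology" where
  "double Y \<equiv> prod_topology Y (discrete_topology UNIV)"

lemma jcont_halves: "jcont (double Y) (\<lambda>z. halves (snd z) i)"
proof (cases "i = 0")
  case True
  let ?P = "prod_topology (double Y) euclideanreal"
  \<comment> \<open>The choice of half is written as a combination with coefficient 0 or 1, which is
    visibly continuous in both variables together.\<close>
  have "continuous_map (discrete_topology UNIV) euclideanreal (\<lambda>b. if b then 1 else 0)" by simp
  from continuous_map_compose[OF continuous_map_compose[OF continuous_map_fst continuous_map_snd] this]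
  have a: "continuous_map ?P euclideanreal (\<lambda>z. if snd (fst z) then 1 else 0)" by (simp add: o_def)
  have e: "continuous_map euclideanreal euclideanreal (\<lambda>s. exp s :: real)"
    "continuous_map euclideanreal euclideanreal (\<lambda>s. - exp (- s) :: real)"
    by (simp_all add: continuous_intros)
  have e1: "continuous_map ?P euclideanreal (\<lambda>z. exp (snd z))"
    using continuous_map_compose[OF continuous_map_snd e(1)] by (simp add: o_def)
  have e2: "continuous_map ?P euclideanreal (\<lambda>z. - exp (- snd z))"
    using continuous_map_compose[OF continuous_map_snd e(2)] by (simp add: o_def)
  have "continuous_map ?P euclideanreal (\<lambda>z. (if snd (fst z) then 1 else 0) * exp (snd z) +
      (1 - (if snd (fst z) then 1 else 0)) * (- exp (- snd z)))"
    by (intro continuous_map_add continuous_map_real_mult continuous_map_diff a e1 e2) simp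
  then show ?thesis unfolding jcont_def
    by (rule continuous_map_eq) (simp add: halves_def True case_prod_unfold)
next
  case False
  then have "halves b i = id" for b by (intro halves_id) simp
  then show ?thesis by simp
qed

lemma finite_cover_double: "finite_cover (double Y) Y fst"
  unfolding finite_cover_def
proof (intro conjI ballI)
  show "continuous_map (double Y) Y fst" by (rule continuous_map_fst)
  fix y assume y: "y \<in> topspace Y"
  have "evenly_covered (double Y) Y fst (topspace Y) (range (\<lambda>b y. (y, b)))"
  proof (rule evenly_coveredI)
    fix s :: "'a \<Rightarrow> 'a \<times> bool" assume "s \<in> range (\<lambda>b y. (y, b))"
    then obtain b where s: "s = (\<lambda>y. (y, b))" by blast
    show "continuous_map (subtopology Y (topspace Y)) (double Y) s"
      unfolding s by (simp add: continuous_map_pairwise o_def)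
    have "s ` topspace Y = topspace Y \<times> {b}" unfolding s by blast
    then show "openin (double Y) (s ` topspace Y)" by (simp add: openin_prod_Times_iff)
    show "fst (s u) = u" for u unfolding s by simp
    fix s' u assume "s' \<in> range (\<lambda>b y. (y, b))" and eq: "s u = s' u"
    then obtain b' where "s' = (\<lambda>y. (y, b'))" by blast
    then show "s = s'" using eq s by simp
  next
    fix x :: "'a \<times> bool"
    show "\<exists>s\<in>range (\<lambda>b y. (y, b)). x = s (fst x)"
      by (rule bexI[of _ "\<lambda>y. (y, snd x)"]) simp_all
  qed simp_all
  with y show "\<exists>U S. y \<in> U \<and> evenly_covered (double Y) Y fst U S" by (intro exI conjI)
qed

lemma box_embedding_double: "box_embedding (double Y) Y fst (\<lambda>z. halves (snd z))"
proof (rule box_embeddingI)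
  show "\<exists>U n. openin Y U \<and> y \<in> U \<and> (\<forall>x\<in>topspace (double Y). fst x \<in> U \<longrightarrow> (\<forall>i\<ge>n. halves (snd x) i = id))"
    if "y \<in> topspace Y" for y
    using that halves_id by (intro exI[of _ "topspace Y"] exI[of _ 1]) simp
  show "\<exists>i. range (halves (snd x) i) \<inter> range (halves (snd x') i) = {}"
    if "x \<noteq> x'" "fst x = fst x'" for x x' :: "'a \<times> bool"
    using halves_disjoint[of "snd x" "snd x'"] that by (intro exI[of _ 0]) (simp add: prod_eq_iff)
qed (simp_all add: strict_mono_halves jcont_halves)

context spectrum_loc
begin

text \<open>The defining condition of addition in \<open>coh\<close> is the Pontryagin-Thom
  condition for the projection of two copies of \<open>Y\<close>, with \<open>halves\<close> as
  boxes.\<close>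

lemma pt_map_double:
  assumes "\<And>y. y \<in> topspace Y \<Longrightarrow> g1 y \<in> topspace (zspace E)" "\<And>y. y \<in> topspace Y \<Longrightarrow> g2 y \<in> topspace (zspace E)"
  shows "pt_map E (double Y) Y fst (\<lambda>z. halves (snd z)) (\<lambda>z. if snd z then g2 (fst z) else g1 (fst z)) s \<longleftrightarrow>
    (\<forall>y\<in>topspace Y. box_sum E 1 UNIV halves (\<lambda>p. if p then g2 y else g1 y) (s y))"
proof -
  have fib: "{z \<in> topspace (double Y). fst z = y} = Pair y ` UNIV" if "y \<in> topspace Y" for y
    using that by force
  have eq: "box_sum E n {z \<in> topspace (double Y). fst z = y} (\<lambda>z. halves (snd z)) (\<lambda>z. if snd z then g2 (fst z) else g1 (fst z)) e
    \<longleftrightarrow> box_sum E n UNIV halves (\<lambda>p. if p then g2 y else g1 y) e" if "y \<in> topspace Y" for n y e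
    unfolding fib[OF that] box_sum_reindex by (simp only: fst_conv snd_conv)
  show ?thesis
  proof
    assume h: "pt_map E (double Y) Y fst (\<lambda>z. halves (snd z)) (\<lambda>z. if snd z then g2 (fst z) else g1 (fst z)) s"
    show "\<forall>y\<in>topspace Y. box_sum E 1 UNIV halves (\<lambda>p. if p then g2 y else g1 y) (s y)"
    proof
      fix y assume y: "y \<in> topspace Y"
      have v: "\<forall>x\<in>topspace (double Y). fst x = y \<longrightarrow> (\<forall>i\<ge>1. halves (snd x) i = id)"
        by (intro ballI impI allI halves_id)
      show "box_sum E 1 UNIV halves (\<lambda>p. if p then g2 y else g1 y) (s y)"
        unfolding eq[OF y, symmetric] by (rule h[unfolded pt_map_def, THEN bspec, OF y, THEN spec, THEN mp, OF v])
    qed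
  next
    assume h: "\<forall>y\<in>topspace Y. box_sum E 1 UNIV halves (\<lambda>p. if p then g2 y else g1 y) (s y)"
    show "pt_map E (double Y) Y fst (\<lambda>z. halves (snd z)) (\<lambda>z. if snd z then g2 (fst z) else g1 (fst z)) s"
    proof (rule pt_mapI)
      show "(if snd x then g2 (fst x) else g1 (fst x)) \<in> topspace (zspace E)" if "x \<in> topspace (double Y)" for x
        using that assms by (simp add: mem_Times_iff)
      fix y assume y: "y \<in> topspace Y"
      have "\<forall>x\<in>topspace (double Y). fst x = y \<longrightarrow> (\<forall>i\<ge>1. halves (snd x) i = id)"
        by (intro ballI impI allI halves_id)
      moreover have "box_sum E 1 {z \<in> topspace (double Y). fst z = y} (\<lambda>z. halves (snd z))
          (\<lambda>z. if snd z then g2 (fst z) else g1 (fst z)) (s y)"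
        unfolding eq[OF y] using h y by blast
      ultimately show "\<exists>n. (\<forall>x\<in>topspace (double Y). fst x = y \<longrightarrow> (\<forall>i\<ge>n. halves (snd x) i = id)) \<and>
         box_sum E n {z \<in> topspace (double Y). fst z = y} (\<lambda>z. halves (snd z))
          (\<lambda>z. if snd z then g2 (fst z) else g1 (fst z)) (s y)"
        by (intro exI conjI)
    qed
  qed
qed

lemma continuous_double:
  assumes "continuous_map Y Z g1" "continuous_map Y Z g2"
  shows "continuous_map (double Y) Z (\<lambda>z. if snd z then g2 (fst z) else g1 (fst z))"
proof (rule continuous_map_prod_discrete)
  fix b show "continuous_map Y Z (\<lambda>y. if snd (y, b) then g2 (fst (y, b)) else g1 (fst (y, b)))"
    using assms by (cases b) simp_all
qed

lemma homotopic_double: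
  assumes "homotopic_with (\<lambda>_. True) Y Z g1 f1" "homotopic_with (\<lambda>_. True) Y Z g2 f2"
  shows "homotopic_with (\<lambda>_. True) (double Y) Z (\<lambda>z. if snd z then g2 (fst z) else g1 (fst z))
     (\<lambda>z. if snd z then f2 (fst z) else f1 (fst z))"
proof -
  obtain h1 where h1: "continuous_map (cyl Y) Z h1" "\<forall>x. h1 (0, x) = g1 x" "\<forall>x. h1 (1, x) = f1 x"
    using assms(1) unfolding homotopic_with_def by blast
  obtain h2 where h2: "continuous_map (cyl Y) Z h2" "\<forall>x. h2 (0, x) = g2 x" "\<forall>x. h2 (1, x) = f2 x"
    using assms(2) unfolding homotopic_with_def by blast
  have a: "continuous_map (cyl (double Y)) (double (cyl Y)) (\<lambda>z. ((fst z, fst (snd z)), snd (snd z)))"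
  proof -
    have s: "continuous_map (cyl (double Y)) (double Y) snd" by (rule continuous_map_snd)
    have "continuous_map (cyl (double Y)) Y (\<lambda>z. fst (snd z))"
      using continuous_map_compose[OF s continuous_map_fst] by (simp add: o_def)
    moreover have "continuous_map (cyl (double Y)) (discrete_topology UNIV) (\<lambda>z. snd (snd z))"
      using continuous_map_compose[OF s continuous_map_snd] by (simp add: o_def)
    ultimately show ?thesis by (simp add: continuous_map_pairwise o_def continuous_map_fst)
  qed
  let ?h = "\<lambda>z. if snd (snd z) then h2 (fst z, fst (snd z)) else h1 (fst z, fst (snd z))"
  have "continuous_map (cyl (double Y)) Z ?h"
    using continuous_map_compose[OF a continuous_double[OF h1(1) h2(1)]] by (simp only: o_def fst_conv snd_conv)
  then show ?thesis
    unfolding homotopic_with_def using h1(2,3) h2(2,3) by (intro exI[of _ ?h]) simp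
qed

text \<open>Being a transfer along the double cover, the sum inherits independence of
  representatives from \<open>pt_homotopic_class\<close>.\<close>

lemma coh_add:
  assumes k: "locally_k (cyl Y)"
    and g1: "continuous_map Y (zspace E) g1" and g2: "continuous_map Y (zspace E) g2"
    and s: "pt_map E (double Y) Y fst (\<lambda>z. halves (snd z)) (\<lambda>z. if snd z then g2 (fst z) else g1 (fst z)) s"
  shows "htpy_class E Y g1 \<oplus>\<^bsub>coh E \<xi> Y\<^esub> htpy_class E Y g2 = htpy_class E Y s"
proof -
  let ?A = "\<lambda>f g. {s. \<forall>x\<in>topspace Y. box_sum E 1 UNIV halves (\<lambda>p. if p then g x else f x) (s x)}"
  have Z: "f y \<in> topspace (zspace E)" if "continuous_map Y (zspace E) f" "y \<in> topspace Y" for f y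
    using that unfolding continuous_map_def by blast
  have eq: "htpy_class E Y s' = htpy_class E Y s"
    if f: "f \<in> htpy_class E Y g1" and g: "g \<in> htpy_class E Y g2" and s': "s' \<in> ?A f g" for f g s'
  proof -
    have f': "homotopic_with (\<lambda>_. True) Y (zspace E) g1 f" and g': "homotopic_with (\<lambda>_. True) Y (zspace E) g2 g"
      using f g by simp_all
    have fc: "continuous_map Y (zspace E) f" and gc: "continuous_map Y (zspace E) g"
      using homotopic_with_imp_continuous_maps f' g' by blast+
    have "pt_map E (double Y) Y fst (\<lambda>z. halves (snd z)) (\<lambda>z. if snd z then g (fst z) else f (fst z)) s'"
      using s' by (subst pt_map_double) (simp_all add: Z fc gc)
    from pt_homotopic_class[OF finite_cover_double k box_embedding_double homotopic_double[OF f' g'] s this]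
    show ?thesis by (rule htpy_class_eq[symmetric])
  qed
  have "(\<Union>f\<in>htpy_class E Y g1. \<Union>g\<in>htpy_class E Y g2. \<Union>s\<in>?A f g. htpy_class E Y s) = htpy_class E Y s"
  proof (rule equalityI)
    show "(\<Union>f\<in>htpy_class E Y g1. \<Union>g\<in>htpy_class E Y g2. \<Union>s\<in>?A f g. htpy_class E Y s) \<subseteq> htpy_class E Y s"
    proof (intro UN_least)
      fix f g s' assume f: "f \<in> htpy_class E Y g1" and g: "g \<in> htpy_class E Y g2" and s': "s' \<in> ?A f g"
      show "htpy_class E Y s' \<subseteq> htpy_class E Y s" by (rule equalityD1[OF eq[OF f g s']])
    qed
    have sA: "s \<in> ?A g1 g2" using s by (subst (asm) pt_map_double) (simp_all add: Z g1 g2)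
    show "htpy_class E Y s \<subseteq> (\<Union>f\<in>htpy_class E Y g1. \<Union>g\<in>htpy_class E Y g2. \<Union>s\<in>?A f g. htpy_class E Y s)"
      by (rule subsetI, rule UN_I[OF in_htpy_class[OF g1]], rule UN_I[OF in_htpy_class[OF g2]], rule UN_I[OF sA])
  qed
  then show ?thesis by (simp add: coh_def)
qed

end

section \<open>Additivity over disjoint open parts\<close>

lemma continuous_map_open_cases:
  assumes A: "openin X A" and B: "openin X B" and AB: "A \<union> B = topspace X" "A \<inter> B = {}"
    and f: "continuous_map (subtopology X A) Z f" and g: "continuous_map (subtopology X B) Z g"
  shows "continuous_map X Z (\<lambda>x. if x \<in> A then f x else g x)"
proof (rule pasting_lemma[where I=UNIV and T="\<lambda>b. if b then A else B" and f="\<lambda>b. if b then f else g"])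
  fix b :: bool
  show "openin X (if b then A else B)" using A B by simp
  show "continuous_map (subtopology X (if b then A else B)) Z (if b then f else g)" using f g by simp
next
  fix i j x assume "x \<in> topspace X \<inter> (if i then A else B) \<inter> (if j then A else B)"
  then have "i = j" using AB(2) by (cases i; cases j) auto
  then show "(if i then f else g) x = (if j then f else g) x" by simp
next
  fix x assume "x \<in> topspace X"
  then show "\<exists>j. j \<in> UNIV \<and> x \<in> (if j then A else B) \<and> (if x \<in> A then f x else g x) = (if j then f else g) x"
    using AB by (cases "x \<in> A") (auto intro: exI[of _ True] exI[of _ False])
qed

lemma jcont_open_cases:
  assumes A: "openin X A" and B: "openin X B" and AB: "A \<union> B = topspace X" "A \<inter> B = {}"
    and f: "jcont (subtopology X A) f" and g: "jcont (subtopology X B) g"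
  shows "jcont X (\<lambda>x. if x \<in> A then f x else g x)"
proof -
  let ?P = "prod_topology X euclideanreal"
  have sub: "subtopology ?P (C \<times> UNIV) = prod_topology (subtopology X C) euclideanreal" for C
    by (simp add: subtopology_Times)
  have "continuous_map ?P euclideanreal (\<lambda>z. if z \<in> A \<times> UNIV then (case z of (x, s) \<Rightarrow> f x s) else (case z of (x, s) \<Rightarrow> g x s))"
  proof (rule continuous_map_open_cases[where B="B \<times> UNIV"])
    show "openin ?P (A \<times> UNIV)" "openin ?P (B \<times> UNIV)" using A B by (simp_all add: openin_prod_Times_iff)
    show "A \<times> UNIV \<union> B \<times> UNIV = topspace ?P" using AB(1) by auto
    show "A \<times> UNIV \<inter> B \<times> UNIV = {}" using AB(2) by auto
  qed (use f g in \<open>simp_all only: sub jcont_def\<close>)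
  then show ?thesis unfolding jcont_def
    by (rule continuous_map_eq) (simp add: case_prod_unfold mem_Times_iff)
qed

text \<open>The boxes of \<open>A\<close> are squeezed into the negative half-line of coordinate 0
  and those of \<open>B\<close> into the positive one. Points of different parts are then separated
  in coordinate 0; points of the same part stay separated, because composing with an injective map
  keeps images disjoint.\<close>

lemma box_embedding_halves:
  assumes A: "openin X A" and B: "openin X B" and AB: "A \<union> B = topspace X" "A \<inter> B = {}"
    and c1: "box_embedding (subtopology X A) Y p c1" and c2: "box_embedding (subtopology X B) Y p c2"
  shows "box_embedding X Y p (\<lambda>x i. if x \<in> A then halves False i \<circ> c1 x i else halves True i \<circ> c2 x i)"
    (is "box_embedding X Y p ?c")
proof (rule box_embeddingI)
  note D1 = box_embeddingD[OF c1] and D2 = box_embeddingD[OF c2]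
  have tA: "topspace (subtopology X A) = A" "topspace (subtopology X B) = B" using AB(1) by auto
  fix i
  show "strict_mono (?c x i)" if "x \<in> topspace X" for x
  proof (cases "x \<in> A")
    case True
    then show ?thesis using D1(1)[of x i] tA that by (simp add: strict_mono_comp strict_mono_halves)
  next
    case False
    then have "x \<in> B" using that AB(1) by blast
    then show ?thesis using False D2(1)[of x i] tA that by (simp add: strict_mono_comp strict_mono_halves)
  qed
  have h: "jcont C (\<lambda>x. halves b i)" for C :: "'a topology" and b
  proof -
    have "continuous_map C (double C) (\<lambda>x. (x, b))" by (simp add: continuous_map_pairwise o_def)
    from jcont_pullback[OF jcont_halves this] show ?thesis by simp
  qed
  have "jcont X (\<lambda>x. if x \<in> A then halves False i \<circ> c1 x i else halves True i \<circ> c2 x i)"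
    by (rule jcont_open_cases[OF A B AB jcont_comp[OF h D1(2)] jcont_comp[OF h D2(2)]])
  then show "jcont X (\<lambda>x. ?c x i)" .
next
  have tA: "topspace (subtopology X A) = A" "topspace (subtopology X B) = B" using AB(1) by auto
  fix y assume y: "y \<in> topspace Y"
  obtain U1 n1 where 1: "openin Y U1" "y \<in> U1" "\<And>x i. x \<in> A \<Longrightarrow> p x \<in> U1 \<Longrightarrow> n1 \<le> i \<Longrightarrow> c1 x i = id"
    using box_embedding_bound[OF c1 y, unfolded tA] by metis
  obtain U2 n2 where 2: "openin Y U2" "y \<in> U2" "\<And>x i. x \<in> B \<Longrightarrow> p x \<in> U2 \<Longrightarrow> n2 \<le> i \<Longrightarrow> c2 x i = id"
    using box_embedding_bound[OF c2 y, unfolded tA] by metis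
  have "?c x i = id" if "x \<in> topspace X" "p x \<in> U1 \<inter> U2" "n1 + n2 + 1 \<le> i" for x i
  proof (cases "x \<in> A")
    case True
    then show ?thesis using 1(3)[OF True] that(2,3) halves_id[of i False] by simp
  next
    case False
    then have "x \<in> B" using that(1) AB(1) by blast
    then show ?thesis using 2(3)[of x i] False that(2,3) halves_id[of i True] by simp
  qed
  then show "\<exists>U n. openin Y U \<and> y \<in> U \<and> (\<forall>x\<in>topspace X. p x \<in> U \<longrightarrow> (\<forall>i\<ge>n. ?c x i = id))"
    using openin_Int[OF 1(1) 2(1)] 1(2) 2(2)
    by (intro exI[of _ "U1 \<inter> U2"] exI[of _ "n1 + n2 + 1"]) (simp del: Int_iff, simp)
next
  note D1 = box_embeddingD[OF c1] and D2 = box_embeddingD[OF c2]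
  have tA: "topspace (subtopology X A) = A" "topspace (subtopology X B) = B" using AB(1) by auto
  fix x x' assume x: "x \<in> topspace X" "x' \<in> topspace X" "x \<noteq> x'" "p x = p x'"
  have comp: "range (f \<circ> g) \<inter> range (f \<circ> g') = {}" if "strict_mono f" "range g \<inter> range g' = {}" for f g g' :: "real \<Rightarrow> real"
  proof -
    have "inj f" using that(1) strict_mono_eq by (intro injI) blast
    then have "f ` range g \<inter> f ` range g' = {}" using that(2) by (metis image_Int image_empty)
    then show ?thesis by (simp add: image_comp)
  qed
  have mixed: "\<exists>i. range (?c u i) \<inter> range (?c u' i) = {}" if "u \<in> A" "u' \<notin> A" for u u'
  proof -
    have "range (halves False 0) \<inter> range (halves True 0) = {}" by (rule halves_disjoint) simp
    moreover have "range (?c u 0) \<subseteq> range (halves False 0)" "range (?c u' 0) \<subseteq> range (halves True 0)"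
      using that range_comp_subset by simp_all
    ultimately have "range (?c u 0) \<inter> range (?c u' 0) = {}" by blast
    then show ?thesis ..
  qed
  show "\<exists>i. range (?c x i) \<inter> range (?c x' i) = {}"
  proof (cases "x \<in> A")
    case xA: True
    show ?thesis
    proof (cases "x' \<in> A")
      case True
      obtain i where "range (c1 x i) \<inter> range (c1 x' i) = {}" using D1(3)[of x x'] xA True x tA by auto
      then have "range (?c x i) \<inter> range (?c x' i) = {}"
        using xA True comp[OF strict_mono_halves] by simp
      then show ?thesis ..
    next
      case False then show ?thesis by (rule mixed[OF xA])
    qed
  next
    case xB: False
    show ?thesis
    proof (cases "x' \<in> A")
      case True
      from mixed[OF True xB] show ?thesis by (simp only: Int_commute)
    next
      case False
      have "x \<in> B" "x' \<in> B" using x(1,2) xB False AB(1) by blast+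
      then obtain i where "range (c2 x i) \<inter> range (c2 x' i) = {}" using D2(3)[of x x'] x tA by auto
      then have "range (?c x i) \<inter> range (?c x' i) = {}"
        using xB False comp[OF strict_mono_halves] by simp
      then show ?thesis ..
    qed
  qed
qed

context spectrum_loc
begin

text \<open>With the boxes of \<open>box_embedding_halves\<close>, the sum over a fibre is a
  composite box sum: inner sums over the two parts of the fibre, outer sum along
  \<open>halves\<close>, which is the addition in cohomology.\<close>

lemma transfer_add:
  assumes cov: "finite_cover X Y p" and cA: "finite_cover (subtopology X A) Y p" and cB: "finite_cover (subtopology X B) Y p"
    and k: "locally_k Y" "locally_k (cyl Y)"
    and A: "openin X A" and B: "openin X B" and AB: "A \<union> B = topspace X" "A \<inter> B = {}"
    and c1: "box_embedding (subtopology X A) Y p c1" and c2: "box_embedding (subtopology X B) Y p c2"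
    and f: "continuous_map X (zspace E) f"
  shows "transfer_along E X Y p (htpy_class E X f) =
    transfer_along E (subtopology X A) Y p (htpy_class E (subtopology X A) f) \<oplus>\<^bsub>coh E \<xi> Y\<^esub>
    transfer_along E (subtopology X B) Y p (htpy_class E (subtopology X B) f)"
proof -
  let ?c = "\<lambda>x i. if x \<in> A then halves False i \<circ> c1 x i else halves True i \<circ> c2 x i"
  have tA: "topspace (subtopology X A) = A" "topspace (subtopology X B) = B" using AB(1) by auto
  have fA: "continuous_map (subtopology X A) (zspace E) f" and fB: "continuous_map (subtopology X B) (zspace E) f"
    using f by (simp_all add: continuous_map_from_subtopology)
  obtain g1 where g1: "continuous_map Y (zspace E) g1" "pt_map E (subtopology X A) Y p c1 f g1"
    using pt_exists[OF cA k(1) c1 fA] by blast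
  obtain g2 where g2: "continuous_map Y (zspace E) g2" "pt_map E (subtopology X B) Y p c2 f g2"
    using pt_exists[OF cB k(1) c2 fB] by blast
  obtain s where s: "pt_map E (double Y) Y fst (\<lambda>z. halves (snd z)) (\<lambda>z. if snd z then g2 (fst z) else g1 (fst z)) s"
    using pt_exists[OF finite_cover_double k(1) box_embedding_double continuous_double[OF g1(1) g2(1)]] by blast
  have Z: "h y \<in> topspace (zspace E)" if "continuous_map Y (zspace E) h" "y \<in> topspace Y" for h y
    using that unfolding continuous_map_def by blast
  have s1: "box_sum E 1 UNIV halves (\<lambda>b. if b then g2 y else g1 y) (s y)" if "y \<in> topspace Y" for y
    using s that by (subst (asm) pt_map_double) (simp_all add: Z g1(1) g2(1))
  have "pt_map E X Y p ?c f s"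
  proof (rule pt_mapI)
    show "f x \<in> topspace (zspace E)" if "x \<in> topspace X" for x using f that unfolding continuous_map_def by blast
    fix y assume y: "y \<in> topspace Y"
    obtain U1 n1 where 1: "y \<in> U1" "\<And>x i. x \<in> A \<Longrightarrow> p x \<in> U1 \<Longrightarrow> n1 \<le> i \<Longrightarrow> c1 x i = id"
      using box_embedding_bound[OF c1 y, unfolded tA] by metis
    obtain U2 n2 where 2: "y \<in> U2" "\<And>x i. x \<in> B \<Longrightarrow> p x \<in> U2 \<Longrightarrow> n2 \<le> i \<Longrightarrow> c2 x i = id"
      using box_embedding_bound[OF c2 y, unfolded tA] by metis
    \<comment> \<open>Large enough for both embeddings; the extra 1 makes room for coordinate 0,
      which \<open>halves\<close> uses even if both parts need no coordinate.\<close>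
    define N where "N = n1 + n2 + 1"
    have v1: "c1 x i = id" if "x \<in> A" "p x = y" "N \<le> i" for x i
      using 1(2)[OF that(1)] 1(1) that(2,3) by (simp add: N_def)
    have v2: "c2 x i = id" if "x \<in> B" "p x = y" "N \<le> i" for x i
      using 2(2)[OF that(1)] 2(1) that(2,3) by (simp add: N_def)
    define I1 where "I1 b = {x \<in> (if b then B else A). p x = y}" for b
    define c0 where "c0 x = (if x \<in> A then c1 x else c2 x)" for x
    have notA: "x \<notin> A" if "x \<in> B" for x using that AB(2) by blast
    have bN: "box_sum E N UNIV halves (\<lambda>b. if b then g2 y else g1 y) (s y)"
    proof (rule box_sum_raise[OF s1[OF y]])
      show "1 \<le> N" by (simp add: N_def)
      show "halves b i = id" if "1 \<le> i" for b i by (rule halves_id[OF that])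
      show "(if b then g2 y else g1 y) \<in> topspace (zspace E)" for b by (simp add: Z g1(1) g2(1) y)
    qed
    have b1: "box_sum E N (I1 b) c0 f (if b then g2 y else g1 y)" for b
    proof (cases b)
      case False
      have "box_sum E N {x \<in> topspace (subtopology X A). p x = y} c1 f (g1 y)"
        using g1(2)[unfolded pt_map_def, THEN bspec, OF y, THEN spec, of N] v1 unfolding tA by blast
      then have "box_sum E N {x \<in> A. p x = y} c0 f (g1 y)"
        unfolding tA by (subst box_sum_cong[of _ c0 c1 f f]) (simp_all add: c0_def)
      then show ?thesis using False by (simp add: I1_def)
    next
      case True
      have "box_sum E N {x \<in> topspace (subtopology X B). p x = y} c2 f (g2 y)"
        using g2(2)[unfolded pt_map_def, THEN bspec, OF y, THEN spec, of N] v2 unfolding tA by blast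
      then have "box_sum E N {x \<in> B. p x = y} c0 f (g2 y)"
        unfolding tA by (subst box_sum_cong[of _ c0 c2 f f]) (simp_all add: c0_def notA)
      then show ?thesis using True by (simp add: I1_def)
    qed
    have "box_sum E N (\<Union>b\<in>UNIV. I1 b) ?c f (s y)"
    proof (rule box_sum_comp[OF bN b1])
      fix b x i assume x: "x \<in> I1 b"
      have xx: "x \<in> (if b then B else A)" "p x = y" using x by (simp_all add: I1_def)
      show "c0 x i = id" if "N \<le> i"
        using xx v1[of x i] v2[of x i] that by (cases b) (simp_all add: c0_def notA)
      show "?c x i = halves b i \<circ> c0 x i"
        using xx by (cases b) (simp_all add: c0_def notA)
    qed
    moreover have "(\<Union>b\<in>UNIV. I1 b) = {x \<in> topspace X. p x = y}"
      using AB(1) by (auto simp: I1_def UNIV_bool)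
    moreover have "\<forall>x\<in>topspace X. p x = y \<longrightarrow> (\<forall>i\<ge>N. ?c x i = id)"
    proof (intro ballI impI allI)
      fix x i assume x: "x \<in> topspace X" "p x = y" and i: "N \<le> i"
      have h: "halves b i = id" for b using i by (intro halves_id) (simp add: N_def)
      show "?c x i = id"
        using x AB(1) v1[of x i] v2[of x i] i by (cases "x \<in> A") (auto simp: h)
    qed
    ultimately show "\<exists>n. (\<forall>x\<in>topspace X. p x = y \<longrightarrow> (\<forall>i\<ge>n. ?c x i = id)) \<and>
       box_sum E n {x \<in> topspace X. p x = y} ?c f (s y)"
      by (intro exI[of _ N] conjI) simp_all
  qed
  from transfer_eq[OF cov k box_embedding_halves[OF A B AB c1 c2] f this]
  have "transfer_along E X Y p (htpy_class E X f) = htpy_class E Y s" .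
  also have "\<dots> = htpy_class E Y g1 \<oplus>\<^bsub>coh E \<xi> Y\<^esub> htpy_class E Y g2"
    by (rule coh_add[OF k(2) g1(1) g2(1) s, symmetric])
  finally show ?thesis
    unfolding transfer_eq[OF cA k c1 fA g1(2)] transfer_eq[OF cB k c2 fB g2(2)] .
qed

end

section \<open>Composition of covers\<close>

text \<open>A finite intersection of open conditions, one for each point of the fibre. It turns
  choices made near the points upstairs into data that are uniform over a neighbourhood of
  \<open>y\<close>.\<close>

lemma finite_cover_tube:
  assumes cov: "finite_cover X Y p" and y: "y \<in> topspace Y"
    and W: "\<And>x. x \<in> topspace X \<Longrightarrow> p x = y \<Longrightarrow> openin X (W x) \<and> x \<in> W x"
  obtains U S where "y \<in> U" "evenly_covered X Y p U S" "\<And>s u. s \<in> S \<Longrightarrow> u \<in> U \<Longrightarrow> s u \<in> W (s y)"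
proof -
  have p: "continuous_map X Y p" using cov by (simp add: finite_cover_def)
  obtain V S where V: "y \<in> V" "evenly_covered X Y p V S"
    using cov y unfolding finite_cover_def by blast
  note D = evenly_coveredD[OF V(2)]
  define T where "T s = {u \<in> topspace (subtopology Y V). s u \<in> W (s y)}" for s
  have Wo: "openin X (W (s y))" "s y \<in> W (s y)" if "s \<in> S" for s
    using W[OF D(9)[OF that V(1)] D(6)[OF that V(1)]] by blast+
  have To: "openin Y (T s)" if "s \<in> S" for s
    unfolding T_def using openin_continuous_map_preimage[OF D(4)[OF that] Wo(1)[OF that]] D(1)
    by (rule openin_trans_full)
  define U where "U = V \<inter> (\<Inter>s\<in>S. T s)"
  have oU: "openin Y U"
  proof (cases "S = {}")
    case True then show ?thesis using D(1) by (simp add: U_def)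
  next
    case False then show ?thesis unfolding U_def using D(1,2) To by (intro openin_Int openin_INT2) auto
  qed
  have yU: "y \<in> U" unfolding U_def T_def using V(1) D(3) Wo(2) by auto
  show thesis
  proof (rule that[OF yU])
    show "evenly_covered X Y p U S" by (rule evenly_covered_subset[OF V(2) p oU]) (simp add: U_def)
    show "s u \<in> W (s y)" if "s \<in> S" "u \<in> U" for s u using that unfolding U_def T_def by blast
  qed
qed

text \<open>The base is shrunk until each sheet of \<open>p2\<close> lies in a set evenly covered by
  \<open>p1\<close>; the composites of sections of the two covers are then the sheets of the
  composite.\<close>

lemma finite_cover_comp:
  assumes c1: "finite_cover X1 X2 p1" and c2: "finite_cover X2 Y p2"
  shows "finite_cover X1 Y (p2 \<circ> p1)"
  unfolding finite_cover_def
proof (intro conjI ballI)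
  have p1: "continuous_map X1 X2 p1" using c1 by (simp add: finite_cover_def)
  show "continuous_map X1 Y (p2 \<circ> p1)"
    using c1 c2 unfolding finite_cover_def by (blast intro: continuous_map_compose)
  fix y assume y: "y \<in> topspace Y"
  have "\<forall>x\<in>topspace X2. \<exists>W S. x \<in> W \<and> evenly_covered X1 X2 p1 W S"
    using c1 by (simp add: finite_cover_def)
  then obtain W S1 where W: "\<And>x. x \<in> topspace X2 \<Longrightarrow> x \<in> W x \<and> evenly_covered X1 X2 p1 (W x) (S1 x)"
    by metis
  have "openin X2 (W x) \<and> x \<in> W x" if "x \<in> topspace X2" for x
    using W[OF that] evenly_coveredD(1) by blast
  then obtain U S2 where U: "y \<in> U" "evenly_covered X2 Y p2 U S2" "\<And>s u. s \<in> S2 \<Longrightarrow> u \<in> U \<Longrightarrow> s u \<in> W (s y)"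
    using finite_cover_tube[OF c2 y, of W] by metis
  note D2 = evenly_coveredD[OF U(2)]
  have sy: "s y \<in> topspace X2" if "s \<in> S2" for s by (rule D2(9)[OF that U(1)])
  have E1: "evenly_covered X1 X2 p1 (W (s y)) (S1 (s y))" if "s \<in> S2" for s using W[OF sy[OF that]] by blast
  define S where "S = (\<Union>s2\<in>S2. (\<lambda>s1. s1 \<circ> s2) ` S1 (s2 y))"
  have "evenly_covered X1 Y (p2 \<circ> p1) U S"
  proof (rule evenly_coveredI)
    show "openin Y U" by (rule D2(1))
    show "finite S" unfolding S_def using D2(2) evenly_coveredD(2)[OF E1] by blast
    fix s assume "s \<in> S"
    then obtain s1 s2 where s: "s2 \<in> S2" "s1 \<in> S1 (s2 y)" "s = s1 \<circ> s2" unfolding S_def by blast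
    note D1 = evenly_coveredD[OF E1[OF s(1)]]
    have "continuous_map (subtopology Y U) (subtopology X2 (W (s2 y))) s2"
      using D2(4)[OF s(1)] U(3)[OF s(1)] D2(3) by (auto simp: continuous_map_in_subtopology)
    then show "continuous_map (subtopology Y U) X1 s"
      unfolding s(3) using D1(4)[OF s(2)] by (rule continuous_map_compose)
    have "s2 ` U \<subseteq> W (s2 y)" using U(3)[OF s(1)] by blast
    from evenly_coveredD(5)[OF evenly_covered_subset[OF E1[OF s(1)] p1 D2(5)[OF s(1)] this] s(2)]
    show "openin X1 (s ` U)" unfolding s(3) by (simp add: image_comp)
    show "(p2 \<circ> p1) (s u) = u" if "u \<in> U" for u
      unfolding s(3) using D1(6)[OF s(2) U(3)[OF s(1) that]] D2(6)[OF s(1) that] by simp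
    fix s' u assume "s' \<in> S" and u: "u \<in> U" and eq: "s u = s' u"
    then obtain s1' s2' where s': "s2' \<in> S2" "s1' \<in> S1 (s2' y)" "s' = s1' \<circ> s2'" unfolding S_def by blast
    have "s2 u = p1 (s u)" unfolding s(3) using D1(6)[OF s(2) U(3)[OF s(1) u]] by simp
    moreover have "s2' u = p1 (s' u)" unfolding s'(3)
      using evenly_coveredD(6)[OF E1[OF s'(1)] s'(2) U(3)[OF s'(1) u]] by simp
    ultimately have e2: "s2 = s2'" using D2(7)[OF s(1) s'(1) u] eq by simp
    have "s1 (s2 u) = s1' (s2 u)" using eq unfolding s(3) s'(3) e2 by simp
    then have "s1 = s1'" using D1(7)[OF s(2) _ U(3)[OF s(1) u]] s'(2) e2 by simp
    then show "s = s'" unfolding s(3) s'(3) e2 by simp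
  next
    fix x assume x: "x \<in> topspace X1" "(p2 \<circ> p1) x \<in> U"
    have x2: "p1 x \<in> topspace X2" using p1 x(1) unfolding continuous_map_def by blast
    obtain s2 where s2: "s2 \<in> S2" "p1 x = s2 (p2 (p1 x))" using D2(8)[OF x2] x(2) by auto
    have "p1 x \<in> W (s2 y)" using U(3)[OF s2(1), of "p2 (p1 x)"] x(2) s2(2) by simp
    from evenly_coveredD(8)[OF E1[OF s2(1)] x(1) this] obtain s1 where s1: "s1 \<in> S1 (s2 y)" "x = s1 (p1 x)" by blast
    have "x = (s1 \<circ> s2) ((p2 \<circ> p1) x)" using s1(2) s2(2) by simp
    moreover have "s1 \<circ> s2 \<in> S" unfolding S_def using s1(1) s2(1) by blast
    ultimately show "\<exists>s\<in>S. x = s ((p2 \<circ> p1) x)" by (rule bexI)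
  qed
  with U(1) show "\<exists>U S. y \<in> U \<and> evenly_covered X1 Y (p2 \<circ> p1) U S" by (intro exI conjI)
qed

text \<open>The dimension bounds for \<open>c1\<close> are local on \<open>X2\<close>, not on
  \<open>Y\<close>. Over a small neighbourhood of \<open>y\<close> only finitely many of them occur,
  and their sum bounds them all.\<close>

lemma comp_bound:
  assumes cov: "finite_cover X1 X2 p1" and c2: "finite_cover X2 Y p2"
    and b1: "box_embedding X1 X2 p1 c1" and b2: "box_embedding X2 Y p2 c2" and y: "y \<in> topspace Y"
  obtains U n where "openin Y U" "y \<in> U"
    "\<And>x i. x \<in> topspace X2 \<Longrightarrow> p2 x \<in> U \<Longrightarrow> n \<le> i \<Longrightarrow> c2 x i = id"
    "\<And>x i. x \<in> topspace X1 \<Longrightarrow> p2 (p1 x) \<in> U \<Longrightarrow> n \<le> i \<Longrightarrow> c1 x i = id"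
proof -
  have p1: "continuous_map X1 X2 p1" using cov by (simp add: finite_cover_def)
  define Q where "Q x W n \<longleftrightarrow> openin X2 W \<and> x \<in> W \<and> (\<forall>x\<in>topspace X1. p1 x \<in> W \<longrightarrow> (\<forall>i\<ge>n. c1 x i = id))" for x W and n :: nat
  have "\<exists>W n. Q x W n" if "x \<in> topspace X2" for x
    using b1 that unfolding box_embedding_def Q_def by blast
  then obtain W N where WN: "\<And>x. x \<in> topspace X2 \<Longrightarrow> Q x (W x) (N x)" by metis
  have "openin X2 (W x) \<and> x \<in> W x" if "x \<in> topspace X2" for x
    using WN[OF that] unfolding Q_def by blast
  then obtain U S where U: "y \<in> U" "evenly_covered X2 Y p2 U S" "\<And>s u. s \<in> S \<Longrightarrow> u \<in> U \<Longrightarrow> s u \<in> W (s y)"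
    using finite_cover_tube[OF c2 y, of W] by metis
  note D = evenly_coveredD[OF U(2)]
  obtain V n where V: "openin Y V" "y \<in> V" "\<And>x i. x \<in> topspace X2 \<Longrightarrow> p2 x \<in> V \<Longrightarrow> n \<le> i \<Longrightarrow> c2 x i = id"
    using box_embedding_bound[OF b2 y] by metis
  show thesis
  proof (rule that[of "U \<inter> V" "n + (\<Sum>s\<in>S. N (s y))"])
    show "openin Y (U \<inter> V)" using D(1) V(1) by (rule openin_Int)
    show "y \<in> U \<inter> V" using U(1) V(2) by simp
    show "c2 x i = id" if "x \<in> topspace X2" "p2 x \<in> U \<inter> V" "n + (\<Sum>s\<in>S. N (s y)) \<le> i" for x i
      using V(3)[OF that(1)] that(2,3) by simp
    fix x i assume x: "x \<in> topspace X1" "p2 (p1 x) \<in> U \<inter> V" and i: "n + (\<Sum>s\<in>S. N (s y)) \<le> i"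
    have x2: "p1 x \<in> topspace X2" using p1 x(1) unfolding continuous_map_def by blast
    have pU: "p2 (p1 x) \<in> U" using x(2) by simp
    obtain s where s: "s \<in> S" "p1 x = s (p2 (p1 x))" using D(8)[OF x2 pU] by blast
    have "p1 x \<in> W (s y)" using U(3)[OF s(1) pU] s(2) by simp
    moreover have "N (s y) \<le> i"
      using member_le_sum[OF s(1), of "\<lambda>s. N (s y)"] D(2) i by simp
    ultimately show "c1 x i = id"
      using WN[OF D(9)[OF s(1) U(1)]] x(1) unfolding Q_def by blast
  qed
qed

text \<open>Two points of a fibre are separated by the inner boxes if they have the same image in
  \<open>X2\<close>, and by the outer boxes otherwise.\<close>

lemma box_embedding_comp:
  assumes cov: "finite_cover X1 X2 p1" and cov2: "finite_cover X2 Y p2"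
    and b1: "box_embedding X1 X2 p1 c1" and b2: "box_embedding X2 Y p2 c2"
  shows "box_embedding X1 Y (p2 \<circ> p1) (\<lambda>x i. c2 (p1 x) i \<circ> c1 x i)"
proof (rule box_embeddingI)
  note D1 = box_embeddingD[OF b1] and D2 = box_embeddingD[OF b2]
  have p1: "continuous_map X1 X2 p1" using cov by (simp add: finite_cover_def)
  have x2: "p1 x \<in> topspace X2" if "x \<in> topspace X1" for x using p1 that unfolding continuous_map_def by blast
  show "strict_mono (c2 (p1 x) i \<circ> c1 x i)" if "x \<in> topspace X1" for x i
    by (rule strict_mono_comp[OF D2(1)[OF x2[OF that]] D1(1)[OF that]])
  show "jcont X1 (\<lambda>x. c2 (p1 x) i \<circ> c1 x i)" for i
    by (rule jcont_comp[OF jcont_pullback[OF D2(2) p1] D1(2)])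
  show "\<exists>U n. openin Y U \<and> y \<in> U \<and> (\<forall>x\<in>topspace X1. (p2 \<circ> p1) x \<in> U \<longrightarrow> (\<forall>i\<ge>n. c2 (p1 x) i \<circ> c1 x i = id))"
    if y: "y \<in> topspace Y" for y
  proof -
    obtain U n where U: "openin Y U" "y \<in> U"
      "\<And>x i. x \<in> topspace X2 \<Longrightarrow> p2 x \<in> U \<Longrightarrow> n \<le> i \<Longrightarrow> c2 x i = id"
      "\<And>x i. x \<in> topspace X1 \<Longrightarrow> p2 (p1 x) \<in> U \<Longrightarrow> n \<le> i \<Longrightarrow> c1 x i = id"
      using comp_bound[OF cov cov2 b1 b2 y] by metis
    then show ?thesis using x2 by (intro exI[of _ U] exI[of _ n]) simp
  qed
  fix x x' assume x: "x \<in> topspace X1" "x' \<in> topspace X1" "x \<noteq> x'" "(p2 \<circ> p1) x = (p2 \<circ> p1) x'"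
  show "\<exists>i. range (c2 (p1 x) i \<circ> c1 x i) \<inter> range (c2 (p1 x') i \<circ> c1 x' i) = {}"
  proof (cases "p1 x = p1 x'")
    case True
    obtain i where i: "range (c1 x i) \<inter> range (c1 x' i) = {}" using D1(3)[OF x(1-3) True] by blast
    have "inj (c2 (p1 x) i)"
      using D2(1)[OF x2[OF x(1)], of i] strict_mono_eq by (intro injI) blast
    then have "c2 (p1 x) i ` range (c1 x i) \<inter> c2 (p1 x) i ` range (c1 x' i) = {}"
      using i by (metis image_Int image_empty)
    then show ?thesis unfolding True by (intro exI[of _ i]) (simp add: image_comp)
  next
    case False
    obtain i where i: "range (c2 (p1 x) i) \<inter> range (c2 (p1 x') i) = {}"
      using D2(3)[OF x2[OF x(1)] x2[OF x(2)] False] x(4) by auto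
    then have "range (c2 (p1 x) i \<circ> c1 x i) \<inter> range (c2 (p1 x') i \<circ> c1 x' i) = {}"
      using range_comp_subset[of "c2 (p1 x) i" "c1 x i"] range_comp_subset[of "c2 (p1 x') i" "c1 x' i"] by blast
    then show ?thesis ..
  qed
qed

context spectrum_loc
begin

text \<open>The class on \<open>X2\<close> is the pushforward of \<open>f\<close> along
  \<open>p1\<close>, and \<open>box_sum_comp\<close> identifies the iterated sum with the sum over
  the fibre of the composite. Only images of transfers are compared later, so the existence of
  \<open>g\<close> is the useful form.\<close>

lemma transfer_comp:
  assumes cov1: "finite_cover X1 X2 p1" and cov2: "finite_cover X2 Y p2"
    and k2: "locally_k X2" and k: "locally_k Y" "locally_k (cyl Y)"
    and b1: "box_embedding X1 X2 p1 c1" and b2: "box_embedding X2 Y p2 c2"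
    and f: "continuous_map X1 (zspace E) f"
  obtains g where "continuous_map X2 (zspace E) g"
    "transfer_along E X1 Y (p2 \<circ> p1) (htpy_class E X1 f) = transfer_along E X2 Y p2 (htpy_class E X2 g)"
proof -
  have p1: "continuous_map X1 X2 p1" using cov1 by (simp add: finite_cover_def)
  have x2: "p1 x \<in> topspace X2" if "x \<in> topspace X1" for x using p1 that unfolding continuous_map_def by blast
  obtain g where g: "continuous_map X2 (zspace E) g" "pt_map E X1 X2 p1 c1 f g"
    using pt_exists[OF cov1 k2 b1 f] by blast
  obtain h where h: "continuous_map Y (zspace E) h" "pt_map E X2 Y p2 c2 g h"
    using pt_exists[OF cov2 k(1) b2 g(1)] by blast
  let ?c = "\<lambda>x i. c2 (p1 x) i \<circ> c1 x i"
  have "pt_map E X1 Y (p2 \<circ> p1) ?c f h"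
  proof (rule pt_mapI)
    show "f x \<in> topspace (zspace E)" if "x \<in> topspace X1" for x using f that unfolding continuous_map_def by blast
    fix y assume y: "y \<in> topspace Y"
    obtain U n where U: "openin Y U" "y \<in> U"
      "\<And>x i. x \<in> topspace X2 \<Longrightarrow> p2 x \<in> U \<Longrightarrow> n \<le> i \<Longrightarrow> c2 x i = id"
      "\<And>x i. x \<in> topspace X1 \<Longrightarrow> p2 (p1 x) \<in> U \<Longrightarrow> n \<le> i \<Longrightarrow> c1 x i = id"
      using comp_bound[OF cov1 cov2 b1 b2 y] by metis
    have v2: "\<forall>x\<in>topspace X2. p2 x = y \<longrightarrow> (\<forall>i\<ge>n. c2 x i = id)" using U(2,3) by blast
    have v1: "\<forall>x\<in>topspace X1. p1 x = x' \<longrightarrow> (\<forall>i\<ge>n. c1 x i = id)" if "p2 x' = y" for x'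
      using U(2,4) that by blast
    have s2: "box_sum E n {x \<in> topspace X2. p2 x = y} c2 g (h y)"
      by (rule h(2)[unfolded pt_map_def, THEN bspec, OF y, THEN spec, THEN mp, OF v2])
    have s1: "box_sum E n {x \<in> topspace X1. p1 x = x'} c1 f (g x')" if "x' \<in> {x \<in> topspace X2. p2 x = y}" for x'
    proof -
      have x': "x' \<in> topspace X2" "p2 x' = y" using that by simp_all
      show ?thesis
        by (rule g(2)[unfolded pt_map_def, THEN bspec, OF x'(1), THEN spec, THEN mp, OF v1[OF x'(2)]])
    qed
    have "box_sum E n (\<Union>x'\<in>{x \<in> topspace X2. p2 x = y}. {x \<in> topspace X1. p1 x = x'}) ?c f (h y)"
      by (rule box_sum_comp[OF s2 s1]) (use v1 in auto)
    moreover have "(\<Union>x'\<in>{x \<in> topspace X2. p2 x = y}. {x \<in> topspace X1. p1 x = x'}) = {x \<in> topspace X1. (p2 \<circ> p1) x = y}"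
      using x2 by auto
    moreover have "\<forall>x\<in>topspace X1. (p2 \<circ> p1) x = y \<longrightarrow> (\<forall>i\<ge>n. ?c x i = id)"
      using v1 v2 x2 by simp
    ultimately show "\<exists>n. (\<forall>x\<in>topspace X1. (p2 \<circ> p1) x = y \<longrightarrow> (\<forall>i\<ge>n. ?c x i = id)) \<and>
       box_sum E n {x \<in> topspace X1. (p2 \<circ> p1) x = y} ?c f (h y)"
      by (intro exI[of _ n] conjI) simp_all
  qed
  from transfer_eq[OF finite_cover_comp[OF cov1 cov2] k box_embedding_comp[OF cov1 cov2 b1 b2] f this]
    transfer_eq[OF cov2 k b2 g(1) h(2)]
  show thesis by (intro that[OF g(1)]) simp
qed

end

text \<open>A homeomorphism over the base is a finite cover with the identity boxes.\<close>

lemma finite_cover_homeomorphic: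
  assumes "homeomorphic_map X Y p"
  shows "finite_cover X Y p"
proof -
  obtain q where q: "homeomorphic_maps X Y p q" using assms homeomorphic_map_maps by blast
  then have p: "continuous_map X Y p" and qc: "continuous_map Y X q"
    and qp: "\<And>x. x \<in> topspace X \<Longrightarrow> q (p x) = x" and pq: "\<And>y. y \<in> topspace Y \<Longrightarrow> p (q y) = y"
    by (auto simp: homeomorphic_maps_def)
  have im: "q ` topspace Y = topspace X"
    using q by (meson homeomorphic_imp_surjective_map homeomorphic_maps_map homeomorphic_maps_sym)
  have "evenly_covered X Y p (topspace Y) {q}"
    by (rule evenly_coveredI) (use qc pq qp im in auto)
  then show ?thesis using p unfolding finite_cover_def by blast
qed

lemma box_embedding_id:
  assumes "inj_on p (topspace X)"
  shows "box_embedding X Y p (\<lambda>x i. id)"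
proof (rule box_embeddingI)
  show "\<exists>U n. openin Y U \<and> y \<in> U \<and> (\<forall>x\<in>topspace X. p x \<in> U \<longrightarrow> (\<forall>i\<ge>n. id = id))" if "y \<in> topspace Y" for y
    using that by (intro exI[of _ "topspace Y"] exI[of _ 0]) simp
  show "\<exists>i. range id \<inter> range id = {}"
    if "x \<in> topspace X" "x' \<in> topspace X" "x \<noteq> x'" "p x = p x'" for x x'
    using assms that by (metis inj_onD)
qed (simp_all add: strict_mono_def)

lemma finite_cover_cong:
  assumes c: "finite_cover X Y p" and p: "\<And>x. x \<in> topspace X \<Longrightarrow> p x = p' x"
  shows "finite_cover X Y p'"
  unfolding finite_cover_def
proof (intro conjI ballI)
  show "continuous_map X Y p'" using c p unfolding finite_cover_def by (blast intro: continuous_map_eq)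
  fix y assume "y \<in> topspace Y"
  then obtain U S where U: "y \<in> U" "evenly_covered X Y p U S" using c unfolding finite_cover_def by blast
  note D = evenly_coveredD[OF U(2)]
  have "evenly_covered X Y p' U S"
  proof (rule evenly_coveredI[OF D(1,2) D(4,5)])
    show "p' (s u) = u" if "s \<in> S" "u \<in> U" for s u using D(6,9)[OF that] p by metis
    show "\<exists>s\<in>S. x = s (p' x)" if "x \<in> topspace X" "p' x \<in> U" for x using D(8)[of x] p[of x] that by simp
  qed (use D(7) in blast)+
  with U(1) show "\<exists>U S. y \<in> U \<and> evenly_covered X Y p' U S" by (intro exI conjI)
qed

section \<open>Open images of metrizable spaces as bases\<close>

text \<open>An open subset of the base is a quotient of an open subset of a metrizable space.
  Metrizable spaces are k-spaces, and quotients of k-spaces are k-spaces.\<close>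

lemma locally_k_open_image:
  assumes W: "metrizable_space W" and q: "continuous_map W Y q" "open_map W Y q" "q ` topspace W = topspace Y"
  shows "locally_k Y"
  unfolding locally_k_def
proof (intro allI impI)
  fix U assume U: "openin Y U"
  let ?V = "{w \<in> topspace W. q w \<in> U}"
  have UY: "U \<subseteq> topspace Y" by (rule openin_subset[OF U])
  have c: "continuous_map (subtopology W ?V) (subtopology Y U) q"
    by (simp add: continuous_map_in_subtopology continuous_map_from_subtopology q(1) Pi_iff)
  have o: "open_map (subtopology W ?V) (subtopology Y U) q"
    by (rule open_map_restriction[OF q(2)]) simp
  have im: "q ` topspace (subtopology W ?V) = topspace (subtopology Y U)"
  proof -
    have "q ` ?V = U"
    proof (intro equalityI subsetI)
      fix u assume u: "u \<in> U"
      then have "u \<in> q ` topspace W" using q(3) UY by auto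
      then obtain w where "u = q w" "w \<in> topspace W" by (rule imageE)
      then show "u \<in> q ` ?V" using u by (intro image_eqI[of _ _ w]) simp_all
    next
      fix u assume "u \<in> q ` ?V"
      then show "u \<in> U" by (elim imageE) simp
    qed
    moreover have "topspace (subtopology W ?V) = ?V" by auto
    moreover have "topspace (subtopology Y U) = U" using UY by auto
    ultimately show ?thesis by simp
  qed
  have "quotient_map (subtopology W ?V) (subtopology Y U) q"
    by (rule continuous_open_imp_quotient_map[OF c o im])
  moreover have "k_space (subtopology W ?V)"
    by (rule metrizable_imp_k_space[OF metrizable_space_subtopology[OF W]])
  ultimately show "k_space (subtopology Y U)" by (rule k_space_quotient_map_image)
qed

lemma locally_k_cyl_open_image:
  assumes W: "metrizable_space W" and q: "continuous_map W Y q" "open_map W Y q" "q ` topspace W = topspace Y"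
  shows "locally_k (cyl Y)"
proof (rule locally_k_open_image)
  show "metrizable_space (cyl W)"
    using W by (simp add: metrizable_space_prod_topology metrizable_space_subtopology metrizable_space_euclidean)
  show "continuous_map (cyl W) (cyl Y) (cylmap q)" by (rule cylmap_continuous[OF q(1)])
  have "open_map (cyl W) (cyl Y) (\<lambda>(t, w). (t, q w))"
    by (rule open_map_prod[OF _ q(2)]) (simp add: open_map_def)
  then show "open_map (cyl W) (cyl Y) (cylmap q)" by (simp add: case_prod_unfold)
  show "cylmap q ` topspace (cyl W) = topspace (cyl Y)"
  proof (intro equalityI subsetI)
    fix z assume "z \<in> cylmap q ` topspace (cyl W)"
    then obtain u where "z = cylmap q u" "u \<in> topspace (cyl W)" by (rule imageE)
    then show "z \<in> topspace (cyl Y)" using q(3) by (simp add: mem_Times_iff) blast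
  next
    fix z assume z: "z \<in> topspace (cyl Y)"
    then have "snd z \<in> q ` topspace W" using q(3) by (simp add: mem_Times_iff)
    then obtain w where w: "snd z = q w" "w \<in> topspace W" by (rule imageE)
    have "z = cylmap q (fst z, w)" using w(1) by (simp add: prod_eq_iff)
    moreover have "(fst z, w) \<in> topspace (cyl W)" using z w(2) by (simp add: mem_Times_iff)
    ultimately show "z \<in> cylmap q ` topspace (cyl W)" by (rule image_eqI)
  qed
qed

section \<open>Orbit spaces\<close>

text \<open>Phrased for a set \<open>K\<close> of transformations, with unit, inverses and products
  only up to their effect on points, so that it fits whole groups, subgroups and diagonal actions
  alike.\<close>

definition orbit_action :: "'x topology \<Rightarrow> ('k \<Rightarrow> 'x \<Rightarrow> 'x) \<Rightarrow> 'k set \<Rightarrow> bool" where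
  "orbit_action X act K \<longleftrightarrow> (\<forall>k\<in>K. continuous_map X X (act k)) \<and>
     (\<exists>e\<in>K. \<forall>x\<in>topspace X. act e x = x) \<and>
     (\<forall>k\<in>K. \<exists>k'\<in>K. \<forall>x\<in>topspace X. act k' (act k x) = x) \<and>
     (\<forall>k\<in>K. \<forall>k'\<in>K. \<exists>l\<in>K. \<forall>x\<in>topspace X. act k (act k' x) = act l x)"

context
  fixes X :: "'x topology" and act :: "'k \<Rightarrow> 'x \<Rightarrow> 'x" and K :: "'k set"
  assumes oa: "orbit_action X act K"
begin

lemma oa_closed: "k \<in> K \<Longrightarrow> x \<in> topspace X \<Longrightarrow> act k x \<in> topspace X"
proof -
  assume "k \<in> K" "x \<in> topspace X"
  moreover from this have "continuous_map X X (act k)" using oa unfolding orbit_action_def by blast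
  ultimately show "act k x \<in> topspace X" unfolding continuous_map_def by blast
qed

lemma oa_one: "\<exists>e\<in>K. \<forall>x\<in>topspace X. act e x = x"
  using oa unfolding orbit_action_def by blast

lemma oa_inv: "k \<in> K \<Longrightarrow> \<exists>k'\<in>K. \<forall>x\<in>topspace X. act k' (act k x) = x"
  using oa unfolding orbit_action_def by blast

lemma oa_mult: "k \<in> K \<Longrightarrow> k' \<in> K \<Longrightarrow> \<exists>l\<in>K. \<forall>x\<in>topspace X. act k (act k' x) = act l x"
  using oa unfolding orbit_action_def by blast

lemma orb_self: "x \<in> topspace X \<Longrightarrow> x \<in> orb act K x"
  using oa_one unfolding orb_def by (metis image_eqI)

lemma orb_act:
  assumes k: "k \<in> K" and x: "x \<in> topspace X"
  shows "orb act K (act k x) = orb act K x"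
proof (intro equalityI subsetI)
  fix z assume "z \<in> orb act K (act k x)"
  then obtain k' where k': "k' \<in> K" "z = act k' (act k x)" unfolding orb_def by blast
  obtain l where "l \<in> K" "act k' (act k x) = act l x" using oa_mult[OF k'(1) k] x by blast
  then show "z \<in> orb act K x" unfolding orb_def k'(2) by blast
next
  fix z assume "z \<in> orb act K x"
  then obtain k' where k': "k' \<in> K" "z = act k' x" unfolding orb_def by blast
  obtain j where j: "j \<in> K" "act j (act k x) = x" using oa_inv[OF k] x by blast
  obtain l where "l \<in> K" "act k' (act j (act k x)) = act l (act k x)"
    using oa_mult[OF k'(1) j(1)] oa_closed[OF k x] by blast
  then show "z \<in> orb act K (act k x)" unfolding orb_def k'(2) using j(2) by (metis image_eqI)
qed

lemma orb_eq_iff: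
  assumes x: "x \<in> topspace X" and x': "x' \<in> topspace X"
  shows "orb act K x = orb act K x' \<longleftrightarrow> (\<exists>k\<in>K. x' = act k x)"
proof
  assume "orb act K x = orb act K x'"
  then have "x' \<in> orb act K x" using orb_self[OF x'] by simp
  then show "\<exists>k\<in>K. x' = act k x" unfolding orb_def by blast
next
  assume "\<exists>k\<in>K. x' = act k x"
  then show "orb act K x = orb act K x'" using orb_act[OF _ x] by metis
qed

lemma topspace_orbit_space: "topspace (orbit_space X act K) = orb act K ` topspace X"
proof
  show "topspace (orbit_space X act K) \<subseteq> orb act K ` topspace X"
    using openin_topspace[of "orbit_space X act K"] unfolding openin_orbit_space by blast
  have "{x \<in> topspace X. orb act K x \<in> orb act K ` topspace X} = topspace X" by blast
  then have "openin (orbit_space X act K) (orb act K ` topspace X)"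
    unfolding openin_orbit_space by simp
  then show "orb act K ` topspace X \<subseteq> topspace (orbit_space X act K)" by (rule openin_subset)
qed

lemma continuous_map_orb: "continuous_map X (orbit_space X act K) (orb act K)"
  unfolding continuous_map_def topspace_orbit_space
proof (intro conjI allI impI)
  fix U assume "openin (orbit_space X act K) U"
  then show "openin X {x \<in> topspace X. orb act K x \<in> U}" unfolding openin_orbit_space by blast
qed blast

text \<open>The union of the orbits that meet an open set is a union of preimages of that set under
  the transformations.\<close>

lemma open_map_orb: "open_map X (orbit_space X act K) (orb act K)"
  unfolding open_map_def
proof (intro allI impI)
  fix U assume U: "openin X U"
  have UX: "U \<subseteq> topspace X" by (rule openin_subset[OF U])
  have "{x \<in> topspace X. orb act K x \<in> orb act K ` U} = (\<Union>k\<in>K. {x \<in> topspace X. act k x \<in> U})"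
  proof (intro equalityI subsetI)
    fix x assume "x \<in> {x \<in> topspace X. orb act K x \<in> orb act K ` U}"
    then obtain u where u: "x \<in> topspace X" "u \<in> U" "orb act K x = orb act K u" by blast
    then obtain k where "k \<in> K" "u = act k x" using orb_eq_iff[of x u] UX by blast
    then show "x \<in> (\<Union>k\<in>K. {x \<in> topspace X. act k x \<in> U})" using u by blast
  next
    fix x assume "x \<in> (\<Union>k\<in>K. {x \<in> topspace X. act k x \<in> U})"
    then obtain k where k: "k \<in> K" "x \<in> topspace X" "act k x \<in> U" by blast
    then have "orb act K x = orb act K (act k x)" using orb_act by simp
    then show "x \<in> {x \<in> topspace X. orb act K x \<in> orb act K ` U}" using k by blast
  qed
  moreover have "openin X (\<Union>k\<in>K. {x \<in> topspace X. act k x \<in> U})"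
  proof (rule openin_Union)
    fix T assume "T \<in> (\<lambda>k. {x \<in> topspace X. act k x \<in> U}) ` K"
    then obtain k where k: "k \<in> K" "T = {x \<in> topspace X. act k x \<in> U}" by blast
    have "continuous_map X X (act k)" using oa k(1) unfolding orbit_action_def by blast
    then show "openin X T" unfolding k(2) by (rule openin_continuous_map_preimage[OF _ U])
  qed
  ultimately show "openin (orbit_space X act K) (orb act K ` U)"
    unfolding openin_orbit_space using UX by auto
qed

lemma quotient_map_orb: "quotient_map X (orbit_space X act K) (orb act K)"
  by (rule continuous_open_imp_quotient_map[OF continuous_map_orb open_map_orb topspace_orbit_space[symmetric]])

text \<open>The covers are defined through \<open>the_elem\<close> of an image of an orbit; this
  evaluates them on representatives.\<close>

lemma the_elem_orb:
  assumes x: "x \<in> topspace X" and f: "\<And>k x. k \<in> K \<Longrightarrow> x \<in> topspace X \<Longrightarrow> f (act k x) = f x"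
  shows "the_elem (f ` orb act K x) = f x"
proof -
  have "f ` orb act K x = {f x}"
  proof (intro equalityI subsetI)
    fix y assume "y \<in> f ` orb act K x"
    then obtain k where "k \<in> K" "y = f (act k x)" unfolding orb_def by blast
    then show "y \<in> {f x}" using f x by simp
  next
    fix y assume "y \<in> {f x}"
    then show "y \<in> f ` orb act K x" using orb_self[OF x] by blast
  qed
  then show ?thesis by simp
qed

lemma continuous_map_from_orbit_space:
  assumes c: "continuous_map X Z f" and f: "\<And>k x. k \<in> K \<Longrightarrow> x \<in> topspace X \<Longrightarrow> f (act k x) = f x"
  shows "continuous_map (orbit_space X act K) Z (\<lambda>B. the_elem (f ` B))"
proof (rule continuous_compose_quotient_map[OF quotient_map_orb])
  show "continuous_map X Z ((\<lambda>B. the_elem (f ` B)) \<circ> orb act K)"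
    using c by (rule continuous_map_eq) (simp add: the_elem_orb[OF _ f])
qed

end

section \<open>Maps between covers of the same base\<close>

text \<open>After shrinking the base, \<open>p1\<close> maps each sheet of \<open>X1\<close> onto a
  single sheet of \<open>X2\<close>. Over one sheet of \<open>X2\<close>, the sheets of
  \<open>X1\<close> lying above it give the even cover.\<close>

lemma finite_cover_factor:
  assumes c1: "finite_cover X1 Y p" and c2: "finite_cover X2 Y p2"
    and p1: "continuous_map X1 X2 p1" and p: "\<And>x. x \<in> topspace X1 \<Longrightarrow> p2 (p1 x) = p x"
  shows "finite_cover X1 X2 p1"
  unfolding finite_cover_def
proof (intro conjI ballI p1)
  fix x2 assume x2: "x2 \<in> topspace X2"
  have p2c: "continuous_map X2 Y p2" and pc: "continuous_map X1 Y p" using c1 c2 by (simp_all add: finite_cover_def)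
  define y where "y = p2 x2"
  have y: "y \<in> topspace Y" using p2c x2 unfolding y_def continuous_map_def by blast
  obtain U1 S1 where U1: "y \<in> U1" "evenly_covered X1 Y p U1 S1" using c1 y unfolding finite_cover_def by blast
  obtain U2 S2 where U2: "y \<in> U2" "evenly_covered X2 Y p2 U2 S2" using c2 y unfolding finite_cover_def by blast
  define U where "U = U1 \<inter> U2"
  have oU: "openin Y U" unfolding U_def by (rule openin_Int[OF evenly_coveredD(1)[OF U1(2)] evenly_coveredD(1)[OF U2(2)]])
  have yU: "y \<in> U" using U1(1) U2(1) by (simp add: U_def)
  have e1: "evenly_covered X1 Y p U S1" by (rule evenly_covered_subset[OF U1(2) pc oU]) (simp add: U_def)
  have e2: "evenly_covered X2 Y p2 U S2" by (rule evenly_covered_subset[OF U2(2) p2c oU]) (simp add: U_def)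
  note D1 = evenly_coveredD[OF e1] and D2 = evenly_coveredD[OF e2]
  have x2U: "p2 x2 \<in> U" using yU by (simp add: y_def)
  obtain s2 where s2: "s2 \<in> S2" "x2 = s2 y" using D2(8)[OF x2 x2U] unfolding y_def by blast
  have pp: "p2 (p1 (s u)) = u" "p1 (s u) \<in> topspace X2" if "s \<in> S1" "u \<in> U" for s u
  proof -
    have "s u \<in> topspace X1" by (rule D1(9)[OF that])
    then show "p2 (p1 (s u)) = u" "p1 (s u) \<in> topspace X2"
      using p D1(6)[OF that] p1 unfolding continuous_map_def by auto
  qed
  have "\<exists>t\<in>S2. p1 (s y) = t y" if "s \<in> S1" for s
    using D2(8)[OF pp(2)[OF that yU]] pp(1)[OF that yU] yU by simp
  then obtain t where t: "\<And>s. s \<in> S1 \<Longrightarrow> t s \<in> S2 \<and> p1 (s y) = t s y" by metis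
  \<comment> \<open>The points over which \<open>p1\<close> still sends the sheet \<open>s\<close>
    into the sheet \<open>t s\<close> chosen at \<open>y\<close>; an open condition, as images of
    sections are open.\<close>
  define O' where "O' s = {u \<in> topspace (subtopology Y U). (p1 \<circ> s) u \<in> t s ` U}" for s
  have Oo: "openin Y (O' s)" if "s \<in> S1" for s
  proof -
    have "openin (subtopology Y U) (O' s)" unfolding O'_def
      using continuous_map_compose[OF D1(4)[OF that] p1] D2(5) t[OF that] by (intro openin_continuous_map_preimage) blast+
    then show ?thesis using oU by (rule openin_trans_full)
  qed
  have Ot: "p1 (s u) = t s u" if h: "s \<in> S1" "u \<in> U" "u \<in> O' s" for s u
  proof -
    obtain u' where u': "u' \<in> U" "p1 (s u) = t s u'" using h(3) unfolding O'_def by auto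
    have "u = u'" using pp(1)[OF h(1,2)] u' D2(6) t[OF h(1)] by metis
    with u' show ?thesis by simp
  qed
  define V where "V = U \<inter> (\<Inter>s\<in>S1. O' s)"
  have oV: "openin Y V"
  proof (cases "S1 = {}")
    case True then show ?thesis using oU by (simp add: V_def)
  next
    case False then show ?thesis unfolding V_def using oU D1(2) Oo by (intro openin_Int openin_INT2) auto
  qed
  have yO: "y \<in> O' s" if "s \<in> S1" for s
    unfolding O'_def using yU y t[OF that] by auto
  have yV: "y \<in> V" unfolding V_def using yU yO by blast
  have VU: "V \<subseteq> U" by (auto simp: V_def)
  have Vt: "p1 (s u) = t s u" if "s \<in> S1" "u \<in> V" for s u
    using Ot[OF that(1)] that unfolding V_def by blast
  have e1V: "evenly_covered X1 Y p V S1" by (rule evenly_covered_subset[OF U1(2) pc oV]) (use VU U_def in blast)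
  have e2V: "evenly_covered X2 Y p2 V S2" by (rule evenly_covered_subset[OF U2(2) p2c oV]) (use VU U_def in blast)
  note D1 = evenly_coveredD[OF e1V] and D2 = evenly_coveredD[OF e2V]
  \<comment> \<open>A section over the sheet \<open>s2\<close> goes down to the base by
    \<open>p2\<close> and up again along a sheet lying over \<open>s2\<close>.\<close>
  define S where "S = (\<lambda>s. s \<circ> p2) ` {s \<in> S1. t s = s2}"
  have im: "(s \<circ> p2) ` s2 ` V = s ` V" for s
    using D2(6)[OF s2(1)] by (auto simp: image_comp image_iff)
  have "evenly_covered X1 X2 p1 (s2 ` V) S"
  proof (rule evenly_coveredI)
    show "openin X2 (s2 ` V)" by (rule D2(5)[OF s2(1)])
    show "finite S" unfolding S_def using D1(2) by simp
    fix r assume "r \<in> S"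
    then obtain s where s: "s \<in> S1" "t s = s2" "r = s \<circ> p2" unfolding S_def by blast
    have "continuous_map (subtopology X2 (s2 ` V)) (subtopology Y V) p2"
      using p2c D2(6)[OF s2(1)] by (auto simp: continuous_map_in_subtopology continuous_map_from_subtopology)
    then show "continuous_map (subtopology X2 (s2 ` V)) X1 r"
      unfolding s(3) using D1(4)[OF s(1)] by (rule continuous_map_compose)
    show "openin X1 (r ` s2 ` V)" unfolding s(3) im by (rule D1(5)[OF s(1)])
    show "p1 (r x) = x" if x: "x \<in> s2 ` V" for x
    proof -
      obtain v where v: "v \<in> V" "x = s2 v" using x by blast
      show ?thesis unfolding s(3) v(2) using D2(6)[OF s2(1) v(1)] Vt[OF s(1) v(1)] s(2) by simp
    qed
    fix r' x assume "r' \<in> S" and x: "x \<in> s2 ` V" and eq: "r x = r' x"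
    then obtain s' where s': "s' \<in> S1" "r' = s' \<circ> p2" unfolding S_def by blast
    obtain v where v: "v \<in> V" "x = s2 v" using x by blast
    have "s v = s' v" using eq D2(6)[OF s2(1) v(1)] unfolding s(3) s'(2) v(2) by simp
    then have "s = s'" by (rule D1(7)[OF s(1) s'(1) v(1)])
    then show "r = r'" unfolding s(3) s'(2) by simp
  next
    fix x assume x: "x \<in> topspace X1" "p1 x \<in> s2 ` V"
    obtain v where v: "v \<in> V" "p1 x = s2 v" using x(2) by blast
    have "p x = v" using p[OF x(1)] v D2(6)[OF s2(1) v(1)] by simp
    then obtain s where s: "s \<in> S1" "x = s v" using D1(8)[OF x(1)] v(1) by auto
    have "t s v = s2 v" using Vt[OF s(1) v(1)] s(2) v(2) by simp
    then have "t s = s2" using D2(7)[OF _ s2(1) v(1)] t[OF s(1)] by blast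
    then have "s \<circ> p2 \<in> S" unfolding S_def using s(1) by blast
    moreover have "x = (s \<circ> p2) (p1 x)" using s(2) v D2(6)[OF s2(1) v(1)] by simp
    ultimately show "\<exists>r\<in>S. x = r (p1 x)" by blast
  qed
  moreover have "x2 \<in> s2 ` V" using yV s2(2) by blast
  ultimately show "\<exists>U S. x2 \<in> U \<and> evenly_covered X1 X2 p1 U S" by (intro exI conjI)
qed

text \<open>Fibres of \<open>p1\<close> are contained in fibres of \<open>p\<close>, so boxes
  separating the latter separate the former.\<close>

lemma box_embedding_factor:
  assumes c: "box_embedding X1 Y p c" and p2: "continuous_map X2 Y p2"
    and p: "\<And>x. x \<in> topspace X1 \<Longrightarrow> p2 (p1 x) = p x" and p1: "continuous_map X1 X2 p1"
  shows "box_embedding X1 X2 p1 c"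
proof (rule box_embeddingI)
  note D = box_embeddingD[OF c]
  show "strict_mono (c x i)" if "x \<in> topspace X1" for x i by (rule D(1)[OF that])
  show "jcont X1 (\<lambda>x. c x i)" for i by (rule D(2))
  show "\<exists>i. range (c x i) \<inter> range (c x' i) = {}"
    if "x \<in> topspace X1" "x' \<in> topspace X1" "x \<noteq> x'" "p1 x = p1 x'" for x x'
    using D(3)[OF that(1-3)] p[OF that(1)] p[OF that(2)] that(4) by simp
  fix y assume y: "y \<in> topspace X2"
  then have "p2 y \<in> topspace Y" using p2 unfolding continuous_map_def by blast
  then obtain U n where U: "openin Y U" "p2 y \<in> U"
    "\<And>x i. x \<in> topspace X1 \<Longrightarrow> p x \<in> U \<Longrightarrow> n \<le> i \<Longrightarrow> c x i = id"
    using box_embedding_bound[OF c] by metis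
  have "openin X2 {x \<in> topspace X2. p2 x \<in> U}" by (rule openin_continuous_map_preimage[OF p2 U(1)])
  then show "\<exists>V n. openin X2 V \<and> y \<in> V \<and> (\<forall>x\<in>topspace X1. p1 x \<in> V \<longrightarrow> (\<forall>i\<ge>n. c x i = id))"
    using y U(2,3) p by (intro exI[of _ "{x \<in> topspace X2. p2 x \<in> U}"] exI[of _ n]) simp
qed

section \<open>Finite group sets and principal actions with bump functions\<close>

definition finite_gset :: "('k, 'm) monoid_scheme \<Rightarrow> ('k \<Rightarrow> 'z \<Rightarrow> 'z) \<Rightarrow> 'z set \<Rightarrow> bool" where
  "finite_gset K act F \<longleftrightarrow> finite F \<and> (\<forall>k\<in>carrier K. \<forall>z\<in>F. act k z \<in> F) \<and>
     (\<forall>z\<in>F. act \<one>\<^bsub>K\<^esub> z = z) \<and>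
     (\<forall>k\<in>carrier K. \<forall>k'\<in>carrier K. \<forall>z\<in>F. act (k \<otimes>\<^bsub>K\<^esub> k') z = act k (act k' z))"

lemma finite_gsetD:
  assumes "finite_gset K act F"
  shows "finite F" "\<And>k z. k \<in> carrier K \<Longrightarrow> z \<in> F \<Longrightarrow> act k z \<in> F"
    "\<And>z. z \<in> F \<Longrightarrow> act \<one>\<^bsub>K\<^esub> z = z"
    "\<And>k k' z. k \<in> carrier K \<Longrightarrow> k' \<in> carrier K \<Longrightarrow> z \<in> F \<Longrightarrow> act (k \<otimes>\<^bsub>K\<^esub> k') z = act k (act k' z)"
  using assms by (simp_all add: finite_gset_def)

lemma finite_gset_inv:
  assumes "group K" "finite_gset K act F" "k \<in> carrier K" "z \<in> F"
  shows "act (inv\<^bsub>K\<^esub> k) (act k z) = z" "act k (act (inv\<^bsub>K\<^esub> k) z) = z"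
proof -
  interpret group K by fact
  note D = finite_gsetD[OF assms(2)]
  have "act (inv\<^bsub>K\<^esub> k) (act k z) = act (inv\<^bsub>K\<^esub> k \<otimes>\<^bsub>K\<^esub> k) z"
    using D(4)[of "inv\<^bsub>K\<^esub> k" k z] assms(3,4) by simp
  then show "act (inv\<^bsub>K\<^esub> k) (act k z) = z" using assms(3,4) D(3) by simp
  have "act k (act (inv\<^bsub>K\<^esub> k) z) = act (k \<otimes>\<^bsub>K\<^esub> inv\<^bsub>K\<^esub> k) z"
    using D(4)[of k "inv\<^bsub>K\<^esub> k" z] assms(3,4) by simp
  then show "act k (act (inv\<^bsub>K\<^esub> k) z) = z" using assms(3,4) D(3) by simp
qed

text \<open>An increasing embedding of the line into the open interval from \<open>j\<close> to
  \<open>j + 1\<close>, so different numbers give disjoint boxes.\<close>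

definition unit_box :: "nat \<Rightarrow> real \<Rightarrow> real" where
  "unit_box j s = real j + (1 / 2 + arctan s / pi)"

lemma strict_mono_unit_box: "strict_mono (unit_box j)"
  by (rule strict_monoI) (simp add: unit_box_def arctan_less_iff divide_strict_right_mono)

lemma unit_box_bounds: "real j < unit_box j s" "unit_box j s < real j + 1"
proof -
  have "- (pi / 2) < arctan s" "arctan s < pi / 2" using arctan_bounded by auto
  then have "- (1 / 2) < arctan s / pi" "arctan s / pi < 1 / 2"
    by (simp_all add: pos_less_divide_eq pos_divide_less_eq)
  then show "real j < unit_box j s" "unit_box j s < real j + 1" unfolding unit_box_def by linarith+
qed

lemma unit_box_disjoint: "j \<noteq> l \<Longrightarrow> range (unit_box j) \<inter> range (unit_box l) = {}"
proof -
  assume "j \<noteq> l"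
  then have "real j + 1 \<le> real l \<or> real l + 1 \<le> real j" by linarith
  then have "unit_box j s \<noteq> unit_box l t" for s t
    using unit_box_bounds[of j s] unit_box_bounds[of l t] by linarith
  then show ?thesis by blast
qed

text \<open>An axiomatic universal cover. Freeness is encoded in \<open>bump_sep\<close> together
  with \<open>bump_cover\<close>: near every orbit some bump function is positive on exactly one
  translate. The bump functions provide both the local sections of \<open>q\<close> and the
  boxes.\<close>

locale principal_action = group K for K :: "('k, 'm) monoid_scheme" (structure) +
  fixes W :: "'w topology" and actW :: "'k \<Rightarrow> 'w \<Rightarrow> 'w" and Y :: "'y topology" and q :: "'w \<Rightarrow> 'y"
    and bump :: "nat \<Rightarrow> 'w \<Rightarrow> real"
  assumes fin: "finite (carrier K)"
    and actW_cont: "\<And>k. k \<in> carrier K \<Longrightarrow> continuous_map W W (actW k)"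
    and actW_one: "\<And>w. w \<in> topspace W \<Longrightarrow> actW \<one> w = w"
    and actW_mult: "\<And>k k' w. k \<in> carrier K \<Longrightarrow> k' \<in> carrier K \<Longrightarrow> w \<in> topspace W \<Longrightarrow> actW (k \<otimes> k') w = actW k (actW k' w)"
    and metr: "metrizable_space W"
    and q_cont: "continuous_map W Y q" and q_open: "open_map W Y q" and q_surj: "q ` topspace W = topspace Y"
    and q_eq: "\<And>w w'. w \<in> topspace W \<Longrightarrow> w' \<in> topspace W \<Longrightarrow> q w = q w' \<longleftrightarrow> (\<exists>k\<in>carrier K. w' = actW k w)"
    and bump_cont: "\<And>n. continuous_map W euclideanreal (bump n)"
    and bump_nonneg: "\<And>n w. 0 \<le> bump n w"
    and bump_sep: "\<And>n k w. w \<in> topspace W \<Longrightarrow> k \<in> carrier K \<Longrightarrow> 0 < bump n w \<Longrightarrow> 0 < bump n (actW k w) \<Longrightarrow> k = \<one>"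
    and bump_cover: "\<And>w. w \<in> topspace W \<Longrightarrow> \<exists>n. \<exists>k\<in>carrier K. 0 < bump n (actW k w)"
    and bump_finite: "\<And>w. w \<in> topspace W \<Longrightarrow> \<exists>V N. openin W V \<and> w \<in> V \<and> (\<forall>v\<in>V. \<forall>n\<ge>N. bump n v = 0)"
begin

abbreviation total :: "'z set \<Rightarrow> ('w \<times> 'z) topology" where
  "total F \<equiv> prod_topology W (discrete_topology F)"

abbreviation diag :: "('k \<Rightarrow> 'z \<Rightarrow> 'z) \<Rightarrow> 'k \<Rightarrow> 'w \<times> 'z \<Rightarrow> 'w \<times> 'z" where
  "diag act \<equiv> (\<lambda>k x. (actW k (fst x), act k (snd x)))"

abbreviation hoq :: "('k \<Rightarrow> 'z \<Rightarrow> 'z) \<Rightarrow> 'z set \<Rightarrow> ('w \<times> 'z) set topology" where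
  "hoq act F \<equiv> orbit_space (total F) (diag act) (carrier K)"

abbreviation cls :: "('k \<Rightarrow> 'z \<Rightarrow> 'z) \<Rightarrow> 'w \<times> 'z \<Rightarrow> ('w \<times> 'z) set" where
  "cls act \<equiv> orb (diag act) (carrier K)"

text \<open>Written so that it unfolds to the projection in
  \<open>tr_homotopy_orbits\<close>.\<close>

definition pr :: "('w \<times> 'z) set \<Rightarrow> 'y" where
  "pr B = the_elem ((q \<circ> fst) ` B)"

lemma actW_closed: "k \<in> carrier K \<Longrightarrow> w \<in> topspace W \<Longrightarrow> actW k w \<in> topspace W"
  using actW_cont unfolding continuous_map_def by blast

lemma actW_inv:
  assumes "k \<in> carrier K" "w \<in> topspace W"
  shows "actW (inv k) (actW k w) = w" "actW k (actW (inv k) w) = w"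
  using actW_mult[of "inv k" k w] actW_mult[of k "inv k" w] assms actW_one by simp_all

lemma q_act: "k \<in> carrier K \<Longrightarrow> w \<in> topspace W \<Longrightarrow> q (actW k w) = q w"
  using q_eq[of w "actW k w"] actW_closed by metis

lemma orbit_action_total:
  assumes F: "finite_gset K act F"
  shows "orbit_action (total F) (diag act) (carrier K)"
  unfolding orbit_action_def
proof (intro conjI ballI)
  note D = finite_gsetD[OF F]
  fix k assume k: "k \<in> carrier K"
  have "continuous_map (total F) W (\<lambda>x. actW k (fst x))"
    using continuous_map_compose[OF continuous_map_fst actW_cont[OF k]] by (simp add: o_def)
  moreover have "continuous_map (discrete_topology F) (discrete_topology F) (act k)"
    using D(2)[OF k] by (simp add: Pi_iff)
  from continuous_map_compose[OF continuous_map_snd this]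
  have "continuous_map (total F) (discrete_topology F) (\<lambda>x. act k (snd x))" by (simp add: o_def)
  ultimately show "continuous_map (total F) (total F) (diag act k)" by (simp add: continuous_map_pairwise o_def)
  show "\<exists>k'\<in>carrier K. \<forall>x\<in>topspace (total F). diag act k' (diag act k x) = x"
    using finite_gset_inv(1)[OF is_group F k] actW_inv(1)[OF k] k
    by (intro bexI[of _ "inv k"]) (simp_all add: mem_Times_iff)
  fix k' assume k': "k' \<in> carrier K"
  show "\<exists>l\<in>carrier K. \<forall>x\<in>topspace (total F). diag act k (diag act k' x) = diag act l x"
    using D(4)[OF k k'] actW_mult[OF k k'] k k'
    by (intro bexI[of _ "k \<otimes> k'"]) (simp_all add: mem_Times_iff)
next
  show "\<exists>e\<in>carrier K. \<forall>x\<in>topspace (total F). diag act e x = x"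
    using finite_gsetD(3)[OF F] actW_one by (intro bexI[of _ \<one>]) (simp_all add: mem_Times_iff)
qed

lemma orbit_action_subgroup:
  assumes S: "subgroup S K"
  shows "orbit_action W actW S"
  unfolding orbit_action_def
proof (intro conjI ballI)
  note sc = subgroup.mem_carrier[OF S]
  fix k assume k: "k \<in> S"
  show "continuous_map W W (actW k)" by (rule actW_cont[OF sc[OF k]])
  show "\<exists>k'\<in>S. \<forall>x\<in>topspace W. actW k' (actW k x) = x"
    using actW_inv(1)[OF sc[OF k]] subgroup.m_inv_closed[OF S k] by blast
  fix k' assume k': "k' \<in> S"
  show "\<exists>l\<in>S. \<forall>x\<in>topspace W. actW k (actW k' x) = actW l x"
    using actW_mult[OF sc[OF k] sc[OF k']] subgroup.m_closed[OF S k k'] by metis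
next
  show "\<exists>e\<in>S. \<forall>x\<in>topspace W. actW e x = x"
    using subgroup.one_closed[OF S] actW_one by blast
qed

context
  fixes act :: "'k \<Rightarrow> 'z \<Rightarrow> 'z" and F :: "'z set"
  assumes F: "finite_gset K act F"
begin

lemmas oaF = orbit_action_total[OF F]

lemma topspace_hoq: "topspace (hoq act F) = cls act ` (topspace W \<times> F)"
  using topspace_orbit_space[OF oaF] by simp

lemma cls_eq_iff:
  assumes "w \<in> topspace W" "z \<in> F" "w' \<in> topspace W" "z' \<in> F"
  shows "cls act (w, z) = cls act (w', z') \<longleftrightarrow> (\<exists>k\<in>carrier K. w' = actW k w \<and> z' = act k z)"
  using orb_eq_iff[OF oaF, of "(w, z)" "(w', z')"] assms by simp

lemma cls_act:
  assumes "k \<in> carrier K" "w \<in> topspace W" "z \<in> F"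
  shows "cls act (actW k w, act k z) = cls act (w, z)"
  using orb_act[OF oaF assms(1), of "(w, z)"] assms(2,3) by simp

lemma pr_cls: "w \<in> topspace W \<Longrightarrow> z \<in> F \<Longrightarrow> pr (cls act (w, z)) = q w"
  unfolding pr_def using the_elem_orb[OF oaF, of "(w, z)" "q \<circ> fst"] q_act by (simp add: mem_Times_iff)

lemma pr_continuous: "continuous_map (hoq act F) Y pr"
proof -
  have "continuous_map (total F) Y (q \<circ> fst)" by (rule continuous_map_compose[OF continuous_map_fst q_cont])
  then show ?thesis unfolding pr_def[abs_def]
    by (rule continuous_map_from_orbit_space[OF oaF]) (simp add: q_act mem_Times_iff)
qed

lemma hoqE:
  assumes "B \<in> topspace (hoq act F)"
  obtains w z where "w \<in> topspace W" "z \<in> F" "B = cls act (w, z)"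
  using assms unfolding topspace_hoq by blast

text \<open>Translating a representative moves its first coordinate to any prescribed point
  \<open>w\<close> over the same base point, so the fibre consists of the classes of
  \<open>(w, z)\<close> with \<open>z\<close> in \<open>F\<close>.\<close>

lemma cls_fibre:
  assumes B: "B \<in> topspace (hoq act F)" and w: "w \<in> topspace W" and q: "pr B = q w"
  obtains z where "z \<in> F" "B = cls act (w, z)"
proof -
  obtain w' z' where wz: "w' \<in> topspace W" "z' \<in> F" "B = cls act (w', z')" using hoqE[OF B] by blast
  have "q w' = q w" using q pr_cls[OF wz(1,2)] wz(3) by simp
  then obtain k where k: "k \<in> carrier K" "w = actW k w'" using q_eq[OF wz(1) w] by blast
  show thesis
    by (rule that[of "act k z'"]) (use k wz cls_act finite_gsetD(2)[OF F] in simp_all)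
qed

lemma open_map_cls: "open_map (total F) (hoq act F) (cls act)"
  by (rule open_map_orb[OF oaF])

lemma continuous_map_cls: "continuous_map (total F) (hoq act F) (cls act)"
  by (rule continuous_map_orb[OF oaF])

text \<open>Where a bump function is positive, \<open>q\<close> is injective by
  \<open>bump_sep\<close> and open, so it has a continuous section \<open>\<sigma>\<close> there.
  The sheets are the classes of \<open>(\<sigma> u, z)\<close> for \<open>z\<close> in
  \<open>F\<close>, distinct again by \<open>bump_sep\<close>.\<close>

lemma finite_cover_hoq: "finite_cover (hoq act F) Y pr"
  unfolding finite_cover_def
proof (intro conjI ballI pr_continuous)
  note D = finite_gsetD[OF F]
  fix y assume "y \<in> topspace Y"
  then obtain w0 where w0: "w0 \<in> topspace W" "y = q w0" using q_surj by blast
  obtain n k0 where nk: "k0 \<in> carrier K" "0 < bump n (actW k0 w0)" using bump_cover[OF w0(1)] by blast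
  define V where "V = {v \<in> topspace W. bump n v \<in> {0<..}}"
  have Vo: "openin W V" unfolding V_def
    by (rule openin_continuous_map_preimage[OF bump_cont]) simp
  have VW: "V \<subseteq> topspace W" by (auto simp: V_def)
  have inj: "inj_on q V"
  proof (rule inj_onI)
    fix v v' assume v: "v \<in> V" "v' \<in> V" "q v = q v'"
    then obtain k where k: "k \<in> carrier K" "v' = actW k v" using q_eq[of v v'] VW by blast
    have "k = \<one>" using bump_sep[of v k n] v k by (simp add: V_def)
    then show "v = v'" using k(2) actW_one v(1) VW by auto
  qed
  define U where "U = q ` V"
  have Uo: "openin Y U" unfolding U_def using q_open Vo unfolding open_map_def by blast
  define \<sigma> where "\<sigma> = inv_into V q"
  have sV: "\<sigma> u \<in> V" "q (\<sigma> u) = u" if "u \<in> U" for u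
    using that unfolding \<sigma>_def U_def by (simp_all add: inv_into_into f_inv_into_f)
  have sq: "\<sigma> (q v) = v" if "v \<in> V" for v
    using that inj unfolding \<sigma>_def by (simp add: inv_into_f_f)
  have sc: "continuous_map (subtopology Y U) W \<sigma>"
    unfolding continuous_map_def
  proof (intro conjI allI impI)
    show "\<sigma> \<in> topspace (subtopology Y U) \<rightarrow> topspace W"
    proof
      fix u assume "u \<in> topspace (subtopology Y U)"
      then have "u \<in> U" by simp
      from sV(1)[OF this] show "\<sigma> u \<in> topspace W" using VW by blast
    qed
    fix T assume T: "openin W T"
    have "{u \<in> topspace (subtopology Y U). \<sigma> u \<in> T} = q ` (V \<inter> T)"
    proof (intro equalityI subsetI)
      fix u assume "u \<in> {u \<in> topspace (subtopology Y U). \<sigma> u \<in> T}"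
      then have "u \<in> U" "\<sigma> u \<in> T" by auto
      then show "u \<in> q ` (V \<inter> T)" using sV[of u] by (intro image_eqI[of _ _ "\<sigma> u"]) auto
    next
      fix u assume "u \<in> q ` (V \<inter> T)"
      then obtain v where v: "v \<in> V" "v \<in> T" "u = q v" by blast
      then have "u \<in> U" unfolding U_def by blast
      moreover have "u \<in> topspace Y" using openin_subset[OF Uo] calculation by blast
      ultimately show "u \<in> {u \<in> topspace (subtopology Y U). \<sigma> u \<in> T}" using v sq by simp
    qed
    moreover have "openin Y (q ` (V \<inter> T))" using q_open Vo T unfolding open_map_def by blast
    moreover have "q ` (V \<inter> T) \<subseteq> U" unfolding U_def by blast
    ultimately show "openin (subtopology Y U) {u \<in> topspace (subtopology Y U). \<sigma> u \<in> T}"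
      by (metis Uo openin_open_subtopology)
  qed
  have sW: "\<sigma> u \<in> topspace W" if "u \<in> U" for u using sV(1)[OF that] VW by blast
  define S where "S = (\<lambda>z u. cls act (\<sigma> u, z)) ` F"
  have "evenly_covered (hoq act F) Y pr U S"
  proof (rule evenly_coveredI)
    show "openin Y U" by (rule Uo)
    show "finite S" unfolding S_def using D(1) by simp
    fix s assume "s \<in> S"
    then obtain z where z: "z \<in> F" "s = (\<lambda>u. cls act (\<sigma> u, z))" unfolding S_def by blast
    have "continuous_map (subtopology Y U) (total F) (\<lambda>u. (\<sigma> u, z))"
      using sc z(1) by (simp add: continuous_map_pairwise o_def)
    from continuous_map_compose[OF this continuous_map_cls]
    show "continuous_map (subtopology Y U) (hoq act F) s" unfolding z(2) by (simp add: o_def)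
    have "s ` U = cls act ` (V \<times> {z})"
    proof (intro equalityI subsetI)
      fix B assume "B \<in> s ` U"
      then obtain u where "u \<in> U" "B = s u" by blast
      then show "B \<in> cls act ` (V \<times> {z})" unfolding z(2) using sV(1) by blast
    next
      fix B assume "B \<in> cls act ` (V \<times> {z})"
      then obtain v where v: "v \<in> V" "B = cls act (v, z)" by blast
      then have "q v \<in> U" "B = s (q v)" unfolding z(2) U_def using sq by auto
      then show "B \<in> s ` U" by blast
    qed
    moreover have "openin (total F) (V \<times> {z})" using Vo z(1) by (simp add: openin_prod_Times_iff)
    then have "openin (hoq act F) (cls act ` (V \<times> {z}))"
      by (rule open_map_cls[unfolded open_map_def, rule_format])
    ultimately show "openin (hoq act F) (s ` U)" by simp
    show "pr (s u) = u" if "u \<in> U" for u unfolding z(2) using pr_cls[OF sW[OF that] z(1)] sV(2)[OF that] by simp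
    fix s' u assume "s' \<in> S" and u: "u \<in> U" and eq: "s u = s' u"
    then obtain z' where z': "z' \<in> F" "s' = (\<lambda>u. cls act (\<sigma> u, z'))" unfolding S_def by blast
    obtain k where k: "k \<in> carrier K" "\<sigma> u = actW k (\<sigma> u)" "z' = act k z"
      using eq cls_eq_iff[OF sW[OF u] z(1) sW[OF u] z'(1)] unfolding z(2) z'(2) by blast
    have "0 < bump n (\<sigma> u)" using sV(1)[OF u] by (simp add: V_def)
    then have "k = \<one>" using bump_sep[OF sW[OF u] k(1), of n] k(2) by simp
    then show "s = s'" unfolding z(2) z'(2) using k(3) D(3)[OF z(1)] by simp
  next
    fix B assume B: "B \<in> topspace (hoq act F)" "pr B \<in> U"
    have "pr B = q (\<sigma> (pr B))" using sV(2)[OF B(2)] by simp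
    from cls_fibre[OF B(1) sW[OF B(2)] this] obtain z where z: "z \<in> F" "B = cls act (\<sigma> (pr B), z)" by blast
    have S: "(\<lambda>u. cls act (\<sigma> u, z)) \<in> S" unfolding S_def using z(1) by (rule imageI)
    show "\<exists>s\<in>S. B = s (pr B)"
      using z(2) S by (rule bexI[of "\<lambda>s. B = s (pr B)" "\<lambda>u. cls act (\<sigma> u, z)"])
  qed
  moreover have "y \<in> U"
  proof -
    have "actW k0 w0 \<in> V" using nk actW_closed[OF nk(1) w0(1)] by (simp add: V_def)
    then show ?thesis unfolding U_def using q_act[OF nk(1) w0(1)] w0(2) by (metis image_eqI)
  qed
  ultimately show "\<exists>U S. y \<in> U \<and> evenly_covered (hoq act F) Y pr U S" by (intro exI conjI)
qed

lemma metrizable_total: "metrizable_space (total F)"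
  using metr by (simp add: metrizable_space_prod_topology metrizable_space_discrete_topology)

lemma locally_k_hoq: "locally_k (hoq act F)"
  by (rule locally_k_open_image[OF metrizable_total continuous_map_cls open_map_cls topspace_orbit_space[OF oaF, symmetric]])

end

lemma locally_k_base: "locally_k Y" "locally_k (cyl Y)"
  by (rule locally_k_open_image[OF metr q_cont q_open q_surj], rule locally_k_cyl_open_image[OF metr q_cont q_open q_surj])

end

section \<open>Box embeddings from bump functions\<close>

context principal_action
begin

definition bump_total :: "nat \<Rightarrow> 'w \<Rightarrow> real" where
  "bump_total n w = (\<Sum>k\<in>carrier K. bump n (actW k w))"

text \<open>An invariant average of the \<open>bump_total n\<close> with weights 1/2, 1/4, and so
  on. At each point only finitely many terms are nonzero and their weights add up to less than 1, so
  some \<open>bump_total n\<close> reaches the average.\<close>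

definition bump_weight :: "'w \<Rightarrow> real" where
  "bump_weight w = (\<Sum>n. bump_total n w / 2 ^ Suc n)"

text \<open>Normalised so that on every orbit at least one switch is fully on, which
  \<open>switch_attained\<close> confirms.\<close>

definition switch :: "nat \<Rightarrow> 'w \<Rightarrow> real" where
  "switch n w = min 1 (bump n w / bump_weight w)"

lemma bump_total_cont: "continuous_map W euclideanreal (bump_total n)"
  unfolding bump_total_def[abs_def]
proof (rule continuous_map_sum[OF fin])
  fix k assume "k \<in> carrier K"
  from continuous_map_compose[OF actW_cont[OF this] bump_cont]
  show "continuous_map W euclideanreal (\<lambda>w. bump n (actW k w))" by (simp add: o_def)
qed

lemma bump_total_nonneg: "0 \<le> bump_total n w"
  unfolding bump_total_def by (intro sum_nonneg bump_nonneg)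

lemma bij_mult_right: "k \<in> carrier K \<Longrightarrow> bij_betw (\<lambda>j. j \<otimes> k) (carrier K) (carrier K)"
proof -
  assume k: "k \<in> carrier K"
  show ?thesis
    by (rule bij_betw_byWitness[where f'="\<lambda>j. j \<otimes> inv k"]) (use k in \<open>auto simp: m_assoc\<close>)
qed

lemma bump_total_act:
  assumes k: "k \<in> carrier K" and w: "w \<in> topspace W"
  shows "bump_total n (actW k w) = bump_total n w"
proof -
  have "bump_total n (actW k w) = (\<Sum>j\<in>carrier K. bump n (actW (j \<otimes> k) w))"
    unfolding bump_total_def by (rule sum.cong) (simp_all add: actW_mult k w)
  also have "\<dots> = bump_total n w"
    unfolding bump_total_def by (rule sum.reindex_bij_betw[OF bij_mult_right[OF k]])
  finally show ?thesis .
qed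

lemma bump_total_finite:
  assumes w: "w \<in> topspace W"
  shows "\<exists>V N. openin W V \<and> w \<in> V \<and> (\<forall>v\<in>V. \<forall>n\<ge>N. \<forall>k\<in>carrier K. bump n (actW k v) = 0)"
proof -
  define Q where "Q k V N \<longleftrightarrow> openin W V \<and> actW k w \<in> V \<and> (\<forall>v\<in>V. \<forall>n\<ge>N. bump n v = 0)" for k V and N :: nat
  have "\<exists>V N. Q k V N" if "k \<in> carrier K" for k
    unfolding Q_def by (rule bump_finite[OF actW_closed[OF that w]])
  then obtain V N where VN: "\<And>k. k \<in> carrier K \<Longrightarrow> Q k (V k) (N k)" by metis
  let ?T = "\<lambda>k. {v \<in> topspace W. actW k v \<in> V k}"
  have oT: "openin W (?T k)" if "k \<in> carrier K" for k
    using VN[OF that] unfolding Q_def by (intro openin_continuous_map_preimage[OF actW_cont[OF that]]) simp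
  have "openin W (\<Inter>k\<in>carrier K. ?T k)"
    by (rule openin_INT2[OF fin]) (use oT in auto)
  moreover have "w \<in> (\<Inter>k\<in>carrier K. ?T k)" using VN w unfolding Q_def by simp
  moreover have "\<forall>v\<in>(\<Inter>k\<in>carrier K. ?T k). \<forall>n\<ge>(\<Sum>k\<in>carrier K. N k). \<forall>k\<in>carrier K. bump n (actW k v) = 0"
  proof (intro ballI allI impI)
    fix v n k assume v: "v \<in> (\<Inter>k\<in>carrier K. ?T k)" and n: "(\<Sum>k\<in>carrier K. N k) \<le> n" and k: "k \<in> carrier K"
    have "N k \<le> n" using member_le_sum[OF k, of N] fin n by simp
    moreover have "actW k v \<in> V k" using v k by simp
    ultimately show "bump n (actW k v) = 0" using VN[OF k] unfolding Q_def by simp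
  qed
  ultimately show ?thesis by (intro exI conjI)
qed

lemma bump_weight_eq:
  assumes "\<And>n k. N \<le> n \<Longrightarrow> k \<in> carrier K \<Longrightarrow> bump n (actW k w) = 0"
  shows "bump_weight w = (\<Sum>n<N. bump_total n w / 2 ^ Suc n)"
  unfolding bump_weight_def
proof (rule suminf_finite)
  fix n assume "n \<notin> {..<N}"
  then have "bump_total n w = 0" unfolding bump_total_def by (intro sum.neutral ballI assms) simp_all
  then show "bump_total n w / 2 ^ Suc n = 0" by simp
qed simp

lemma bump_weight_cont: "continuous_map W euclideanreal bump_weight"
proof -
  have "\<forall>w\<in>topspace W. \<exists>V N. openin W V \<and> w \<in> V \<and> (\<forall>v\<in>V. \<forall>n\<ge>N. \<forall>k\<in>carrier K. bump n (actW k v) = 0)"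
    using bump_total_finite by simp
  then obtain V N where VN: "\<forall>w\<in>topspace W. openin W (V w) \<and> w \<in> V w \<and> (\<forall>v\<in>V w. \<forall>n\<ge>N w. \<forall>k\<in>carrier K. bump n (actW k v) = 0)"
    by (elim bchoice[THEN exE] bchoice[THEN exE, rotated]) metis
  have eq: "bump_weight v = (\<Sum>n<N w. bump_total n v / 2 ^ Suc n)" if "w \<in> topspace W" "v \<in> V w" for w v
    using VN that by (intro bump_weight_eq) simp
  show ?thesis
  proof (rule pasting_lemma[where I="topspace W" and T=V and f="\<lambda>w v. \<Sum>n<N w. bump_total n v / 2 ^ Suc n"])
    fix w assume w: "w \<in> topspace W"
    show "openin W (V w)" using VN w by simp
    have "continuous_map W euclideanreal (\<lambda>v. \<Sum>n<N w. bump_total n v / 2 ^ Suc n)"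
      by (intro continuous_map_sum continuous_map_real_divide bump_total_cont) simp_all
    then show "continuous_map (subtopology W (V w)) euclideanreal (\<lambda>v. \<Sum>n<N w. bump_total n v / 2 ^ Suc n)"
      by (rule continuous_map_from_subtopology)
    show "\<exists>j. j \<in> topspace W \<and> w \<in> V j \<and> bump_weight w = (\<Sum>n<N j. bump_total n w / 2 ^ Suc n)"
      using eq[OF w] VN w by (intro exI[of _ w]) simp
  next
    fix i j x assume "i \<in> topspace W" "j \<in> topspace W" "x \<in> topspace W \<inter> V i \<inter> V j"
    then show "(\<Sum>n<N i. bump_total n x / 2 ^ Suc n) = (\<Sum>n<N j. bump_total n x / 2 ^ Suc n)"
      using eq[of i x] eq[of j x] by simp
  qed
qed

lemma bump_weight_act: "k \<in> carrier K \<Longrightarrow> w \<in> topspace W \<Longrightarrow> bump_weight (actW k w) = bump_weight w"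
  unfolding bump_weight_def by (simp add: bump_total_act)

lemma sum_halves: "(\<Sum>n<N. 1 / 2 ^ Suc n) = 1 - 1 / (2::real) ^ N"
  by (induction N) (simp_all add: field_simps)

text \<open>If every \<open>bump_total n\<close> stayed below the average, a finite sum with total
  weight \<open>1 - 1 / 2 ^ N\<close> could not reach it.\<close>

lemma bump_weight_pos_attained:
  assumes w: "w \<in> topspace W"
  shows "0 < bump_weight w" "\<exists>n. bump_weight w \<le> bump_total n w"
proof -
  obtain V N where VN: "w \<in> V" "\<And>v n k. v \<in> V \<Longrightarrow> N \<le> n \<Longrightarrow> k \<in> carrier K \<Longrightarrow> bump n (actW k v) = 0"
    using bump_total_finite[OF w] by metis
  have eq: "bump_weight w = (\<Sum>n<N. bump_total n w / 2 ^ Suc n)"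
    by (rule bump_weight_eq[OF VN(2)[OF VN(1)]])
  obtain n k where nk: "k \<in> carrier K" "0 < bump n (actW k w)" using bump_cover[OF w] by blast
  have nN: "n < N"
  proof (rule ccontr)
    assume "\<not> n < N"
    then have "bump n (actW k w) = 0" using VN(2)[OF VN(1) _ nk(1)] by simp
    with nk(2) show False by simp
  qed
  have "bump n (actW k w) \<le> bump_total n w"
    unfolding bump_total_def by (rule member_le_sum[OF nk(1)]) (simp_all add: bump_nonneg fin)
  then have "0 < bump_total n w / 2 ^ Suc n" using nk(2) by simp
  also have "\<dots> \<le> (\<Sum>n<N. bump_total n w / 2 ^ Suc n)"
    by (rule member_le_sum[of n]) (simp_all add: nN bump_total_nonneg)
  finally show pos: "0 < bump_weight w" using eq by simp
  show "\<exists>n. bump_weight w \<le> bump_total n w"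
  proof (rule ccontr)
    assume "\<not> ?thesis"
    then have "bump_total n w \<le> bump_weight w" for n by (meson less_imp_le not_le)
    then have "(\<Sum>n<N. bump_total n w / 2 ^ Suc n) \<le> (\<Sum>n<N. bump_weight w * (1 / 2 ^ Suc n))"
      by (intro sum_mono) (simp add: divide_right_mono)
    also have "\<dots> = bump_weight w * (1 - 1 / 2 ^ N)"
      unfolding sum_distrib_left[symmetric] sum_halves ..
    also have "\<dots> < bump_weight w * 1" using pos by (intro mult_strict_left_mono) simp_all
    finally show False using eq by simp
  qed
qed

lemma switch_bounds: "w \<in> topspace W \<Longrightarrow> 0 \<le> switch n w" "switch n w \<le> 1"
  unfolding switch_def using bump_weight_pos_attained(1)[of w] bump_nonneg[of n w] by simp_all

lemma switch_cont: "continuous_map W euclideanreal (switch n)"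
proof -
  have ne: "bump_weight w \<noteq> 0" if "w \<in> topspace W" for w
    using bump_weight_pos_attained(1)[OF that] by simp
  have "continuous_map W euclideanreal (\<lambda>w. bump n w / bump_weight w)"
    by (rule continuous_map_real_divide[OF bump_cont bump_weight_cont ne])
  then show ?thesis unfolding switch_def[abs_def]
    by (intro continuous_map_real_min) simp_all
qed

text \<open>If \<open>bump n\<close> is positive on two translates of one point,
  \<open>bump_sep\<close> applied to the group element carrying one to the other makes them equal.
  Hence sums over the group reduce to a single term.\<close>

lemma bump_at_most_one:
  assumes w: "w \<in> topspace W" and k: "k \<in> carrier K" "0 < bump n (actW k w)"
    and j: "j \<in> carrier K" "j \<noteq> k"
  shows "bump n (actW j w) = 0"
proof (rule ccontr)
  assume "bump n (actW j w) \<noteq> 0"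
  then have pos: "0 < bump n (actW j w)" using bump_nonneg[of n "actW j w"] by simp
  have "actW (j \<otimes> inv k) (actW k w) = actW j (actW (inv k) (actW k w))"
    using actW_mult[OF j(1) inv_closed[OF k(1)] actW_closed[OF k(1) w]] .
  also have "\<dots> = actW j w" using actW_inv(1)[OF k(1) w] by simp
  finally have "j \<otimes> inv k = \<one>"
    using bump_sep[OF actW_closed[OF k(1) w] _ k(2), of "j \<otimes> inv k"] pos j(1) k(1) by simp
  then have "j = k" using j(1) k(1) by (metis inv_closed inv_equality inv_inv)
  with j(2) show False by simp
qed

lemma switch_attained:
  assumes w: "w \<in> topspace W"
  obtains n k where "k \<in> carrier K" "switch n (actW k w) = 1"
proof -
  obtain n where n: "bump_weight w \<le> bump_total n w" using bump_weight_pos_attained(2)[OF w] by blast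
  note pos = bump_weight_pos_attained(1)[OF w]
  have "\<exists>k\<in>carrier K. 0 < bump n (actW k w)"
  proof (rule ccontr)
    assume "\<not> ?thesis"
    then have "bump n (actW k w) \<le> 0" if "k \<in> carrier K" for k using that by (meson not_le)
    then have "bump_total n w \<le> 0" unfolding bump_total_def by (intro sum_nonpos) simp
    with n pos show False by simp
  qed
  then obtain k where k: "k \<in> carrier K" "0 < bump n (actW k w)" by blast
  have "bump_total n w = bump n (actW k w) + (\<Sum>j\<in>carrier K - {k}. bump n (actW j w))"
    unfolding bump_total_def by (rule sum.remove[OF fin k(1)])
  also have "(\<Sum>j\<in>carrier K - {k}. bump n (actW j w)) = 0"
    by (intro sum.neutral ballI bump_at_most_one[OF w k]) simp_all
  finally have "bump_weight w \<le> bump n (actW k w)" using n by simp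
  then have "1 \<le> bump n (actW k w) / bump_weight w" using pos by (simp add: pos_le_divide_eq)
  then have "switch n (actW k w) = 1" unfolding switch_def bump_weight_act[OF k(1) w] by simp
  with k(1) show thesis by (rule that)
qed

context
  fixes act :: "'k \<Rightarrow> 'z \<Rightarrow> 'z" and F :: "'z set" and r :: "'z \<Rightarrow> nat"
  assumes F: "finite_gset K act F" and r: "inj_on r F"
begin

text \<open>Summing over the group makes the box depend only on the class of \<open>(w, z)\<close>,
  though the numbering \<open>r\<close> of \<open>F\<close> is not equivariant. At most one summand
  is nonzero, so each coordinate is an interpolation between the identity and one
  \<open>unit_box\<close>.\<close>

definition pre_box :: "'w \<times> 'z \<Rightarrow> nat \<Rightarrow> real \<Rightarrow> real" where
  "pre_box x n s = s + (\<Sum>k\<in>carrier K. switch n (actW k (fst x)) * (unit_box (r (act k (snd x))) s - s))"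

lemma pre_box_act:
  assumes j: "j \<in> carrier K" and x: "x \<in> topspace (total F)"
  shows "pre_box (diag act j x) = pre_box x"
proof (intro ext)
  fix n s
  have w: "fst x \<in> topspace W" and z: "snd x \<in> F" using x by (simp_all add: mem_Times_iff)
  have "(\<Sum>k\<in>carrier K. switch n (actW k (actW j (fst x))) * (unit_box (r (act k (act j (snd x)))) s - s)) =
    (\<Sum>k\<in>carrier K. switch n (actW (k \<otimes> j) (fst x)) * (unit_box (r (act (k \<otimes> j) (snd x))) s - s))"
    by (rule sum.cong) (simp_all add: actW_mult[OF _ j w] finite_gsetD(4)[OF F _ j z])
  also have "\<dots> = (\<Sum>k\<in>carrier K. switch n (actW k (fst x)) * (unit_box (r (act k (snd x))) s - s))"
    by (rule sum.reindex_bij_betw[OF bij_mult_right[OF j]])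
  finally show "pre_box (diag act j x) n s = pre_box x n s" by (simp add: pre_box_def)
qed

lemma switch_eq_0: "bump n w = 0 \<Longrightarrow> switch n w = 0"
  by (simp add: switch_def)

lemma pre_box_cases:
  assumes w: "w \<in> topspace W" and z: "z \<in> F"
  obtains "\<And>k. k \<in> carrier K \<Longrightarrow> bump n (actW k w) = 0" "pre_box (w, z) n = id"
  | k where "k \<in> carrier K" "0 < bump n (actW k w)" "pre_box (w, z) n = mix (switch n (actW k w)) (unit_box (r (act k z)))"
proof (cases "\<exists>k\<in>carrier K. 0 < bump n (actW k w)")
  case False
  then have b0: "bump n (actW k w) = 0" if "k \<in> carrier K" for k
    using that bump_nonneg[of n "actW k w"] by (metis less_eq_real_def)
  have "pre_box (w, z) n s = s" for s
    unfolding pre_box_def by (simp add: b0 switch_eq_0)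
  then show thesis using that(1) b0 by (simp add: fun_eq_iff)
next
  case True
  then obtain k where k: "k \<in> carrier K" "0 < bump n (actW k w)" by blast
  have "pre_box (w, z) n s = mix (switch n (actW k w)) (unit_box (r (act k z))) s" for s
  proof -
    let ?f = "\<lambda>k. switch n (actW k w) * (unit_box (r (act k z)) s - s)"
    have "(\<Sum>k\<in>carrier K. ?f k) = ?f k + (\<Sum>j\<in>carrier K - {k}. ?f j)"
      by (rule sum.remove[OF fin k(1)])
    also have "(\<Sum>j\<in>carrier K - {k}. ?f j) = 0"
      by (intro sum.neutral ballI) (simp add: switch_eq_0 bump_at_most_one[OF w k])
    finally show ?thesis unfolding pre_box_def mix_def by (simp add: algebra_simps)
  qed
  then show thesis using that(2)[OF k] by (simp add: fun_eq_iff)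
qed

lemma strict_mono_pre_box:
  assumes w: "w \<in> topspace W" and z: "z \<in> F"
  shows "strict_mono (pre_box (w, z) n)"
proof (rule pre_box_cases[OF w z, of n])
  assume "pre_box (w, z) n = id"
  then show ?thesis by (simp add: strict_mono_def)
next
  fix k assume k: "k \<in> carrier K" "pre_box (w, z) n = mix (switch n (actW k w)) (unit_box (r (act k z)))"
  show ?thesis unfolding k(2)
    by (rule strict_mono_mix[OF switch_bounds(1)[OF actW_closed[OF k(1) w]] switch_bounds(2) strict_mono_unit_box])
qed

lemma jcont_pre_box: "jcont (total F) (\<lambda>x. pre_box x n)"
proof -
  let ?P = "prod_topology (total F) euclideanreal"
  have s: "continuous_map ?P euclideanreal (\<lambda>z. snd z)" by (rule continuous_map_snd)
  have at: "continuous_map ?P euclideanreal (\<lambda>z. arctan (snd z))"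
  proof -
    have "continuous_map euclideanreal euclideanreal arctan" by (simp add: continuous_intros)
    from continuous_map_compose[OF s this] show ?thesis by (simp add: o_def)
  qed
  have fs: "continuous_map ?P W (\<lambda>z. fst (fst z))"
    using continuous_map_compose[OF continuous_map_fst continuous_map_fst] by (simp add: o_def)
  have sw: "continuous_map ?P euclideanreal (\<lambda>z. switch n (actW k (fst (fst z))))" if "k \<in> carrier K" for k
    using continuous_map_compose[OF continuous_map_compose[OF fs actW_cont[OF that]] switch_cont] by (simp add: o_def)
  have dz: "continuous_map ?P (discrete_topology F) (\<lambda>z. snd (fst z))"
    using continuous_map_compose[OF continuous_map_fst continuous_map_snd] by (simp add: o_def)
  have rz: "continuous_map ?P euclideanreal (\<lambda>z. real (r (act k (snd (fst z)))))" for k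
  proof -
    have "continuous_map (discrete_topology F) euclideanreal (\<lambda>z. real (r (act k z)))" by simp
    from continuous_map_compose[OF dz this] show ?thesis by (simp add: o_def)
  qed
  have "continuous_map ?P euclideanreal (\<lambda>z. snd z + (\<Sum>k\<in>carrier K. switch n (actW k (fst (fst z))) *
      ((real (r (act k (snd (fst z)))) + (1 / 2 + arctan (snd z) / pi)) - snd z)))"
    by (intro continuous_map_add continuous_map_sum[OF fin] continuous_map_real_mult continuous_map_diff
        continuous_map_real_divide s at sw rz) simp_all
  then show ?thesis unfolding jcont_def pre_box_def unit_box_def by (simp add: case_prod_unfold)
qed

text \<open>Two points of a fibre have representatives \<open>(w, z)\<close> and
  \<open>(w, z')\<close>. At a pair \<open>n\<close>, \<open>k\<close> with full switch their
  \<open>n\<close>-th coordinates are the unit boxes numbered \<open>r (act k z)\<close> and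
  \<open>r (act k z')\<close>, which are disjoint as \<open>r\<close> is injective.\<close>

lemma box_embedding_hoq_exists: "\<exists>c. box_embedding (hoq act F) Y pr c"
proof -
  note oaF = orbit_action_total[OF F] and D = finite_gsetD[OF F]
  define c where "c B = the_elem (pre_box ` B)" for B
  have c_cls: "c (cls act (w, z)) = pre_box (w, z)" if "w \<in> topspace W" "z \<in> F" for w z
    unfolding c_def using the_elem_orb[OF oaF, of "(w, z)" pre_box] pre_box_act that by simp
  have "box_embedding (hoq act F) Y pr c"
  proof (rule box_embeddingI)
    fix B i assume "B \<in> topspace (hoq act F)"
    then obtain w z where "w \<in> topspace W" "z \<in> F" "B = cls act (w, z)" by (rule hoqE[OF F])
    then show "strict_mono (c B i)" using c_cls strict_mono_pre_box by simp
  next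
    fix i
    let ?f = "\<lambda>z. (cls act (fst z), snd z)"
    \<comment> \<open>Continuity of the descended boxes is checked upstairs: the product of a
      quotient map with the locally compact line is again a quotient map.\<close>
    have q: "quotient_map (prod_topology (total F) euclideanreal) (prod_topology (hoq act F) euclideanreal) ?f"
      using quotient_map_prod_left[OF _ _ quotient_map_orb[OF oaF], of euclideanreal]
      by (simp add: case_prod_unfold locally_compact_space_euclidean)
    have "continuous_map (prod_topology (total F) euclideanreal) euclideanreal ((\<lambda>(B, s). c B i s) \<circ> ?f)"
      using jcont_pre_box[of i] unfolding jcont_def
    proof (rule continuous_map_eq)
      fix x assume "x \<in> topspace (prod_topology (total F) euclideanreal)"
      then show "(case x of (x, s) \<Rightarrow> pre_box x i s) = ((\<lambda>(B, s). c B i s) \<circ> ?f) x"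
        using c_cls[of "fst (fst x)" "snd (fst x)"] by (simp add: case_prod_unfold mem_Times_iff)
    qed
    from continuous_compose_quotient_map[OF q this]
    show "jcont (hoq act F) (\<lambda>B. c B i)" by (simp add: jcont_def)
  next
    fix y assume "y \<in> topspace Y"
    then obtain w0 where w0: "w0 \<in> topspace W" "y = q w0" using q_surj by blast
    obtain V N where V: "openin W V" "w0 \<in> V" "\<forall>v\<in>V. \<forall>n\<ge>N. \<forall>k\<in>carrier K. bump n (actW k v) = 0"
      using bump_total_finite[OF w0(1)] by blast
    have oU: "openin Y (q ` V)" using q_open V(1) unfolding open_map_def by blast
    have "c B i = id" if B: "B \<in> topspace (hoq act F)" "pr B \<in> q ` V" and i: "N \<le> i" for B i
    proof -
      obtain v where v: "v \<in> V" "pr B = q v" using B(2) by (rule imageE)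
      have vW: "v \<in> topspace W" using v(1) openin_subset[OF V(1)] by blast
      obtain z where z: "z \<in> F" "B = cls act (v, z)" using cls_fibre[OF F B(1) vW v(2)] by blast
      show ?thesis unfolding z(2) c_cls[OF vW z(1)]
      proof (rule pre_box_cases[OF vW z(1), of i])
        fix k assume "k \<in> carrier K" "0 < bump i (actW k v)"
        then show "pre_box (v, z) i = id" using V(3) v(1) i by simp
      qed
    qed
    then show "\<exists>U n. openin Y U \<and> y \<in> U \<and> (\<forall>B\<in>topspace (hoq act F). pr B \<in> U \<longrightarrow> (\<forall>i\<ge>n. c B i = id))"
      using oU V(2) w0(2) by (intro exI[of _ "q ` V"] exI[of _ N]) simp
  next
    fix B B' assume B: "B \<in> topspace (hoq act F)" "B' \<in> topspace (hoq act F)" "B \<noteq> B'" "pr B = pr B'"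
    obtain w z where wz: "w \<in> topspace W" "z \<in> F" "B = cls act (w, z)" using B(1) by (rule hoqE[OF F])
    have "pr B' = q w" using B(4) pr_cls[OF F wz(1,2)] wz(3) by simp
    then obtain z' where z': "z' \<in> F" "B' = cls act (w, z')" using cls_fibre[OF F B(2) wz(1)] by blast
    have zz: "z \<noteq> z'" using B(3) wz(3) z'(2) by blast
    obtain n k where nk: "k \<in> carrier K" "switch n (actW k w) = 1" by (rule switch_attained[OF wz(1)])
    have bpos: "0 < bump n (actW k w)"
      using nk(2) bump_nonneg[of n "actW k w"] switch_eq_0[of n "actW k w"] by (cases "bump n (actW k w) = 0") simp_all
    have ub: "pre_box (w, x) n = unit_box (r (act k x))" if x: "x \<in> F" for x
    proof (rule pre_box_cases[OF wz(1) x, of n])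
      assume "\<And>k. k \<in> carrier K \<Longrightarrow> bump n (actW k w) = 0"
      then have "bump n (actW k w) = 0" using nk(1) by blast
      then show ?thesis using bpos by simp
    next
      fix j assume j: "j \<in> carrier K" "0 < bump n (actW j w)"
        "pre_box (w, x) n = mix (switch n (actW j w)) (unit_box (r (act j x)))"
      have "j = k" using bump_at_most_one[OF wz(1) nk(1) bpos j(1)] j(2) by (cases "j = k") simp_all
      then show ?thesis using j(3) nk(2) by simp
    qed
    have "act k z \<noteq> act k z'"
      using zz finite_gset_inv(1)[OF is_group F nk(1) wz(2)] finite_gset_inv(1)[OF is_group F nk(1) z'(1)] by metis
    then have "r (act k z) \<noteq> r (act k z')"
      using r D(2)[OF nk(1) wz(2)] D(2)[OF nk(1) z'(1)] by (meson inj_onD)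
    then have "range (c B n) \<inter> range (c B' n) = {}"
      unfolding wz(3) z'(2) c_cls[OF wz(1,2)] c_cls[OF wz(1) z'(1)] ub[OF wz(2)] ub[OF z'(1)]
      by (rule unit_box_disjoint)
    then show "\<exists>i. range (c B i) \<inter> range (c B' i) = {}" ..
  qed
  then show ?thesis by (intro exI[of _ c])
qed

end

lemma box_embedding_hoq:
  assumes F: "finite_gset K act F"
  obtains c where "box_embedding (hoq act F) Y pr c"
proof -
  obtain r n where r: "r ` F = {i. i < (n::nat)}" "inj_on r F"
    using finite_imp_inj_to_nat_seg[OF finite_gsetD(1)[OF F]] by metis
  from box_embedding_hoq_exists[OF F r(2)] show thesis using that by (elim exE)
qed

end

section \<open>Images of transfers from finite group sets\<close>

locale transfer_action = principal_action K W actW Y q bump + spectrum_loc E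
  for K :: "('k, 'm) monoid_scheme" (structure) and W :: "'w topology" and actW :: "'k \<Rightarrow> 'w \<Rightarrow> 'w"
    and Y :: "'y topology" and q :: "'w \<Rightarrow> 'y" and bump :: "nat \<Rightarrow> 'w \<Rightarrow> real"
    and E :: "'a spec" +
  fixes \<xi> :: "'a power_maps"
begin

definition tr_set :: "('k \<Rightarrow> 'z \<Rightarrow> 'z) \<Rightarrow> 'z set \<Rightarrow> ('y \<Rightarrow> 'a) set set" where
  "tr_set act F = transfer_along E (hoq act F) Y pr ` carrier (coh E \<xi> (hoq act F))"

lemma tr_set_carrier:
  assumes F: "finite_gset K act F"
  shows "tr_set act F \<subseteq> carrier (coh E \<xi> Y)"
proof -
  obtain c where c: "box_embedding (hoq act F) Y pr c" by (rule box_embedding_hoq[OF F])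
  show ?thesis unfolding tr_set_def
    using transfer_carrier[OF finite_cover_hoq[OF F] locally_k_base c] by blast
qed

lemma tr_zero:
  assumes F: "finite_gset K act F"
  shows "transfer_along E (hoq act F) Y pr \<zero>\<^bsub>coh E \<xi> (hoq act F)\<^esub> = \<zero>\<^bsub>coh E \<xi> Y\<^esub>"
proof -
  obtain c where c: "box_embedding (hoq act F) Y pr c" by (rule box_embedding_hoq[OF F])
  show ?thesis by (rule transfer_zero[OF finite_cover_hoq[OF F] locally_k_base c])
qed

text \<open>A cover that factors through \<open>X2\<close> contributes no transfers beyond those
  from \<open>X2\<close>, because of \<open>transfer_comp\<close>.\<close>

lemma tr_set_comp:
  assumes "finite_cover X1 X2 p1" "finite_cover X2 Y p2" "locally_k X2"
    "box_embedding X1 X2 p1 c1" "box_embedding X2 Y p2 c2"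
    and p: "\<And>x. x \<in> topspace X1 \<Longrightarrow> p2 (p1 x) = p x"
  shows "transfer_along E X1 Y p ` carrier (coh E \<xi> X1) \<subseteq> transfer_along E X2 Y p2 ` carrier (coh E \<xi> X2)"
proof
  fix b assume "b \<in> transfer_along E X1 Y p ` carrier (coh E \<xi> X1)"
  then obtain a where a: "a \<in> carrier (coh E \<xi> X1)" "b = transfer_along E X1 Y p a" by blast
  then obtain f where f: "a = htpy_class E X1 f" "continuous_map X1 (zspace E) f" unfolding carrier_coh by blast
  obtain g where g: "continuous_map X2 (zspace E) g"
    "transfer_along E X1 Y (p2 \<circ> p1) (htpy_class E X1 f) = transfer_along E X2 Y p2 (htpy_class E X2 g)"
    by (rule transfer_comp[OF assms(1,2,3) locally_k_base assms(4,5) f(2)])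
  have "transfer_along E X1 Y p a = transfer_along E X1 Y (p2 \<circ> p1) a"
    by (rule transfer_along_cong) (simp add: p)
  then have "b = transfer_along E X2 Y p2 (htpy_class E X2 g)" using a(2) f(1) g(2) by simp
  moreover have "htpy_class E X2 g \<in> carrier (coh E \<xi> X2)" unfolding carrier_coh using g(1) by blast
  ultimately show "b \<in> transfer_along E X2 Y p2 ` carrier (coh E \<xi> X2)" by (rule image_eqI)
qed

text \<open>An equivariant map induces a map of homotopy orbits over the base, which is itself a
  finite cover by \<open>finite_cover_factor\<close>.\<close>

lemma tr_set_mono:
  assumes F: "finite_gset K act F" and F': "finite_gset K act' F'"
    and al: "\<And>z. z \<in> F \<Longrightarrow> \<alpha> z \<in> F'"
    and eqv: "\<And>k z. k \<in> carrier K \<Longrightarrow> z \<in> F \<Longrightarrow> \<alpha> (act k z) = act' k (\<alpha> z)"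
  shows "tr_set act F \<subseteq> tr_set act' F'"
proof -
  let ?f = "\<lambda>x. cls act' (fst x, \<alpha> (snd x))"
  define h where "h B = the_elem (?f ` B)" for B
  note oaF = orbit_action_total[OF F]
  have inv: "?f (diag act k x) = ?f x" if "k \<in> carrier K" "x \<in> topspace (total F)" for k x
    using that eqv cls_act[OF F' that(1)] al by (simp add: mem_Times_iff)
  have "continuous_map (total F) (discrete_topology F') (\<lambda>x. \<alpha> (snd x))"
  proof -
    have "continuous_map (discrete_topology F) (discrete_topology F') \<alpha>" using al by (simp add: Pi_iff)
    from continuous_map_compose[OF continuous_map_snd this] show ?thesis by (simp add: o_def)
  qed
  then have "continuous_map (total F) (total F') (\<lambda>x. (fst x, \<alpha> (snd x)))"
    by (simp add: continuous_map_pairwise o_def continuous_map_fst)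
  from continuous_map_compose[OF this continuous_map_cls[OF F']]
  have "continuous_map (total F) (hoq act' F') ?f" by (simp add: o_def)
  then have hc: "continuous_map (hoq act F) (hoq act' F') h"
    unfolding h_def[abs_def] by (rule continuous_map_from_orbit_space[OF oaF]) (rule inv)
  have hcls: "h (cls act (w, z)) = cls act' (w, \<alpha> z)" if "w \<in> topspace W" "z \<in> F" for w z
    unfolding h_def using the_elem_orb[OF oaF, of "(w, z)" ?f] inv that by simp
  have hp: "pr (h B) = pr B" if B: "B \<in> topspace (hoq act F)" for B
  proof -
    obtain w z where "w \<in> topspace W" "z \<in> F" "B = cls act (w, z)" using B by (rule hoqE[OF F])
    then show ?thesis using hcls pr_cls[OF F] pr_cls[OF F'] al by simp
  qed
  obtain c where c: "box_embedding (hoq act F) Y pr c" by (rule box_embedding_hoq[OF F])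
  obtain c' where c': "box_embedding (hoq act' F') Y pr c'" by (rule box_embedding_hoq[OF F'])
  show ?thesis unfolding tr_set_def
    by (rule tr_set_comp[OF finite_cover_factor[OF finite_cover_hoq[OF F] finite_cover_hoq[OF F'] hc hp]
        finite_cover_hoq[OF F'] locally_k_hoq[OF F'] box_embedding_factor[OF c pr_continuous[OF F'] hp hc] c' hp])
qed

text \<open>For a transitive set, sending the orbit of \<open>w\<close> under the stabilizer of
  \<open>z0\<close> to the class of \<open>(w, z0)\<close> is a homeomorphism over the base; each of
  the two covers then factors through the other. This translates the subgroup transfers of the
  theorem into transfers from group sets.\<close>

lemma tr_set_orbit:
  assumes F: "finite_gset K act F" and z0: "z0 \<in> F" and tra: "F = (\<lambda>k. act k z0) ` carrier K"
    and S: "S = {k \<in> carrier K. act k z0 = z0}"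
  shows "transfer_along E (orbit_space W actW S) Y (\<lambda>B. the_elem (q ` B)) `
    carrier (coh E \<xi> (orbit_space W actW S)) = tr_set act F"
proof -
  let ?X = "orbit_space W actW S" and ?p = "\<lambda>B. the_elem (q ` B)"
  note D = finite_gsetD[OF F]
  have sg: "subgroup S K"
  proof (rule subgroupI)
    show "S \<subseteq> carrier K" unfolding S by blast
    show "S \<noteq> {}" unfolding S using D(3)[OF z0] by blast
    show "inv k \<in> S" if "k \<in> S" for k
      using that finite_gset_inv(1)[OF is_group F _ z0, of k] unfolding S by simp
    show "k \<otimes> k' \<in> S" if "k \<in> S" "k' \<in> S" for k k'
      using that D(4)[OF _ _ z0, of k k'] unfolding S by simp
  qed
  note oaS = orbit_action_subgroup[OF sg]
  have SK: "S \<subseteq> carrier K" unfolding S by blast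
  let ?f = "\<lambda>w. cls act (w, z0)"
  define th where "th B = the_elem (?f ` B)" for B
  have inv: "?f (actW k w) = ?f w" if "k \<in> S" "w \<in> topspace W" for k w
    using cls_act[OF F _ that(2) z0, of k] that(1) unfolding S by simp
  have thc: "th (orb actW S w) = cls act (w, z0)" if "w \<in> topspace W" for w
    unfolding th_def by (rule the_elem_orb[OF oaS that]) (rule inv)
  have "continuous_map W (total F) (\<lambda>w. (w, z0))" using z0 by (simp add: continuous_map_pairwise o_def)
  from continuous_map_compose[OF this continuous_map_cls[OF F]]
  have "continuous_map W (hoq act F) ?f" by (simp add: o_def)
  then have cont: "continuous_map ?X (hoq act F) th"
    unfolding th_def[abs_def] by (rule continuous_map_from_orbit_space[OF oaS]) (rule inv)
  have tX: "topspace ?X = orb actW S ` topspace W" by (rule topspace_orbit_space[OF oaS])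
  have opn: "open_map ?X (hoq act F) th"
    unfolding open_map_def
  proof (intro allI impI)
    fix U assume U: "openin ?X U"
    let ?V = "{w \<in> topspace W. orb actW S w \<in> U}"
    have V: "openin W ?V" and UX: "U \<subseteq> orb actW S ` topspace W" using U unfolding openin_orbit_space by blast+
    have "th ` U = cls act ` (?V \<times> {z0})"
    proof (intro equalityI subsetI)
      fix B assume "B \<in> th ` U"
      then obtain u where u: "u \<in> U" "B = th u" by blast
      then obtain w where w: "w \<in> topspace W" "u = orb actW S w" using UX by blast
      then have "(w, z0) \<in> ?V \<times> {z0}" and Bw: "B = cls act (w, z0)" using u thc by simp_all
      from this(1) show "B \<in> cls act ` (?V \<times> {z0})" unfolding Bw by (rule imageI)
    next
      fix B assume "B \<in> cls act ` (?V \<times> {z0})"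
      then obtain w where w: "w \<in> topspace W" "orb actW S w \<in> U" "B = cls act (w, z0)" by blast
      then show "B \<in> th ` U" using thc[OF w(1)] by (intro image_eqI[of _ th "orb actW S w"]) simp_all
    qed
    moreover have "openin (total F) (?V \<times> {z0})" using V z0 by (simp add: openin_prod_Times_iff)
    then have "openin (hoq act F) (cls act ` (?V \<times> {z0}))"
      by (rule open_map_cls[OF F, unfolded open_map_def, rule_format])
    ultimately show "openin (hoq act F) (th ` U)" by simp
  qed
  have surj: "th ` topspace ?X = topspace (hoq act F)"
  proof (intro equalityI subsetI)
    fix B assume "B \<in> th ` topspace ?X"
    then obtain w where "w \<in> topspace W" "B = th (orb actW S w)" unfolding tX by blast
    then show "B \<in> topspace (hoq act F)" unfolding topspace_hoq[OF F] using thc z0 by simp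
  next
    fix B assume "B \<in> topspace (hoq act F)"
    then obtain w z where wz: "w \<in> topspace W" "z \<in> F" "B = cls act (w, z)" by (rule hoqE[OF F])
    then obtain k where k: "k \<in> carrier K" "z = act k z0" using tra by blast
    let ?w = "actW (inv k) w"
    have w': "?w \<in> topspace W" using actW_closed k(1) wz(1) by simp
    have "cls act (actW k ?w, act k z0) = cls act (?w, z0)" by (rule cls_act[OF F k(1) w' z0])
    then have "B = th (orb actW S ?w)" using wz(3) k(2) actW_inv(2)[OF k(1) wz(1)] thc[OF w'] by simp
    then show "B \<in> th ` topspace ?X" unfolding tX using w' by blast
  qed
  have inj: "inj_on th (topspace ?X)"
  proof (rule inj_onI)
    fix B B' assume B: "B \<in> topspace ?X" "B' \<in> topspace ?X" "th B = th B'"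
    obtain w where w: "w \<in> topspace W" "B = orb actW S w" using B(1) unfolding tX by blast
    obtain w' where w': "w' \<in> topspace W" "B' = orb actW S w'" using B(2) unfolding tX by blast
    have "cls act (w, z0) = cls act (w', z0)" using B(3) thc w w' by simp
    then obtain k where k: "k \<in> carrier K" "w' = actW k w" "z0 = act k z0"
      using cls_eq_iff[OF F w(1) z0 w'(1) z0] by blast
    have "k \<in> S" unfolding S using k(1,3) by simp
    then show "B = B'" unfolding w(2) w'(2) k(2) using orb_act[OF oaS _ w(1)] by simp
  qed
  have homeo: "homeomorphic_map ?X (hoq act F) th"
    by (rule bijective_open_imp_homeomorphic_map[OF cont opn surj inj])
  obtain th' where th': "homeomorphic_maps ?X (hoq act F) th th'" using homeo homeomorphic_map_maps by blast
  have homeo': "homeomorphic_map (hoq act F) ?X th'"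
    using th' homeomorphic_maps_sym homeomorphic_maps_map by blast
  have ththm: "th (th' B) = B" "th' B \<in> topspace ?X" if "B \<in> topspace (hoq act F)" for B
    using th' that unfolding homeomorphic_maps_def continuous_map_def by blast+
  have pp: "pr (th B) = ?p B" if B: "B \<in> topspace ?X" for B
  proof -
    obtain w where w: "w \<in> topspace W" "B = orb actW S w" using B unfolding tX by blast
    have "the_elem (q ` orb actW S w) = q w"
      by (rule the_elem_orb[OF oaS w(1)]) (use q_act SK in blast)
    then show ?thesis unfolding w(2) thc[OF w(1)] pr_cls[OF F w(1) z0] by simp
  qed
  have pp': "?p (th' B) = pr B" if "B \<in> topspace (hoq act F)" for B
    using pp[OF ththm(2)[OF that]] ththm(1)[OF that] by simp
  obtain c where c: "box_embedding (hoq act F) Y pr c" by (rule box_embedding_hoq[OF F])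
  have fc: "finite_cover ?X (hoq act F) th" by (rule finite_cover_homeomorphic[OF homeo])
  have fc': "finite_cover (hoq act F) ?X th'" by (rule finite_cover_homeomorphic[OF homeo'])
  have b: "box_embedding ?X (hoq act F) th (\<lambda>x i. id)" by (rule box_embedding_id[OF inj])
  have b': "box_embedding (hoq act F) ?X th' (\<lambda>x i. id)"
    by (rule box_embedding_id[OF homeomorphic_imp_injective_map[OF homeo']])
  have fX: "finite_cover ?X Y ?p"
    by (rule finite_cover_cong[OF finite_cover_comp[OF fc finite_cover_hoq[OF F]]]) (simp add: pp)
  have bX: "box_embedding ?X Y ?p (\<lambda>x i. c (th x) i \<circ> id)"
    by (rule box_embedding_cong[OF box_embedding_comp[OF fc finite_cover_hoq[OF F] b c]]) (simp_all add: pp)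
  have kX: "locally_k ?X"
    by (rule locally_k_open_image[OF metr continuous_map_orb[OF oaS] open_map_orb[OF oaS] tX[symmetric]])
  show ?thesis unfolding tr_set_def
  proof (rule equalityI)
    show "transfer_along E ?X Y ?p ` carrier (coh E \<xi> ?X) \<subseteq> transfer_along E (hoq act F) Y pr ` carrier (coh E \<xi> (hoq act F))"
      by (rule tr_set_comp[OF fc finite_cover_hoq[OF F] locally_k_hoq[OF F] b c pp])
    show "transfer_along E (hoq act F) Y pr ` carrier (coh E \<xi> (hoq act F)) \<subseteq> transfer_along E ?X Y ?p ` carrier (coh E \<xi> ?X)"
      by (rule tr_set_comp[OF fc' fX kX b' bX pp'])
  qed
qed

text \<open>Since \<open>A\<close> is invariant, its classes are literally classes of
  \<open>F\<close>. The homotopy orbits of \<open>A\<close> are therefore equal to an open subspace,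
  not just homeomorphic to one, and \<open>transfer_add\<close> can be restated by rewriting with
  this equation.\<close>

lemma hoq_sub:
  assumes F: "finite_gset K act F" and A: "finite_gset K act A" and AF: "A \<subseteq> F"
  shows "hoq act A = subtopology (hoq act F) (topspace (hoq act A))" "openin (hoq act F) (topspace (hoq act A))"
proof -
  have tot: "total A = subtopology (total F) (topspace W \<times> A)"
  proof -
    have "subtopology (total F) (topspace W \<times> A) = prod_topology (subtopology W (topspace W)) (subtopology (discrete_topology F) A)"
      by (rule subtopology_Times)
    also have "subtopology (discrete_topology F) A = discrete_topology A"
      using AF by (simp add: inf.absorb2)
    finally show ?thesis by simp
  qed
  have oA: "openin (total F) (topspace W \<times> A)" using AF by (simp add: openin_prod_Times_iff)
  have oS: "openin (total A) T \<longleftrightarrow> openin (total F) T" if "T \<subseteq> topspace W \<times> A" for T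
    unfolding tot using openin_open_subtopology[OF oA] that by simp
  have zA: "z \<in> A" if h: "w \<in> topspace W" "z \<in> F" "cls act (w, z) \<in> topspace (hoq act A)" for w z
  proof -
    obtain w' z' where wz: "w' \<in> topspace W" "z' \<in> A" "cls act (w, z) = cls act (w', z')" using h(3) by (rule hoqE[OF A])
    then obtain k where k: "k \<in> carrier K" "z' = act k z" using cls_eq_iff[OF F h(1,2) wz(1)] AF by blast
    have "z = act (inv k) z'" using finite_gset_inv(1)[OF is_group F k(1) h(2)] k(2) by simp
    then show ?thesis using finite_gsetD(2)[OF A, of "inv k" z'] k(1) wz(2) by simp
  qed
  have tA: "topspace (hoq act A) = cls act ` (topspace W \<times> A)" by (rule topspace_hoq[OF A])
  have AsubF: "topspace (hoq act A) \<subseteq> cls act ` (topspace W \<times> F)" unfolding tA using AF by blast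
  have eq: "{x \<in> topspace (total F). cls act x \<in> U} = {x \<in> topspace (total A). cls act x \<in> U}"
    if U: "U \<subseteq> topspace (hoq act A)" for U
  proof (intro equalityI subsetI)
    fix x assume x: "x \<in> {x \<in> topspace (total F). cls act x \<in> U}"
    obtain w z where wz: "x = (w, z)" by (cases x)
    have h: "w \<in> topspace W" "z \<in> F" "cls act (w, z) \<in> U" using x wz by simp_all
    have "z \<in> A" by (rule zA[OF h(1,2) subsetD[OF U h(3)]])
    then show "x \<in> {x \<in> topspace (total A). cls act x \<in> U}" using h wz by simp
  next
    fix x assume x: "x \<in> {x \<in> topspace (total A). cls act x \<in> U}"
    obtain w z where wz: "x = (w, z)" by (cases x)
    have "w \<in> topspace W" "z \<in> A" "cls act (w, z) \<in> U" using x wz by simp_all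
    then show "x \<in> {x \<in> topspace (total F). cls act x \<in> U}" using wz subsetD[OF AF] by simp
  qed
  have key: "openin (hoq act F) U \<longleftrightarrow> openin (hoq act A) U" if U: "U \<subseteq> topspace (hoq act A)" for U
  proof -
    have "openin (hoq act F) U \<longleftrightarrow> openin (total F) {x \<in> topspace (total F). cls act x \<in> U}"
      unfolding openin_orbit_space using subset_trans[OF U AsubF] by simp
    also have "\<dots> \<longleftrightarrow> openin (total A) {x \<in> topspace (total A). cls act x \<in> U}"
      unfolding eq[OF U] by (rule oS[symmetric]) simp
    also have "\<dots> \<longleftrightarrow> openin (hoq act A) U"
      unfolding openin_orbit_space using U tA by simp
    finally show ?thesis .
  qed
  show o: "openin (hoq act F) (topspace (hoq act A))" using key[of "topspace (hoq act A)"] by simp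
  show "hoq act A = subtopology (hoq act F) (topspace (hoq act A))"
    unfolding topology_eq openin_open_subtopology[OF o]
  proof (intro allI iffI conjI)
    fix U assume U: "openin (hoq act A) U"
    show UA: "U \<subseteq> topspace (hoq act A)" by (rule openin_subset[OF U])
    show "openin (hoq act F) U" using key[OF UA] U by simp
  next
    fix U assume "openin (hoq act F) U \<and> U \<subseteq> topspace (hoq act A)"
    then have UF: "openin (hoq act F) U" and UA: "U \<subseteq> topspace (hoq act A)" by blast+
    show "openin (hoq act A) U" using key[OF UA] UF by (rule iffD1)
  qed
qed

lemma hoq_split:
  assumes F: "finite_gset K act F" and A: "finite_gset K act A" and B: "finite_gset K act B"
    and AB: "F = A \<union> B" "A \<inter> B = {}"
  shows "topspace (hoq act A) \<union> topspace (hoq act B) = topspace (hoq act F)"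
    "topspace (hoq act A) \<inter> topspace (hoq act B) = {}"
proof -
  show "topspace (hoq act A) \<union> topspace (hoq act B) = topspace (hoq act F)"
    unfolding topspace_hoq[OF A] topspace_hoq[OF B] topspace_hoq[OF F]
    by (simp only: AB(1) Sigma_Un_distrib2 image_Un)
  show "topspace (hoq act A) \<inter> topspace (hoq act B) = {}"
  proof (rule ccontr)
    assume "topspace (hoq act A) \<inter> topspace (hoq act B) \<noteq> {}"
    then obtain C where C: "C \<in> topspace (hoq act A)" "C \<in> topspace (hoq act B)" by blast
    obtain w z where wz: "w \<in> topspace W" "z \<in> A" "C = cls act (w, z)" using C(1) by (rule hoqE[OF A])
    obtain w' z' where wz': "w' \<in> topspace W" "z' \<in> B" "C = cls act (w', z')" using C(2) by (rule hoqE[OF B])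
    have "cls act (w, z) = cls act (w', z')" using wz(3) wz'(3) by simp
    then obtain k where "k \<in> carrier K" "z' = act k z" using cls_eq_iff[OF F wz(1) _ wz'(1)] wz(2) wz'(2) AB(1) by blast
    then have "z' \<in> A" using finite_gsetD(2)[OF A] wz(2) by blast
    then show False using wz'(2) AB(2) by blast
  qed
qed

lemma tr_add:
  assumes F: "finite_gset K act F" and A: "finite_gset K act A" and B: "finite_gset K act B"
    and AB: "F = A \<union> B" "A \<inter> B = {}"
    and f: "continuous_map (hoq act F) (zspace E) f"
  shows "transfer_along E (hoq act F) Y pr (htpy_class E (hoq act F) f) =
    transfer_along E (hoq act A) Y pr (htpy_class E (hoq act A) f) \<oplus>\<^bsub>coh E \<xi> Y\<^esub>
    transfer_along E (hoq act B) Y pr (htpy_class E (hoq act B) f)"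
proof -
  have AF: "A \<subseteq> F" and BF: "B \<subseteq> F" using AB(1) by blast+
  note sA = hoq_sub[OF F A AF] and sB = hoq_sub[OF F B BF] and sp = hoq_split[OF F A B AB]
  obtain c1 where c1: "box_embedding (hoq act A) Y pr c1" by (rule box_embedding_hoq[OF A])
  obtain c2 where c2: "box_embedding (hoq act B) Y pr c2" by (rule box_embedding_hoq[OF B])
  note fA = finite_cover_hoq[OF A] and fB = finite_cover_hoq[OF B]
  show ?thesis
    by (rule transfer_add[OF finite_cover_hoq[OF F] _ _ locally_k_base sA(2) sB(2) sp _ _ f,
          folded sA(1) sB(1), OF fA fB c1 c2])
qed

text \<open>Extend a map by the constant base point over the complementary part; additivity shows
  that its transfer is the given one plus the transfer of zero.\<close>

lemma tr_set_subset:
  assumes R: "ring (coh E \<xi> Y)"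
    and F: "finite_gset K act F" and A: "finite_gset K act A" and B: "finite_gset K act B"
    and AB: "F = A \<union> B" "A \<inter> B = {}"
  shows "tr_set act A \<subseteq> tr_set act F"
proof
  interpret R: ring "coh E \<xi> Y" by (rule R)
  fix b assume b: "b \<in> tr_set act A"
  then obtain f1 where f1: "continuous_map (hoq act A) (zspace E) f1"
    "b = transfer_along E (hoq act A) Y pr (htpy_class E (hoq act A) f1)"
    unfolding tr_set_def carrier_coh by blast
  have AF: "A \<subseteq> F" and BF: "B \<subseteq> F" using AB(1) by blast+
  note sA = hoq_sub[OF F A AF] and sB = hoq_sub[OF F B BF] and sp = hoq_split[OF F A B AB]
  let ?f = "\<lambda>x. if x \<in> topspace (hoq act A) then f1 x else b0"
  have f: "continuous_map (hoq act F) (zspace E) ?f"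
    by (rule continuous_map_open_cases[OF sA(2) sB(2) sp]) (use f1(1) sA(1) in simp_all)
  have fA: "htpy_class E (hoq act A) ?f = htpy_class E (hoq act A) f1"
    by (rule htpy_class_cong[OF f1(1), symmetric]) simp
  have "htpy_class E (hoq act B) ?f = htpy_class E (hoq act B) (\<lambda>x. b0)"
    by (rule htpy_class_cong[symmetric]) (use sp(2) in auto)
  then have fB: "htpy_class E (hoq act B) ?f = \<zero>\<^bsub>coh E \<xi> (hoq act B)\<^esub>" by (simp add: coh_def)
  have "transfer_along E (hoq act F) Y pr (htpy_class E (hoq act F) ?f) = b \<oplus>\<^bsub>coh E \<xi> Y\<^esub> \<zero>\<^bsub>coh E \<xi> Y\<^esub>"
    unfolding tr_add[OF F A B AB f] fA fB tr_zero[OF B] f1(2) ..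
  also have "\<dots> = b" using tr_set_carrier[OF A] b by (intro R.r_zero) blast
  finally have "b = transfer_along E (hoq act F) Y pr (htpy_class E (hoq act F) ?f)" ..
  moreover have "htpy_class E (hoq act F) ?f \<in> carrier (coh E \<xi> (hoq act F))"
    unfolding carrier_coh using f by blast
  ultimately show "b \<in> tr_set act F" unfolding tr_set_def by (rule image_eqI)
qed

lemma finite_gset_orbit:
  assumes F: "finite_gset K act F" and z: "z \<in> F"
  shows "finite_gset K act ((\<lambda>k. act k z) ` carrier K)" "(\<lambda>k. act k z) ` carrier K \<subseteq> F"
    "z \<in> (\<lambda>k. act k z) ` carrier K"
proof -
  note D = finite_gsetD[OF F]
  show sub: "(\<lambda>k. act k z) ` carrier K \<subseteq> F" using D(2) z by blast
  have "act k (act j z) \<in> (\<lambda>k. act k z) ` carrier K" if "k \<in> carrier K" "j \<in> carrier K" for k j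
    using D(4)[OF that z, symmetric] that by simp
  then show "finite_gset K act ((\<lambda>k. act k z) ` carrier K)"
    unfolding finite_gset_def using fin D(3,4) sub by (simp add: subset_iff)
  show "z \<in> (\<lambda>k. act k z) ` carrier K" using D(3)[OF z] by (intro image_eqI[of _ _ \<one>]) simp_all
qed

lemma finite_gset_diff:
  assumes F: "finite_gset K act F" and A: "finite_gset K act A" and AF: "A \<subseteq> F"
  shows "finite_gset K act (F - A)"
proof -
  note D = finite_gsetD[OF F]
  have "act k z \<in> F - A" if "k \<in> carrier K" "z \<in> F - A" for k z
  proof -
    have "act k z \<notin> A"
    proof
      assume "act k z \<in> A"
      then have "act (inv k) (act k z) \<in> A" using finite_gsetD(2)[OF A] that(1) by simp
      then show False using finite_gset_inv(1)[OF is_group F that(1)] that(2) by simp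
    qed
    then show ?thesis using D(2) that by simp
  qed
  then show ?thesis unfolding finite_gset_def using D by simp
qed

text \<open>Induction on the size of \<open>F\<close>: split off one orbit and use additivity of the
  transfer.\<close>

lemma tr_set_ideal:
  assumes I: "ideal I (coh E \<xi> Y)" and F: "finite_gset K act F"
    and orb: "\<And>z. z \<in> F \<Longrightarrow> tr_set act ((\<lambda>k. act k z) ` carrier K) \<subseteq> I"
  shows "tr_set act F \<subseteq> I"
  using F orb
proof (induction "card F" arbitrary: F rule: less_induct)
  case less
  interpret I: ideal I "coh E \<xi> Y" by (rule I)
  note F = less.prems(1) and orb = less.prems(2)
  show ?case
  proof (cases "F = {}")
    case True
    have "t \<in> I" if t: "t \<in> tr_set act F" for t
    proof -
      obtain f where f: "continuous_map (hoq act F) (zspace E) f" "t = transfer_along E (hoq act F) Y pr (htpy_class E (hoq act F) f)"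
        using t unfolding tr_set_def carrier_coh by blast
      \<comment> \<open>On the empty space every class is the zero class, whose transfer is
        zero.\<close>
      have "topspace (hoq act F) = {}" unfolding topspace_hoq[OF F] using True by simp
      then have "htpy_class E (hoq act F) f = htpy_class E (hoq act F) (\<lambda>x. b0)"
        by (intro htpy_class_cong[OF f(1)]) simp
      then have "htpy_class E (hoq act F) f = \<zero>\<^bsub>coh E \<xi> (hoq act F)\<^esub>" by (simp add: coh_def)
      then have "t = \<zero>\<^bsub>coh E \<xi> Y\<^esub>" using f(2) tr_zero[OF F] by simp
      then show ?thesis by (simp add: additive_subgroup.zero_closed[OF I.additive_subgroup_axioms])
    qed
    then show ?thesis by blast
  next
    case False
    then obtain z where z: "z \<in> F" by blast
    define A where "A = (\<lambda>k. act k z) ` carrier K"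
    note oA = finite_gset_orbit[OF F z, folded A_def]
    have B: "finite_gset K act (F - A)" by (rule finite_gset_diff[OF F oA(1,2)])
    have AB: "F = A \<union> (F - A)" "A \<inter> (F - A) = {}" using oA(2) by blast+
    have "card (F - A) < card F"
    proof (rule psubset_card_mono[OF finite_gsetD(1)[OF F]])
      show "F - A \<subset> F" using oA(3) z by blast
    qed
    then have tB: "tr_set act (F - A) \<subseteq> I"
      by (rule less.hyps[OF _ B]) (use orb in blast)
    have tA: "tr_set act A \<subseteq> I" unfolding A_def by (rule orb[OF z])
    show ?thesis
    proof
      fix t assume "t \<in> tr_set act F"
      then obtain f where f: "continuous_map (hoq act F) (zspace E) f" "t = transfer_along E (hoq act F) Y pr (htpy_class E (hoq act F) f)"
        unfolding tr_set_def carrier_coh by blast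
      have AF: "A \<subseteq> F" and BF: "F - A \<subseteq> F" using AB(1) by blast+
      have c1: "continuous_map (hoq act A) (zspace E) f"
        by (subst hoq_sub(1)[OF F oA(1) AF]) (rule continuous_map_from_subtopology[OF f(1)])
      have c2: "continuous_map (hoq act (F - A)) (zspace E) f"
        by (subst hoq_sub(1)[OF F B BF]) (rule continuous_map_from_subtopology[OF f(1)])
      have "transfer_along E (hoq act A) Y pr (htpy_class E (hoq act A) f) \<in> I"
        by (rule subsetD[OF tA]) (use c1 in \<open>auto simp: tr_set_def carrier_coh\<close>)
      moreover have "transfer_along E (hoq act (F - A)) Y pr (htpy_class E (hoq act (F - A)) f) \<in> I"
        by (rule subsetD[OF tB]) (use c2 in \<open>auto simp: tr_set_def carrier_coh\<close>)
      ultimately show "t \<in> I" unfolding f(2) tr_add[OF F oA(1) B AB f(1)] by (rule additive_subgroup.a_closed[OF I.additive_subgroup_axioms])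
    qed
  qed
qed

end

section \<open>Milnor's join and its bump functions\<close>

lemma continuous_map_into_functions:
  fixes f :: "'x \<Rightarrow> 'i \<Rightarrow> real"
  assumes "\<And>i. continuous_map A euclideanreal (\<lambda>a. f a i)" "f \<in> topspace A \<rightarrow> S"
  shows "continuous_map A (top_of_set S) f"
proof -
  have "continuous_map A (product_topology (\<lambda>i. euclideanreal) UNIV) f"
    using assms(1) by (subst continuous_map_componentwise_UNIV) simp
  then have "continuous_map A euclidean f" by (simp only: euclidean_product_topology)
  then show ?thesis using assms(2) by (auto simp: continuous_map_in_subtopology)
qed

lemma continuous_map_coordinate:
  "continuous_map (top_of_set S) euclideanreal (\<lambda>u::'i \<Rightarrow> real. u i)"
  by (intro continuous_map_from_subtopology) (simp add: continuous_on_product_coordinates)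

locale finite_group = group G for G :: "('g, 'b) monoid_scheme" (structure) +
  assumes finG: "finite (carrier G)"
begin

abbreviation join_pts :: "(nat \<times> 'g \<Rightarrow> real) set" where
  "join_pts \<equiv> topspace (EG G)"

lemma EG_D:
  assumes "u \<in> join_pts"
  shows "0 \<le> u z" "finite {z. u z \<noteq> 0}" "u (n, h) \<noteq> 0 \<Longrightarrow> h \<in> carrier G"
    "u (n, g) \<noteq> 0 \<Longrightarrow> u (n, h) \<noteq> 0 \<Longrightarrow> g = h" "(\<Sum>z | u z \<noteq> 0. u z) = 1"
  using assms unfolding EG_def by (auto simp del: split_paired_All)

lemma EG_I:
  assumes "\<And>z. 0 \<le> u z" "finite {z. u z \<noteq> 0}" "\<And>n h. u (n, h) \<noteq> 0 \<Longrightarrow> h \<in> carrier G"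
    "\<And>n g h. u (n, g) \<noteq> 0 \<Longrightarrow> u (n, h) \<noteq> 0 \<Longrightarrow> g = h" "(\<Sum>z | u z \<noteq> 0. u z) = 1"
  shows "u \<in> join_pts"
proof -
  have "{z. u z \<noteq> 0} \<subseteq> UNIV \<times> carrier G" using assms(3) by auto
  moreover have "\<forall>n g h. u (n, g) \<noteq> 0 \<and> u (n, h) \<noteq> 0 \<longrightarrow> g = h"
    using assms(4) by (intro allI impI, elim conjE)
  ultimately show ?thesis unfolding EG_def using assms(1,2,5) by (simp del: split_paired_All)
qed

lemma EG_act_closed:
  assumes g: "g \<in> carrier G" and u: "u \<in> join_pts"
  shows "EG_act G g u \<in> join_pts"
proof -
  note D = EG_D[OF u]
  let ?f = "\<lambda>(n :: nat, h). (n, g \<otimes> h)"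
  have val: "EG_act G g u (n, g \<otimes> h) = u (n, h)" if "h \<in> carrier G" for n h
    using that g by (simp add: EG_act_def m_assoc[symmetric])
  have supp: "{z. EG_act G g u z \<noteq> 0} = ?f ` {z. u z \<noteq> 0}"
  proof (intro equalityI subsetI)
    fix z assume "z \<in> {z. EG_act G g u z \<noteq> 0}"
    then obtain n h where z: "z = (n, h)" "EG_act G g u (n, h) \<noteq> 0" by (cases z) simp
    then have h: "h \<in> carrier G" "u (n, inv g \<otimes> h) \<noteq> 0" by (auto simp: EG_act_def split: if_splits)
    have "z = ?f (n, inv g \<otimes> h)" using z(1) h(1) g by (simp add: m_assoc[symmetric])
    then show "z \<in> ?f ` {z. u z \<noteq> 0}" using h(2) by (intro image_eqI) simp_all
  next
    fix z assume "z \<in> ?f ` {z. u z \<noteq> 0}"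
    then obtain n h where z: "z = (n, g \<otimes> h)" "u (n, h) \<noteq> 0" by auto
    then show "z \<in> {z. EG_act G g u z \<noteq> 0}" using val[OF D(3)[OF z(2)]] by simp
  qed
  have inj: "inj_on ?f {z. u z \<noteq> 0}"
  proof (rule inj_onI)
    fix z z' assume z: "z \<in> {z. u z \<noteq> 0}" "z' \<in> {z. u z \<noteq> 0}" "?f z = ?f z'"
    obtain n h n' h' where e: "z = (n, h)" "z' = (n', h')" by (cases z, cases z')
    have "h \<in> carrier G" "h' \<in> carrier G" using z(1,2) e D(3) by auto
    then show "z = z'" using z(3) e g by simp
  qed
  show ?thesis
  proof (rule EG_I)
    show "0 \<le> EG_act G g u z" for z using D(1) by (cases z) (simp add: EG_act_def)
    show "finite {z. EG_act G g u z \<noteq> 0}" unfolding supp using D(2) by simp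
    show "h \<in> carrier G" if "EG_act G g u (n, h) \<noteq> 0" for n h
      using that by (auto simp: EG_act_def split: if_splits)
    show "h = h'" if h: "EG_act G g u (n, h) \<noteq> 0" "EG_act G g u (n, h') \<noteq> 0" for n h h'
    proof -
      have "h \<in> carrier G" "u (n, inv g \<otimes> h) \<noteq> 0" "h' \<in> carrier G" "u (n, inv g \<otimes> h') \<noteq> 0"
        using h by (auto simp: EG_act_def split: if_splits)
      then show ?thesis using D(4)[of n "inv g \<otimes> h" "inv g \<otimes> h'"] g by simp
    qed
    have "(\<Sum>z | EG_act G g u z \<noteq> 0. EG_act G g u z) = (\<Sum>z | u z \<noteq> 0. EG_act G g u (?f z))"
      unfolding supp by (subst sum.reindex[OF inj]) simp
    also have "\<dots> = (\<Sum>z | u z \<noteq> 0. u z)"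
      by (rule sum.cong) (use val D(3) in auto)
    finally show "(\<Sum>z | EG_act G g u z \<noteq> 0. EG_act G g u z) = 1" using D(5) by simp
  qed
qed

lemma EG_coord: "continuous_map (EG G) euclideanreal (\<lambda>u. u z)"
  unfolding EG_def by (rule continuous_map_coordinate)

lemma EG_act_continuous:
  assumes g: "g \<in> carrier G"
  shows "continuous_map (EG G) (EG G) (EG_act G g)"
proof -
  have c: "continuous_map (EG G) euclideanreal (\<lambda>u. EG_act G g u z)" for z
  proof -
    obtain n h where z: "z = (n, h)" by (cases z)
    show ?thesis unfolding z EG_act_def by (cases "h \<in> carrier G") (simp_all add: EG_coord)
  qed
  have e: "EG G = top_of_set join_pts" unfolding EG_def by simp
  show ?thesis
    by (subst (2) e, rule continuous_map_into_functions[OF c]) (use EG_act_closed[OF g] in blast)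
qed

lemma EG_act_one: "u \<in> join_pts \<Longrightarrow> EG_act G \<one> u = u"
  using EG_D(3)[of u] by (auto simp: EG_act_def fun_eq_iff)

lemma EG_act_mult:
  "g \<in> carrier G \<Longrightarrow> g' \<in> carrier G \<Longrightarrow> EG_act G (g \<otimes> g') u = EG_act G g (EG_act G g' u)"
  by (auto simp: EG_act_def fun_eq_iff inv_mult_group m_assoc)

lemma EG_act_inv: "g \<in> carrier G \<Longrightarrow> u \<in> join_pts \<Longrightarrow> EG_act G (inv g) (EG_act G g u) = u"
  using EG_act_mult[of "inv g" g u] EG_act_one by simp

lemma orbit_action_EG: "orbit_action (EG G) (EG_act G) (carrier G)"
  unfolding orbit_action_def
proof (intro conjI ballI)
  fix k assume k: "k \<in> carrier G"
  show "continuous_map (EG G) (EG G) (EG_act G k)" by (rule EG_act_continuous[OF k])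
  show "\<exists>k'\<in>carrier G. \<forall>x\<in>join_pts. EG_act G k' (EG_act G k x) = x"
    using EG_act_inv[OF k] k by (intro bexI[of _ "inv k"]) simp_all
  fix k' assume k': "k' \<in> carrier G"
  show "\<exists>l\<in>carrier G. \<forall>x\<in>join_pts. EG_act G k (EG_act G k' x) = EG_act G l x"
    using EG_act_mult[OF k k'] k k' by (intro bexI[of _ "k \<otimes> k'"]) simp_all
next
  show "\<exists>e\<in>carrier G. \<forall>x\<in>join_pts. EG_act G e x = x"
    using EG_act_one by (intro bexI[of _ \<one>]) simp_all
qed

text \<open>The ambient function space may have uncountably many coordinates, but those outside the
  finite carrier vanish identically. So the join embeds in a countable product of lines.\<close>

lemma metrizable_EG: "metrizable_space (EG G)"
proof -
  let ?I = "UNIV \<times> carrier G :: (nat \<times> 'g) set"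
  let ?P = "product_topology (\<lambda>_. euclideanreal) ?I"
  let ?R = "\<lambda>u. restrict u ?I" and ?e = "\<lambda>x z. if z \<in> ?I then x z else 0"
  let ?T = "subtopology ?P (?R ` join_pts)"
  have eR: "?e (?R u) = u" if "u \<in> join_pts" for u
  proof
    fix z show "?e (?R u) z = u z"
      using EG_D(3)[OF that, of "fst z" "snd z"] by (cases "z \<in> ?I") (auto simp: mem_Times_iff)
  qed
  have c1: "continuous_map (EG G) ?T ?R"
    unfolding continuous_map_in_subtopology
    by (intro conjI) (auto simp: continuous_map_componentwise EG_coord)
  have ee: "EG G = top_of_set join_pts" unfolding EG_def by simp
  have c2: "continuous_map ?T (EG G) ?e"
  proof (subst ee, rule continuous_map_into_functions)
    fix z show "continuous_map ?T euclideanreal (\<lambda>x. ?e x z)"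
    proof (cases "z \<in> ?I")
      case True
      have "continuous_map ?P euclideanreal (\<lambda>x. x z)"
        by (rule continuous_map_product_projection[OF True])
      then show ?thesis using True by (simp add: continuous_map_from_subtopology)
    next
      case False
      then show ?thesis by (simp only: if_False) simp
    qed
  next
    show "?e \<in> topspace ?T \<rightarrow> join_pts"
    proof
      fix x assume "x \<in> topspace ?T"
      then obtain u where u: "u \<in> join_pts" "x = ?R u" by auto
      show "?e x \<in> join_pts" unfolding u(2) eR[OF u(1)] by (rule u(1))
    qed
  qed
  have Re: "?R (?e x) = x" if x: "x \<in> topspace ?T" for x
  proof -
    obtain u where u: "u \<in> join_pts" "x = ?R u" using x by auto
    show ?thesis unfolding u(2) eR[OF u(1)] ..
  qed
  have "homeomorphic_maps (EG G) ?T ?R ?e"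
    unfolding homeomorphic_maps_def using c1 c2 eR Re by blast
  then have "EG G homeomorphic_space ?T" unfolding homeomorphic_space_def by blast
  moreover have "metrizable_space ?P"
    unfolding metrizable_space_product_topology
  proof (rule disjI2, intro conjI ballI)
    have "countable ?I" using finG by (intro countable_SIGMA) (simp_all add: countable_finite)
    then show "countable {i \<in> ?I. \<not> (\<exists>a. topspace euclideanreal \<subseteq> {a})}"
      by (rule countable_subset[rotated]) blast
  qed (simp add: metrizable_space_euclidean)
  ultimately show ?thesis
    using homeomorphic_metrizable_space metrizable_space_subtopology by blast
qed

definition head :: "nat \<Rightarrow> (nat \<times> 'g \<Rightarrow> real) \<Rightarrow> real" where
  "head n u = (\<Sum>z\<in>{..<n} \<times> carrier G. u z)"

text \<open>Positive where the \<open>n\<close>-th group coordinate is the unit and its weight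
  exceeds the total weight of all earlier join coordinates; subtracting that total makes the family
  locally finite.\<close>

definition milnor_bump :: "nat \<Rightarrow> (nat \<times> 'g \<Rightarrow> real) \<Rightarrow> real" where
  "milnor_bump n u = max 0 (u (n, \<one>) - head n u)"

lemma head_cont: "continuous_map (EG G) euclideanreal (head n)"
  unfolding head_def[abs_def] using finG by (intro continuous_map_sum EG_coord) simp

lemma milnor_bump_cont: "continuous_map (EG G) euclideanreal (milnor_bump n)"
  unfolding milnor_bump_def[abs_def]
  by (intro continuous_map_real_max continuous_map_diff EG_coord head_cont) simp

lemma milnor_bump_nonneg: "0 \<le> milnor_bump n u"
  by (simp add: milnor_bump_def)

lemma head_nonneg: "u \<in> join_pts \<Longrightarrow> 0 \<le> head n u"
  unfolding head_def by (intro sum_nonneg EG_D(1))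

lemma milnor_bump_pos:
  assumes u: "u \<in> join_pts" and "0 < milnor_bump n u"
  shows "u (n, \<one>) \<noteq> 0"
  using assms(2) head_nonneg[OF u, of n] by (auto simp: milnor_bump_def)

lemma milnor_bump_sep:
  assumes u: "u \<in> join_pts" and g: "g \<in> carrier G"
    and "0 < milnor_bump n u" "0 < milnor_bump n (EG_act G g u)"
  shows "g = \<one>"
proof -
  have "EG_act G g u (n, \<one>) \<noteq> 0" by (rule milnor_bump_pos[OF EG_act_closed[OF g u] assms(4)])
  then have "u (n, inv g) \<noteq> 0" using g by (simp add: EG_act_def)
  then have "inv g = \<one>" using EG_D(4)[OF u] milnor_bump_pos[OF u assms(3)] by blast
  then show ?thesis using g by (metis inv_inv inv_one)
qed

text \<open>At the least index with a nonzero weight nothing precedes it, and a translation turns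
  the group coordinate there into the unit.\<close>

lemma milnor_bump_cover:
  assumes u: "u \<in> join_pts"
  shows "\<exists>n. \<exists>g\<in>carrier G. 0 < milnor_bump n (EG_act G g u)"
proof -
  note D = EG_D[OF u]
  have "\<exists>n h. u (n, h) \<noteq> 0"
  proof (rule ccontr)
    assume "\<not> ?thesis"
    then have e: "{z. u z \<noteq> 0} = {}" by auto
    show False using D(5) unfolding e by simp
  qed
  then have ex: "\<exists>n. \<exists>h. u (n, h) \<noteq> 0" .
  define n where "n = (LEAST n. \<exists>h. u (n, h) \<noteq> 0)"
  obtain h where h: "u (n, h) \<noteq> 0" using LeastI_ex[OF ex] unfolding n_def by blast
  have hG: "h \<in> carrier G" by (rule D(3)[OF h])
  have low: "u (k, x) = 0" if "k < n" for k x
    using not_less_Least[of k "\<lambda>n. \<exists>h. u (n, h) \<noteq> 0"] that unfolding n_def by blast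
  have "head n (EG_act G (inv h) u) = 0"
    unfolding head_def by (intro sum.neutral) (auto simp: EG_act_def low)
  moreover have "EG_act G (inv h) u (n, \<one>) = u (n, h)" using hG by (simp add: EG_act_def)
  moreover have "0 < u (n, h)" using h D(1)[of "(n, h)"] by simp
  ultimately have "0 < milnor_bump n (EG_act G (inv h) u)" by (simp add: milnor_bump_def)
  then show ?thesis using hG by blast
qed

lemma EG_partial_sum:
  assumes u: "u \<in> join_pts" and A: "finite A"
  shows "sum u A \<le> 1"
proof -
  note D = EG_D[OF u]
  have "sum u A \<le> sum u (A \<union> {z. u z \<noteq> 0})"
    using A D(1,2) by (intro sum_mono2) auto
  also have "\<dots> = sum u {z. u z \<noteq> 0}"
    using A D(2) by (intro sum.mono_neutral_right) auto
  finally show ?thesis using D(5) by simp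
qed

text \<open>Once the first \<open>N\<close> join coordinates carry more than half of the total
  weight 1, no later coordinate can outweigh them, and this is an open condition.\<close>

lemma milnor_bump_finite:
  assumes u: "u \<in> join_pts"
  shows "\<exists>V N. openin (EG G) V \<and> u \<in> V \<and> (\<forall>v\<in>V. \<forall>n\<ge>N. milnor_bump n v = 0)"
proof -
  note D = EG_D[OF u]
  define N where "N = Suc (\<Sum>z | u z \<noteq> 0. fst z)"
  have sub: "{z. u z \<noteq> 0} \<subseteq> {..<N} \<times> carrier G"
  proof
    fix z assume z: "z \<in> {z. u z \<noteq> 0}"
    have "fst z \<le> (\<Sum>z | u z \<noteq> 0. fst z)" using z D(2) by (intro member_le_sum) auto
    moreover have "snd z \<in> carrier G" using z D(3)[of "fst z" "snd z"] by simp
    ultimately show "z \<in> {..<N} \<times> carrier G" by (simp add: mem_Times_iff N_def)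
  qed
  have hN: "head N u = 1"
    unfolding head_def D(5)[symmetric] using sub finG by (intro sum.mono_neutral_right) auto
  let ?V = "{v \<in> join_pts. head N v \<in> {1/2<..}}"
  have "openin (EG G) ?V" by (rule openin_continuous_map_preimage[OF head_cont]) simp
  moreover have "u \<in> ?V" using u hN by simp
  moreover have "\<forall>v\<in>?V. \<forall>n\<ge>N. milnor_bump n v = 0"
  proof (intro ballI allI impI)
    fix v n assume v: "v \<in> ?V" and n: "N \<le> n"
    then have vE: "v \<in> join_pts" "1/2 < head N v" by auto
    have "sum v (insert (n, \<one>) ({..<N} \<times> carrier G)) \<le> 1"
      by (rule EG_partial_sum[OF vE(1)]) (simp add: finG)
    then have "v (n, \<one>) + head N v \<le> 1" using n finG by (simp add: head_def)
    moreover have "head N v \<le> head n v"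
      unfolding head_def using n finG EG_D(1)[OF vE(1)] by (intro sum_mono2) auto
    ultimately have "v (n, \<one>) - head n v \<le> 0" using vE(2) by linarith
    then show "milnor_bump n v = 0" by (simp add: milnor_bump_def)
  qed
  ultimately show ?thesis by (intro exI conjI)
qed

end

section \<open>The principal action of the product group\<close>

lemma finite_group_sym: "finite_group (sym_group m)"
proof -
  interpret group "sym_group m" by (rule sym_group_is_group)
  show ?thesis by unfold_locales (simp add: sym_group_def finite_permutations)
qed

text \<open>Products of bump functions of the two factors, with the pairs of indices listed by
  \<open>prod_decode\<close>.\<close>

definition product_bump :: "('g, 'b) monoid_scheme \<Rightarrow> nat \<Rightarrow> nat \<Rightarrow> 'g epoint \<Rightarrow> real" where
  "product_bump G m n u = finite_group.milnor_bump G (fst (prod_decode n)) (fst u) *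
     finite_group.milnor_bump (sym_group m) (snd (prod_decode n)) (snd u)"

lemma principal_action_Etot:
  fixes G :: "('g, 'b) monoid_scheme"
  assumes "group G" "finite (carrier G)"
  shows "principal_action (G \<times>\<times> sym_group m) (Etot G m) (Etot_act G m) (Bprod G m) (Bproj G m) (product_bump G m)"
proof -
  interpret A: finite_group G using assms by (simp add: finite_group_def finite_group_axioms_def)
  interpret B: finite_group "sym_group m" by (rule finite_group_sym)
  interpret K: group "G \<times>\<times> sym_group m" by (rule DirProd_group[OF assms(1) sym_group_is_group])
  let ?K = "G \<times>\<times> sym_group m"
  have tE: "topspace (Etot G m) = topspace (EG G) \<times> topspace (EG (sym_group m))"
    by (simp add: Etot_def)
  note oA = A.orbit_action_EG and oB = B.orbit_action_EG
  let ?a = A.milnor_bump and ?b = B.milnor_bump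
  show ?thesis
  proof
    show "finite (carrier ?K)" using A.finG B.finG by simp
    fix k assume k: "k \<in> carrier ?K"
    then have k12: "fst k \<in> carrier G" "snd k \<in> carrier (sym_group m)" by (simp_all add: mem_Times_iff)
    have "continuous_map (Etot G m) (EG G) (\<lambda>u. EG_act G (fst k) (fst u))"
      using continuous_map_compose[OF continuous_map_fst A.EG_act_continuous[OF k12(1)]] by (simp add: Etot_def o_def)
    moreover have "continuous_map (Etot G m) (EG (sym_group m)) (\<lambda>u. EG_act (sym_group m) (snd k) (snd u))"
      using continuous_map_compose[OF continuous_map_snd B.EG_act_continuous[OF k12(2)]] by (simp add: Etot_def o_def)
    ultimately show "continuous_map (Etot G m) (Etot G m) (Etot_act G m k)"
      unfolding Etot_act_def[abs_def] by (subst (2) Etot_def) (simp add: continuous_map_pairwise o_def)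
    fix k' w assume k': "k' \<in> carrier ?K" and w: "w \<in> topspace (Etot G m)"
    then have k12': "fst k' \<in> carrier G" "snd k' \<in> carrier (sym_group m)" by (simp_all add: mem_Times_iff)
    have "k \<otimes>\<^bsub>?K\<^esub> k' = (fst k \<otimes>\<^bsub>G\<^esub> fst k', snd k \<otimes>\<^bsub>sym_group m\<^esub> snd k')"
      by (cases k; cases k') simp
    then show "Etot_act G m (k \<otimes>\<^bsub>?K\<^esub> k') w = Etot_act G m k (Etot_act G m k' w)"
      unfolding Etot_act_def using A.EG_act_mult[OF k12(1) k12'(1)] B.EG_act_mult[OF k12(2) k12'(2)] by simp
  next
    fix w assume "w \<in> topspace (Etot G m)"
    then show "Etot_act G m \<one>\<^bsub>?K\<^esub> w = w"
      unfolding tE Etot_act_def using A.EG_act_one B.EG_act_one by (simp add: mem_Times_iff one_DirProd)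
  next
    show "metrizable_space (Etot G m)"
      unfolding Etot_def using A.metrizable_EG B.metrizable_EG by (simp add: metrizable_space_prod_topology)
    have c1: "continuous_map (Etot G m) (BG G) (\<lambda>u. orb (EG_act G) (carrier G) (fst u))"
      using continuous_map_compose[OF continuous_map_fst continuous_map_orb[OF oA]] by (simp add: Etot_def BG_def o_def)
    have c2: "continuous_map (Etot G m) (BG (sym_group m)) (\<lambda>u. orb (EG_act (sym_group m)) (carrier (sym_group m)) (snd u))"
      using continuous_map_compose[OF continuous_map_snd continuous_map_orb[OF oB]] by (simp add: Etot_def BG_def o_def)
    show "continuous_map (Etot G m) (Bprod G m) (Bproj G m)"
      unfolding Bproj_def[abs_def] Bprod_def using c1 c2 by (simp add: continuous_map_pairwise o_def)
    have "open_map (Etot G m) (Bprod G m) (\<lambda>(x, y). (orb (EG_act G) (carrier G) x, orb (EG_act (sym_group m)) (carrier (sym_group m)) y))"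
      unfolding Etot_def Bprod_def BG_def by (rule open_map_prod[OF open_map_orb[OF oA] open_map_orb[OF oB]])
    then show "open_map (Etot G m) (Bprod G m) (Bproj G m)"
      by (simp add: Bproj_def[abs_def] case_prod_unfold)
    have "topspace (Bprod G m) = (orb (EG_act G) (carrier G) ` topspace (EG G)) \<times>
        (orb (EG_act (sym_group m)) (carrier (sym_group m)) ` topspace (EG (sym_group m)))"
      unfolding Bprod_def BG_def by (simp add: topspace_orbit_space[OF oA] topspace_orbit_space[OF oB])
    also have "\<dots> = Bproj G m ` topspace (Etot G m)"
    proof (intro equalityI subsetI)
      fix z assume "z \<in> (orb (EG_act G) (carrier G) ` topspace (EG G)) \<times>
        (orb (EG_act (sym_group m)) (carrier (sym_group m)) ` topspace (EG (sym_group m)))"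
      then obtain x y where "x \<in> topspace (EG G)" "y \<in> topspace (EG (sym_group m))"
        "z = (orb (EG_act G) (carrier G) x, orb (EG_act (sym_group m)) (carrier (sym_group m)) y)" by blast
      then have "z = Bproj G m (x, y)" "(x, y) \<in> topspace (Etot G m)" unfolding Bproj_def tE by simp_all
      then show "z \<in> Bproj G m ` topspace (Etot G m)" by (rule image_eqI)
    next
      fix z assume "z \<in> Bproj G m ` topspace (Etot G m)"
      then obtain u where "z = Bproj G m u" "u \<in> topspace (Etot G m)" by (rule imageE)
      then show "z \<in> (orb (EG_act G) (carrier G) ` topspace (EG G)) \<times>
        (orb (EG_act (sym_group m)) (carrier (sym_group m)) ` topspace (EG (sym_group m)))"
        unfolding Bproj_def tE by (simp add: mem_Times_iff)
    qed
    finally show "Bproj G m ` topspace (Etot G m) = topspace (Bprod G m)" ..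
  next
    fix w w' assume w: "w \<in> topspace (Etot G m)" "w' \<in> topspace (Etot G m)"
    then have p: "fst w \<in> topspace (EG G)" "snd w \<in> topspace (EG (sym_group m))"
      "fst w' \<in> topspace (EG G)" "snd w' \<in> topspace (EG (sym_group m))" unfolding tE by (simp_all add: mem_Times_iff)
    have "Bproj G m w = Bproj G m w' \<longleftrightarrow>
      (\<exists>g\<in>carrier G. fst w' = EG_act G g (fst w)) \<and> (\<exists>s\<in>carrier (sym_group m). snd w' = EG_act (sym_group m) s (snd w))"
      unfolding Bproj_def using orb_eq_iff[OF oA p(1,3)] orb_eq_iff[OF oB p(2,4)] by simp
    also have "\<dots> \<longleftrightarrow> (\<exists>k\<in>carrier ?K. w' = Etot_act G m k w)"
      unfolding Etot_act_def carrier_DirProd prod_eq_iff by fastforce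
    finally show "Bproj G m w = Bproj G m w' \<longleftrightarrow> (\<exists>k\<in>carrier ?K. w' = Etot_act G m k w)" .
  next
    fix n
    have "continuous_map (Etot G m) euclideanreal (\<lambda>u. ?a (fst (prod_decode n)) (fst u))"
      using continuous_map_compose[OF continuous_map_fst A.milnor_bump_cont] by (simp add: Etot_def o_def)
    moreover have "continuous_map (Etot G m) euclideanreal (\<lambda>u. ?b (snd (prod_decode n)) (snd u))"
      using continuous_map_compose[OF continuous_map_snd B.milnor_bump_cont] by (simp add: Etot_def o_def)
    ultimately show "continuous_map (Etot G m) euclideanreal (product_bump G m n)"
      unfolding product_bump_def[abs_def] by (rule continuous_map_real_mult)
    show nn: "0 \<le> product_bump G m n w" for w
      unfolding product_bump_def by (intro mult_nonneg_nonneg A.milnor_bump_nonneg B.milnor_bump_nonneg)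
    fix k w assume w: "w \<in> topspace (Etot G m)" and k: "k \<in> carrier ?K"
      and pos: "0 < product_bump G m n w" "0 < product_bump G m n (Etot_act G m k w)"
    have p: "fst w \<in> topspace (EG G)" "snd w \<in> topspace (EG (sym_group m))" using w unfolding tE by (simp_all add: mem_Times_iff)
    have k12: "fst k \<in> carrier G" "snd k \<in> carrier (sym_group m)" using k by (simp_all add: mem_Times_iff)
    have split: "0 < ?a (fst (prod_decode n)) (fst v) \<and> 0 < ?b (snd (prod_decode n)) (snd v)"
      if "0 < product_bump G m n v" for v
      using that A.milnor_bump_nonneg[of "fst (prod_decode n)" "fst v"] B.milnor_bump_nonneg[of "snd (prod_decode n)" "snd v"]
      unfolding product_bump_def by (auto simp: zero_less_mult_iff)
    have "fst k = \<one>\<^bsub>G\<^esub>"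
      by (rule A.milnor_bump_sep[OF p(1) k12(1), of "fst (prod_decode n)"])
        (use split[OF pos(1)] split[OF pos(2)] in \<open>simp_all add: Etot_act_def\<close>)
    moreover have "snd k = \<one>\<^bsub>sym_group m\<^esub>"
      by (rule B.milnor_bump_sep[OF p(2) k12(2), of "snd (prod_decode n)"])
        (use split[OF pos(1)] split[OF pos(2)] in \<open>simp_all add: Etot_act_def\<close>)
    ultimately show "k = \<one>\<^bsub>?K\<^esub>" by (simp add: prod_eq_iff one_DirProd)
  next
    fix w assume w: "w \<in> topspace (Etot G m)"
    have p: "fst w \<in> topspace (EG G)" "snd w \<in> topspace (EG (sym_group m))" using w unfolding tE by (simp_all add: mem_Times_iff)
    obtain n1 g where g: "g \<in> carrier G" "0 < ?a n1 (EG_act G g (fst w))" using A.milnor_bump_cover[OF p(1)] by blast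
    obtain n2 s where s: "s \<in> carrier (sym_group m)" "0 < ?b n2 (EG_act (sym_group m) s (snd w))" using B.milnor_bump_cover[OF p(2)] by blast
    have "0 < product_bump G m (prod_encode (n1, n2)) (Etot_act G m (g, s) w)"
      unfolding product_bump_def Etot_act_def using g(2) s(2) by simp
    moreover have "(g, s) \<in> carrier ?K" using g(1) s(1) by simp
    ultimately show "\<exists>n. \<exists>k\<in>carrier ?K. 0 < product_bump G m n (Etot_act G m k w)" by blast
    obtain V1 N1 where V1: "openin (EG G) V1" "fst w \<in> V1" "\<forall>v\<in>V1. \<forall>n\<ge>N1. ?a n v = 0"
      using A.milnor_bump_finite[OF p(1)] by blast
    obtain V2 N2 where V2: "openin (EG (sym_group m)) V2" "snd w \<in> V2" "\<forall>v\<in>V2. \<forall>n\<ge>N2. ?b n v = 0"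
      using B.milnor_bump_finite[OF p(2)] by blast
    \<comment> \<open>The sum of the codes of all pairs below \<open>(N1, N2)\<close> bounds each of
      those codes, so for larger \<open>n\<close> at least one factor vanishes.\<close>
    have "product_bump G m n v = 0" if v: "v \<in> V1 \<times> V2" and n: "Suc (\<Sum>z\<in>{..<N1} \<times> {..<N2}. prod_encode z) \<le> n" for v n
    proof -
      have "\<not> (fst (prod_decode n) < N1 \<and> snd (prod_decode n) < N2)"
      proof
        assume "fst (prod_decode n) < N1 \<and> snd (prod_decode n) < N2"
        then have "prod_decode n \<in> {..<N1} \<times> {..<N2}" by (simp add: mem_Times_iff)
        then have "prod_encode (prod_decode n) \<le> (\<Sum>z\<in>{..<N1} \<times> {..<N2}. prod_encode z)"
          by (intro member_le_sum) auto
        then show False using n by simp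
      qed
      then have "?a (fst (prod_decode n)) (fst v) = 0 \<or> ?b (snd (prod_decode n)) (snd v) = 0"
        using v V1(3) V2(3) by (auto simp: mem_Times_iff not_less)
      then show ?thesis unfolding product_bump_def by auto
    qed
    moreover have "openin (Etot G m) (V1 \<times> V2)" using V1(1) V2(1) by (simp add: Etot_def openin_prod_Times_iff)
    moreover have "w \<in> V1 \<times> V2" using V1(2) V2(2) by (simp add: mem_Times_iff)
    ultimately show "\<exists>V N. openin (Etot G m) V \<and> w \<in> V \<and> (\<forall>v\<in>V. \<forall>n\<ge>N. product_bump G m n v = 0)"
      by (intro exI[of _ "V1 \<times> V2"] exI[of _ "Suc (\<Sum>z\<in>{..<N1} \<times> {..<N2}. prod_encode z)"]) simp
  qed
qed

section \<open>Matching permutations and generated ideals\<close>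

text \<open>Labellings with equal multiplicities differ by a permutation, assembled from bijections
  between fibres of the same label.\<close>

lemma permutes_matching:
  assumes S: "finite S" and card: "\<And>t. card {i \<in> S. f i = t} = card {i \<in> S. f' i = t}"
  obtains \<sigma> where "\<sigma> permutes S" "\<And>i. i \<in> S \<Longrightarrow> f' (\<sigma> i) = f i"
proof -
  have "\<exists>h. bij_betw h {i \<in> S. f i = t} {i \<in> S. f' i = t}" for t
    using S card by (intro finite_same_card_bij) simp_all
  then obtain h where h: "\<And>t. bij_betw (h t) {i \<in> S. f i = t} {i \<in> S. f' i = t}" by metis
  define \<sigma> where "\<sigma> i = (if i \<in> S then h (f i) i else i)" for i
  have s: "\<sigma> i \<in> S \<and> f' (\<sigma> i) = f i" if "i \<in> S" for i
    using bij_betwE[OF h[of "f i"]] that by (simp add: \<sigma>_def)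
  have "inj_on \<sigma> S"
  proof (rule inj_onI)
    fix i j assume ij: "i \<in> S" "j \<in> S" "\<sigma> i = \<sigma> j"
    then have "f i = f j" using s by metis
    then show "i = j" using bij_betw_imp_inj_on[OF h[of "f i"]] ij by (simp add: \<sigma>_def inj_on_def)
  qed
  moreover have "\<sigma> ` S \<subseteq> S" using s by blast
  ultimately have "bij_betw \<sigma> S S" using S by (simp add: bij_betw_def endo_inj_surj)
  then have "\<sigma> permutes S" by (rule bij_imp_permutes) (simp add: \<sigma>_def)
  then show thesis using s that by blast
qed

lemma (in ideal) finsum_in_ideal:
  assumes "finite A" "\<And>i. i \<in> A \<Longrightarrow> f i \<in> I"
  shows "finsum R f A \<in> I"
  using assms
proof (induction A rule: finite_induct)
  case empty
  then show ?case by (simp add: additive_subgroup.zero_closed[OF additive_subgroup_axioms])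
next
  case (insert x A)
  have "f \<in> A \<rightarrow> carrier R" "f x \<in> carrier R" using insert.prems a_subset by auto
  then have "finsum R f (insert x A) = f x \<oplus> finsum R f A"
    using insert.hyps by (simp add: finsum_insert)
  then show ?case using insert additive_subgroup.a_closed[OF additive_subgroup_axioms] by simp
qed

text \<open>Generated ideals are intersections of the ideals containing the generators. This reduces
  the theorem to containments in one ideal at a time.\<close>

lemma genideal_cong:
  assumes "\<And>I. ideal I R \<Longrightarrow> A \<subseteq> I \<longleftrightarrow> B \<subseteq> I"
  shows "Idl\<^bsub>R\<^esub> A = Idl\<^bsub>R\<^esub> B"
  unfolding genideal_def by (rule arg_cong[where f=Inter], rule Collect_cong) (use assms in blast)

section \<open>Configurations of cosets\<close>

definition block :: "nat \<Rightarrow> nat \<Rightarrow> nat" where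
  "block q i = (i - 1) div q + 1"

definition offset :: "nat \<Rightarrow> nat \<Rightarrow> nat" where
  "offset q i = (i - 1) mod q + 1"

text \<open>Counting starts at 1: block \<open>b\<close> occupies the positions from
  \<open>(b - 1) * q + 1\<close> to \<open>b * q\<close>, as in \<open>wreath_perm\<close>.\<close>

definition position :: "nat \<Rightarrow> nat \<Rightarrow> nat \<Rightarrow> nat" where
  "position q b r = (b - 1) * q + r"

lemma position_block_offset: "1 \<le> i \<Longrightarrow> position q (block q i) (offset q i) = i"
  unfolding position_def block_def offset_def by simp

lemma block_in:
  assumes "i \<in> {1..n * q}"
  shows "block q i \<in> {1..n}"
proof -
  have "i - 1 < n * q" using assms by auto
  then have "(i - 1) div q < n" by (rule less_mult_imp_div_less)
  then show ?thesis by (simp add: block_def)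
qed

lemma offset_in: "q \<ge> 1 \<Longrightarrow> offset q i \<in> {1..q}"
  unfolding offset_def using mod_less_divisor[of q "i - 1"] by (simp add: Suc_le_eq)

lemma position_inverse:
  assumes "b \<in> {1..n}" "r \<in> {1..q}"
  shows "block q (position q b r) = b" "offset q (position q b r) = r" "position q b r \<in> {1..n * q}"
proof -
  obtain b' r' where br: "b = Suc b'" "r = Suc r'" using assms by (cases b; cases r) auto
  have r': "r' < q" "b' < n" using assms br by auto
  have e: "position q b r - 1 = r' + b' * q" by (simp add: position_def br)
  show "block q (position q b r) = b" "offset q (position q b r) = r"
    unfolding block_def offset_def e using r' br by simp_all
  have "r' + b' * q < q + b' * q" using r' by simp
  also have "\<dots> = Suc b' * q" by simp
  also have "\<dots> \<le> n * q" using r'(2) by (intro mult_le_mono1) simp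
  finally show "position q b r \<in> {1..n * q}" by (simp add: position_def br)
qed

lemma wreath_perm_position:
  "i \<in> {1..n * q} \<Longrightarrow> wreath_perm q n \<rho> \<pi> i = position q (\<pi> (block q i)) (\<rho> (\<pi> (block q i)) (offset q i))"
  by (simp add: wreath_perm_def Let_def position_def block_def offset_def)

lemma wreath_perm_permutes:
  assumes q: "q \<ge> 1" and \<pi>: "\<pi> permutes {1..n}" and \<rho>: "\<forall>b\<in>{1..n}. \<rho> b permutes {1..q}"
  shows "wreath_perm q n \<rho> \<pi> permutes {1..n * q}"
    "\<And>i. i \<in> {1..n * q} \<Longrightarrow> block q (wreath_perm q n \<rho> \<pi> i) = \<pi> (block q i)"
proof -
  let ?w = "wreath_perm q n \<rho> \<pi>"
  have pb: "\<pi> (block q i) \<in> {1..n}" if "i \<in> {1..n * q}" for i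
    using permutes_in_image[OF \<pi>] block_in[OF that] by blast
  have rb: "\<rho> (\<pi> (block q i)) (offset q i) \<in> {1..q}" if "i \<in> {1..n * q}" for i
    using permutes_in_image[OF bspec[OF \<rho> pb[OF that]]] offset_in[OF q, of i] by blast
  note P = position_inverse[OF pb rb]
  show blk: "block q (?w i) = \<pi> (block q i)" if "i \<in> {1..n * q}" for i
    unfolding wreath_perm_position[OF that] by (rule P(1)[OF that that])
  have off: "offset q (?w i) = \<rho> (\<pi> (block q i)) (offset q i)" if "i \<in> {1..n * q}" for i
    unfolding wreath_perm_position[OF that] by (rule P(2)[OF that that])
  have "inj_on ?w {1..n * q}"
  proof (rule inj_onI)
    fix i j assume ij: "i \<in> {1..n * q}" "j \<in> {1..n * q}" "?w i = ?w j"
    have "\<pi> (block q i) = \<pi> (block q j)" using blk[OF ij(1)] blk[OF ij(2)] ij(3) by simp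
    then have b: "block q i = block q j" using permutes_inj[OF \<pi>] by (simp add: inj_eq)
    have "\<rho> (\<pi> (block q i)) (offset q i) = \<rho> (\<pi> (block q i)) (offset q j)" using off[OF ij(1)] off[OF ij(2)] ij(3) b by simp
    moreover have "inj (\<rho> (\<pi> (block q i)))" by (rule permutes_inj[OF bspec[OF \<rho> pb[OF ij(1)]]])
    ultimately have "offset q i = offset q j" by (simp add: inj_eq)
    then have "position q (block q i) (offset q i) = position q (block q j) (offset q j)" using b by (simp only:)
    moreover have "1 \<le> i" "1 \<le> j" using ij(1,2) by simp_all
    ultimately show "i = j" by (simp only: position_block_offset)
  qed
  moreover have "?w ` {1..n * q} \<subseteq> {1..n * q}"
  proof (rule image_subsetI)
    fix i assume i: "i \<in> {1..n * q}"
    show "?w i \<in> {1..n * q}" unfolding wreath_perm_position[OF i] by (rule P(3)[OF i i])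
  qed
  ultimately have "bij_betw ?w {1..n * q} {1..n * q}" by (simp add: bij_betw_def endo_inj_surj)
  then show "?w permutes {1..n * q}" by (rule bij_imp_permutes) (simp add: wreath_perm_def del: atLeastAtMost_iff)
qed

section \<open>Coset configurations and their stabilizers\<close>

locale coset_config = normal H G for H :: "'g set" and G :: "('g, 'b) monoid_scheme" (structure) +
  fixes m :: nat
  assumes finG: "finite (carrier G)"
begin

abbreviation "\<Gamma> \<equiv> G \<times>\<times> sym_group m"
abbreviation "cact \<equiv> coset_power_act G m"
abbreviation "configs \<equiv> {1..m} \<rightarrow>\<^sub>E lcos G (carrier G) H"
abbreviation "diagonal \<equiv> {\<lambda>i\<in>{1..m}. g <# H | g. g \<in> carrier G}"

lemma carrier_iff: "k \<in> carrier \<Gamma> \<longleftrightarrow> fst k \<in> carrier G \<and> snd k permutes {1..m}"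
  by (simp add: mem_Times_iff sym_group_carrier)

lemma H_sub: "H \<subseteq> carrier G" by (rule subset)

lemma group_Gamma: "group \<Gamma>"
  by (rule DirProd_group[OF is_group sym_group_is_group])

lemma lcosE:
  assumes "t \<in> lcos G S H"
  obtains s where "s \<in> S" "t = s <# H"
  using assms unfolding lcos_def by blast

lemma lcos_mult: "g \<in> carrier G \<Longrightarrow> x \<in> carrier G \<Longrightarrow> g <# (x <# H) = (g \<otimes> x) <# H"
  by (rule lcos_m_assoc[OF H_sub])

lemma lcos_carrier: "t \<in> lcos G (carrier G) H \<Longrightarrow> t \<subseteq> carrier G"
  by (elim lcosE) (simp add: l_coset_subset_G[OF H_sub])

lemma lcos_closed: "g \<in> carrier G \<Longrightarrow> t \<in> lcos G (carrier G) H \<Longrightarrow> g <# t \<in> lcos G (carrier G) H"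
proof (elim lcosE)
  fix s assume "g \<in> carrier G" "s \<in> carrier G" "t = s <# H"
  then show "g <# t \<in> lcos G (carrier G) H" by (simp add: lcos_mult lcos_def)
qed

lemma cact_at: "i \<in> {1..m} \<Longrightarrow> cact k z i = fst k <# z (inv_into UNIV (snd k) i)"
  by (simp add: coset_power_act_def)

lemma inv_perm_in: "\<sigma> permutes {1..m} \<Longrightarrow> i \<in> {1..m} \<Longrightarrow> inv_into UNIV \<sigma> i \<in> {1..m}"
  by (simp only: permutes_in_image[OF permutes_inv])

lemma cact_perm_at: "snd k permutes {1..m} \<Longrightarrow> i \<in> {1..m} \<Longrightarrow> cact k z (snd k i) = fst k <# z i"
  using cact_at[of "snd k i" k z] permutes_in_image[of "snd k" "{1..m}" i] permutes_inverses(2)[of "snd k"] by simp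

lemma finite_gset_configs: "finite_gset \<Gamma> cact configs"
  unfolding finite_gset_def
proof (intro conjI ballI)
  have "finite (lcos G (carrier G) H)" unfolding lcos_def using finG by simp
  then show "finite configs" by (intro finite_PiE) simp_all
next
  fix k z assume k: "k \<in> carrier \<Gamma>" and z: "z \<in> configs"
  have k': "fst k \<in> carrier G" "snd k permutes {1..m}" using k unfolding carrier_iff by simp_all
  show "cact k z \<in> configs"
  proof (rule PiE_I)
    fix i assume i: "i \<in> {1..m}"
    have "z (inv_into UNIV (snd k) i) \<in> lcos G (carrier G) H" using z inv_perm_in[OF k'(2) i] by (rule PiE_mem)
    then show "cact k z i \<in> lcos G (carrier G) H" unfolding cact_at[OF i] by (rule lcos_closed[OF k'(1)])
  qed (simp add: coset_power_act_def del: atLeastAtMost_iff)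
next
  fix z assume z: "z \<in> configs"
  show "cact \<one>\<^bsub>\<Gamma>\<^esub> z = z"
  proof
    fix i show "cact \<one>\<^bsub>\<Gamma>\<^esub> z i = z i"
    proof (cases "i \<in> {1..m}")
      case True
      have "z i \<subseteq> carrier G" by (rule lcos_carrier[OF PiE_mem[OF z True]])
      then show ?thesis unfolding cact_at[OF True] by (simp add: one_DirProd sym_group_one lcos_mult_one)
    next
      case False
      then show ?thesis using PiE_arb[OF z False] unfolding coset_power_act_def restrict_def by (simp only: if_False)
    qed
  qed
next
  fix k k' z assume k: "k \<in> carrier \<Gamma>" and k': "k' \<in> carrier \<Gamma>" and z: "z \<in> configs"
  have p: "fst k \<in> carrier G" "snd k permutes {1..m}" "fst k' \<in> carrier G" "snd k' permutes {1..m}"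
    using k k' unfolding carrier_iff by simp_all
  have kk: "k \<otimes>\<^bsub>\<Gamma>\<^esub> k' = (fst k \<otimes> fst k', snd k \<circ> snd k')" by (cases k; cases k') (simp add: sym_group_mult)
  have iv: "inv_into UNIV (snd k \<circ> snd k') = inv_into UNIV (snd k') \<circ> inv_into UNIV (snd k)"
    by (rule o_inv_distrib[OF permutes_bij[OF p(2)] permutes_bij[OF p(4)]])
  show "cact (k \<otimes>\<^bsub>\<Gamma>\<^esub> k') z = cact k (cact k' z)"
  proof
    fix i show "cact (k \<otimes>\<^bsub>\<Gamma>\<^esub> k') z i = cact k (cact k' z) i"
    proof (cases "i \<in> {1..m}")
      case True
      have j: "inv_into UNIV (snd k) i \<in> {1..m}" by (rule inv_perm_in[OF p(2) True])
      have "z (inv_into UNIV (snd k') (inv_into UNIV (snd k) i)) \<subseteq> carrier G"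
        by (rule lcos_carrier[OF PiE_mem[OF z inv_perm_in[OF p(4) j]]])
      then show ?thesis unfolding cact_at[OF True] cact_at[OF j] kk iv
        using lcos_m_assoc[OF _ p(1,3)] by (simp add: iv)
    qed (simp add: coset_power_act_def restrict_def del: atLeastAtMost_iff)
  qed
qed

lemma finite_gset_diagonal: "finite_gset \<Gamma> cact diagonal" "diagonal \<subseteq> configs"
proof -
  show sub: "diagonal \<subseteq> configs" by (auto simp: lcos_def)
  note D = finite_gsetD[OF finite_gset_configs]
  have cl: "cact k z \<in> diagonal" if k: "k \<in> carrier \<Gamma>" and z: "z \<in> diagonal" for k z
  proof -
    have k': "fst k \<in> carrier G" "snd k permutes {1..m}" using k unfolding carrier_iff by simp_all
    obtain g where g: "g \<in> carrier G" "z = (\<lambda>i\<in>{1..m}. g <# H)" using z by blast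
    have "cact k z = (\<lambda>i\<in>{1..m}. (fst k \<otimes> g) <# H)"
    proof
      fix i show "cact k z i = (\<lambda>i\<in>{1..m}. (fst k \<otimes> g) <# H) i"
      proof (cases "i \<in> {1..m}")
        case True
        have zi: "z (inv_into UNIV (snd k) i) = g <# H" unfolding g(2) using inv_perm_in[OF k'(2) True] by (rule restrict_apply')
        show ?thesis unfolding cact_at[OF True] zi lcos_mult[OF k'(1) g(1)] using True by (simp only: restrict_apply')
      qed (simp add: coset_power_act_def restrict_def del: atLeastAtMost_iff)
    qed
    then show ?thesis using k'(1) g(1) by blast
  qed
  show "finite_gset \<Gamma> cact diagonal"
    unfolding finite_gset_def
  proof (intro conjI ballI)
    show "finite diagonal" by (rule finite_subset[OF sub D(1)])
    show "cact k z \<in> diagonal" if "k \<in> carrier \<Gamma>" "z \<in> diagonal" for k z by (rule cl[OF that])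
    show "cact \<one>\<^bsub>\<Gamma>\<^esub> z = z" if "z \<in> diagonal" for z by (rule D(3)[OF subsetD[OF sub that]])
    show "cact (k \<otimes>\<^bsub>\<Gamma>\<^esub> k') z = cact k (cact k' z)"
      if "k \<in> carrier \<Gamma>" "k' \<in> carrier \<Gamma>" "z \<in> diagonal" for k k' z
      by (rule D(4)[OF that(1,2) subsetD[OF sub that(3)]])
  qed
qed

definition block_config :: "nat \<Rightarrow> (nat \<Rightarrow> 'g set) \<Rightarrow> nat \<Rightarrow> 'g set" where
  "block_config q w = (\<lambda>i\<in>{1..m}. w (block q i))"

text \<open>Evaluating at \<open>snd k i\<close> instead of \<open>i\<close> cancels the inverse
  permutation in the action.\<close>

lemma stab_iff:
  assumes k: "k \<in> carrier \<Gamma>" and z: "z \<in> extensional {1..m}"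
  shows "cact k z = z \<longleftrightarrow> (\<forall>i\<in>{1..m}. fst k <# z i = z (snd k i))"
proof
  have p: "snd k permutes {1..m}" using k unfolding carrier_iff by simp
  assume "cact k z = z"
  then show "\<forall>i\<in>{1..m}. fst k <# z i = z (snd k i)" using cact_perm_at[OF p] by metis
next
  have p: "snd k permutes {1..m}" using k unfolding carrier_iff by simp
  assume h: "\<forall>i\<in>{1..m}. fst k <# z i = z (snd k i)"
  show "cact k z = z"
  proof (rule extensionalityI[where A="{1..m}"])
    show "cact k z \<in> extensional {1..m}" by (simp add: coset_power_act_def)
    fix i assume i: "i \<in> {1..m}"
    let ?j = "inv_into UNIV (snd k) i"
    have j: "?j \<in> {1..m}" by (rule inv_perm_in[OF p i])
    have "snd k ?j = i" by (rule permutes_inverses(1)[OF p])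
    then show "cact k z i = z i" unfolding cact_at[OF i] using h j by metis
  qed (rule z)
qed

lemma lcos_sub:
  assumes "subgroup S G"
  shows "lcos G S H \<subseteq> lcos G (carrier G) H"
  unfolding lcos_def using subgroup.subset[OF assms] by blast

lemma lcos_subgroup_closed:
  assumes S: "subgroup S G" and s: "s \<in> S" and t: "t \<in> lcos G S H"
  shows "s <# t \<in> lcos G S H"
proof -
  obtain x where x: "x \<in> S" "t = x <# H" using t by (rule lcosE)
  have "s <# t = (s \<otimes> x) <# H" unfolding x(2)
    by (rule lcos_mult[OF subgroup.mem_carrier[OF S s] subgroup.mem_carrier[OF S x(1)]])
  then show ?thesis unfolding lcos_def using subgroup.m_closed[OF S s x(1)] by blast
qed

lemma lcos_self: "g \<in> carrier G \<Longrightarrow> g \<in> g <# H"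
  using one_closed unfolding l_coset_def by force

text \<open>As \<open>S\<close> contains \<open>H\<close>, a left coset of an element of
  \<open>S\<close> lies inside \<open>S\<close>; moving one such coset to another therefore forces
  \<open>g\<close> into \<open>S\<close>.\<close>

lemma lcos_subgroup_mem:
  assumes S: "subgroup S G" and HS: "H \<subseteq> S" and g: "g \<in> carrier G" and t: "t \<in> lcos G S H" "g <# t \<in> lcos G S H"
  shows "g \<in> S"
proof -
  obtain x where x: "x \<in> S" "t = x <# H" using t(1) by (rule lcosE)
  obtain y where y: "y \<in> S" "g <# t = y <# H" using t(2) by (rule lcosE)
  have xG: "x \<in> carrier G" by (rule subgroup.mem_carrier[OF S x(1)])
  have "(g \<otimes> x) <# H = y <# H" using y(2) unfolding x(2) lcos_mult[OF g xG] .
  then have "g \<otimes> x \<in> y <# H" using lcos_self[of "g \<otimes> x"] g xG by simp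
  then obtain h where h: "h \<in> H" "g \<otimes> x = y \<otimes> h" unfolding l_coset_def by blast
  have "g \<otimes> x \<in> S" unfolding h(2) using subgroup.m_closed[OF S y(1)] h(1) HS by blast
  then have "(g \<otimes> x) \<otimes> inv x \<in> S" using subgroup.m_closed[OF S] subgroup.m_inv_closed[OF S x(1)] by blast
  then show ?thesis using g xG by (simp add: m_assoc)
qed

lemma lcos_inj: "g \<in> carrier G \<Longrightarrow> t \<in> lcos G (carrier G) H \<Longrightarrow> inv g <# (g <# t) = t"
  using lcos_m_assoc[OF lcos_carrier, of t "inv g" g] lcos_carrier[of t] by (simp add: lcos_mult_one)

text \<open>A pair \<open>(s, \<sigma>)\<close> fixes the block configuration when
  \<open>\<sigma>\<close> sends the block labelled \<open>t\<close> to the block labelled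
  \<open>s <# t\<close>. This forces \<open>s\<close> into \<open>S\<close> and the motion of the
  blocks to be that of \<open>s\<close> on S/H, and leaves the permutations inside the blocks
  free.\<close>

lemma stab_block_config:
  assumes S: "subgroup S G" and HS: "H \<subseteq> S" and w: "bij_betw w {1..n} (lcos G S H)"
    and n: "n \<ge> 1" and q: "q \<ge> 1" and m: "m = n * q"
  shows "{k \<in> carrier \<Gamma>. cact k (block_config q w) = block_config q w} = wreath_graph G S n q w"
proof -
  let ?z = "block_config q w"
  have ze: "?z \<in> extensional {1..m}" by (simp add: block_config_def)
  have zat: "?z i = w (block q i)" if "i \<in> {1..m}" for i using that by (simp add: block_config_def)
  have wl: "w b \<in> lcos G S H" if "b \<in> {1..n}" for b using w that by (rule bij_betwE[THEN bspec])
  have winj: "b = b'" if "b \<in> {1..n}" "b' \<in> {1..n}" "w b = w b'" for b b'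
    by (rule inj_onD[OF bij_betw_imp_inj_on[OF w] that(3,1,2)])
  have bl: "block q i \<in> {1..n}" if "i \<in> {1..m}" for i using block_in[of i n q] that m by (simp only:)
  have cp: "w (coset_perm G n w s b) = s <# w b" "coset_perm G n w s b \<in> {1..n}" if s: "s \<in> S" and b: "b \<in> {1..n}" for s b
  proof -
    have "s <# w b \<in> w ` {1..n}" using lcos_subgroup_closed[OF S s wl[OF b]] w unfolding bij_betw_def by simp
    then show "w (coset_perm G n w s b) = s <# w b" "coset_perm G n w s b \<in> {1..n}"
      unfolding coset_perm_def using b by (simp_all add: f_inv_into_f inv_into_into del: atLeastAtMost_iff)
  qed
  have cpp: "coset_perm G n w s permutes {1..n}" if s: "s \<in> S" for s
  proof -
    have sG: "s \<in> carrier G" by (rule subgroup.mem_carrier[OF S s])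
    have "inj_on (coset_perm G n w s) {1..n}"
    proof (rule inj_onI)
      fix b b' assume b: "b \<in> {1..n}" "b' \<in> {1..n}" "coset_perm G n w s b = coset_perm G n w s b'"
      have "s <# w b = s <# w b'" using cp(1)[OF s b(1)] cp(1)[OF s b(2)] b(3) by simp
      then have "inv s <# (s <# w b) = inv s <# (s <# w b')" by (simp only:)
      then have "w b = w b'"
        unfolding lcos_inj[OF sG subsetD[OF lcos_sub[OF S] wl[OF b(1)]]] lcos_inj[OF sG subsetD[OF lcos_sub[OF S] wl[OF b(2)]]] .
      then show "b = b'" by (rule winj[OF b(1,2)])
    qed
    moreover have "coset_perm G n w s ` {1..n} \<subseteq> {1..n}" using cp(2)[OF s] by blast
    ultimately have "bij_betw (coset_perm G n w s) {1..n} {1..n}" by (simp add: bij_betw_def endo_inj_surj)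
    then show ?thesis by (rule bij_imp_permutes) (simp add: coset_perm_def del: atLeastAtMost_iff)
  qed
  show ?thesis
  proof (intro equalityI subsetI)
    fix k assume "k \<in> wreath_graph G S n q w"
    then obtain s \<rho> where k: "k = (s, wreath_perm q n \<rho> (coset_perm G n w s))" "s \<in> S" "\<forall>b\<in>{1..n}. \<rho> b permutes {1..q}"
      unfolding wreath_graph_def act_graph_def by blast
    note W = wreath_perm_permutes[OF q cpp[OF k(2)] k(3), folded m]
    have kc: "k \<in> carrier \<Gamma>" unfolding carrier_iff k(1) using W(1) subgroup.mem_carrier[OF S k(2)] by simp
    have "fst k <# ?z i = ?z (snd k i)" if i: "i \<in> {1..m}" for i
    proof -
      have wi: "snd k i \<in> {1..m}" unfolding k(1) snd_conv using permutes_in_image[OF W(1)] i by blast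
      have "block q (snd k i) = coset_perm G n w s (block q i)" unfolding k(1) snd_conv by (rule W(2)[OF i])
      then show ?thesis unfolding zat[OF i] zat[OF wi] using cp(1)[OF k(2) bl[OF i]] k(1) by simp
    qed
    then show "k \<in> {k \<in> carrier \<Gamma>. cact k ?z = ?z}" using kc stab_iff[OF kc ze] by blast
  next
    fix k assume "k \<in> {k \<in> carrier \<Gamma>. cact k ?z = ?z}"
    then have kc: "k \<in> carrier \<Gamma>" and "cact k ?z = ?z" by simp_all
    then have st: "\<And>i. i \<in> {1..m} \<Longrightarrow> fst k <# ?z i = ?z (snd k i)" using stab_iff[OF kc ze] by blast
    define s where "s = fst k"
    define \<sigma> where "\<sigma> = snd k"
    have kp: "s \<in> carrier G" "\<sigma> permutes {1..m}" using kc unfolding carrier_iff s_def \<sigma>_def by simp_all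
    have \<sigma>i: "\<sigma> i \<in> {1..m}" if "i \<in> {1..m}" for i using permutes_in_image[OF kp(2)] that by blast
    have swb: "s <# w (block q i) = w (block q (\<sigma> i))" if i: "i \<in> {1..m}" for i
      using st[OF i] unfolding zat[OF i] s_def \<sigma>_def zat[OF \<sigma>i[OF i, unfolded \<sigma>_def]] .
    have "1 \<le> n * q" using mult_le_mono[OF n q] by simp
    then have one: "1 \<in> {1..m}" using m by simp
    \<comment> \<open>Position 1 exists because \<open>n\<close> and \<open>q\<close> are positive;
      there \<open>s\<close> takes one coset in S/H to another.\<close>
    have sS: "s \<in> S"
      by (rule lcos_subgroup_mem[OF S HS kp(1) wl[OF bl[OF one]]]) (simp only: swb[OF one] wl[OF bl[OF \<sigma>i[OF one]]])
    let ?\<pi> = "coset_perm G n w s"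
    have b\<sigma>: "block q (\<sigma> i) = ?\<pi> (block q i)" if i: "i \<in> {1..m}" for i
      by (rule winj[OF bl[OF \<sigma>i[OF i]] cp(2)[OF sS bl[OF i]]]) (simp only: cp(1)[OF sS bl[OF i]] swb[OF i])
    let ?b = "\<lambda>c. inv_into UNIV ?\<pi> c"
    \<comment> \<open>Since \<open>wreath_perm\<close> applies \<open>\<rho>\<close> in the target
      block, \<open>\<rho> c\<close> is read off from the positions of the block that is moved to
      \<open>c\<close>. It is the identity outside \<open>{1..q}\<close>, as a permutation of that
      set must be.\<close>
    define \<rho> where "\<rho> c r = (if r \<in> {1..q} then offset q (\<sigma> (position q (?b c) r)) else r)" for c r
    have bc: "?b c \<in> {1..n}" "?\<pi> (?b c) = c" if "c \<in> {1..n}" for c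
      using that by (simp_all only: permutes_in_image[OF permutes_inv[OF cpp[OF sS]]] permutes_inverses(1)[OF cpp[OF sS]])
    have perm: "\<rho> c permutes {1..q}" if c: "c \<in> {1..n}" for c
    proof -
      note P = position_inverse[OF bc(1)[OF c], of _ q, folded m]
      have "inj_on (\<rho> c) {1..q}"
      proof (rule inj_onI)
        fix r r' assume r: "r \<in> {1..q}" "r' \<in> {1..q}" "\<rho> c r = \<rho> c r'"
        let ?i = "position q (?b c) r" and ?j = "position q (?b c) r'"
        have o: "offset q (\<sigma> ?i) = offset q (\<sigma> ?j)" using r unfolding \<rho>_def by (simp del: atLeastAtMost_iff)
        have b: "block q (\<sigma> ?i) = block q (\<sigma> ?j)" unfolding b\<sigma>[OF P(3)[OF r(1)]] b\<sigma>[OF P(3)[OF r(2)]] P(1)[OF r(1)] P(1)[OF r(2)] ..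
        have "1 \<le> \<sigma> ?i" "1 \<le> \<sigma> ?j" using \<sigma>i[OF P(3)[OF r(1)]] \<sigma>i[OF P(3)[OF r(2)]] by simp_all
        then have "\<sigma> ?i = \<sigma> ?j" using position_block_offset[of "\<sigma> ?i" q] position_block_offset[of "\<sigma> ?j" q] unfolding o b by (simp only:)
        then have "?i = ?j" using permutes_inj[OF kp(2)] by (simp add: inj_eq)
        then have "offset q ?i = offset q ?j" by (simp only:)
        then show "r = r'" unfolding P(2)[OF r(1)] P(2)[OF r(2)] .
      qed
      moreover have "\<rho> c ` {1..q} \<subseteq> {1..q}" unfolding \<rho>_def using offset_in[OF q] by auto
      ultimately have "bij_betw (\<rho> c) {1..q} {1..q}" by (simp add: bij_betw_def endo_inj_surj)
      then show ?thesis by (rule bij_imp_permutes) (simp only: \<rho>_def if_False)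
    qed
    have "\<sigma> = wreath_perm q n \<rho> ?\<pi>"
    proof
      fix i show "\<sigma> i = wreath_perm q n \<rho> ?\<pi> i"
      proof (cases "i \<in> {1..m}")
        case True
        have bi: "?b (?\<pi> (block q i)) = block q i" by (rule permutes_inverses(2)[OF cpp[OF sS]])
        have i1: "1 \<le> i" "1 \<le> \<sigma> i" using True \<sigma>i[OF True] by simp_all
        have "wreath_perm q n \<rho> ?\<pi> i = position q (?\<pi> (block q i)) (\<rho> (?\<pi> (block q i)) (offset q i))"
          using wreath_perm_position True m by simp
        also have "\<rho> (?\<pi> (block q i)) (offset q i) = offset q (\<sigma> i)"
          unfolding \<rho>_def bi position_block_offset[OF i1(1)] using offset_in[OF q, of i] by (simp del: atLeastAtMost_iff)
        also have "position q (?\<pi> (block q i)) (offset q (\<sigma> i)) = \<sigma> i"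
          unfolding b\<sigma>[OF True, symmetric] by (rule position_block_offset[OF i1(2)])
        finally show ?thesis ..
      next
        case False
        then show ?thesis using permutes_not_in[OF kp(2) False] m by (simp add: wreath_perm_def del: atLeastAtMost_iff)
      qed
    qed
    then have "k = (s, wreath_perm q n \<rho> ?\<pi>)" by (simp add: s_def \<sigma>_def prod_eq_iff)
    moreover have "(s, ?\<pi>) \<in> act_graph G S n w" unfolding act_graph_def using sS by blast
    ultimately show "k \<in> wreath_graph G S n q w" unfolding wreath_graph_def using perm by blast
  qed
qed

end

section \<open>Comparing orbits; subsets and Young subgroups\<close>

text \<open>Because the stabilizer of \<open>z\<close> fixes \<open>z'\<close>, sending
  \<open>act k z\<close> to \<open>act' k z'\<close> is a well-defined equivariant map on the
  orbit.\<close>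

lemma (in transfer_action) tr_set_orbit_mono:
  assumes F: "finite_gset K act F" and z: "z \<in> F" and F': "finite_gset K act' F'" and z': "z' \<in> F'"
    and st: "\<And>k. k \<in> carrier K \<Longrightarrow> act k z = z \<Longrightarrow> act' k z' = z'"
  shows "tr_set act ((\<lambda>k. act k z) ` carrier K) \<subseteq> tr_set act' F'"
proof -
  note D = finite_gsetD[OF F] and D' = finite_gsetD[OF F']
  \<comment> \<open>Some group element that moves \<open>z\<close> to \<open>u\<close>; the
    inclusion of stabilizers makes \<open>\<alpha>\<close> independent of the choice.\<close>
  define c where "c u = (SOME k. k \<in> carrier K \<and> act k z = u)" for u
  define \<alpha> where "\<alpha> u = act' (c u) z'" for u
  have al: "\<alpha> (act k z) = act' k z'" if k: "k \<in> carrier K" for k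
  proof -
    let ?c = "c (act k z)"
    have "?c \<in> carrier K \<and> act ?c z = act k z" unfolding c_def by (rule someI[of _ k]) (simp add: k)
    then have c: "?c \<in> carrier K" "act ?c z = act k z" by simp_all
    have ik: "inv k \<in> carrier K" "inv k \<otimes> ?c \<in> carrier K" using k c(1) by simp_all
    have "act (inv k \<otimes> ?c) z = act (inv k) (act k z)" using D(4)[OF ik(1) c(1) z] c(2) by simp
    also have "\<dots> = z" by (rule finite_gset_inv(1)[OF is_group F k z])
    finally have e: "act' (inv k \<otimes> ?c) z' = z'" by (rule st[OF ik(2)])
    have "k \<otimes> (inv k \<otimes> ?c) = ?c" using c(1) k by (simp add: m_assoc[symmetric])
    then have "act' ?c z' = act' k (act' (inv k \<otimes> ?c) z')" using D'(4)[OF k ik(2) z'] by simp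
    then show ?thesis unfolding \<alpha>_def e .
  qed
  show ?thesis
  proof (rule tr_set_mono[OF finite_gset_orbit(1)[OF F z] F'])
    fix u assume "u \<in> (\<lambda>k. act k z) ` carrier K"
    then obtain k where k: "u = act k z" "k \<in> carrier K" by (rule imageE)
    show "\<alpha> u \<in> F'" unfolding k(1) al[OF k(2)] by (rule D'(2)[OF k(2) z'])
  next
    fix j u assume j: "j \<in> carrier K" and "u \<in> (\<lambda>k. act k z) ` carrier K"
    then obtain k where k: "u = act k z" "k \<in> carrier K" by (elim imageE)
    have jk: "j \<otimes> k \<in> carrier K" using j k(2) by simp
    show "\<alpha> (act j u) = act' j (\<alpha> u)"
      unfolding k(1) al[OF k(2)] D(4)[OF j k(2) z, symmetric] al[OF jk] by (rule D'(4)[OF j k(2) z'])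
  qed
qed

lemma finite_gset_orbit_eq:
  assumes K: "group K" and F: "finite_gset K act F" and z: "z \<in> F" and j: "j \<in> carrier K"
  shows "(\<lambda>k. act k (act j z)) ` carrier K = (\<lambda>k. act k z) ` carrier K"
proof -
  interpret group K by (rule K)
  note D = finite_gsetD[OF F]
  show ?thesis
  proof (intro equalityI subsetI)
    fix u assume "u \<in> (\<lambda>k. act k (act j z)) ` carrier K"
    then obtain k where k: "u = act k (act j z)" "k \<in> carrier K" by (rule imageE)
    have "u = act (k \<otimes>\<^bsub>K\<^esub> j) z" unfolding k(1) by (rule D(4)[OF k(2) j z, symmetric])
    then show "u \<in> (\<lambda>k. act k z) ` carrier K" using k(2) j by (intro image_eqI[of _ _ "k \<otimes>\<^bsub>K\<^esub> j"]) simp_all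
  next
    fix u assume "u \<in> (\<lambda>k. act k z) ` carrier K"
    then obtain k where k: "u = act k z" "k \<in> carrier K" by (rule imageE)
    have kj: "k \<otimes>\<^bsub>K\<^esub> inv\<^bsub>K\<^esub> j \<in> carrier K" using k(2) j by simp
    have "act (k \<otimes>\<^bsub>K\<^esub> inv\<^bsub>K\<^esub> j) (act j z) = act ((k \<otimes>\<^bsub>K\<^esub> inv\<^bsub>K\<^esub> j) \<otimes>\<^bsub>K\<^esub> j) z"
      by (rule D(4)[OF kj j z, symmetric])
    also have "\<dots> = u" using k j by (simp add: m_assoc)
    finally show "u \<in> (\<lambda>k. act k (act j z)) ` carrier K" by (intro image_eqI[OF _ kj]) simp
  qed
qed

text \<open>The action on subsets of a fixed size is transitive with the Young subgroup as the
  stabilizer of \<open>{1..i}\<close>, so the transfers from Young subgroups become transfers from a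
  group set.\<close>

definition subset_act :: "'g \<times> (nat \<Rightarrow> nat) \<Rightarrow> nat set \<Rightarrow> nat set" where
  "subset_act k A = snd k ` A"

definition subsets :: "nat \<Rightarrow> nat \<Rightarrow> nat set set" where
  "subsets m i = {A. A \<subseteq> {1..m} \<and> card A = i}"

lemma carrier_snd_permutes: "k \<in> carrier (G \<times>\<times> sym_group m) \<Longrightarrow> snd k permutes {1..m}"
  by (simp add: mem_Times_iff sym_group_carrier)

lemma finite_gset_subsets: "finite_gset (G \<times>\<times> sym_group m) subset_act (subsets m i)"
  unfolding finite_gset_def
proof (intro conjI ballI)
  have "subsets m i \<subseteq> Pow {1..m}" unfolding subsets_def by blast
  then show "finite (subsets m i)" by (rule finite_subset) simp
next
  fix k A assume k: "k \<in> carrier (G \<times>\<times> sym_group m)" and A: "A \<in> subsets m i"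
  note p = carrier_snd_permutes[OF k]
  have "snd k ` A \<subseteq> snd k ` {1..m}" using A unfolding subsets_def by blast
  then show "subset_act k A \<in> subsets m i"
    using A card_image[OF permutes_inj_on[OF p], of A] unfolding subsets_def subset_act_def permutes_image[OF p] by simp
next
  fix A show "subset_act \<one>\<^bsub>G \<times>\<times> sym_group m\<^esub> A = A" by (simp add: subset_act_def one_DirProd sym_group_one)
next
  fix k k' :: "'a \<times> (nat \<Rightarrow> nat)" and A
  show "subset_act (k \<otimes>\<^bsub>G \<times>\<times> sym_group m\<^esub> k') A = subset_act k (subset_act k' A)"
    by (cases k; cases k') (simp add: subset_act_def sym_group_mult image_comp)
qed

text \<open>Membership in two subsets of equal size gives labellings with equal multiplicities, and
  \<open>permutes_matching\<close> supplies the permutation.\<close>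

lemma subsets_transitive:
  assumes G: "group G" and i: "i \<le> m"
  shows "subsets m i = (\<lambda>k. subset_act k {1..i}) ` carrier (G \<times>\<times> sym_group m)"
proof (intro equalityI subsetI)
  fix A assume "A \<in> subsets m i"
  then have A: "A \<subseteq> {1..m}" "card A = i" unfolding subsets_def by simp_all
  have cA: "card {j \<in> {1..m}. (j \<in> B) = t} = (if t then i else m - i)" if "B \<subseteq> {1..m}" "card B = i" for B t
  proof (cases t)
    case True
    moreover have "{j \<in> {1..m}. j \<in> B} = B" using that(1) by blast
    ultimately show ?thesis using that(2) by (simp del: atLeastAtMost_iff)
  next
    case False
    moreover have "{j \<in> {1..m}. j \<notin> B} = {1..m} - B" by blast
    ultimately show ?thesis using that(2) card_Diff_subset[OF finite_subset[OF that(1)] that(1)]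
      by (simp del: atLeastAtMost_iff)
  qed
  have ii: "{1..i} \<subseteq> {1..m}" "card {1..i} = i" using i by simp_all
  obtain \<sigma> where \<sigma>: "\<sigma> permutes {1..m}" "\<And>j. j \<in> {1..m} \<Longrightarrow> (\<sigma> j \<in> A) = (j \<in> {1..i})"
    by (rule permutes_matching[of "{1..m}" "\<lambda>j. j \<in> {1..i}" "\<lambda>j. j \<in> A"])
      (simp_all only: cA[OF ii] cA[OF A] finite_atLeastAtMost)
  have "\<sigma> ` {1..i} \<subseteq> A" using \<sigma>(2) ii(1) by blast
  moreover have "card (\<sigma> ` {1..i}) = card A" using card_image[OF permutes_inj_on[OF \<sigma>(1)]] ii(2) A(2) by metis
  ultimately have "\<sigma> ` {1..i} = A" using finite_subset[OF A(1)] by (intro card_subset_eq) simp_all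
  moreover have "(\<one>\<^bsub>G\<^esub>, \<sigma>) \<in> carrier (G \<times>\<times> sym_group m)"
    using \<sigma>(1) monoid.one_closed[OF group.is_monoid[OF G]] by (simp add: sym_group_carrier)
  ultimately show "A \<in> (\<lambda>k. subset_act k {1..i}) ` carrier (G \<times>\<times> sym_group m)"
    by (intro image_eqI[of _ _ "(\<one>\<^bsub>G\<^esub>, \<sigma>)"]) (simp_all only: subset_act_def snd_conv)
next
  fix A assume "A \<in> (\<lambda>k. subset_act k {1..i}) ` carrier (G \<times>\<times> sym_group m)"
  then obtain k where k: "A = subset_act k {1..i}" "k \<in> carrier (G \<times>\<times> sym_group m)" by (rule imageE)
  have "{1..i} \<in> subsets m i" using i by (simp add: subsets_def)
  then show "A \<in> subsets m i" unfolding k(1) by (rule finite_gsetD(2)[OF finite_gset_subsets k(2)])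
qed

lemma young_stabilizer: "young G m i = {k \<in> carrier (G \<times>\<times> sym_group m). subset_act k {1..i} = {1..i}}"
  unfolding young_def subset_act_def by (auto simp: sym_group_carrier)

lemma card_block:
  assumes b: "b \<in> {1..n}"
  shows "card {i \<in> {1..n * q}. block q i = b} = q"
proof -
  have "bij_betw (position q b) {1..q} {i \<in> {1..n * q}. block q i = b}"
  proof (rule bij_betw_byWitness[where f'="offset q"])
    show "\<forall>r\<in>{1..q}. offset q (position q b r) = r" using position_inverse(2)[OF b] by blast
    show "\<forall>i\<in>{i \<in> {1..n * q}. block q i = b}. position q b (offset q i) = i"
      using position_block_offset[of _ q] by auto
    show "position q b ` {1..q} \<subseteq> {i \<in> {1..n * q}. block q i = b}"
      using position_inverse(1,3)[OF b] by blast
    show "offset q ` {i \<in> {1..n * q}. block q i = b} \<subseteq> {1..q}"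
    proof (intro image_subsetI)
      fix i assume "i \<in> {i \<in> {1..n * q}. block q i = b}"
      then have "q \<noteq> 0" by (intro notI) simp
      then show "offset q i \<in> {1..q}" by (intro offset_in) simp
    qed
  qed
  then show ?thesis using bij_betw_same_card by fastforce
qed

section \<open>Classification of the nondiagonal configurations\<close>

context coset_config
begin

lemma block_config_Zset:
  assumes S: "subgroup S G" and w: "bij_betw w {1..n} (lcos G S H)"
    and n: "n \<ge> 2" and q: "q \<ge> 1" and m: "m = n * q"
  shows "block_config q w \<in> Zset G H m"
proof -
  have "w (block q i) \<in> lcos G (carrier G) H" if "i \<in> {1..m}" for i
    using bij_betwE[OF w] block_in[of i n q] that lcos_sub[OF S] m by blast
  then have "block_config q w \<in> configs" unfolding block_config_def by (intro PiE_I) (simp_all del: atLeastAtMost_iff)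
  moreover have "block_config q w \<notin> diagonal"
  proof
    assume "block_config q w \<in> diagonal"
    then obtain g where g: "block_config q w = (\<lambda>i\<in>{1..m}. g <# H)" by blast
    \<comment> \<open>As \<open>n \<ge> 2\<close> there are two blocks; a diagonal configuration
      would give them the same coset, against injectivity of \<open>w\<close>.\<close>
    have r: "1 \<in> {1..n}" "2 \<in> {1..n}" "1 \<in> {1..q}" using n q by simp_all
    have "w b = g <# H" if b: "b \<in> {1..n}" for b
    proof -
      note P = position_inverse[OF b r(3), folded m]
      show ?thesis using fun_cong[OF g, of "position q b 1"] 
        unfolding block_config_def restrict_apply'[OF P(3)] P(1) .
    qed
    then have "w 1 = w 2" using r(1,2) by simp
    then have "(1::nat) = 2" using inj_onD[OF bij_betw_imp_inj_on[OF w]] r(1,2) by blast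
    then show False by simp
  qed
  ultimately show ?thesis unfolding Zset_def by blast
qed

text \<open>Normality: move \<open>h\<close> past \<open>x\<close> to its conjugate, which is again
  in \<open>H\<close> and is absorbed by the coset.\<close>

lemma H_fixes: "h \<in> H \<Longrightarrow> x \<in> carrier G \<Longrightarrow> h <# (x <# H) = x <# H"
proof -
  assume h: "h \<in> H" and x: "x \<in> carrier G"
  have hG: "h \<in> carrier G" using h H_sub by blast
  have c: "inv x \<otimes> h \<otimes> x \<in> H" by (rule inv_op_closed1[OF x h])
  have cG: "inv x \<otimes> h \<otimes> x \<in> carrier G" using c H_sub by blast
  have "x \<otimes> (inv x \<otimes> h \<otimes> x) = h \<otimes> x" using x hG by (simp add: m_assoc[symmetric])
  then have "h <# (x <# H) = x <# ((inv x \<otimes> h \<otimes> x) <# H)"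
    using lcos_mult[OF hG x] lcos_mult[OF x cG] by simp
  then show ?thesis using coset_join3[OF cG subgroup_axioms c] by simp
qed

text \<open>The alternative is whether the stabilizer of \<open>z\<close> acts transitively on
  positions. If not, an orbit of positions is the set \<open>A\<close>; if so, \<open>z\<close> is a
  permuted block configuration. The second case allows every enumeration \<open>w\<close>, so that
  the prescribed ordering of S/H can be inserted.\<close>

lemma normalized_config_cases:
  assumes m: "m \<ge> 1" and z: "z \<in> Zset G H m" and z1: "z 1 = H"
  shows "(\<exists>A. A \<subseteq> {1..m} \<and> A \<noteq> {} \<and> A \<noteq> {1..m} \<and>
       (\<forall>k\<in>carrier \<Gamma>. cact k z = z \<longrightarrow> subset_act k A = A)) \<or>
     (\<exists>S. subgroup S G \<and> H \<subset> S \<and> card (lcos G S H) \<noteq> 1 \<and>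
       (\<forall>w. bij_betw w {1..card (lcos G S H)} (lcos G S H) \<longrightarrow>
         (\<exists>q. m = card (lcos G S H) * q \<and> block_config q w \<in> (\<lambda>k. cact k z) ` carrier \<Gamma>)))"
proof -
  interpret \<Gamma>: group \<Gamma> by (rule group_Gamma)
  have zc: "z \<in> configs" and zd: "z \<notin> diagonal" using z unfolding Zset_def by blast+
  have ze: "z \<in> extensional {1..m}" using zc unfolding PiE_def by simp
  have one: "1 \<in> {1..m}" using m by simp
  note D = finite_gsetD[OF finite_gset_configs]
  define St where "St = {k \<in> carrier \<Gamma>. cact k z = z}"
  have stC: "k \<in> carrier \<Gamma>" "cact k z = z" if "k \<in> St" for k using that unfolding St_def by simp_all
  have st1: "\<one>\<^bsub>\<Gamma>\<^esub> \<in> St" unfolding St_def using D(3)[OF zc] \<Gamma>.one_closed by simp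
  have stm: "k \<otimes>\<^bsub>\<Gamma>\<^esub> k' \<in> St" if k: "k \<in> St" "k' \<in> St" for k k'
    unfolding St_def using D(4)[OF stC(1)[OF k(1)] stC(1)[OF k(2)] zc] stC(2)[OF k(1)] stC(2)[OF k(2)]
      \<Gamma>.m_closed[OF stC(1)[OF k(1)] stC(1)[OF k(2)]] by simp
  have sti: "inv\<^bsub>\<Gamma>\<^esub> k \<in> St" if k: "k \<in> St" for k
    unfolding St_def using finite_gset_inv(1)[OF group_Gamma finite_gset_configs stC(1)[OF k] zc] stC(2)[OF k]
      \<Gamma>.inv_closed[OF stC(1)[OF k]] by simp
  have sp: "fst k \<in> carrier G" "snd k permutes {1..m}" if "k \<in> St" for k
    using stC(1)[OF that] unfolding carrier_iff by simp_all
  have sin: "snd k i \<in> {1..m}" if "k \<in> St" "i \<in> {1..m}" for k i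
    using permutes_in_image[OF sp(2)[OF that(1)]] that(2) by blast
  have sz: "z (snd k i) = fst k <# z i" if "k \<in> St" "i \<in> {1..m}" for k i
    using stab_iff[OF stC(1)[OF that(1)] ze] stC(2)[OF that(1)] that(2) by simp
  have fm: "fst (k \<otimes>\<^bsub>\<Gamma>\<^esub> k') = fst k \<otimes> fst k'" "snd (k \<otimes>\<^bsub>\<Gamma>\<^esub> k') = snd k \<circ> snd k'" for k k'
    by (cases k; cases k'; simp add: sym_group_mult)+
  \<comment> \<open>The orbit of position 1 under the stabilizer; whether it is everything decides
    between the two cases.\<close>
  define O' where "O' = (\<lambda>k. snd k 1) ` St"
  have Osub: "O' \<subseteq> {1..m}" unfolding O'_def using sin one by (intro image_subsetI)
  have "snd \<one>\<^bsub>\<Gamma>\<^esub> 1 \<in> O'" unfolding O'_def by (rule imageI[OF st1])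
  then have One: "O' \<noteq> {}" by blast
  have Oinv: "subset_act k O' = O'" if k: "k \<in> St" for k
  proof -
    have "snd k ` O' \<subseteq> O'" unfolding O'_def
    proof (intro image_subsetI)
      fix i assume "i \<in> (\<lambda>k. snd k 1) ` St"
      then obtain k' where k': "i = snd k' 1" "k' \<in> St" by (rule imageE)
      have "snd k i = snd (k \<otimes>\<^bsub>\<Gamma>\<^esub> k') 1" unfolding fm k'(1) by simp
      then show "snd k i \<in> (\<lambda>k. snd k 1) ` St" using stm[OF k k'(2)] by (rule image_eqI)
    qed
    then show ?thesis unfolding subset_act_def
      by (intro endo_inj_surj finite_subset[OF Osub] permutes_inj_on[OF sp(2)[OF k]]) simp_all
  qed
  show ?thesis
  proof (cases "O' = {1..m}")
    case False
    have "\<forall>k\<in>carrier \<Gamma>. cact k z = z \<longrightarrow> subset_act k O' = O'" using Oinv unfolding St_def by blast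
    then show ?thesis using Osub One False by (intro disjI1 exI[of _ O'] conjI)
  next
    case True
    define S where "S = fst ` St"
    have S: "subgroup S G"
    proof (rule subgroupI)
      show "S \<subseteq> carrier G" unfolding S_def using sp(1) by (intro image_subsetI)
      show "S \<noteq> {}" unfolding S_def using st1 by blast
      show "inv a \<in> S" if aS: "a \<in> S" for a
      proof -
        obtain k where k: "a = fst k" "k \<in> St" using aS unfolding S_def by (rule imageE)
        have "inv\<^bsub>\<Gamma>\<^esub> (fst k, snd k) = (inv (fst k), inv\<^bsub>sym_group m\<^esub> (snd k))"
          using stC(1)[OF k(2)] by (intro inv_DirProd is_group sym_group_is_group) (simp_all add: mem_Times_iff)
        then have "inv a = fst (inv\<^bsub>\<Gamma>\<^esub> k)" unfolding k(1) by simp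
        then show ?thesis unfolding S_def using sti[OF k(2)] by (rule image_eqI)
      qed
      show "a \<otimes> b \<in> S" if abS: "a \<in> S" "b \<in> S" for a b
      proof -
        obtain k where k: "a = fst k" "k \<in> St" using abS(1) unfolding S_def by (rule imageE)
        obtain k' where k': "b = fst k'" "k' \<in> St" using abS(2) unfolding S_def by (rule imageE)
        have "a \<otimes> b = fst (k \<otimes>\<^bsub>\<Gamma>\<^esub> k')" unfolding fm k(1) k'(1) ..
        then show ?thesis unfolding S_def using stm[OF k(2) k'(2)] by (rule image_eqI)
      qed
    qed
    \<comment> \<open>Normality of \<open>H\<close> enters here: each \<open>h\<close> fixes every
      entry, so paired with the identity permutation it stabilizes \<open>z\<close>.\<close>
    have HS: "H \<subseteq> S"
    proof
      fix h assume h: "h \<in> H"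
      have hc: "(h, id) \<in> carrier \<Gamma>" unfolding carrier_iff using h H_sub by (auto simp: permutes_id)
      have "h <# z i = z i" if i: "i \<in> {1..m}" for i
        using PiE_mem[OF zc i] H_fixes[OF h] by (elim lcosE) simp
      then have "cact (h, id) z = z" unfolding stab_iff[OF hc ze] by simp
      then have "(h, id) \<in> St" unfolding St_def using hc by simp
      then show "h \<in> S" unfolding S_def by (rule image_eqI[rotated]) simp
    qed
    \<comment> \<open>Every position has the form \<open>snd k 1\<close>, and its entry is
      \<open>fst k <# H\<close> because \<open>z 1 = H\<close>.\<close>
    have img: "z ` {1..m} = lcos G S H"
    proof (intro equalityI subsetI)
      fix t assume "t \<in> z ` {1..m}"
      then obtain i where i: "t = z i" "i \<in> O'" unfolding True by (rule imageE)
      obtain k where k: "i = snd k 1" "k \<in> St" using i(2) unfolding O'_def by (rule imageE)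
      have "t = fst k <# H" unfolding i(1) k(1) sz[OF k(2) one] z1 ..
      then show "t \<in> lcos G S H" unfolding lcos_def S_def using k(2) by blast
    next
      fix t assume "t \<in> lcos G S H"
      then obtain s where s: "s \<in> S" "t = s <# H" by (rule lcosE)
      obtain k where k: "s = fst k" "k \<in> St" using s(1) unfolding S_def by (rule imageE)
      have "t = z (snd k 1)" unfolding s(2) k(1) sz[OF k(2) one] z1 ..
      then show "t \<in> z ` {1..m}" using sin[OF k(2) one] by (rule image_eqI)
    qed
    \<comment> \<open>The multiplicity of an entry. A stabilizing \<open>k\<close> injects the
      positions with entry \<open>t\<close> into those with entry \<open>fst k <# t\<close>; using
      this over \<open>s\<close> and over \<open>inv s\<close> makes all multiplicities on S/H
      equal.\<close>
    define N where "N t = card {i \<in> {1..m}. z i = t}" for t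
    have Nle: "N t \<le> N (fst k <# t)" if k: "k \<in> St" for k t
      unfolding N_def
    proof (rule card_inj_on_le[of "snd k"])
      show "inj_on (snd k) {i \<in> {1..m}. z i = t}" by (rule permutes_inj_on[OF sp(2)[OF k]])
      show "snd k ` {i \<in> {1..m}. z i = t} \<subseteq> {i \<in> {1..m}. z i = fst k <# t}"
      proof (intro image_subsetI)
        fix i assume "i \<in> {i \<in> {1..m}. z i = t}"
        then have "i \<in> {1..m}" "z i = t" by simp_all
        then show "snd k i \<in> {i \<in> {1..m}. z i = fst k <# t}" using sin[OF k] sz[OF k] by blast
      qed
    qed simp
    define q where "q = N H"
    have Nq: "N t = q" if t: "t \<in> lcos G S H" for t
    proof -
      obtain s where s: "s \<in> S" "t = s <# H" using t by (rule lcosE)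
      have sG: "s \<in> carrier G" by (rule subgroup.mem_carrier[OF S s(1)])
      obtain k where k: "s = fst k" "k \<in> St" using s(1) unfolding S_def by (rule imageE)
      obtain k' where k': "inv s = fst k'" "k' \<in> St" using subgroup.m_inv_closed[OF S s(1)] unfolding S_def by (rule imageE)
      have "H = \<one> <# H" using coset_join3[OF one_closed subgroup_axioms subgroup.one_closed[OF subgroup_axioms]] by simp
      also have "\<dots> \<in> lcos G (carrier G) H" unfolding lcos_def by (rule imageI[OF one_closed])
      finally have "inv s <# t = H" unfolding s(2) by (rule lcos_inj[OF sG])
      then have "N t \<le> q" using Nle[OF k'(2), of t] unfolding q_def k'(1)[symmetric] by simp
      moreover have "q \<le> N t" using Nle[OF k(2), of H] unfolding q_def s(2) k(1) .
      ultimately show ?thesis by simp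
    qed
    let ?n = "card (lcos G S H)"
    have "m = card {1..m}" by simp
    also have "\<dots> = (\<Sum>i\<in>{1..m}. 1)" by simp
    also have "\<dots> = (\<Sum>t\<in>z ` {1..m}. \<Sum>i\<in>{i. i \<in> {1..m} \<and> z i = t}. 1)"
      by (rule sum.image_gen) simp
    also have "\<dots> = (\<Sum>t\<in>lcos G S H. N t)" unfolding img N_def by simp
    also have "\<dots> = (\<Sum>t\<in>lcos G S H. q)" by (rule sum.cong[OF refl Nq])
    finally have mnq: "m = ?n * q" by simp
    \<comment> \<open>A single coset as the only entry would make \<open>z\<close> constant, hence
      diagonal.\<close>
    have n1: "?n \<noteq> 1"
    proof
      assume "?n = 1"
      then obtain t where t: "lcos G S H = {t}" by (rule card_1_singletonE)
      have zi: "z i = t" if "i \<in> {1..m}" for i using img t imageI[OF that, of z] by simp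
      have "t = \<one> <# H" using zi[OF one] z1 coset_join3[OF one_closed subgroup_axioms subgroup.one_closed[OF subgroup_axioms]] by simp
      then have "z = (\<lambda>i\<in>{1..m}. \<one> <# H)" using zi ze by (intro extensionalityI[where A="{1..m}"]) (simp_all del: atLeastAtMost_iff)
      then show False using zd one_closed by blast
    qed
    have "H \<noteq> S"
    proof
      assume "H = S"
      then have "lcos G S H = {H}" unfolding lcos_def using coset_join3[OF _ subgroup_axioms] H_sub
        subgroup.one_closed[OF subgroup_axioms] by (auto simp: subset_iff image_iff)
      then show False using n1 by simp
    qed
    then have HS': "H \<subset> S" using HS by blast
    have "block_config q w \<in> (\<lambda>k. cact k z) ` carrier \<Gamma>" if w: "bij_betw w {1..?n} (lcos G S H)" for w
    proof -
      have bat: "block_config q w i = w (block q i)" if "i \<in> {1..m}" for i using that by (simp add: block_config_def)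
      have bin: "block q i \<in> {1..?n}" if "i \<in> {1..m}" for i using block_in[of i ?n q] that mnq by simp
      \<comment> \<open>In both configurations every coset in S/H occurs \<open>q\<close> times and
        nothing else occurs, so they differ by a permutation of positions.\<close>
      have cards: "card {i \<in> {1..m}. z i = t} = card {i \<in> {1..m}. block_config q w i = t}" for t
      proof (cases "t \<in> lcos G S H")
        case True
        then have "t \<in> w ` {1..?n}" using w unfolding bij_betw_def by simp
        then obtain b where b: "t = w b" "b \<in> {1..?n}" by (rule imageE)
        have "block_config q w i = t \<longleftrightarrow> block q i = b" if i: "i \<in> {1..m}" for i
          unfolding bat[OF i] b(1) by (rule inj_on_eq_iff[OF bij_betw_imp_inj_on[OF w] bin[OF i] b(2)])
        then have "{i \<in> {1..m}. block_config q w i = t} = {i \<in> {1..?n * q}. block q i = b}"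
          unfolding mnq[symmetric] by (intro Collect_cong conj_cong refl)
        then show ?thesis using card_block[OF b(2), of q] Nq[OF True] unfolding N_def by simp
      next
        case False
        have "z i \<noteq> t" "block_config q w i \<noteq> t" if i: "i \<in> {1..m}" for i
          using False img imageI[OF i, of z] bij_betwE[OF w] bin[OF i] bat[OF i] by auto
        then have "{i \<in> {1..m}. z i = t} = {}" "{i \<in> {1..m}. block_config q w i = t} = {}" by blast+
        then show ?thesis by (simp only:)
      qed
      obtain \<sigma> where \<sigma>: "\<sigma> permutes {1..m}" "\<And>i. i \<in> {1..m} \<Longrightarrow> block_config q w (\<sigma> i) = z i"
        by (rule permutes_matching[OF _ cards]) simp_all
      have kc: "(\<one>, \<sigma>) \<in> carrier \<Gamma>" unfolding carrier_iff using \<sigma>(1) by simp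
      have "block_config q w = cact (\<one>, \<sigma>) z"
      proof (rule extensionalityI[where A="{1..m}"])
        show "block_config q w \<in> extensional {1..m}" by (simp add: block_config_def)
        show "cact (\<one>, \<sigma>) z \<in> extensional {1..m}" by (simp add: coset_power_act_def)
        fix i assume i: "i \<in> {1..m}"
        have j: "inv_into UNIV \<sigma> i \<in> {1..m}" by (rule inv_perm_in[OF \<sigma>(1) i])
        have "cact (\<one>, \<sigma>) z i = z (inv_into UNIV \<sigma> i)"
          unfolding cact_at[OF i] using lcos_mult_one[OF lcos_carrier[OF PiE_mem[OF zc j]]] by simp
        also have "\<dots> = block_config q w i"
          using \<sigma>(2)[OF j] unfolding permutes_inverses(1)[OF \<sigma>(1)] by simp
        finally show "block_config q w i = cact (\<one>, \<sigma>) z i" ..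
      qed
      then show ?thesis using kc by (rule image_eqI)
    qed
    then show ?thesis using S HS' n1 mnq by (intro disjI2 exI[of _ S] conjI allI impI exI[of _ q])
  qed
qed

text \<open>Translate by the inverse of a representative of the first entry, with the identity
  permutation.\<close>

lemma normalize_config:
  assumes m: "m \<ge> 1" and z: "z \<in> Zset G H m"
  obtains j where "j \<in> carrier \<Gamma>" "cact j z 1 = H"
proof -
  have one: "1 \<in> {1..m}" using m by simp
  have "z \<in> configs" using z unfolding Zset_def by (rule DiffD1)
  then have "z 1 \<in> lcos G (carrier G) H" using one by (rule PiE_mem)
  then obtain g where g: "g \<in> carrier G" "z 1 = g <# H" by (rule lcosE)
  have "(inv g, id) \<in> carrier \<Gamma>" unfolding carrier_iff using g(1) by (simp add: permutes_id)
  moreover have "cact (inv g, id) z 1 = H"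
    unfolding cact_at[OF one] using g lcos_mult[of "inv g" g]
      coset_join3[OF one_closed subgroup_axioms subgroup.one_closed[OF subgroup_axioms]] by simp
  ultimately show thesis by (rule that)
qed

end

section \<open>Comparison of the two ideals\<close>

lemma zero_in_carrier_coh:
  assumes "spectrum E"
  shows "\<zero>\<^bsub>coh E \<xi> X\<^esub> \<in> carrier (coh E \<xi> X)"
proof -
  interpret spectrum_loc E by (rule spectrum_loc.intro) (rule assms)
  have "continuous_map X (zspace E) (\<lambda>_. b0)" by simp
  then show ?thesis unfolding carrier_coh by (auto simp: coh_def)
qed

theorem theorem2p11:
  fixes E :: "'a spec" and \<xi> :: "'a power_maps"
    and G :: "('g, 'b) monoid_scheme" and H :: "'g set" and m :: nat
    and \<omega> :: "'g set \<Rightarrow> nat \<Rightarrow> 'g set"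
  assumes "Hinf_ring_spectrum E \<xi>"
    and "group G" and "finite (carrier G)"
    and "m \<ge> 1"
    and "H \<lhd> G"
    and "\<And>S. subgroup S G \<Longrightarrow> H \<subset> S \<Longrightarrow> bij_betw (\<omega> S) {1..card (lcos G S H)} (lcos G S H)"
  shows "J_ideal E \<xi> G H m =
    Idl\<^bsub>coh E \<xi> (Bprod G m)\<^esub>
      (I_Tr E \<xi> G m \<union>
       \<Union>{tr_image E \<xi> G m (wreath_graph G S n q (\<omega> S)) | S n q.
            subgroup S G \<and> H \<subset> S \<and> card (lcos G S H) = n \<and> n \<noteq> 1 \<and> m = n * q})"
proof -
  let ?K = "G \<times>\<times> sym_group m" and ?R = "coh E \<xi> (Bprod G m)" and ?cact = "coset_power_act G m"
  have sp: "spectrum E" using assms(1) unfolding Hinf_ring_spectrum_def by blast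
  interpret C: coset_config H G m
    by (intro coset_config.intro coset_config_axioms.intro assms)
  interpret T: transfer_action ?K "Etot G m" "Etot_act G m" "Bprod G m" "Bproj G m" "product_bump G m" E \<xi>
    by (intro transfer_action.intro principal_action_Etot spectrum_loc.intro assms sp)
  note gc = C.finite_gset_configs
  have Zeq: "Zset G H m = C.configs - C.diagonal" unfolding Zset_def ..
  have Zsub: "Zset G H m \<subseteq> C.configs" unfolding Zeq by (rule Diff_subset)
  have gZ: "finite_gset ?K ?cact (Zset G H m)"
    unfolding Zeq by (rule T.finite_gset_diff[OF gc C.finite_gset_diagonal])
  have trZ: "tr_homotopy_orbits E G m ?cact (Zset G H m) `
      carrier (coh E \<xi> (homotopy_orbits G m ?cact (Zset G H m))) = T.tr_set ?cact (Zset G H m)"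
    unfolding tr_homotopy_orbits_def homotopy_orbits_def T.tr_set_def T.pr_def[abs_def] ..
  \<comment> \<open>The Young subgroup is the stabilizer of \<open>{1..i}\<close> in the transitive
    set of its translates.\<close>
  have trY: "tr_image E \<xi> G m (young G m i) = T.tr_set subset_act (subsets m i)" if i: "i \<in> {1..<m}" for i
    unfolding tr_image_def tr_subgroup_def Bsub_def
  proof (rule T.tr_set_orbit[OF finite_gset_subsets _ _ young_stabilizer])
    show "{1..i} \<in> subsets m i" using i by (simp add: subsets_def)
    show "subsets m i = (\<lambda>k. subset_act k {1..i}) ` carrier ?K"
      using i by (intro subsets_transitive assms) simp
  qed
  \<comment> \<open>The wreath graph is the stabilizer of a block configuration, so its transfers
    are those from one orbit inside \<open>Zset G H m\<close>.\<close>
  have trW: "tr_image E \<xi> G m (wreath_graph G S n q (\<omega> S)) =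
      T.tr_set ?cact ((\<lambda>k. ?cact k (C.block_config q (\<omega> S))) ` carrier ?K)"
    "C.block_config q (\<omega> S) \<in> Zset G H m"
    if S: "subgroup S G" "H \<subset> S" "card (lcos G S H) = n" "n \<noteq> 1" "m = n * q" for S n q
  proof -
    \<comment> \<open>Since \<open>m = n * q\<close> is positive, neither factor is 0, and
      \<open>n\<close> is not 1.\<close>
    have nq: "n \<ge> 2" "q \<ge> 1" using S(4,5) assms(4) by (cases n; cases q; simp)+
    have w: "bij_betw (\<omega> S) {1..n} (lcos G S H)" using assms(6)[OF S(1,2)] unfolding S(3) .
    show bZ: "C.block_config q (\<omega> S) \<in> Zset G H m" by (rule C.block_config_Zset[OF S(1) w nq S(5)])
    note orb = T.finite_gset_orbit[OF gZ bZ]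
    have HS: "H \<subseteq> S" using S(2) by (rule psubset_imp_subset)
    have n1: "n \<ge> 1" using nq(1) by simp
    show "tr_image E \<xi> G m (wreath_graph G S n q (\<omega> S)) =
      T.tr_set ?cact ((\<lambda>k. ?cact k (C.block_config q (\<omega> S))) ` carrier ?K)"
      unfolding tr_image_def tr_subgroup_def Bsub_def
      by (rule T.tr_set_orbit[OF orb(1,3) refl C.stab_block_config[OF S(1) HS w n1 nq(2) S(5), symmetric]])
  qed
  \<comment> \<open>\<open>I_Tr\<close> consists of sums with one summand for each splitting of
    \<open>m\<close>. An ideal containing the individual images contains the sums, and a single
    image is recovered from sums with all other summands zero.\<close>
  have ITr: "I_Tr E \<xi> G m \<subseteq> I \<longleftrightarrow> (\<Union>i\<in>{1..<m}. tr_image E \<xi> G m (young G m i)) \<subseteq> I" if I: "ideal I ?R" for I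
  proof
    interpret I: ideal I ?R by (rule I)
    assume sub: "I_Tr E \<xi> G m \<subseteq> I"
    show "(\<Union>i\<in>{1..<m}. tr_image E \<xi> G m (young G m i)) \<subseteq> I"
    proof (intro UN_least subsetI)
      fix i0 b assume i0: "i0 \<in> {1..<m}" and bi: "b \<in> tr_image E \<xi> G m (young G m i0)"
      have bR: "b \<in> carrier ?R" using bi T.tr_set_carrier[OF finite_gset_subsets] unfolding trY[OF i0] by blast
      obtain a0 where a0: "b = tr_subgroup E G m (young G m i0) a0" "a0 \<in> carrier (coh E \<xi> (Bsub G m (young G m i0)))"
        using bi unfolding tr_image_def by (rule imageE)
      have "\<exists>e. e \<in> carrier (coh E \<xi> (Bsub G m (young G m i))) \<and> tr_subgroup E G m (young G m i) e = \<zero>\<^bsub>?R\<^esub>"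
        if i: "i \<in> {1..<m}" for i
      proof -
        have "\<zero>\<^bsub>?R\<^esub> \<in> T.tr_set subset_act (subsets m i)"
          using imageI[OF zero_in_carrier_coh[OF sp, of \<xi> "T.hoq subset_act (subsets m i)"],
              of "transfer_along E (T.hoq subset_act (subsets m i)) (Bprod G m) T.pr"]
          unfolding T.tr_set_def T.tr_zero[OF finite_gset_subsets] .
        then have "\<zero>\<^bsub>?R\<^esub> \<in> tr_image E \<xi> G m (young G m i)" unfolding trY[OF i] .
        then obtain e where "\<zero>\<^bsub>?R\<^esub> = tr_subgroup E G m (young G m i) e"
          "e \<in> carrier (coh E \<xi> (Bsub G m (young G m i)))" unfolding tr_image_def by (rule imageE)
        then show ?thesis by (intro exI[of _ e]) simp
      qed
      then obtain e where e: "\<And>i. i \<in> {1..<m} \<Longrightarrow> e i \<in> carrier (coh E \<xi> (Bsub G m (young G m i)))"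
        "\<And>i. i \<in> {1..<m} \<Longrightarrow> tr_subgroup E G m (young G m i) (e i) = \<zero>\<^bsub>?R\<^esub>" by metis
      \<comment> \<open>All summands except the one at \<open>i0\<close> are chosen with zero
        transfer.\<close>
      define a where "a i = (if i = i0 then a0 else e i)" for i
      have "finsum ?R (\<lambda>i. tr_subgroup E G m (young G m i) (a i)) {1..<m} =
        finsum ?R (\<lambda>i. if i0 = i then b else \<zero>\<^bsub>?R\<^esub>) {1..<m}"
      proof (rule I.finsum_cong'[OF refl])
        show "(\<lambda>i. if i0 = i then b else \<zero>\<^bsub>?R\<^esub>) \<in> {1..<m} \<rightarrow> carrier ?R" using bR by simp
        show "tr_subgroup E G m (young G m i) (a i) = (if i0 = i then b else \<zero>\<^bsub>?R\<^esub>)" if "i \<in> {1..<m}" for i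
          using e(2)[OF that] a0(1) by (simp add: a_def)
      qed
      also have "\<dots> = b" by (rule I.finsum_singleton[OF i0]) (use bR in simp_all)
      finally have "b = finsum ?R (\<lambda>i. tr_subgroup E G m (young G m i) (a i)) {1..<m}" ..
      moreover have "\<forall>i\<in>{1..<m}. a i \<in> carrier (coh E \<xi> (Bsub G m (young G m i)))"
        using e(1) a0(2) by (simp add: a_def)
      ultimately have "b \<in> I_Tr E \<xi> G m" unfolding I_Tr_def by (intro CollectI exI[of _ a] conjI)
      then show "b \<in> I" by (rule subsetD[OF sub])
    qed
  next
    interpret I: ideal I ?R by (rule I)
    assume sub: "(\<Union>i\<in>{1..<m}. tr_image E \<xi> G m (young G m i)) \<subseteq> I"
    show "I_Tr E \<xi> G m \<subseteq> I"
    proof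
      fix b assume "b \<in> I_Tr E \<xi> G m"
      then obtain a where b: "b = finsum ?R (\<lambda>i. tr_subgroup E G m (young G m i) (a i)) {1..<m}"
        and a: "\<forall>i\<in>{1..<m}. a i \<in> carrier (coh E \<xi> (Bsub G m (young G m i)))"
        unfolding I_Tr_def by (elim CollectE exE conjE)
      show "b \<in> I" unfolding b
      proof (rule I.finsum_in_ideal)
        fix i assume i: "i \<in> {1..<m}"
        have "tr_subgroup E G m (young G m i) (a i) \<in> tr_image E \<xi> G m (young G m i)"
          unfolding tr_image_def by (rule imageI[OF bspec[OF a i]])
        then show "tr_subgroup E G m (young G m i) (a i) \<in> I" by (rule subsetD[OF sub UN_I[OF i]])
      qed simp
    qed
  qed
  let ?W = "\<Union>{tr_image E \<xi> G m (wreath_graph G S n q (\<omega> S)) | S n q.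
            subgroup S G \<and> H \<subset> S \<and> card (lcos G S H) = n \<and> n \<noteq> 1 \<and> m = n * q}"
  \<comment> \<open>The orbit of a block configuration is an invariant part of
    \<open>Zset G H m\<close>, so extension by zero applies.\<close>
  have WZ: "?W \<subseteq> I" if I: "ideal I ?R" and sub: "T.tr_set ?cact (Zset G H m) \<subseteq> I" for I
  proof (rule Union_least)
    interpret I: ideal I ?R by (rule I)
    fix X assume "X \<in> {tr_image E \<xi> G m (wreath_graph G S n q (\<omega> S)) | S n q.
            subgroup S G \<and> H \<subset> S \<and> card (lcos G S H) = n \<and> n \<noteq> 1 \<and> m = n * q}"
    then obtain S n q where X: "X = tr_image E \<xi> G m (wreath_graph G S n q (\<omega> S))"
      and S: "subgroup S G" "H \<subset> S" "card (lcos G S H) = n" "n \<noteq> 1" "m = n * q"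
      by (elim CollectE exE conjE)
    note orb = T.finite_gset_orbit[OF gZ trW(2)[OF S]]
    let ?O = "(\<lambda>k. ?cact k (C.block_config q (\<omega> S))) ` carrier ?K"
    have "Zset G H m = ?O \<union> (Zset G H m - ?O)" "?O \<inter> (Zset G H m - ?O) = {}" using orb(2) by blast+
    then have "T.tr_set ?cact ?O \<subseteq> T.tr_set ?cact (Zset G H m)"
      by (rule T.tr_set_subset[OF I.ring_axioms gZ orb(1) T.finite_gset_diff[OF gZ orb(1,2)]])
    then show "X \<subseteq> I" unfolding X trW(1)[OF S] using sub by (rule subset_trans)
  qed
  \<comment> \<open>By \<open>tr_set_ideal\<close> it suffices to treat one orbit at a time, and
    passing to a normalized point does not change the orbit.\<close>
  have ZW: "T.tr_set ?cact (Zset G H m) \<subseteq> I"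
    if I: "ideal I ?R" and Y: "(\<Union>i\<in>{1..<m}. tr_image E \<xi> G m (young G m i)) \<subseteq> I" and W: "?W \<subseteq> I" for I
  proof (rule T.tr_set_ideal[OF I gZ])
    fix z0 assume z0: "z0 \<in> Zset G H m"
    obtain j where j: "j \<in> carrier ?K" "?cact j z0 1 = H" by (rule C.normalize_config[OF assms(4) z0])
    define z where "z = ?cact j z0"
    have z: "z \<in> Zset G H m" "z 1 = H" unfolding z_def using finite_gsetD(2)[OF gZ j(1) z0] j(2) by simp_all
    let ?O = "\<lambda>z. (\<lambda>k. ?cact k z) ` carrier ?K"
    have Oz: "?O z0 = ?O z" unfolding z_def by (rule finite_gset_orbit_eq[OF C.group_Gamma gZ z0 j(1), symmetric])
    show "T.tr_set ?cact (?O z0) \<subseteq> I" unfolding Oz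
      using C.normalized_config_cases[OF assms(4) z]
    proof (elim disjE exE conjE)
      \<comment> \<open>Intransitive case: the stabilizer of \<open>z\<close> fixes the point
        \<open>A\<close> in the set of subsets of its size, so the transfers from the orbit are
        among the Young transfers.\<close>
      fix A assume A: "A \<subseteq> {1..m}" "A \<noteq> {}" "A \<noteq> {1..m}" "\<forall>k\<in>carrier ?K. ?cact k z = z \<longrightarrow> subset_act k A = A"
      have fA: "finite A" by (rule finite_subset[OF A(1)]) simp
      have "card A < card {1..m}" using A(1,3) by (intro psubset_card_mono psubsetI) simp_all
      then have i: "card A \<in> {1..<m}" using fA A(2) by (simp add: Suc_le_eq card_gt_0_iff)
      have "T.tr_set ?cact (?O z) \<subseteq> T.tr_set subset_act (subsets m (card A))"
      proof (rule T.tr_set_orbit_mono[OF gZ z(1) finite_gset_subsets])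
        show "A \<in> subsets m (card A)" using A(1) by (simp add: subsets_def)
        show "subset_act k A = A" if "k \<in> carrier ?K" "?cact k z = z" for k using A(4) that by blast
      qed
      also have "\<dots> \<subseteq> I" unfolding trY[OF i, symmetric] using Y i by blast
      finally show "T.tr_set ?cact (?O z) \<subseteq> I" .
    next
      \<comment> \<open>Transitive case: the orbit of \<open>z\<close> contains the block
        configuration for the ordering \<open>\<omega> S\<close> and hence equals its orbit.\<close>
      fix S assume S: "subgroup S G" "H \<subset> S" "card (lcos G S H) \<noteq> 1"
        and bl: "\<forall>w. bij_betw w {1..card (lcos G S H)} (lcos G S H) \<longrightarrow>
         (\<exists>q. m = card (lcos G S H) * q \<and> C.block_config q w \<in> ?O z)"
      obtain q where q: "m = card (lcos G S H) * q" "C.block_config q (\<omega> S) \<in> ?O z"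
        using bl[THEN spec, THEN mp, OF assms(6)[OF S(1,2)]] by (elim exE conjE)
      obtain k where k: "C.block_config q (\<omega> S) = ?cact k z" "k \<in> carrier ?K" using q(2) by (rule imageE)
      have "?O (C.block_config q (\<omega> S)) = ?O z" unfolding k(1) by (rule finite_gset_orbit_eq[OF C.group_Gamma gZ z(1) k(2)])
      then have "T.tr_set ?cact (?O z) = tr_image E \<xi> G m (wreath_graph G S (card (lcos G S H)) q (\<omega> S))"
        using trW(1)[OF S(1,2) refl S(3) q(1)] by simp
      also have "\<dots> \<subseteq> ?W" by (intro Union_upper CollectI exI conjI) (rule refl S q(1))+
      also have "\<dots> \<subseteq> I" by (rule W)
      finally show "T.tr_set ?cact (?O z) \<subseteq> I" .
    qed
  qed
  \<comment> \<open>Each test takes place in a given ideal \<open>I\<close>, whose axioms include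
    the ring axioms for cohomology on which the containments above rely.\<close>
  show ?thesis unfolding J_ideal_def trZ
  proof (rule genideal_cong)
    fix I assume I: "ideal I ?R"
    show "(\<Union>i\<in>{1..<m}. tr_image E \<xi> G m (young G m i)) \<union> T.tr_set ?cact (Zset G H m) \<subseteq> I \<longleftrightarrow>
      I_Tr E \<xi> G m \<union> ?W \<subseteq> I"
      unfolding Un_subset_iff ITr[OF I] using WZ[OF I] ZW[OF I] by (intro iffI conjI) (elim conjE; assumption | simp only:)+
  qed
qed

end
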